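(* In $\overline{\mathbb{H}}^5$, consider all congruent ball packings and all horoball packings of at most two horoball types (each ideal vertex of the fundamental domain carrying at most one horoball, of arbitrary admissible type) generated by simply truncated Coxeter orthoschemes with parallel faces, i.e. by the orthoscheme with Schläfli symbol $\{4,3,4,3,3,\infty\}$ (the only one in dimension $5$). Among all these packings the densest is the horoball configuration $\mathcal{B}_{\{4,3,4,3,3,\infty\}}$ consisting of the images of the two maximal horoballs centered at the two ideal vertices $A_0$ and $A_4$, and its density is $$\frac{5}{7\zeta(3)}\approx 0.59421,$$ where $\zeta$ is the Riemann zeta function.
   Context: Simply truncated Coxeter orthoschemes with parallel faces. Let $\mathbb{R}^{n+1}$ carry the Lorentzian form $\langle x,y\rangle=-x^0y^0+x^1y^1+\dots+x^ny^n$, and use the projective (Beltrami–Cayley–Klein) model of $\mathbb{H}^n$ (curvature $-1$), with ideal points $\partial\mathbb{H}^n$ (null vectors), $\overline{\mathbb{H}}^n=\mathbb{H}^n\cup\partial\mathbb{H}^n$, and outer points (vectors of positive norm). For a symbol $\{m_1,\dots,m_n,\infty\}$ let $H^0,\dots,H^{n+1}$ be hyperplanes with outward unit normals $b^0,\dots,b^{n+1}$ satisfying $\langle b^i,b^i\rangle=1$, $\langle b^{i-1},b^i\rangle=-\cos(\pi/m_i)$ for $1\le i\le n$, $\langle b^n,b^{n+1}\rangle=-1$ (i.e. $H^n,H^{n+1}$ are parallel), and $\langle b^i,b^j\rangle=0$ for $|i-j|\ge 2$. The fundamental domain $\widehat{\mathcal S}=\mathcal F$ is the polytope bounded by $H^0,\dots,H^{n+1}$.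 For $0\le i\le n$, $A_i$ denotes the common point of the $H^j$ with $0\le j\le n$, $j\ne i$; $A_n$ is an outer point, $H^{n+1}$ is its polar hyperplane (the truncating hyperplane), and $A_{n-1}$ is ideal. $\Gamma$ is the discrete group generated by the reflections in $H^0,\dots,H^{n+1}$; the images of $\mathcal F$ under $\Gamma$ tile $\overline{\mathbb{H}}^n$. Here $n=5$. Packings. A congruent ball packing generated by $\mathcal F$ consists of the $\Gamma$-images of a ball $\mathcal B\subset\mathcal F$; its density is $\mathrm{vol}(\mathcal B)/\mathrm{vol}(\mathcal F)$. A horoball packing generated by $\mathcal F$ consists of the $\Gamma$-images of a nonempty family of horoballs $B_i$ centered at ideal vertices of $\mathcal F$ (at most one per ideal vertex, their sizes being independent of one another), such that no two horoballs have a common interior point (tangency is allowed) and no $B_i$ extends beyond a bounding hyperplane of $\mathcal F$ that does not contain its center. Its density is $\sum_i \mathrm{vol}(B_i\cap\mathcal F)/\mathrm{vol}(\mathcal F)$. Two horoballs are of the same type if their densities relative to $\mathcal F$ are equal, otherwise of different type. A maximal horoball at an ideal vertex $A_i$ is the largest horoball centered at $A_i$ that does not extend beyond a bounding hyperplane of $\mathcal F$ not containing $A_i$. The sign $\approx$ indicates a decimal approximation accurate to within one unit of the last displayed digit. *)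

theory Defs
  imports "HOL-Analysis.Analysis"
begin

text \<open>
  A vector of $R^{n+1}$ is a pair of its time coordinate $x^0$ and its spatial part, and the
  dimension is $n$ = \<open>CARD('n)\<close>.  In the projective model a point \<open>p\<close> of the
  affine chart $x^0 = 1$ stands for the vector \<open>(1, p)\<close>: it lies in hyperbolic space iff
  \<open>norm p < 1\<close>, is ideal iff \<open>norm p = 1\<close>, and is outer iff \<open>norm p > 1\<close>.
\<close>

definition lorentz :: "real \<times> (real^'n) \<Rightarrow> real \<times> (real^'n) \<Rightarrow> real" where
  "lorentz x y = - (fst x * fst y) + snd x \<bullet> snd y"

definition lift :: "real^'n \<Rightarrow> real \<times> (real^'n)" where
  "lift p = (1, p)"

definition proj :: "real \<times> (real^'n) \<Rightarrow> real^'n" where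
  "proj x = (1 / fst x) *\<^sub>R snd x"

definition hdist :: "real^'n \<Rightarrow> real^'n \<Rightarrow> real" where
  "hdist p q = arcosh (- lorentz (lift p) (lift q) /
     sqrt (lorentz (lift p) (lift p) * lorentz (lift q) (lift q)))"

text \<open>The Riemannian volume of curvature $-1$ has density $(1-|p|^2)^{-(n+1)/2}$ in this model.\<close>

definition hyp_measure :: "(real^'n) measure" where
  "hyp_measure = density lborel (\<lambda>p. ennreal (if norm p < 1
     then (1 - (norm p)\<^sup>2) powr (- (real CARD('n) + 1) / 2) else 0))"

definition hvol :: "(real^'n) set \<Rightarrow> real" where
  "hvol S = measure hyp_measure S"

definition hball :: "real^'n \<Rightarrow> real \<Rightarrow> (real^'n) set" where
  "hball x r = {q. norm q < 1 \<and> hdist x q \<le> r}"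

text \<open>
  The horospheres centered at the ideal point \<open>c\<close> are the level sets of
  $-\langle x, (1,c)\rangle$ on the hyperboloid $\langle x,x\rangle = -1$, $x^0 > 0$;
  the horoballs are the sublevel sets, so \<open>s > 0\<close> measures the size.
\<close>

definition horoball :: "real^'n \<Rightarrow> real \<Rightarrow> (real^'n) set" where
  "horoball c s = {q. norm q < 1 \<and>
     - lorentz (lift q) (lift c) / sqrt (- lorentz (lift q) (lift q)) \<le> s}"

definition fund_domain :: "(nat \<Rightarrow> real \<times> (real^'n)) \<Rightarrow> (real^'n) set" where
  "fund_domain b = {p. norm p \<le> 1 \<and> (\<forall>i\<le>CARD('n) + 1. lorentz (lift p) (b i) \<le> 0)}"

text \<open>
  Simply truncated Coxeter orthoschemes with parallel faces, with symbol
  $\{m_1,\dots,m_n,\infty\}$; here $m_i$ is \<open>ms ! (i - 1)\<close>.  The point with all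
  \<open>lorentz (lift p) (b i) < 0\<close> says that the \<open>b i\<close> are the outward normals of a
  polytope with nonempty interior.  The last condition says that
  the vertices $A_0,\dots,A_{n-1}$ are ordinary or ideal, i.e. only $A_n$ is truncated.  That
  $A_n$ is outer with polar hyperplane $H^{n+1}$ is contained in the products: \<open>b (n + 1)\<close> is
  a vector of norm 1 orthogonal to $b^0,\dots,b^{n-1}$.  Likewise $A_{n-1}$ is
  represented by the null vector $b^n + b^{n+1}$.
\<close>

definition simply_truncated_parallel :: "nat list \<Rightarrow> (nat \<Rightarrow> real \<times> (real^'n)) \<Rightarrow> bool" where
  "simply_truncated_parallel ms b \<longleftrightarrow>
     (let n = CARD('n) in
      length ms = n \<and> (\<forall>m\<in>set ms. 3 \<le> m) \<and>
      (\<forall>i\<le>n + 1. lorentz (b i) (b i) = 1) \<and>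
      (\<forall>i\<in>{1..n}. lorentz (b (i - 1)) (b i) = - cos (pi / real (ms ! (i - 1)))) \<and>
      lorentz (b n) (b (n + 1)) = - 1 \<and>
      (\<forall>i j. j \<le> n + 1 \<and> i + 2 \<le> j \<longrightarrow> lorentz (b i) (b j) = 0) \<and>
      (\<exists>p. norm p < 1 \<and> (\<forall>i\<le>n + 1. lorentz (lift p) (b i) < 0)) \<and>
      (\<forall>i<n. \<exists>a. a \<noteq> 0 \<and> lorentz a a \<le> 0 \<and> (\<forall>j\<le>n. j \<noteq> i \<longrightarrow> lorentz a (b j) = 0)))"

definition vertex :: "(nat \<Rightarrow> real \<times> (real^'n)) \<Rightarrow> nat \<Rightarrow> real^'n" where
  "vertex b i = (THE p. \<forall>j\<le>CARD('n). j \<noteq> i \<longrightarrow> lorentz (lift p) (b j) = 0)"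

text \<open>
  Vertices are extreme points of the intersection of the half-spaces alone: intersecting with the
  closed ball first would make every boundary point of the model that it contains extreme.
\<close>

definition ideal_vertices :: "(nat \<Rightarrow> real \<times> (real^'n)) \<Rightarrow> (real^'n) set" where
  "ideal_vertices b = {p. norm p = 1 \<and>
     p extreme_point_of {q. \<forall>i\<le>CARD('n) + 1. lorentz (lift q) (b i) \<le> 0}}"

definition reflection :: "real \<times> (real^'n) \<Rightarrow> real \<times> (real^'n) \<Rightarrow> real \<times> (real^'n)" where
  "reflection e x = x - (2 * lorentz x e) *\<^sub>R e"

inductive_set refl_group ::
    "(nat \<Rightarrow> real \<times> (real^'n)) \<Rightarrow> (real \<times> (real^'n) \<Rightarrow> real \<times> (real^'n)) set"
  for b :: "nat \<Rightarrow> real \<times> (real^'n)" where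
  id: "id \<in> refl_group b"
| step: "g \<in> refl_group b \<Longrightarrow> i \<le> CARD('n) + 1 \<Longrightarrow> reflection (b i) \<circ> g \<in> refl_group b"

definition act :: "(real \<times> (real^'n) \<Rightarrow> real \<times> (real^'n)) \<Rightarrow> real^'n \<Rightarrow> real^'n" where
  "act g p = proj (g (lift p))"

definition orbit :: "(nat \<Rightarrow> real \<times> (real^'n)) \<Rightarrow> (real^'n) set set \<Rightarrow> (real^'n) set set" where
  "orbit b \<B> = {act g ` B | g B. g \<in> refl_group b \<and> B \<in> \<B>}"

text \<open>In the two packing predicates \<open>\<P>\<close> is the family of all bodies and \<open>d\<close> is its density.\<close>

definition congruent_ball_packing ::
    "(nat \<Rightarrow> real \<times> (real^'n)) \<Rightarrow> (real^'n) set set \<Rightarrow> real \<Rightarrow> bool" where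
  "congruent_ball_packing b \<P> d \<longleftrightarrow>
     (\<exists>x r. norm x < 1 \<and> 0 < r \<and> hball x r \<subseteq> fund_domain b \<and>
        \<P> = orbit b {hball x r} \<and> d = hvol (hball x r) / hvol (fund_domain b))"

definition admissible_horoball :: "(nat \<Rightarrow> real \<times> (real^'n)) \<Rightarrow> real^'n \<Rightarrow> real \<Rightarrow> bool" where
  "admissible_horoball b c s \<longleftrightarrow> 0 < s \<and>
     (\<forall>i\<le>CARD('n) + 1. lorentz (lift c) (b i) \<noteq> 0 \<longrightarrow>
        (\<forall>q\<in>horoball c s. lorentz (lift q) (b i) \<le> 0))"

definition maximal_horoball ::
    "(nat \<Rightarrow> real \<times> (real^'n)) \<Rightarrow> real^'n \<Rightarrow> (real^'n) set \<Rightarrow> bool" where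
  "maximal_horoball b c B \<longleftrightarrow>
     (\<exists>s. admissible_horoball b c s \<and> B = horoball c s) \<and>
     (\<forall>s. admissible_horoball b c s \<longrightarrow> horoball c s \<subseteq> B)"

definition horoball_density :: "(nat \<Rightarrow> real \<times> (real^'n)) \<Rightarrow> (real^'n) set \<Rightarrow> real" where
  "horoball_density b B = hvol (B \<inter> fund_domain b) / hvol (fund_domain b)"

text \<open>
  \<open>V\<close> is the set of ideal vertices that carry a horoball, \<open>s\<close> gives the sizes, and \<open>k\<close> bounds
  the number of horoball types, i.e. of different densities relative to the fundamental domain.
\<close>

definition horoball_packing ::
    "nat \<Rightarrow> (nat \<Rightarrow> real \<times> (real^'n)) \<Rightarrow> (real^'n) set set \<Rightarrow> real \<Rightarrow> bool" where
  "horoball_packing k b \<P> d \<longleftrightarrow>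
     (\<exists>V s. V \<noteq> {} \<and> finite V \<and> V \<subseteq> ideal_vertices b \<and>
        (\<forall>c\<in>V. admissible_horoball b c (s c)) \<and>
        \<P> = orbit b ((\<lambda>c. horoball c (s c)) ` V) \<and>
        (\<forall>B\<in>\<P>. \<forall>B'\<in>\<P>. B \<noteq> B' \<longrightarrow> interior B \<inter> interior B' = {}) \<and>
        card ((\<lambda>c. horoball_density b (horoball c (s c))) ` V) \<le> k \<and>
        d = (\<Sum>c\<in>V. horoball_density b (horoball c (s c))))"

text \<open>The Riemann zeta function on the half-line \<open>s > 1\<close>, where its Dirichlet series converges.\<close>

definition zeta :: "real \<Rightarrow> real" where
  "zeta s = (\<Sum>k. 1 / real (Suc k) powr s)"

end

theory Submission
  imports Defs "HOL-Real_Asymp.Real_Asymp"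
begin

text \<open>In the upper half-space model with $A_4$ at infinity the polytope is the part above the unit
  hemisphere of the cylinder over a product of a simplex and an interval, and symmetry makes its
  volume $1/24$ of the integral of $(1-|v|^2)^{-2}$ over the cube $[0,1/2]^4$.  That integral reduces to one of
  Lobachevsky functions, whose antiderivative is a combination of
  $\sum_n \cos(2nx)/n^3$; the duplication and triplication formulas of this series leave only $\zeta(3)$.

  A horoball at $A_4$ is a half-space $t \ge \mathit{const}$, and a Lorentz isometry moves $A_0$ to infinity, so horoball
  volumes are volumes of Euclidean bases.  The normals generate a group that preserves an even lattice, in
  which two non-proportional null orbit vectors have product at most $-2$; that is exactly the condition for
  the corresponding horoballs to have disjoint interiors.  A ball in the polytope is a Euclidean ball
  whose projection fits into the base, which bounds its volume below $5/1152$.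

  The symbol is forced since $b^5 + b^6$ is null: the Gram matrix of $b^0,\dots,b^3$ is singular,
  and causality of $A_0$ makes the form positive semidefinite on the span of $b^1,\dots,b^5$.\<close>

section \<open>The Lobachevsky function and its antiderivative\<close>

text \<open>The obstacle is the double integral of \<open>lam 1\<close> over the unit square.
  Integrating it directly in one variable leaves angles such as arctan (sqrt (2 - X^2)), and the
  second integral then has no visible antiderivative. Hence the side of the square is made a
  parameter T: the integral becomes a boundary term along X = T minus an integral of a rational
  kernel, and for fixed T both are Lobachevsky values at angles built from \<open>alp T\<close> and
  \<open>arctan T\<close>. Together they form rho d(arctan T) - 2 qq d(alp T), which splits into
  exact terms Lob(g) dg; this is why only values of \<open>Cl3\<close> at the end angles remain.

  Multiple integrals are kept as nonnegative integrals, so that changing their order needs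
  measurability only.

  Every realisation of the symbol is an isometric image of one explicit list of normals, so that
  geometry is computed in coordinates and pulled back. The null vectors of the two ideal vertices
  are scaled to have product -1 with each wall that misses the vertex. In this scale a horoball is
  admissible exactly for multiples at least 1, and its sector volume falls with the fourth power of
  the multiple.\<close>

definition Cl3 :: "real \<Rightarrow> real" where
  "Cl3 x = (\<Sum>n. cos (2 * real (Suc n) * x) / real (Suc n) ^ 3)"

text \<open>With Li the polylogarithm, \<open>Cl3 x\<close> is the real part of Li_3(exp(2ix)) and
  \<open>Lob x\<close> is half the imaginary part of Li_2(exp(2ix)). The series serve as definitions
  because the multiplication formulas are statements about their terms; the usual integral of -ln (2
  sin x) is recovered in \<open>Lob_diff_eq_integral\<close>.\<close>

definition Lob :: "real \<Rightarrow> real" where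
  "Lob x = (\<Sum>n. sin (2 * real (Suc n) * x) / real (Suc n) ^ 2) / 2"

lemma summable_inverse_Suc_power:
  assumes "2 \<le> k"
  shows "summable (\<lambda>n. 1 / real (Suc n) ^ k)"
  using inverse_power_summable[OF assms, where 'a=real]
  by (subst (asm) summable_Suc_iff[symmetric]) (simp add: divide_inverse)

lemma Cl3_summable: "summable (\<lambda>n. cos (2 * real (Suc n) * x) / real (Suc n) ^ 3)"
  by (rule summable_comparison_test'[OF summable_inverse_Suc_power[of 3]]) (auto simp: divide_simps)

lemma Lob_summable: "summable (\<lambda>n. sin (2 * real (Suc n) * x) / real (Suc n) ^ 2)"
  by (rule summable_comparison_test'[OF summable_inverse_Suc_power[of 2]]) (auto simp: divide_simps)

text \<open>Termwise differentiation: the differentiated series is dominated by 2/n^2. The factor 4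
  combines the 2 in the argument with the factor 1/2 in \<open>Lob\<close>.\<close>

lemma Cl3_has_derivative: "(Cl3 has_real_derivative - 4 * Lob x) (at x)"
proof -
  let ?f = "\<lambda>n x. cos (2 * real (Suc n) * x) / real (Suc n) ^ 3"
  let ?f' = "\<lambda>n x. - 2 * (sin (2 * real (Suc n) * x) / real (Suc n) ^ 2)"
  have u: "uniformly_convergent_on UNIV (\<lambda>n x. \<Sum>i<n. ?f' i x)"
    by (rule Weierstrass_m_test'[where M = "\<lambda>n. 2 * (1 / real (Suc n) ^ 2)"])
      (use summable_mult[OF summable_inverse_Suc_power[of 2], of 2] in \<open>auto simp: divide_simps abs_mult\<close>)
  have d: "(?f n has_real_derivative ?f' n y) (at y within UNIV)" for n y
  proof -
    have "(?f n has_real_derivative - sin (2 * real (Suc n) * y) * (2 * real (Suc n)) / real (Suc n) ^ 3) (at y)"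
      by (intro DERIV_cdivide derivative_eq_intros) auto
    also have "- sin (2 * real (Suc n) * y) * (2 * real (Suc n)) / real (Suc n) ^ 3 = ?f' n y"
      by (simp add: divide_simps eval_nat_numeral del: of_nat_Suc)
    finally show ?thesis by simp
  qed
  have "((\<lambda>x. \<Sum>n. ?f n x) has_real_derivative (\<Sum>n. ?f' n x)) (at x)"
    by (rule has_field_derivative_series'(2)[of UNIV, OF convex_UNIV d u UNIV_I Cl3_summable[of 0]]) simp
  also have "(\<Sum>n. ?f' n x) = - 4 * Lob x"
    unfolding Lob_def by (subst suminf_mult[OF Lob_summable]) simp
  finally show ?thesis unfolding Cl3_def[abs_def] .
qed

text \<open>Continuity is needed separately from differentiability: later antiderivatives reach the
  angle 0, where the derivative of \<open>Lob\<close> is infinite.\<close>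

lemma isCont_Lob: "isCont Lob x"
proof -
  let ?f = "\<lambda>n x. sin (2 * real (Suc n) * x) / real (Suc n) ^ 2"
  have u: "uniform_limit UNIV (\<lambda>n x. \<Sum>i<n. ?f i x) (\<lambda>x. \<Sum>i. ?f i x) sequentially"
    by (rule Weierstrass_m_test[where M = "\<lambda>n. 1 / real (Suc n) ^ 2"])
      (use summable_inverse_Suc_power[of 2] in \<open>auto simp: divide_simps\<close>)
  have "continuous_on UNIV (\<lambda>x. \<Sum>i. ?f i x)"
    by (rule uniform_limit_theorem[OF _ u]) (auto intro!: continuous_intros always_eventually simp del: of_nat_Suc)
  then have "continuous_on UNIV Lob"
    unfolding Lob_def[abs_def] by (intro continuous_intros) auto
  then show ?thesis by (simp add: continuous_on_eq_continuous_at)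
qed

lemma Cl3_minus [simp]: "Cl3 (- x) = Cl3 x"
  by (simp add: Cl3_def)

lemma Lob_minus [simp]: "Lob (- x) = - Lob x"
  unfolding Lob_def using suminf_minus[OF Lob_summable, of x] by (simp del: of_nat_Suc)

lemma Cl3_add_pi: "Cl3 (x + pi) = Cl3 x"
proof -
  have "cos (2 * real (Suc n) * (x + pi)) = cos (2 * real (Suc n) * x)" for n
  proof -
    have "2 * real (Suc n) * (x + pi) = 2 * real (Suc n) * x + 2 * real (Suc n) * pi" by (simp add: algebra_simps)
    also have "cos \<dots> = cos (2 * real (Suc n) * x)"
      by (simp only: cos_add) (simp add: cos_2npi sin_2npi del: of_nat_Suc)
    finally show ?thesis .
  qed
  then show ?thesis by (simp add: Cl3_def del: of_nat_Suc)
qed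

lemma Lob_add_pi: "Lob (x + pi) = Lob x"
proof -
  have "sin (2 * real (Suc n) * (x + pi)) = sin (2 * real (Suc n) * x)" for n
  proof -
    have "2 * real (Suc n) * (x + pi) = 2 * real (Suc n) * x + 2 * real (Suc n) * pi" by (simp add: algebra_simps)
    also have "sin \<dots> = sin (2 * real (Suc n) * x)"
      by (simp only: sin_add) (simp add: cos_2npi sin_2npi del: of_nat_Suc)
    finally show ?thesis .
  qed
  then show ?thesis by (simp add: Lob_def del: of_nat_Suc)
qed

lemma Lob_pi_minus: "Lob (pi - x) = - Lob x"
  using Lob_add_pi[of "- x"] by simp

lemma Cl3_pi_minus: "Cl3 (pi - x) = Cl3 x"
  using Cl3_add_pi[of "- x"] by simp

lemma Lob_0 [simp]: "Lob 0 = 0"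
  by (simp add: Lob_def)

lemma Lob_half_pi [simp]: "Lob (pi / 2) = 0"
  using Lob_pi_minus[of "pi/2"] by simp

section \<open>Multiplication formulas and special values\<close>

lemma Cl3_0: "Cl3 0 = zeta 3"
  by (simp add: Cl3_def zeta_def powr_numeral del: of_nat_Suc)

text \<open>The shift by pi/2 multiplies the n-th term by (-1)^n, so only even n survive, doubled; n
  = 2m contributes 2/8 of the m-th term at 2x.\<close>

lemma Cl3_duplication: "Cl3 x + Cl3 (x + pi / 2) = Cl3 (2 * x) / 4"
proof -
  let ?h = "\<lambda>n. (cos (2 * real (Suc n) * x) + cos (2 * real (Suc n) * (x + pi / 2))) / real (Suc n) ^ 3"
  have s: "?h sums (Cl3 x + Cl3 (x + pi / 2))"
    unfolding Cl3_def add_divide_distrib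
    by (intro sums_add summable_sums Cl3_summable)
  have e: "cos (2 * real (Suc n) * (x + pi / 2)) = (- 1) ^ Suc n * cos (2 * real (Suc n) * x)" for n
  proof -
    have "2 * real (Suc n) * (x + pi / 2) = 2 * real (Suc n) * x + real (Suc n) * pi"
      by (simp add: algebra_simps)
    then show ?thesis by (simp add: cos_add del: of_nat_Suc)
  qed
  \<comment> \<open>The summand with index n has frequency \<open>Suc n\<close>, so the even
    frequencies are the odd indices.\<close>
  have "(\<lambda>n. ?h (2 * n + 1)) sums (Cl3 x + Cl3 (x + pi / 2))"
  proof (subst sums_mono_reindex[of "\<lambda>n. 2 * n + 1" ?h])
    show "strict_mono (\<lambda>n. 2 * n + 1 :: nat)" by (simp add: strict_mono_def)
    fix n :: nat assume "n \<notin> range (\<lambda>n. 2 * n + 1)"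
    then have "even n" by (metis oddE rangeI)
    then show "?h n = 0" unfolding e by simp
  qed (rule s)
  also have "(\<lambda>n. ?h (2 * n + 1)) = (\<lambda>n. (cos (2 * real (Suc n) * (2 * x)) / real (Suc n) ^ 3) / 4)"
  proof
    fix n
    have "real (Suc (2 * n + 1)) = 2 * real (Suc n)" by simp
    then show "?h (2 * n + 1) = (cos (2 * real (Suc n) * (2 * x)) / real (Suc n) ^ 3) / 4"
      unfolding e by (simp add: power_mult_distrib mult.commute mult.left_commute del: of_nat_Suc)
  qed
  finally have "(\<lambda>n. (cos (2 * real (Suc n) * (2 * x)) / real (Suc n) ^ 3) / 4) sums (Cl3 x + Cl3 (x + pi / 2))" .
  moreover have "(\<lambda>n. (cos (2 * real (Suc n) * (2 * x)) / real (Suc n) ^ 3) / 4) sums (Cl3 (2 * x) / 4)"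
    unfolding Cl3_def by (intro sums_divide summable_sums Cl3_summable)
  ultimately show ?thesis by (rule sums_unique2)
qed

text \<open>Differentiating both sides of \<open>Cl3_duplication\<close> and using uniqueness of
  derivatives avoids a second manipulation of series.\<close>

lemma Lob_duplication: "Lob (2 * x) = 2 * Lob x - 2 * Lob (pi / 2 - x)"
proof -
  have "((\<lambda>x. Cl3 x + Cl3 (x + pi / 2)) has_real_derivative - 4 * Lob x + - 4 * Lob (x + pi / 2) * 1) (at x)"
    by (intro DERIV_add Cl3_has_derivative DERIV_chain2[OF Cl3_has_derivative] derivative_eq_intros) auto
  moreover have "((\<lambda>x. Cl3 (2 * x) / 4) has_real_derivative - 4 * Lob (2 * x) * 2 / 4) (at x)"
    by (intro DERIV_cdivide DERIV_chain2[OF Cl3_has_derivative] derivative_eq_intros) auto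
  ultimately have "- 4 * Lob x + - 4 * Lob (x + pi / 2) * 1 = - 4 * Lob (2 * x) * 2 / 4"
    unfolding Cl3_duplication by (rule DERIV_unique)
  moreover have "Lob (x + pi / 2) = - Lob (pi / 2 - x)"
    using Lob_pi_minus[of "pi / 2 - x"] by (simp add: algebra_simps)
  ultimately show ?thesis by simp
qed

text \<open>A sum over the cube roots of unity; it keeps every third term in the triplication
  formula.\<close>

lemma cos_third_sum:
  "cos y + cos (y + real k * (2 * pi / 3)) + cos (y + real k * (4 * pi / 3)) = (if 3 dvd k then 3 * cos y else 0)"
proof -
  obtain j r where k: "k = 3 * j + r" "r < 3"
    by (metis mod_less_divisor div_mult_mod_eq mult.commute zero_less_numeral)
  have 1: "y + real k * (2 * pi / 3) = (y + real r * (2 * pi / 3)) + 2 * real j * pi"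
    "y + real k * (4 * pi / 3) = (y + real r * (4 * pi / 3)) + 2 * real (2 * j) * pi"
    unfolding k by (simp_all add: field_simps)
  have c: "cos (z + 2 * real n * pi) = cos z" for z n
    by (simp only: cos_add) (simp add: cos_2npi sin_2npi)
  have "r = 0 \<or> r = 1 \<or> r = 2" using k by auto
  moreover have "3 dvd k \<longleftrightarrow> r = 0" using k by presburger
  moreover have t: "cos (2 * pi / 3) = - 1 / 2" "cos (4 * pi / 3) = - 1 / 2"
      "sin (4 * pi / 3) = - sin (2 * pi / 3)"
    using cos_120 cos_periodic_pi[of "pi / 3"] sin_periodic_pi[of "pi / 3"] sin_120 sin_60 cos_60
    by (simp_all add: field_simps)
  moreover have "cos (8 * pi / 3) = - 1 / 2" "sin (8 * pi / 3) = sin (2 * pi / 3)"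
    using cos_periodic[of "2 * pi / 3"] sin_periodic[of "2 * pi / 3"] t by (simp_all add: field_simps)
  ultimately show ?thesis unfolding 1 c
    by (elim disjE) (auto simp: cos_add)
qed

lemma Cl3_triplication: "Cl3 x + Cl3 (x + pi / 3) + Cl3 (x + 2 * pi / 3) = Cl3 (3 * x) / 9"
proof -
  let ?h = "\<lambda>n. (cos (2 * real (Suc n) * x) + cos (2 * real (Suc n) * (x + pi / 3))
     + cos (2 * real (Suc n) * (x + 2 * pi / 3))) / real (Suc n) ^ 3"
  have s: "?h sums (Cl3 x + Cl3 (x + pi / 3) + Cl3 (x + 2 * pi / 3))"
    unfolding Cl3_def add_divide_distrib
    by (intro sums_add summable_sums Cl3_summable)
  have e: "?h n = (if 3 dvd Suc n then 3 * cos (2 * real (Suc n) * x) else 0) / real (Suc n) ^ 3" for n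
  proof -
    have "2 * real (Suc n) * (x + pi / 3) = 2 * real (Suc n) * x + real (Suc n) * (2 * pi / 3)"
      "2 * real (Suc n) * (x + 2 * pi / 3) = 2 * real (Suc n) * x + real (Suc n) * (4 * pi / 3)"
      by (simp_all add: algebra_simps)
    then show ?thesis by (simp only: cos_third_sum)
  qed
  have "(\<lambda>n. ?h (3 * n + 2)) sums (Cl3 x + Cl3 (x + pi / 3) + Cl3 (x + 2 * pi / 3))"
  proof (subst sums_mono_reindex[of "\<lambda>n. 3 * n + 2" ?h])
    show "strict_mono (\<lambda>n. 3 * n + 2 :: nat)" by (simp add: strict_mono_def)
    fix n :: nat assume *: "n \<notin> range (\<lambda>n. 3 * n + 2)"
    have "\<not> 3 dvd Suc n"
    proof
      assume "3 dvd Suc n"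
      then have "n = 3 * (n div 3) + 2" by presburger
      then show False using * by blast
    qed
    then show "?h n = 0" unfolding e by simp
  qed (rule s)
  also have "(\<lambda>n. ?h (3 * n + 2)) = (\<lambda>n. (cos (2 * real (Suc n) * (3 * x)) / real (Suc n) ^ 3) / 9)"
  proof
    fix n
    have 1: "real (Suc (3 * n + 2)) = 3 * real (Suc n)" by simp
    have 2: "3 dvd Suc (3 * n + 2)" by presburger
    show "?h (3 * n + 2) = (cos (2 * real (Suc n) * (3 * x)) / real (Suc n) ^ 3) / 9"
      unfolding e using 2 by (simp only: if_True 1) (simp add: power_mult_distrib mult.commute mult.left_commute del: of_nat_Suc)
  qed
  finally have "(\<lambda>n. (cos (2 * real (Suc n) * (3 * x)) / real (Suc n) ^ 3) / 9) sums (Cl3 x + Cl3 (x + pi / 3) + Cl3 (x + 2 * pi / 3))" .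
  moreover have "(\<lambda>n. (cos (2 * real (Suc n) * (3 * x)) / real (Suc n) ^ 3) / 9) sums (Cl3 (3 * x) / 9)"
    unfolding Cl3_def by (intro sums_divide summable_sums Cl3_summable)
  ultimately show ?thesis by (rule sums_unique2)
qed

text \<open>Duplication at 0, pi/4, pi/6 and triplication at 0 determine the single values. At pi/12
  duplication only gives the sum with 7 pi/12; these are the difference and the sum of
  \<open>alp 1\<close> = pi/3 and \<open>arctan 1\<close> = pi/4, and just this sum will be
  needed.\<close>

lemma Cl3_values:
  "Cl3 (pi / 2) = - 3 / 4 * zeta 3" "Cl3 (pi / 4) = - 3 / 32 * zeta 3"
  "Cl3 (pi / 3) = - 4 / 9 * zeta 3" "Cl3 (2 * pi / 3) = - 4 / 9 * zeta 3"
  "Cl3 (pi / 12) + Cl3 (7 * pi / 12) = zeta 3 / 12"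
proof -
  show 1: "Cl3 (pi / 2) = - 3 / 4 * zeta 3"
    using Cl3_duplication[of 0] by (simp add: Cl3_0)
  have "Cl3 (3 * pi / 4) = Cl3 (pi / 4)"
    using Cl3_pi_minus[of "pi / 4"] by (simp add: field_simps)
  then show "Cl3 (pi / 4) = - 3 / 32 * zeta 3"
    using Cl3_duplication[of "pi / 4"] 1 by (simp add: field_simps)
  have s: "Cl3 (2 * pi / 3) = Cl3 (pi / 3)"
    using Cl3_pi_minus[of "pi / 3"] by (simp add: field_simps)
  then show 3: "Cl3 (pi / 3) = - 4 / 9 * zeta 3"
    using Cl3_triplication[of 0] by (simp add: Cl3_0)
  then show "Cl3 (2 * pi / 3) = - 4 / 9 * zeta 3" using s by simp
  have "Cl3 (pi / 6) + Cl3 (2 * pi / 3) = Cl3 (pi / 3) / 4"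
    using Cl3_duplication[of "pi / 6"] by (simp add: field_simps)
  then have "Cl3 (pi / 6) = zeta 3 / 3" using 3 s by simp
  then show "Cl3 (pi / 12) + Cl3 (7 * pi / 12) = zeta 3 / 12"
    using Cl3_duplication[of "pi / 12"] by (simp add: field_simps)
qed


text \<open>The real part of the Taylor series of Ln (1 - r cis y).\<close>

lemma abel_log_sums:
  assumes "0 \<le> r" "r < 1"
  shows "(\<lambda>n. r ^ Suc n * cos (real (Suc n) * y) / real (Suc n)) sums (- ln (1 - 2 * r * cos y + r\<^sup>2) / 2)"
proof -
  define z where "z = - of_real r * cis y"
  have "cmod z < 1" using assms by (simp add: z_def norm_mult)
  then have "(\<lambda>n. - ((- z) ^ n) / of_nat n) sums Ln (1 + z)" by (rule Ln_series')
  then have "(\<lambda>n. Re (- ((- z) ^ n) / of_nat n)) sums Re (Ln (1 + z))" by (rule sums_Re)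
  moreover have "Re (- ((- z) ^ n) / of_nat n) = - (r ^ n * cos (real n * y) / real n)" for n
  proof -
    have "(- z) ^ n = of_real (r ^ n) * cis (real n * y)"
      by (simp add: z_def power_mult_distrib Complex.DeMoivre)
    then have "Re ((- z) ^ n) = r ^ n * cos (real n * y)" by simp
    then show ?thesis by (simp add: Re_divide_of_nat)
  qed
  ultimately have "(\<lambda>n. - (r ^ n * cos (real n * y) / real n)) sums Re (Ln (1 + z))" by (simp only:)
  from sums_minus[OF this] have *: "(\<lambda>n. r ^ n * cos (real n * y) / real n) sums - Re (Ln (1 + z))" by simp
  \<comment> \<open>The series of \<open>Ln_series'\<close> starts at n = 0, where division by zero
    makes the term 0, so dropping it does not change the sum.\<close>
  have "(\<lambda>n. r ^ Suc n * cos (real (Suc n) * y) / real (Suc n)) sums - Re (Ln (1 + z))"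
    by (subst sums_Suc_iff) (use * in simp)
  moreover have "Re (Ln (1 + z)) = ln (1 - 2 * r * cos y + r\<^sup>2) / 2"
  proof -
    have "1 + z \<noteq> 0" using \<open>cmod z < 1\<close> by (metis add.commute add_eq_0_iff norm_minus_cancel norm_one order_less_irrefl)
    then have "Re (Ln (1 + z)) = ln (cmod (1 + z))" by simp
    also have c: "cmod (1 + z) = sqrt (1 - 2 * r * cos y + r\<^sup>2)"
    proof -
      have "(1 - r * cos y)\<^sup>2 + (r * sin y)\<^sup>2 = 1 - 2 * r * cos y + r\<^sup>2 * ((sin y)\<^sup>2 + (cos y)\<^sup>2)"
        by algebra
      then show ?thesis by (simp add: cmod_def z_def)
    qed
    also have "ln (sqrt (1 - 2 * r * cos y + r\<^sup>2)) = ln (1 - 2 * r * cos y + r\<^sup>2) / 2"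
      using \<open>1 + z \<noteq> 0\<close> c zero_less_norm_iff[of "1 + z"] by (simp add: ln_sqrt)
    finally show ?thesis .
  qed
  ultimately show ?thesis by simp
qed

text \<open>Abel summation: the series with the extra factor \<open>r ^ n\<close> can be differentiated termwise for
  \<open>r < 1\<close>, and both sides of the integrated identity are continuous up to \<open>r = 1\<close>.\<close>

lemma Lob_diff_eq_integral:
  assumes "0 < a" "a \<le> b" "b < pi"
  shows "Lob b - Lob a = integral {a..b} (\<lambda>x. - ln (2 * sin x))"
proof -
  define G where "G r x = (\<Sum>n. r ^ Suc n * sin (2 * real (Suc n) * x) / real (Suc n) ^ 2) / 2" for r x :: real
  define h where "h r x = - ln (1 - 2 * r * cos (2 * x) + r\<^sup>2) / 2" for r x :: real
  have contG: "continuous_on {0..1} (\<lambda>r. G r x)" for x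
  proof -
    have u: "uniform_limit {0..1} (\<lambda>n r. \<Sum>i<n. r ^ Suc i * sin (2 * real (Suc i) * x) / real (Suc i) ^ 2)
       (\<lambda>r. \<Sum>i. r ^ Suc i * sin (2 * real (Suc i) * x) / real (Suc i) ^ 2) sequentially"
    proof (rule Weierstrass_m_test[where M = "\<lambda>n. 1 / real (Suc n) ^ 2"])
      fix n and r :: real assume r: "r \<in> {0..1}"
      have "\<bar>r ^ Suc n * sin (2 * real (Suc n) * x)\<bar> \<le> 1 * 1"
        unfolding abs_mult using r by (intro mult_mono) (auto simp: abs_le_iff power_le_one simp del: of_nat_Suc power_Suc)
      then show "norm (r ^ Suc n * sin (2 * real (Suc n) * x) / real (Suc n) ^ 2) \<le> 1 / real (Suc n) ^ 2"
        by (auto simp: divide_simps simp del: of_nat_Suc power_Suc)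
    qed (use summable_inverse_Suc_power[of 2] in auto)
    show ?thesis unfolding G_def
      by (intro continuous_intros uniform_limit_theorem[OF _ u])
        (auto intro!: continuous_intros always_eventually simp del: of_nat_Suc)
  qed
  have pos: "0 < 1 - 2 * r * cos (2 * x) + r\<^sup>2" if "r \<in> {0..1}" "x \<in> {a..b}" for r x
  proof -
    have s: "sin x > 0" using that assms by (intro sin_gt_zero) auto
    \<comment> \<open>In this form positivity is visible up to r = 1, where it rests on sin x > 0;
      hence the interval must stay inside (0, pi).\<close>
    have e: "1 - 2 * r * cos (2 * x) + r\<^sup>2 = (1 - r)\<^sup>2 + 4 * r * (sin x)\<^sup>2"
      unfolding cos_double_sin by (simp add: power2_eq_square algebra_simps)
    show ?thesis
    proof (cases "r = 0")
      case False
      then have "0 < 4 * r * (sin x)\<^sup>2" using that s by simp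
      then show ?thesis unfolding e by (simp add: add_nonneg_pos)
    qed simp
  qed
  have eq: "G r b - G r a = integral {a..b} (h r)" if r: "0 \<le> r" "r < 1" for r
  proof -
    have d: "((\<lambda>x. G r x) has_real_derivative h r x) (at x)" for x
    proof -
      let ?f = "\<lambda>n x. r ^ Suc n * sin (2 * real (Suc n) * x) / real (Suc n) ^ 2"
      let ?f' = "\<lambda>n x. 2 * (r ^ Suc n * cos (real (Suc n) * (2 * x)) / real (Suc n))"
      have sr: "summable (\<lambda>n. 2 * r ^ Suc n)"
        using summable_geometric[of r] r by (auto intro!: summable_mult)
      have u: "uniformly_convergent_on UNIV (\<lambda>n x. \<Sum>i<n. ?f' i x)"
      proof (rule Weierstrass_m_test'[OF _ sr])
        fix n and x :: real
        have "\<bar>r ^ Suc n * cos (real (Suc n) * (2 * x))\<bar> / real (Suc n) \<le> r ^ Suc n * 1 / 1"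
          unfolding abs_mult using r by (intro frac_le mult_mono) (auto simp del: power_Suc)
        then show "norm (?f' n x) \<le> 2 * r ^ Suc n"
          by (simp add: abs_mult del: of_nat_Suc power_Suc)
      qed
      have d: "(?f n has_real_derivative ?f' n y) (at y within UNIV)" for n y
      proof -
        have "(?f n has_real_derivative r ^ Suc n * (cos (2 * real (Suc n) * y) * (2 * real (Suc n))) / real (Suc n) ^ 2) (at y)"
          by (intro DERIV_cdivide DERIV_cmult derivative_eq_intros) auto
        also have "r ^ Suc n * (cos (2 * real (Suc n) * y) * (2 * real (Suc n))) / real (Suc n) ^ 2 = ?f' n y"
          by (simp add: divide_simps power2_eq_square mult_ac del: of_nat_Suc power_Suc)
        finally show ?thesis by simp
      qed
      have s0: "summable (\<lambda>n. ?f n 0)" by simp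
      have "((\<lambda>x. \<Sum>n. ?f n x) has_real_derivative (\<Sum>n. ?f' n x)) (at x)"
        by (rule has_field_derivative_series'(2)[of UNIV, OF convex_UNIV d u UNIV_I s0]) simp
      also have "(\<Sum>n. ?f' n x) = 2 * h r x"
        using sums_mult[OF abel_log_sums[OF r, of "2 * x"], of 2] unfolding h_def
        by (simp add: sums_iff del: of_nat_Suc power_Suc)
      finally show ?thesis
        unfolding G_def by (auto intro!: derivative_eq_intros)
    qed
    have "(h r has_integral G r b - G r a) {a..b}"
      by (rule fundamental_theorem_of_calculus)
        (use assms d in \<open>auto simp: has_real_derivative_iff_has_vector_derivative intro: has_vector_derivative_at_within\<close>)
    then show ?thesis by (simp add: integral_unique)
  qed
  have c2: "continuous_on {0..1} (\<lambda>r. integral {a..b} (h r))"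
  proof -
    have "continuous_on {0..1} (\<lambda>r. integral (cbox a b) (h r))"
    proof (rule integral_continuous_on_param)
      show "continuous_on ({0..1} \<times> cbox a b) (\<lambda>(x, y). h x y)"
        unfolding h_def split_beta using pos
        by (intro continuous_intros ballI) (auto dest: pos simp: less_le mem_box split: prod.splits)
    qed
    then show ?thesis by simp
  qed
  have "(\<lambda>r. G r b - G r a - integral {a..b} (h r)) 1 = 0"
  proof -
    let ?g = "\<lambda>r. G r b - G r a - integral {a..b} (h r)"
    have "continuous_on {0..1} ?g" by (intro continuous_on_diff contG c2)
    then have "(?g \<longlongrightarrow> ?g 1) (at_left 1)"
      by (rule continuous_on_Icc_at_leftD) simp
    moreover have "eventually (\<lambda>r. ?g r = 0) (at_left (1::real))"
      using eventually_at_left_real[of 0 "1::real"] by (rule eventually_mono) (use eq in auto)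
    then have "(?g \<longlongrightarrow> 0) (at_left 1)" by (rule tendsto_eventually)
    ultimately show ?thesis by (rule tendsto_unique[OF trivial_limit_at_left_real])
  qed
  moreover have "G 1 x = Lob x" for x by (simp add: G_def Lob_def)
  moreover have "integral {a..b} (h 1) = integral {a..b} (\<lambda>x. - ln (2 * sin x))"
  proof (rule integral_cong)
    fix x assume "x \<in> {a..b}"
    then have s: "sin x > 0" using assms by (intro sin_gt_zero) auto
    have "1 - 2 * 1 * cos (2 * x) + 1\<^sup>2 = (2 * sin x)\<^sup>2"
      unfolding cos_double_sin by (simp add: power2_eq_square algebra_simps)
    then show "h 1 x = - ln (2 * sin x)"
      unfolding h_def using s by (simp only: ln_realpow)
  qed
  ultimately show ?thesis by simp
qed

text \<open>The integral representation is available on compact subintervals of (0, pi) only, so the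
  fundamental theorem is applied on one with x in its interior.\<close>

lemma Lob_has_derivative:
  assumes "0 < x" "x < pi"
  shows "(Lob has_real_derivative - ln (2 * sin x)) (at x)"
proof -
  define a b where "a = x / 2" and "b = (x + pi) / 2"
  have ab: "0 < a" "a < x" "x < b" "b < pi" using assms by (auto simp: a_def b_def)
  have "continuous_on {a..b} (\<lambda>x. - ln (2 * sin x))"
  proof (intro continuous_intros ballI)
    fix y assume "y \<in> {a..b}"
    then show "2 * sin y \<noteq> 0" using ab sin_gt_zero[of y] by auto
  qed
  then have "((\<lambda>y. integral {a..y} (\<lambda>x. - ln (2 * sin x))) has_real_derivative - ln (2 * sin x)) (at x within {a..b})"
    by (rule integral_has_real_derivative) (use ab in auto)
  then have "((\<lambda>y. integral {a..y} (\<lambda>x. - ln (2 * sin x)) + Lob a) has_real_derivative - ln (2 * sin x)) (at x within {a..b})"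
    by (rule DERIV_add[OF _ DERIV_const, simplified])
  then have "(Lob has_real_derivative - ln (2 * sin x)) (at x within {a..b})"
  proof (rule has_field_derivative_transform_within[where d = 1])
    fix y assume "y \<in> {a..b}"
    then show "integral {a..y} (\<lambda>x. - ln (2 * sin x)) + Lob a = Lob y"
      using Lob_diff_eq_integral[of a y] ab by simp
  qed (use ab in auto)
  then show ?thesis using ab by (simp add: at_within_Icc_at)
qed

section \<open>The integral over the cube\<close>

text \<open>Only continuity of F is asked at the end points, since the integrands may have
  logarithmic singularities there. The integrand is cut off by a conditional so that it can be
  nested in integrals over the whole line.\<close>

lemma nn_integral_FTC_open:
  fixes F f :: "real \<Rightarrow> real"
  assumes "a \<le> b" and cont: "continuous_on {a..b} F"
    and deriv: "\<And>x. a < x \<Longrightarrow> x < b \<Longrightarrow> (F has_real_derivative f x) (at x)"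
    and nonneg: "\<And>x. a < x \<Longrightarrow> x < b \<Longrightarrow> 0 \<le> f x"
  shows "(\<integral>\<^sup>+x. (if a < x \<and> x < b then ennreal (f x) else 0) \<partial>lborel) = ennreal (F b - F a)"
    and "F a \<le> F b"
proof -
  have "(f has_integral F b - F a) {a..b}"
    by (rule fundamental_theorem_of_calculus_interior)
      (use assms in \<open>auto simp: has_real_derivative_iff_has_vector_derivative\<close>)
  then have i: "(f has_integral F b - F a) {a<..<b}"
    by (simp add: has_integral_Icc_iff_Ioo)
  have "(\<integral>\<^sup>+x. ennreal (f x) * indicator {a<..<b} x \<partial>lborel) = ennreal (F b - F a)"
    by (rule nn_integral_has_integral_lebesgue'[OF _ i]) (use nonneg in auto)
  moreover have "(\<integral>\<^sup>+x. ennreal (f x) * indicator {a<..<b} x \<partial>lborel)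
    = (\<integral>\<^sup>+x. (if a < x \<and> x < b then ennreal (f x) else 0) \<partial>lborel)"
    by (intro nn_integral_cong) (auto simp: indicator_def)
  ultimately show "(\<integral>\<^sup>+x. (if a < x \<and> x < b then ennreal (f x) else 0) \<partial>lborel) = ennreal (F b - F a)"
    by simp
  have "0 \<le> F b - F a" by (rule has_integral_nonneg[OF i]) (use nonneg in auto)
  then show "F a \<le> F b" by simp
qed

section \<open>Symmetrisation and scaling of plane integrals\<close>

lemma nn_integral_lborel_swap:
  fixes f :: "real \<Rightarrow> real \<Rightarrow> ennreal"
  assumes "(\<lambda>(x, y). f x y) \<in> borel_measurable (lborel \<Otimes>\<^sub>M lborel)"
  shows "(\<integral>\<^sup>+x. \<integral>\<^sup>+y. f x y \<partial>lborel \<partial>lborel) = (\<integral>\<^sup>+y. \<integral>\<^sup>+x. f x y \<partial>lborel \<partial>lborel)"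
  using lborel_pair.Fubini'[OF assms] by simp

text \<open>The diagonal is a null set, and the triangle x < y is reflected to the other side by
  Tonelli.\<close>

lemma nn_integral_split_diagonal:
  fixes g :: "real \<Rightarrow> real \<Rightarrow> ennreal"
  assumes g: "(\<lambda>(x, y). g x y) \<in> borel_measurable (lborel \<Otimes>\<^sub>M lborel)"
  shows "(\<integral>\<^sup>+x. \<integral>\<^sup>+y. g x y \<partial>lborel \<partial>lborel) =
    (\<integral>\<^sup>+x. \<integral>\<^sup>+y. (if y < x then g x y else 0) \<partial>lborel \<partial>lborel)
    + (\<integral>\<^sup>+x. \<integral>\<^sup>+y. (if y < x then g y x else 0) \<partial>lborel \<partial>lborel)"
proof -
  note [measurable] = g
  have [measurable]: "(\<lambda>y. g x y) \<in> borel_measurable lborel" for x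
    using measurable_compose[OF measurable_Pair1' g, of x] by simp
  have "(\<integral>\<^sup>+x. \<integral>\<^sup>+y. g x y \<partial>lborel \<partial>lborel)
    = (\<integral>\<^sup>+x. \<integral>\<^sup>+y. (if y < x then g x y else 0) + (if x < y then g x y else 0) \<partial>lborel \<partial>lborel)"
  proof (rule nn_integral_cong, rule nn_integral_cong_AE)
    fix x :: real
    show "AE y in lborel. g x y = (if y < x then g x y else 0) + (if x < y then g x y else 0)"
      using AE_lborel_singleton[of x] by eventually_elim auto
  qed
  also have "\<dots> = (\<integral>\<^sup>+x. \<integral>\<^sup>+y. (if y < x then g x y else 0) \<partial>lborel \<partial>lborel)
    + (\<integral>\<^sup>+x. \<integral>\<^sup>+y. (if x < y then g x y else 0) \<partial>lborel \<partial>lborel)"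
    by (simp add: nn_integral_add)
  also have "(\<integral>\<^sup>+x. \<integral>\<^sup>+y. (if x < y then g x y else 0) \<partial>lborel \<partial>lborel)
    = (\<integral>\<^sup>+y. \<integral>\<^sup>+x. (if x < y then g x y else 0) \<partial>lborel \<partial>lborel)"
    by (rule nn_integral_lborel_swap) measurable
  finally show ?thesis .
qed

lemma nn_integral_split_symmetric:
  fixes g :: "real \<Rightarrow> real \<Rightarrow> ennreal"
  assumes "(\<lambda>(x, y). g x y) \<in> borel_measurable (lborel \<Otimes>\<^sub>M lborel)" "\<And>x y. g x y = g y x"
  shows "(\<integral>\<^sup>+x. \<integral>\<^sup>+y. g x y \<partial>lborel \<partial>lborel) =
    2 * (\<integral>\<^sup>+x. \<integral>\<^sup>+y. (if y < x then g x y else 0) \<partial>lborel \<partial>lborel)"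
proof -
  have "(\<lambda>x y. if y < x then g y x else 0) = (\<lambda>x y. if y < x then g x y else 0)"
    using assms(2) by (intro ext) auto
  then show ?thesis
    using nn_integral_split_diagonal[OF assms(1)] by (simp add: mult_2 fun_eq_iff)
qed

lemma nn_integral_scale_Ioo:
  fixes f :: "real \<Rightarrow> ennreal"
  assumes [measurable]: "f \<in> borel_measurable borel" and "0 < c"
  shows "(\<integral>\<^sup>+y. (if 0 < y \<and> y < c then f y else 0) \<partial>lborel)
    = (\<integral>\<^sup>+t. (if 0 < t \<and> t < 1 then ennreal c * f (c * t) else 0) \<partial>lborel)"
proof -
  have "(\<integral>\<^sup>+y. (if 0 < y \<and> y < c then f y else 0) \<partial>lborel)
    = ennreal c * (\<integral>\<^sup>+t. (if 0 < c * t \<and> c * t < c then f (c * t) else 0) \<partial>lborel)"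
    using nn_integral_real_affine[of "\<lambda>y. if 0 < y \<and> y < c then f y else 0" c 0] \<open>0 < c\<close>
    by (simp only: add_0_left abs_of_pos) measurable
  also have "\<dots> = (\<integral>\<^sup>+t. ennreal c * (if 0 < c * t \<and> c * t < c then f (c * t) else 0) \<partial>lborel)"
    by (subst nn_integral_cmult) auto
  also have "\<dots> = (\<integral>\<^sup>+t. (if 0 < t \<and> t < 1 then ennreal c * f (c * t) else 0) \<partial>lborel)"
    using \<open>0 < c\<close> by (intro nn_integral_cong) (auto simp: zero_less_mult_iff)
  finally show ?thesis .
qed

lemma nn_integral_continuous_Ioo:
  fixes f :: "real \<Rightarrow> real"
  assumes "continuous_on {a..b} f" "\<And>x. a < x \<Longrightarrow> x < b \<Longrightarrow> 0 \<le> f x"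
  shows "(\<integral>\<^sup>+x. (if a < x \<and> x < b then ennreal (f x) else 0) \<partial>lborel) = ennreal (integral {a..b} f)"
    and "0 \<le> integral {a..b} f"
proof -
  have "(f has_integral integral {a..b} f) {a..b}"
    using assms(1) by (intro integrable_integral integrable_continuous_real)
  then have i: "(f has_integral integral {a..b} f) {a<..<b}"
    by (simp add: has_integral_Icc_iff_Ioo)
  have "(\<integral>\<^sup>+x. ennreal (f x) * indicator {a<..<b} x \<partial>lborel) = ennreal (integral {a..b} f)"
    by (rule nn_integral_has_integral_lebesgue'[OF _ i]) (use assms in auto)
  moreover have "(\<integral>\<^sup>+x. ennreal (f x) * indicator {a<..<b} x \<partial>lborel)
    = (\<integral>\<^sup>+x. (if a < x \<and> x < b then ennreal (f x) else 0) \<partial>lborel)"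
    by (intro nn_integral_cong) (auto simp: indicator_def)
  ultimately show "(\<integral>\<^sup>+x. (if a < x \<and> x < b then ennreal (f x) else 0) \<partial>lborel) = ennreal (integral {a..b} f)"
    by simp
  show "0 \<le> integral {a..b} f" by (rule has_integral_nonneg[OF i]) (use assms in auto)
qed

lemma sin_arctan_diff_sum:
  "sin (arctan p - arctan s) * sin (arctan p + arctan s) = (p\<^sup>2 - s\<^sup>2) / ((1 + p\<^sup>2) * (1 + s\<^sup>2))"
proof -
  define P S where "P = arctan p" and "S = arctan s"
  have "cos P \<noteq> 0" "cos S \<noteq> 0" and t: "tan P = p" "tan S = s"
    by (simp_all add: P_def S_def tan_arctan)
  then have e: "sin P = p * cos P" "sin S = s * cos S" by (auto simp: tan_def)
  have c: "1 + p\<^sup>2 = 1 / (cos P)\<^sup>2" "1 + s\<^sup>2 = 1 / (cos S)\<^sup>2"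
    using tan_sec[OF \<open>cos P \<noteq> 0\<close>] tan_sec[OF \<open>cos S \<noteq> 0\<close>] unfolding t by (simp_all add: power_inverse divide_inverse)
  have "sin (P - S) * sin (P + S) = (p\<^sup>2 - s\<^sup>2) * (cos P)\<^sup>2 * (cos S)\<^sup>2"
    unfolding sin_diff sin_add e by (simp add: power2_eq_square algebra_simps)
  also have "\<dots> = (p\<^sup>2 - s\<^sup>2) / ((1 + p\<^sup>2) * (1 + s\<^sup>2))" unfolding c by simp
  finally show ?thesis unfolding P_def S_def .
qed

text \<open>The derivatives of \<open>Lob\<close> at the angles arctan p - arctan s and arctan p +
  arctan s thus combine to logarithms of polynomials in s. This is how each integrand below is
  recognised as a derivative of Lobachevsky functions.\<close>

lemma ln_sin_arctan_diff_sum: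
  assumes "0 \<le> s" "s < p"
  shows "ln (2 * sin (arctan p - arctan s)) + ln (2 * sin (arctan p + arctan s))
    = ln 4 + ln (p\<^sup>2 - s\<^sup>2) - ln (1 + p\<^sup>2) - ln (1 + s\<^sup>2)"
proof -
  have b: "0 \<le> arctan s" "arctan s < arctan p" "arctan p < pi / 2" "arctan s < pi / 2"
    using assms arctan_ubound by (auto simp: arctan_less_iff)
  have pos: "sin (arctan p - arctan s) > 0" "sin (arctan p + arctan s) > 0"
    by (rule sin_gt_zero; use b pi_gt_zero in linarith)+
  have "p\<^sup>2 - s\<^sup>2 > 0" using assms by (simp add: power_strict_mono)
  have "ln (2 * sin (arctan p - arctan s)) + ln (2 * sin (arctan p + arctan s))
    = ln (4 * (sin (arctan p - arctan s) * sin (arctan p + arctan s)))"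
    using pos by (subst ln_mult_pos[symmetric]) (auto simp: algebra_simps)
  also have "\<dots> = ln 4 + (ln (p\<^sup>2 - s\<^sup>2) - (ln (1 + p\<^sup>2) + ln (1 + s\<^sup>2)))"
  proof -
    have "1 + p\<^sup>2 > 0" "1 + s\<^sup>2 > 0" by (simp_all add: add_pos_nonneg)
    then show ?thesis
      unfolding sin_arctan_diff_sum using \<open>p\<^sup>2 - s\<^sup>2 > 0\<close>
      by (subst ln_mult_pos) (simp_all only: ln_divide_pos ln_mult_pos zero_less_numeral divide_pos_pos mult_pos_pos)
  qed
  finally show ?thesis by simp
qed

text \<open>Half of the limit of \<open>ln_sin_arctan_diff_sum\<close> for p tending to
  infinity.\<close>

lemma ln_cos_arctan: "ln (2 * sin (pi / 2 - arctan s)) = ln 2 - ln (1 + s\<^sup>2) / 2"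
proof -
  have "1 + s\<^sup>2 > 0" by (simp add: add_pos_nonneg)
  have "sin (pi / 2 - arctan s) = 1 / sqrt (1 + s\<^sup>2)" by (simp add: sin_diff cos_arctan)
  then show ?thesis using \<open>1 + s\<^sup>2 > 0\<close> by (simp add: ln_mult_pos ln_div ln_sqrt)
qed

section \<open>The integral over the square and its deformation in T\<close>

text \<open>\<open>lam 1 X Y\<close> is what remains of the integral over the cube after the radial integration over the two
  triangles $\{(x, xX)\}$ and $\{(z, zY)\}$.  The parameter \<open>T\<close> is introduced because
  the integral of \<open>lam T T Y\<close> over \<open>Y\<close> in $[0,T]$ is a combination of Lobachevsky functions, and so is
  that of the $T$-derivative \<open>- (ker T X Y + ker T Y X)\<close> over $[0,T]^2$: \<open>rho\<close> and \<open>qq\<close>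
  are these combinations.  The angle \<open>alp T\<close> satisfies
  $\cos(\arctan T) = \sqrt 2 \cos(\mathit{alp}\, T)$.\<close>

definition lam :: "real \<Rightarrow> real \<Rightarrow> real \<Rightarrow> real" where
  "lam T X Y = (ln (1 + 2 * T\<^sup>2 - X\<^sup>2) + ln (1 + 2 * T\<^sup>2 - Y\<^sup>2) - ln (2 + 2 * T\<^sup>2) - ln (2 * T\<^sup>2 - X\<^sup>2 - Y\<^sup>2))
     / ((1 + X\<^sup>2) * (1 + Y\<^sup>2))"

definition ker :: "real \<Rightarrow> real \<Rightarrow> real \<Rightarrow> real" where
  "ker T X Y = 2 * T / ((1 + T\<^sup>2) * (1 + 2 * T\<^sup>2 - X\<^sup>2) * (2 * T\<^sup>2 - X\<^sup>2 - Y\<^sup>2))"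

definition alp :: "real \<Rightarrow> real" where
  "alp T = arctan (sqrt (1 + 2 * T\<^sup>2))"

definition rho :: "real \<Rightarrow> real" where
  "rho T = Lob (alp T - arctan T) - Lob (alp T + arctan T) + Lob (2 * arctan T)"

definition qq :: "real \<Rightarrow> real" where
  "qq T = Lob (alp T) + (Lob (alp T - arctan T) + Lob (alp T + arctan T) - Lob (2 * alp T)) / 2"

lemma lam_commute: "lam T X Y = lam T Y X"
  by (simp add: lam_def algebra_simps)

lemma sq_bounds:
  fixes X T :: real
  assumes "0 \<le> X" "X \<le> T"
  shows "0 \<le> X\<^sup>2" "X\<^sup>2 \<le> T\<^sup>2"
  using assms by (simp_all add: power_mono)

lemma Lob_chain:
  assumes "(g has_real_derivative g') (at x)" "0 < g x" "g x < pi"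
  shows "((\<lambda>x. Lob (g x)) has_real_derivative - ln (2 * sin (g x)) * g') (at x)"
  by (rule DERIV_chain2[OF Lob_has_derivative]) (use assms in auto)

lemma continuous_on_Lob [continuous_intros]:
  "continuous_on A g \<Longrightarrow> continuous_on A (\<lambda>x. Lob (g x))"
  using continuous_on_compose2[of UNIV Lob A g] isCont_Lob by (auto simp: continuous_on_eq_continuous_at)

text \<open>At T = X the last logarithm is ln (X^2 - Y^2), so the logarithms in Y fit
  \<open>ln_sin_arctan_diff_sum\<close> twice: with p = sqrt (1 + 2 X^2), whose angle is
  \<open>alp X\<close>, and with p = X. The sign conclusions are what later allows nonnegative
  integrals to be read as real numbers.\<close>

lemma integral_lam_diagonal:
  assumes X: "0 < X"
  shows "(\<integral>\<^sup>+Y. (if 0 < Y \<and> Y < X then ennreal (lam X X Y) else 0) \<partial>lborel) = ennreal (rho X / (1 + X\<^sup>2))"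
    and "0 \<le> rho X"
    and "\<And>Y. 0 < Y \<Longrightarrow> Y < X \<Longrightarrow> 0 \<le> lam X X Y"
proof -
  define s where "s = sqrt (1 + 2 * X\<^sup>2)"
  have s2: "s\<^sup>2 = 1 + 2 * X\<^sup>2" by (simp add: s_def)
  have "X\<^sup>2 < s\<^sup>2" unfolding s2 using zero_le_power2[of X] by linarith
  then have sX: "X < s" by (rule power_less_imp_less_base) (simp add: s_def)
  have a: "alp X = arctan s" by (simp add: alp_def s_def)
  define F where "F Y = (- Lob (alp X + arctan Y) + Lob (alp X - arctan Y) + Lob (arctan X + arctan Y)
     - Lob (arctan X - arctan Y)) / (1 + X\<^sup>2)" for Y
  have c: "continuous_on {0..X} F"
    unfolding F_def by (intro continuous_intros ballI) (metis add_pos_nonneg less_irrefl zero_le_power2 zero_less_one)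
  have d: "(F has_real_derivative lam X X Y) (at Y)" if Y: "0 < Y" "Y < X" for Y
  proof -
    have b: "0 < arctan Y" "arctan Y < arctan X" "arctan X < arctan s" "arctan s < pi / 2"
      using Y X sX arctan_ubound by (auto simp: arctan_less_iff)
    have r: "0 < arctan s + arctan Y" "arctan s + arctan Y < pi" "0 < arctan s - arctan Y" "arctan s - arctan Y < pi"
      "0 < arctan X + arctan Y" "arctan X + arctan Y < pi" "0 < arctan X - arctan Y" "arctan X - arctan Y < pi"
      using b pi_gt_zero by linarith+
    have nz: "1 + Y\<^sup>2 > 0" "1 + X\<^sup>2 > 0" by (auto simp: add_pos_nonneg)
    note D = Lob_chain DERIV_arctan
    have "(F has_real_derivative
      (- (- ln (2 * sin (arctan s + arctan Y)) * (0 + inverse (1 + Y\<^sup>2)))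
       + (- ln (2 * sin (arctan s - arctan Y)) * (0 - inverse (1 + Y\<^sup>2)))
       + (- ln (2 * sin (arctan X + arctan Y)) * (0 + inverse (1 + Y\<^sup>2)))
       - (- ln (2 * sin (arctan X - arctan Y)) * (0 - inverse (1 + Y\<^sup>2)))) / (1 + X\<^sup>2)) (at Y)"
      unfolding F_def a
      by (intro DERIV_cdivide DERIV_add DERIV_diff DERIV_minus Lob_chain DERIV_arctan DERIV_const r)
    also have "(- (- ln (2 * sin (arctan s + arctan Y)) * (0 + inverse (1 + Y\<^sup>2)))
       + (- ln (2 * sin (arctan s - arctan Y)) * (0 - inverse (1 + Y\<^sup>2)))
       + (- ln (2 * sin (arctan X + arctan Y)) * (0 + inverse (1 + Y\<^sup>2)))
       - (- ln (2 * sin (arctan X - arctan Y)) * (0 - inverse (1 + Y\<^sup>2)))) / (1 + X\<^sup>2)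
     = ((ln (2 * sin (arctan s - arctan Y)) + ln (2 * sin (arctan s + arctan Y)))
       - (ln (2 * sin (arctan X - arctan Y)) + ln (2 * sin (arctan X + arctan Y)))) / ((1 + X\<^sup>2) * (1 + Y\<^sup>2))"
      by (simp only: divide_inverse inverse_mult_distrib) (simp add: algebra_simps)
    also have "\<dots> = lam X X Y"
    proof -
      have "1 + s\<^sup>2 = 2 + 2 * X\<^sup>2" "s\<^sup>2 - Y\<^sup>2 = 1 + 2 * X\<^sup>2 - Y\<^sup>2" by (simp_all add: s2)
      then show ?thesis
        using ln_sin_arctan_diff_sum[of Y s] ln_sin_arctan_diff_sum[of Y X] Y sX
        by (simp add: lam_def add.commute[of _ 1])
    qed
    finally show ?thesis .
  qed
  show n: "0 \<le> lam X X Y" if Y: "0 < Y" "Y < X" for Y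
  proof -
    have y: "0 < Y\<^sup>2" "Y\<^sup>2 < X\<^sup>2" using Y by (simp_all add: power_strict_mono)
    \<comment> \<open>Nonnegativity of the numerator compares two products whose difference is (1 +
      X^2) (1 + Y^2).\<close>
    have "ln (2 + 2 * X\<^sup>2) + ln (2 * X\<^sup>2 - X\<^sup>2 - Y\<^sup>2) = ln ((2 + 2 * X\<^sup>2) * (X\<^sup>2 - Y\<^sup>2))"
      using y zero_le_power2[of X] by (subst ln_mult_pos) (linarith | simp add: add.commute[of _ 1])+
    also have "\<dots> \<le> ln ((1 + X\<^sup>2) * (1 + 2 * X\<^sup>2 - Y\<^sup>2))"
    proof (subst ln_le_cancel_iff)
      have "(1 + X\<^sup>2) * (1 + 2 * X\<^sup>2 - Y\<^sup>2) - (2 + 2 * X\<^sup>2) * (X\<^sup>2 - Y\<^sup>2) = (1 + X\<^sup>2) * (1 + Y\<^sup>2)"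
        by (simp add: algebra_simps)
      moreover have "0 \<le> (1 + X\<^sup>2) * (1 + Y\<^sup>2)" by simp
      ultimately show "(2 + 2 * X\<^sup>2) * (X\<^sup>2 - Y\<^sup>2) \<le> (1 + X\<^sup>2) * (1 + 2 * X\<^sup>2 - Y\<^sup>2)" by linarith
    qed (rule mult_pos_pos; use y in linarith)+
    also have "\<dots> = ln (1 + 2 * X\<^sup>2 - X\<^sup>2) + ln (1 + 2 * X\<^sup>2 - Y\<^sup>2)"
      using y zero_le_power2[of X] by (subst ln_mult_pos) (linarith | simp add: add.commute[of _ 1])+
    finally show ?thesis unfolding lam_def by (intro divide_nonneg_nonneg) auto
  qed
  have F0: "F 0 = 0" by (simp add: F_def)
  have FX: "F X = rho X / (1 + X\<^sup>2)" by (simp add: F_def rho_def)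
  have p: "1 + X\<^sup>2 > 0" using zero_le_power2[of X] by linarith
  from nn_integral_FTC_open[OF _ c d n, unfolded F0 FX] X p
  show "(\<integral>\<^sup>+Y. (if 0 < Y \<and> Y < X then ennreal (lam X X Y) else 0) \<partial>lborel) = ennreal (rho X / (1 + X\<^sup>2))"
    and "0 \<le> rho X" by (simp_all add: zero_le_divide_iff)
qed

lemma ker_nonneg:
  assumes "0 < X" "X < T" "0 < Y" "Y < T"
  shows "0 \<le> ker T X Y"
proof -
  have "X\<^sup>2 < T\<^sup>2" "Y\<^sup>2 < T\<^sup>2" using assms by (auto simp: power_strict_mono)
  then have "0 \<le> 1 + 2 * T\<^sup>2 - X\<^sup>2" "0 \<le> 2 * T\<^sup>2 - X\<^sup>2 - Y\<^sup>2"
    using zero_le_power2[of T] by linarith+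
  then show ?thesis unfolding ker_def using assms
    by (intro divide_nonneg_nonneg mult_nonneg_nonneg) auto
qed

text \<open>The fundamental theorem in T on [X, 1]. It reaches the wanted \<open>lam 1 X Y\<close>
  from \<open>lam X X Y\<close>, which can be integrated over Y, at the price of a rational
  kernel.\<close>

lemma integral_ker_T:
  assumes Y: "0 < Y" "Y < X" "X < 1"
  shows "ennreal (lam X X Y) = ennreal (lam 1 X Y) +
    (\<integral>\<^sup>+T. (if X < T \<and> T < 1 then ennreal (ker T X Y + ker T Y X) else 0) \<partial>lborel)"
    and "0 \<le> lam 1 X Y"
proof -
  have y: "0 < Y\<^sup>2" "Y\<^sup>2 < X\<^sup>2" "X\<^sup>2 < 1" using Y by (simp_all add: power_strict_mono power_less_one_iff)
  have p: "1 + 2 * T\<^sup>2 - X\<^sup>2 > 0" "1 + 2 * T\<^sup>2 - Y\<^sup>2 > 0" "2 + 2 * T\<^sup>2 > 0" "2 * T\<^sup>2 - X\<^sup>2 - Y\<^sup>2 > 0"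
    if "X \<le> T" for T
  proof -
    have "X\<^sup>2 \<le> T\<^sup>2" using sq_bounds[of X T] Y that by auto
    then show "1 + 2 * T\<^sup>2 - X\<^sup>2 > 0" "1 + 2 * T\<^sup>2 - Y\<^sup>2 > 0" "2 + 2 * T\<^sup>2 > 0" "2 * T\<^sup>2 - X\<^sup>2 - Y\<^sup>2 > 0"
      using y by linarith+
  qed
  define F where "F T = - lam T X Y" for T
  have c: "continuous_on {X..1} F"
    unfolding F_def lam_def
    by (intro continuous_intros ballI) (use p in \<open>force simp: add_pos_nonneg less_imp_neq[symmetric]\<close>)+
  have d: "(F has_real_derivative ker T X Y + ker T Y X) (at T)" if T: "X < T" "T < 1" for T
  proof -
    note q = p[OF less_imp_le[OF T(1)]]
    have nz: "1 + X\<^sup>2 > 0" "1 + Y\<^sup>2 > 0" by (auto simp: add_pos_nonneg)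
    have "(F has_real_derivative - ((4 * T / (1 + 2 * T\<^sup>2 - X\<^sup>2) + 4 * T / (1 + 2 * T\<^sup>2 - Y\<^sup>2) - 4 * T / (2 + 2 * T\<^sup>2)
       - 4 * T / (2 * T\<^sup>2 - X\<^sup>2 - Y\<^sup>2)) / ((1 + X\<^sup>2) * (1 + Y\<^sup>2)))) (at T)"
      unfolding F_def lam_def using q
      by (intro DERIV_minus DERIV_cdivide DERIV_add DERIV_diff)
        (auto intro!: derivative_eq_intros simp: divide_simps)
    also have "- ((4 * T / (1 + 2 * T\<^sup>2 - X\<^sup>2) + 4 * T / (1 + 2 * T\<^sup>2 - Y\<^sup>2) - 4 * T / (2 + 2 * T\<^sup>2)
       - 4 * T / (2 * T\<^sup>2 - X\<^sup>2 - Y\<^sup>2)) / ((1 + X\<^sup>2) * (1 + Y\<^sup>2))) = ker T X Y + ker T Y X"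
    proof -
      \<comment> \<open>In these letters the denominators are n - p', n - q', n and n - p' - q', and
        the claim is a partial fraction identity decided by clearing denominators.\<close>
      define p' q' n where "p' = 1 + X\<^sup>2" and "q' = 1 + Y\<^sup>2" and "n = 2 + 2 * T\<^sup>2"
      have e: "1 + 2 * T\<^sup>2 - X\<^sup>2 = n - p'" "1 + 2 * T\<^sup>2 - Y\<^sup>2 = n - q'" "2 * T\<^sup>2 - X\<^sup>2 - Y\<^sup>2 = n - p' - q'"
        "2 * T\<^sup>2 - Y\<^sup>2 - X\<^sup>2 = n - p' - q'" "1 + T\<^sup>2 = n / 2"
        by (simp_all add: p'_def q'_def n_def)
      have z: "n - p' \<noteq> 0" "n - q' \<noteq> 0" "n - p' - q' \<noteq> 0" "n \<noteq> 0" "p' \<noteq> 0" "q' \<noteq> 0"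
        using q nz unfolding e n_def[symmetric] p'_def[symmetric] q'_def[symmetric] by auto
      have "- ((4 * T / (n - p') + 4 * T / (n - q') - 4 * T / n - 4 * T / (n - p' - q')) / (p' * q'))
        = 2 * T / (n / 2 * (n - p') * (n - p' - q')) + 2 * T / (n / 2 * (n - q') * (n - p' - q'))"
        using z by (simp add: divide_simps) (simp add: algebra_simps)
      then show ?thesis unfolding ker_def e n_def[symmetric] p'_def[symmetric] q'_def[symmetric] .
    qed
    finally show ?thesis .
  qed
  have n: "0 \<le> ker T X Y + ker T Y X" if "X < T" "T < 1" for T
    using ker_nonneg[of X T Y] ker_nonneg[of Y T X] that Y by auto
  have *: "(\<integral>\<^sup>+T. (if X < T \<and> T < 1 then ennreal (ker T X Y + ker T Y X) else 0) \<partial>lborel)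
      = ennreal (lam X X Y - lam 1 X Y)" "lam 1 X Y \<le> lam X X Y"
    using nn_integral_FTC_open[OF _ c d n] Y by (simp_all add: F_def)
  show nn: "0 \<le> lam 1 X Y"
  proof -
    have "ln (2 + 2 * 1\<^sup>2) + ln (2 * 1\<^sup>2 - X\<^sup>2 - Y\<^sup>2) = ln (4 * (2 - X\<^sup>2 - Y\<^sup>2))"
      using y zero_le_power2[of X] by (subst ln_mult_pos) (linarith | simp add: add.commute[of _ 1])+
    also have "\<dots> \<le> ln ((3 - X\<^sup>2) * (3 - Y\<^sup>2))"
    proof (subst ln_le_cancel_iff)
      have "(3 - X\<^sup>2) * (3 - Y\<^sup>2) - 4 * (2 - X\<^sup>2 - Y\<^sup>2) = (1 + X\<^sup>2) * (1 + Y\<^sup>2)"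
        by (simp add: algebra_simps)
      moreover have "0 \<le> (1 + X\<^sup>2) * (1 + Y\<^sup>2)" by simp
      ultimately show "4 * (2 - X\<^sup>2 - Y\<^sup>2) \<le> (3 - X\<^sup>2) * (3 - Y\<^sup>2)" by linarith
    qed (rule mult_pos_pos; use y in linarith)+
    also have "\<dots> = ln (1 + 2 * 1\<^sup>2 - X\<^sup>2) + ln (1 + 2 * 1\<^sup>2 - Y\<^sup>2)"
      using y zero_le_power2[of X] by (subst ln_mult_pos) (linarith | simp add: add.commute[of _ 1])+
    finally show ?thesis unfolding lam_def by (intro divide_nonneg_nonneg) auto
  qed
  show "ennreal (lam X X Y) = ennreal (lam 1 X Y) +
    (\<integral>\<^sup>+T. (if X < T \<and> T < 1 then ennreal (ker T X Y + ker T Y X) else 0) \<partial>lborel)"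
    unfolding *(1) using nn *(2) by (subst ennreal_plus[symmetric]) auto
qed

text \<open>The two triangles of the square lead to this one integral along a ray of slope tau, with
  A = 1 + tau^2 and B = 1 or B = tau^2. It is a partial fraction in x^2: with u and v the two
  factors of the denominator, A u - B v does not depend on x and is the constant dividing the
  result.\<close>

lemma integral_radial:
  fixes T m A B :: real
  assumes "0 < T" "m = 1 + 2 * T\<^sup>2" "0 < A" "A < 2" "0 \<le> B" "B \<le> 1" "B < A"
  shows "(\<integral>\<^sup>+x. (if 0 < x \<and> x < T then ennreal (x / ((m - B * x\<^sup>2) * (2 * T\<^sup>2 - A * x\<^sup>2))) else 0) \<partial>lborel)
    = ennreal ((ln 2 + ln (m - B * T\<^sup>2) - ln m - ln (2 - A)) / (2 * (A * m - 2 * T\<^sup>2 * B)))" (is ?a)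
    and "0 \<le> (ln 2 + ln (m - B * T\<^sup>2) - ln m - ln (2 - A)) / (2 * (A * m - 2 * T\<^sup>2 * B))" (is ?b)
proof -
  have t: "0 < T\<^sup>2" using assms by simp
  have pos: "m - B * x\<^sup>2 > 0" "2 * T\<^sup>2 - A * x\<^sup>2 > 0" if "0 \<le> x" "x \<le> T" for x
  proof -
    have x: "0 \<le> x\<^sup>2" "x\<^sup>2 \<le> T\<^sup>2" using sq_bounds that by auto
    have "B * x\<^sup>2 \<le> 1 * T\<^sup>2" using x assms by (intro mult_mono) auto
    then show "m - B * x\<^sup>2 > 0" unfolding assms(2) using t by linarith
    have "A * x\<^sup>2 \<le> A * T\<^sup>2" using x assms by (intro mult_left_mono) auto
    also have "\<dots> < 2 * T\<^sup>2" using t assms by simp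
    finally show "2 * T\<^sup>2 - A * x\<^sup>2 > 0" by simp
  qed
  have E: "A * m - 2 * T\<^sup>2 * B > 0"
  proof -
    have "A * m - 2 * T\<^sup>2 * B = A + 2 * T\<^sup>2 * (A - B)" by (simp add: assms algebra_simps)
    also have "\<dots> > 0" using assms t by (intro add_pos_nonneg) auto
    finally show ?thesis .
  qed
  define F where "F x = (ln (m - B * x\<^sup>2) - ln (2 * T\<^sup>2 - A * x\<^sup>2)) / (2 * (A * m - 2 * T\<^sup>2 * B))" for x
  have c: "continuous_on {0..T} F"
    unfolding F_def by (intro continuous_intros ballI) (use pos E in \<open>force simp: less_imp_neq[symmetric]\<close>)+
  have d: "(F has_real_derivative x / ((m - B * x\<^sup>2) * (2 * T\<^sup>2 - A * x\<^sup>2))) (at x)" if x: "0 < x" "x < T" for x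
  proof -
    note p = pos[of x]
    define u v where "u = m - B * x\<^sup>2" and "v = 2 * T\<^sup>2 - A * x\<^sup>2"
    have uv: "u > 0" "v > 0" "A * u - B * v = A * m - 2 * T\<^sup>2 * B"
      using p x by (auto simp: u_def v_def algebra_simps)
    have "(F has_real_derivative (- (2 * B * x) / u - - (2 * A * x) / v) / (2 * (A * m - 2 * T\<^sup>2 * B))) (at x)"
      unfolding F_def u_def v_def using p x
      by (intro DERIV_cdivide DERIV_diff) (auto intro!: derivative_eq_intros)
    also have "(- (2 * B * x) / u - - (2 * A * x) / v) / (2 * (A * m - 2 * T\<^sup>2 * B)) = x / (u * v)"
      using E uv(1,2) unfolding uv(3)[symmetric] by (simp add: divide_simps) (simp add: algebra_simps)
    finally show ?thesis unfolding u_def v_def .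
  qed
  have n: "0 \<le> x / ((m - B * x\<^sup>2) * (2 * T\<^sup>2 - A * x\<^sup>2))" if "0 < x" "x < T" for x
    using pos[of x] that by (auto intro!: divide_nonneg_nonneg)
  have "2 * T\<^sup>2 - A * T\<^sup>2 = T\<^sup>2 * (2 - A)" by (simp add: algebra_simps)
  then have "F T - F 0 = (ln 2 + ln (m - B * T\<^sup>2) - ln m - ln (2 - A)) / (2 * (A * m - 2 * T\<^sup>2 * B))"
    using assms t by (simp add: F_def diff_divide_distrib[symmetric] ln_mult_pos)
  then show ?a ?b
    using nn_integral_FTC_open[OF _ c d n] assms by auto
qed

text \<open>The case B = 1 of \<open>integral_radial\<close>, integrated over the slope. The angle
  arctan (s tau) absorbs the factor 1 / (1 + m tau^2), and the logarithms are those of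
  \<open>ln_sin_arctan_diff_sum\<close> and its limit \<open>ln_cos_arctan\<close>.\<close>

lemma integral_tau1:
  assumes T: "0 < T" "m = 1 + 2 * T\<^sup>2"
  shows "(\<integral>\<^sup>+\<tau>. (if 0 < \<tau> \<and> \<tau> < 1 then
      ennreal ((ln 2 + ln (m - T\<^sup>2) - ln m - ln (1 - \<tau>\<^sup>2)) / (2 * (1 + m * \<tau>\<^sup>2))) else 0) \<partial>lborel)
    = ennreal (Lob (alp T) / sqrt m)" (is ?a)
    and "0 \<le> Lob (alp T)" (is ?b)
proof -
  define s where "s = sqrt m"
  have m: "m > 1" using T by simp
  have s: "s > 1" "s\<^sup>2 = m" using m by (auto simp: s_def)
  have a: "alp T = arctan s" by (simp add: alp_def s_def T)
  define F where "F \<tau> = (2 * Lob (pi / 2 - arctan (s * \<tau>)) - Lob (arctan s - arctan (s * \<tau>))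
     + Lob (arctan s + arctan (s * \<tau>))) / (2 * s)" for \<tau>
  have c: "continuous_on {0..1} F"
    unfolding F_def using s by (intro continuous_intros) auto
  have d: "(F has_real_derivative (ln 2 + ln (m - T\<^sup>2) - ln m - ln (1 - \<tau>\<^sup>2)) / (2 * (1 + m * \<tau>\<^sup>2))) (at \<tau>)"
    if \<tau>: "0 < \<tau>" "\<tau> < 1" for \<tau>
  proof -
    have st: "0 < s * \<tau>" "s * \<tau> < s" using s \<tau> by auto
    have b: "0 < arctan (s * \<tau>)" "arctan (s * \<tau>) < arctan s" "arctan s < pi / 2"
      using st arctan_ubound by (auto simp: arctan_less_iff)
    have r: "0 < pi / 2 - arctan (s * \<tau>)" "pi / 2 - arctan (s * \<tau>) < pi"
      "0 < arctan s - arctan (s * \<tau>)" "arctan s - arctan (s * \<tau>) < pi"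
      "0 < arctan s + arctan (s * \<tau>)" "arctan s + arctan (s * \<tau>) < pi"
      using b pi_gt_zero by linarith+
    define w where "w = s / (1 + (s * \<tau>)\<^sup>2)"
    have dw: "((\<lambda>\<tau>. arctan (s * \<tau>)) has_real_derivative w) (at \<tau>)"
      unfolding w_def by (auto intro!: derivative_eq_intros simp: divide_inverse)
    have "(F has_real_derivative
       (2 * (- ln (2 * sin (pi / 2 - arctan (s * \<tau>))) * (0 - w))
         - (- ln (2 * sin (arctan s - arctan (s * \<tau>))) * (0 - w))
         + (- ln (2 * sin (arctan s + arctan (s * \<tau>))) * (0 + w))) / (2 * s)) (at \<tau>)"
      unfolding F_def
      by (intro DERIV_cdivide DERIV_add DERIV_diff DERIV_cmult Lob_chain dw DERIV_const r)
    also have "(2 * (- ln (2 * sin (pi / 2 - arctan (s * \<tau>))) * (0 - w))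
         - (- ln (2 * sin (arctan s - arctan (s * \<tau>))) * (0 - w))
         + (- ln (2 * sin (arctan s + arctan (s * \<tau>))) * (0 + w))) / (2 * s)
       = w / s * (2 * ln (2 * sin (pi / 2 - arctan (s * \<tau>)))
          - (ln (2 * sin (arctan s - arctan (s * \<tau>))) + ln (2 * sin (arctan s + arctan (s * \<tau>))))) / 2"
      by (simp add: algebra_simps add_divide_distrib diff_divide_distrib)
    also have "\<dots> = w / s * (ln 2 + ln (m - T\<^sup>2) - ln m - ln (1 - \<tau>\<^sup>2)) / 2"
    proof -
      have 1: "s\<^sup>2 - (s * \<tau>)\<^sup>2 = m * (1 - \<tau>\<^sup>2)" by (simp add: s power_mult_distrib algebra_simps)
      have 2: "ln (m * (1 - \<tau>\<^sup>2)) = ln m + ln (1 - \<tau>\<^sup>2)"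
        using m \<tau> by (intro ln_mult_pos) (auto simp: power_less_one_iff)
      have "1 + s\<^sup>2 = 2 * (m - T\<^sup>2)" by (simp add: s T)
      moreover have "m - T\<^sup>2 > 0" unfolding T(2) using zero_le_power2[of T] by linarith
      ultimately have 3: "ln (1 + s\<^sup>2) = ln 2 + ln (m - T\<^sup>2)"
        by (simp only: ln_mult_pos zero_less_numeral)
      have 4: "ln (4::real) = 2 * ln 2" using ln_realpow[of 2 2] by simp
      show ?thesis
        unfolding ln_cos_arctan ln_sin_arctan_diff_sum[OF less_imp_le[OF st(1)] st(2)] 1 2 3 4
        by (simp add: algebra_simps)
    qed
    also have "w / s = 1 / (1 + m * \<tau>\<^sup>2)"
      using s by (simp add: w_def power_mult_distrib)
    also have "1 / D * E / 2 = E / (2 * D)" for D E :: real by simp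
    finally show ?thesis .
  qed
  have n: "0 \<le> (ln 2 + ln (m - T\<^sup>2) - ln m - ln (1 - \<tau>\<^sup>2)) / (2 * (1 + m * \<tau>\<^sup>2))"
    if \<tau>: "0 < \<tau>" "\<tau> < 1" for \<tau>
    using integral_radial(2)[of T m "1 + \<tau>\<^sup>2" 1] T \<tau> by (simp add: power_less_one_iff algebra_simps)
  have F0: "F 0 = 0" by (simp add: F_def)
  \<comment> \<open>At tau = 1 the complementary and the double angle of \<open>alp T\<close>
    remain; \<open>Lob_duplication\<close> merges them into one value.\<close>
  have F1: "F 1 = Lob (alp T) / s"
    unfolding F_def a using Lob_duplication[of "arctan s"] by (simp add: field_simps)
  show ?a ?b
    using nn_integral_FTC_open[OF _ c d n, unfolded F0 F1] s m by (auto simp: s_def zero_le_divide_iff)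
qed

text \<open>The case B = tau^2 of \<open>integral_radial\<close>, integrated over the slope.\<close>

lemma integral_tau2:
  assumes T: "0 < T" "m = 1 + 2 * T\<^sup>2"
  shows "(\<integral>\<^sup>+\<tau>. (if 0 < \<tau> \<and> \<tau> < 1 then
      ennreal ((ln 2 + ln (m - \<tau>\<^sup>2 * T\<^sup>2) - ln m - ln (1 - \<tau>\<^sup>2)) / (2 * (m + \<tau>\<^sup>2))) else 0) \<partial>lborel)
    = ennreal ((Lob (alp T - arctan T) + Lob (alp T + arctan T) - Lob (2 * alp T)) / 2 / sqrt m)" (is ?a)
    and "0 \<le> Lob (alp T - arctan T) + Lob (alp T + arctan T) - Lob (2 * alp T)" (is ?b)
proof -
  define s where "s = sqrt m"
  have m: "m > 1" using T by simp
  have s: "s > 1" "s\<^sup>2 = m" using m by (auto simp: s_def)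
  have "T\<^sup>2 < s\<^sup>2" unfolding s T using zero_le_power2[of T] by linarith
  then have Ts: "T < s" by (rule power_less_imp_less_base) (use s in simp)
  have a: "alp T = arctan s" by (simp add: alp_def s_def T)
  \<comment> \<open>Reciprocals are used because m + tau^2 = m (1 + (tau / s)^2) and m - tau^2 T^2 =
    m T^2 (1 / T^2 - (tau / s)^2); the angles become complements of arctan T and
    \<open>alp T\<close>.\<close>
  define p' where "p' = 1 / T"
  define s' where "s' = 1 / s"
  have sp: "0 < s'" "s' < p'" using Ts s T by (auto simp: p'_def s'_def divide_simps)
  have ap: "arctan p' = pi / 2 - arctan T" "arctan s' = pi / 2 - arctan s"
    unfolding p'_def s'_def using arctan_inverse[of T] arctan_inverse[of s] T(1) s(1)
    by (simp_all add: inverse_eq_divide)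
define F where "F \<tau> = (Lob (arctan p' - arctan (s' * \<tau>)) - Lob (arctan p' + arctan (s' * \<tau>))
     - Lob (arctan s' - arctan (s' * \<tau>)) + Lob (arctan s' + arctan (s' * \<tau>))) / (2 * s)" for \<tau>
  have c: "continuous_on {0..1} F"
    unfolding F_def using s by (intro continuous_intros) auto
  have d: "(F has_real_derivative (ln 2 + ln (m - \<tau>\<^sup>2 * T\<^sup>2) - ln m - ln (1 - \<tau>\<^sup>2)) / (2 * (m + \<tau>\<^sup>2))) (at \<tau>)"
    if \<tau>: "0 < \<tau>" "\<tau> < 1" for \<tau>
  proof -
    have st: "0 < s' * \<tau>" "s' * \<tau> < s'" using sp \<tau> by auto
    then have st': "s' * \<tau> < p'" using sp by linarith
    have b: "0 < arctan (s' * \<tau>)" "arctan (s' * \<tau>) < arctan s'" "arctan s' < arctan p'" "arctan p' < pi / 2"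
      using st sp arctan_ubound by (auto simp: arctan_less_iff)
    have r: "0 < arctan p' - arctan (s' * \<tau>)" "arctan p' - arctan (s' * \<tau>) < pi"
      "0 < arctan p' + arctan (s' * \<tau>)" "arctan p' + arctan (s' * \<tau>) < pi"
      "0 < arctan s' - arctan (s' * \<tau>)" "arctan s' - arctan (s' * \<tau>) < pi"
      "0 < arctan s' + arctan (s' * \<tau>)" "arctan s' + arctan (s' * \<tau>) < pi"
      using b pi_gt_zero by linarith+
    define w where "w = s' / (1 + (s' * \<tau>)\<^sup>2)"
    have dw: "((\<lambda>\<tau>. arctan (s' * \<tau>)) has_real_derivative w) (at \<tau>)"
      unfolding w_def by (auto intro!: derivative_eq_intros simp: divide_inverse)
    have "(F has_real_derivative
       ((- ln (2 * sin (arctan p' - arctan (s' * \<tau>))) * (0 - w))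
         - (- ln (2 * sin (arctan p' + arctan (s' * \<tau>))) * (0 + w))
         - (- ln (2 * sin (arctan s' - arctan (s' * \<tau>))) * (0 - w))
         + (- ln (2 * sin (arctan s' + arctan (s' * \<tau>))) * (0 + w))) / (2 * s)) (at \<tau>)"
      unfolding F_def
      by (intro DERIV_cdivide DERIV_add DERIV_diff Lob_chain dw DERIV_const r)
    also have "((- ln (2 * sin (arctan p' - arctan (s' * \<tau>))) * (0 - w))
         - (- ln (2 * sin (arctan p' + arctan (s' * \<tau>))) * (0 + w))
         - (- ln (2 * sin (arctan s' - arctan (s' * \<tau>))) * (0 - w))
         + (- ln (2 * sin (arctan s' + arctan (s' * \<tau>))) * (0 + w))) / (2 * s)
       = w / s * ((ln (2 * sin (arctan p' - arctan (s' * \<tau>))) + ln (2 * sin (arctan p' + arctan (s' * \<tau>))))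
          - (ln (2 * sin (arctan s' - arctan (s' * \<tau>))) + ln (2 * sin (arctan s' + arctan (s' * \<tau>))))) / 2"
      by (simp add: algebra_simps add_divide_distrib diff_divide_distrib)
    also have "\<dots> = w / s * (ln 2 + ln (m - \<tau>\<^sup>2 * T\<^sup>2) - ln m - ln (1 - \<tau>\<^sup>2)) / 2"
    proof -
      have t1: "\<tau>\<^sup>2 < 1" using \<tau> by (simp add: power_less_one_iff)
      have T2: "T\<^sup>2 > 0" using T by simp
      have "\<tau>\<^sup>2 * T\<^sup>2 \<le> 1 * T\<^sup>2" using t1 by (intro mult_right_mono) auto
      then have mt: "m - \<tau>\<^sup>2 * T\<^sup>2 > 0" using T T2 by linarith
      have sq: "s'\<^sup>2 = 1 / m" "p'\<^sup>2 = 1 / T\<^sup>2" by (simp_all add: s'_def p'_def power_divide s)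
      have mz: "m \<noteq> 0" "T \<noteq> 0" using m T(1) by auto
      have m2: "m + 1 = 2 * (1 + T\<^sup>2)" by (simp add: T)
      have 1: "s'\<^sup>2 - (s' * \<tau>)\<^sup>2 = (1 - \<tau>\<^sup>2) / m" by (simp add: sq power_mult_distrib diff_divide_distrib)
      have 2: "p'\<^sup>2 - (s' * \<tau>)\<^sup>2 = (m - \<tau>\<^sup>2 * T\<^sup>2) / (T\<^sup>2 * m)"
        using mz by (simp add: sq power_mult_distrib divide_simps)
      have 3: "1 + s'\<^sup>2 = 2 * (1 + T\<^sup>2) / m" "1 + p'\<^sup>2 = (1 + T\<^sup>2) / T\<^sup>2"
        unfolding m2[symmetric] sq using mz by (simp_all add: divide_simps)
      have p1: "1 + T\<^sup>2 > 0" using T2 by linarith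
      then have p2: "2 * (1 + T\<^sup>2) > 0" by (rule mult_pos_pos[OF zero_less_numeral])
      have l: "ln ((1 - \<tau>\<^sup>2) / m) = ln (1 - \<tau>\<^sup>2) - ln m"
        "ln ((m - \<tau>\<^sup>2 * T\<^sup>2) / (T\<^sup>2 * m)) = ln (m - \<tau>\<^sup>2 * T\<^sup>2) - (ln (T\<^sup>2) + ln m)"
        "ln (2 * (1 + T\<^sup>2) / m) = ln 2 + ln (1 + T\<^sup>2) - ln m"
        "ln ((1 + T\<^sup>2) / T\<^sup>2) = ln (1 + T\<^sup>2) - ln (T\<^sup>2)"
        using mt t1 m T2 p1 p2 by (simp_all only: ln_divide_pos ln_mult_pos mult_pos_pos zero_less_numeral
            diff_gt_0_iff_gt less_trans[OF zero_less_one])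
      show ?thesis
        unfolding ln_sin_arctan_diff_sum[OF less_imp_le[OF st(1)] st(2)]
          ln_sin_arctan_diff_sum[OF less_imp_le[OF st(1)] st'] 1 2 3 l
        by (simp add: algebra_simps)
    qed
    also have "w / s = 1 / (m + \<tau>\<^sup>2)"
    proof -
      have "0 < s * s + \<tau> * \<tau>" using s(1) by (intro add_pos_nonneg) auto
      then show ?thesis
        using s(1) unfolding w_def s'_def s(2)[symmetric] by (simp add: power2_eq_square divide_simps)
    qed
    also have "1 / D * E / 2 = E / (2 * D)" for D E :: real by simp
    finally show ?thesis .
  qed
  have n: "0 \<le> (ln 2 + ln (m - \<tau>\<^sup>2 * T\<^sup>2) - ln m - ln (1 - \<tau>\<^sup>2)) / (2 * (m + \<tau>\<^sup>2))"
    if \<tau>: "0 < \<tau>" "\<tau> < 1" for \<tau>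
  proof -
    have "(1 + \<tau>\<^sup>2) * m - 2 * T\<^sup>2 * \<tau>\<^sup>2 = m + \<tau>\<^sup>2" by (simp add: T algebra_simps)
    then show ?thesis
      using integral_radial(2)[of T m "1 + \<tau>\<^sup>2" "\<tau>\<^sup>2"] T \<tau> by (simp add: power_less_one_iff power_le_one)
  qed
  have F0: "F 0 = 0" by (simp add: F_def)
  have F1: "F 1 = (Lob (alp T - arctan T) + Lob (alp T + arctan T) - Lob (2 * alp T)) / 2 / s"
  proof -
    have "arctan p' - arctan s' = arctan s - arctan T"
      "arctan p' + arctan s' = pi - (arctan s + arctan T)"
      "arctan s' + arctan s' = pi - 2 * arctan s"
      unfolding ap by simp_all
    then show ?thesis unfolding F_def a mult_1_right by (simp only: Lob_pi_minus) simp
  qed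
  have "0 \<le> (Lob (alp T - arctan T) + Lob (alp T + arctan T) - Lob (2 * alp T)) / 2 / s"
    using nn_integral_FTC_open(2)[OF _ c d n, unfolded F0 F1] by simp
  then show ?b using s by (simp add: zero_le_divide_iff)
  show ?a
    using nn_integral_FTC_open(1)[OF _ c d n, unfolded F0 F1] by (simp add: s_def)
qed

text \<open>The kernel is not symmetric in X and Y, so the two triangles give different integrals;
  they are the two summands of \<open>qq\<close>.\<close>

lemma integral_ker_square:
  assumes T: "0 < T"
  shows "(\<integral>\<^sup>+X. \<integral>\<^sup>+Y. (if 0 < X \<and> X < T \<and> 0 < Y \<and> Y < T then ennreal (ker T X Y) else 0) \<partial>lborel \<partial>lborel)
    = ennreal (2 * T / (1 + T\<^sup>2) * (qq T / sqrt (1 + 2 * T\<^sup>2)))"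
    and "0 \<le> qq T"
proof -
  define m where "m = 1 + 2 * T\<^sup>2"
  have m1: "m > 1" using T by (simp add: m_def)
  define c where "c = 2 * T / (1 + T\<^sup>2)"
  have c: "c \<ge> 0" unfolding c_def using T by (intro divide_nonneg_nonneg) auto
  define h where "h X Y = 1 / ((m - X\<^sup>2) * (2 * T\<^sup>2 - X\<^sup>2 - Y\<^sup>2))" for X Y
  have hk: "ker T X Y = c * h X Y" for X Y by (simp add: ker_def c_def h_def m_def)
  have m2: "m - X\<^sup>2 > 0" "2 * T\<^sup>2 - X\<^sup>2 - Y\<^sup>2 > 0" if "0 < X" "X < T" "0 < Y" "Y < T" for X Y
  proof -
    have "X\<^sup>2 < T\<^sup>2" "Y\<^sup>2 < T\<^sup>2" using that by (auto simp: power_strict_mono)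
    then show "m - X\<^sup>2 > 0" "2 * T\<^sup>2 - X\<^sup>2 - Y\<^sup>2 > 0" unfolding m_def using zero_le_power2[of T] by linarith+
  qed
  have h0: "0 \<le> h X Y" if "0 < X" "X < T" "0 < Y" "Y < T" for X Y
    unfolding h_def using m2[OF that] by (intro divide_nonneg_nonneg mult_nonneg_nonneg) auto
  define g where "g X Y = (if 0 < X \<and> X < T \<and> 0 < Y \<and> Y < T then ennreal (h X Y) else 0)" for X Y
  have gm: "(\<lambda>(x, y). g x y) \<in> borel_measurable (lborel \<Otimes>\<^sub>M lborel)"
    unfolding g_def h_def by measurable
  \<comment> \<open>The substitution Y = X tau has Jacobian X; the order is exchanged so that the
    integral along the ray is done first.\<close>
  have polar: "(\<integral>\<^sup>+X. \<integral>\<^sup>+Y. (if Y < X then f X Y else 0) \<partial>lborel \<partial>lborel)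
    = (\<integral>\<^sup>+\<tau>. (if 0 < \<tau> \<and> \<tau> < 1 then \<integral>\<^sup>+X. (if 0 < X \<and> X < T then ennreal X * f X (X * \<tau>) else 0) \<partial>lborel else 0) \<partial>lborel)"
    if fm: "(\<lambda>(x, y). f x y) \<in> borel_measurable (lborel \<Otimes>\<^sub>M lborel)"
      and f0: "\<And>X Y. \<not> (0 < X \<and> X < T \<and> 0 < Y \<and> Y < T) \<Longrightarrow> f X Y = 0" for f :: "real \<Rightarrow> real \<Rightarrow> ennreal"
  proof -
    note [measurable] = fm
    have [measurable]: "(\<lambda>y. f x y) \<in> borel_measurable borel" for x
      using measurable_compose[OF measurable_Pair1' fm, of x] by simp
    have fm': "case_prod f \<in> borel_measurable (borel \<Otimes>\<^sub>M borel)"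
      using fm by (simp cong: measurable_cong_sets add: split_beta')
    note [measurable] = fm'
    have "(\<integral>\<^sup>+X. \<integral>\<^sup>+Y. (if Y < X then f X Y else 0) \<partial>lborel \<partial>lborel)
      = (\<integral>\<^sup>+X. \<integral>\<^sup>+\<tau>. (if 0 < X \<and> X < T \<and> 0 < \<tau> \<and> \<tau> < 1 then ennreal X * f X (X * \<tau>) else 0) \<partial>lborel \<partial>lborel)"
    proof (rule nn_integral_cong)
      fix X :: real
      show "(\<integral>\<^sup>+Y. (if Y < X then f X Y else 0) \<partial>lborel)
        = (\<integral>\<^sup>+\<tau>. (if 0 < X \<and> X < T \<and> 0 < \<tau> \<and> \<tau> < 1 then ennreal X * f X (X * \<tau>) else 0) \<partial>lborel)"
      proof (cases "0 < X \<and> X < T")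
        case True
        have "(\<integral>\<^sup>+Y. (if Y < X then f X Y else 0) \<partial>lborel) = (\<integral>\<^sup>+Y. (if 0 < Y \<and> Y < X then f X Y else 0) \<partial>lborel)"
          using f0 by (intro nn_integral_cong) auto
        also have "\<dots> = (\<integral>\<^sup>+\<tau>. (if 0 < \<tau> \<and> \<tau> < 1 then ennreal X * f X (X * \<tau>) else 0) \<partial>lborel)"
          by (rule nn_integral_scale_Ioo) (use True in auto)
        finally show ?thesis using True by simp
      next
        case False
        then have "(if Y < X then f X Y else 0) = 0"
          "(if 0 < X \<and> X < T \<and> 0 < Y \<and> Y < 1 then ennreal X * f X (X * Y) else 0) = 0" for Y
          using f0 by auto
        then show ?thesis by (simp only:)
      qed
    qed
    also have "\<dots> = (\<integral>\<^sup>+\<tau>. \<integral>\<^sup>+X. (if 0 < X \<and> X < T \<and> 0 < \<tau> \<and> \<tau> < 1 then ennreal X * f X (X * \<tau>) else 0) \<partial>lborel \<partial>lborel)"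
      by (rule nn_integral_lborel_swap) measurable
    also have "\<dots> = (\<integral>\<^sup>+\<tau>. (if 0 < \<tau> \<and> \<tau> < 1 then \<integral>\<^sup>+X. (if 0 < X \<and> X < T then ennreal X * f X (X * \<tau>) else 0) \<partial>lborel else 0) \<partial>lborel)"
      by (intro nn_integral_cong) (auto simp: if_distrib cong: if_cong)
    finally show ?thesis .
  qed
  have 1: "(\<integral>\<^sup>+X. \<integral>\<^sup>+Y. (if Y < X then g X Y else 0) \<partial>lborel \<partial>lborel) = ennreal (Lob (alp T) / sqrt m)"
  proof -
    have "(\<integral>\<^sup>+X. \<integral>\<^sup>+Y. (if Y < X then g X Y else 0) \<partial>lborel \<partial>lborel)
      = (\<integral>\<^sup>+\<tau>. (if 0 < \<tau> \<and> \<tau> < 1 then \<integral>\<^sup>+X. (if 0 < X \<and> X < T then ennreal X * g X (X * \<tau>) else 0) \<partial>lborel else 0) \<partial>lborel)"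
      by (rule polar[OF gm]) (auto simp: g_def)
    also have "\<dots> = (\<integral>\<^sup>+\<tau>. (if 0 < \<tau> \<and> \<tau> < 1 then
      ennreal ((ln 2 + ln (m - T\<^sup>2) - ln m - ln (1 - \<tau>\<^sup>2)) / (2 * (1 + m * \<tau>\<^sup>2))) else 0) \<partial>lborel)"
    proof (intro nn_integral_cong if_cong refl)
      fix \<tau> :: real assume \<tau>: "0 < \<tau> \<and> \<tau> < 1"
      have e: "ennreal X * g X (X * \<tau>) = ennreal (X / ((m - 1 * X\<^sup>2) * (2 * T\<^sup>2 - (1 + \<tau>\<^sup>2) * X\<^sup>2)))"
        if "0 < X \<and> X < T" for X
      proof -
        have "0 < X * \<tau>" "X * \<tau> < T" using that \<tau> mult_strict_mono[of X T \<tau> 1] by auto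
        then show ?thesis unfolding g_def using that h0[of X "X * \<tau>"]
          by (simp add: ennreal_mult[symmetric] h_def power_mult_distrib algebra_simps)
      qed
      have "(\<integral>\<^sup>+X. (if 0 < X \<and> X < T then ennreal X * g X (X * \<tau>) else 0) \<partial>lborel)
        = (\<integral>\<^sup>+X. (if 0 < X \<and> X < T then ennreal (X / ((m - 1 * X\<^sup>2) * (2 * T\<^sup>2 - (1 + \<tau>\<^sup>2) * X\<^sup>2))) else 0) \<partial>lborel)"
        by (intro nn_integral_cong if_cong refl e)
      also have "\<dots> = ennreal ((ln 2 + ln (m - 1 * T\<^sup>2) - ln m - ln (2 - (1 + \<tau>\<^sup>2))) / (2 * ((1 + \<tau>\<^sup>2) * m - 2 * T\<^sup>2 * 1)))"
        by (rule integral_radial(1)) (use T \<tau> in \<open>auto simp: m_def power_less_one_iff add_pos_nonneg\<close>)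
      also have "(1 + \<tau>\<^sup>2) * m - 2 * T\<^sup>2 * 1 = 1 + m * \<tau>\<^sup>2" by (simp add: m_def algebra_simps)
      finally show "(\<integral>\<^sup>+X. (if 0 < X \<and> X < T then ennreal X * g X (X * \<tau>) else 0) \<partial>lborel)
        = ennreal ((ln 2 + ln (m - T\<^sup>2) - ln m - ln (1 - \<tau>\<^sup>2)) / (2 * (1 + m * \<tau>\<^sup>2)))" by simp
    qed
    also have "\<dots> = ennreal (Lob (alp T) / sqrt m)" by (rule integral_tau1) (use T m_def in auto)
    finally show ?thesis .
  qed
  have 2: "(\<integral>\<^sup>+X. \<integral>\<^sup>+Y. (if Y < X then g Y X else 0) \<partial>lborel \<partial>lborel)
     = ennreal ((Lob (alp T - arctan T) + Lob (alp T + arctan T) - Lob (2 * alp T)) / 2 / sqrt m)"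
  proof -
    have gm': "(\<lambda>(x, y). g y x) \<in> borel_measurable (lborel \<Otimes>\<^sub>M lborel)"
      unfolding g_def h_def by measurable
    have "(\<integral>\<^sup>+X. \<integral>\<^sup>+Y. (if Y < X then g Y X else 0) \<partial>lborel \<partial>lborel)
      = (\<integral>\<^sup>+\<tau>. (if 0 < \<tau> \<and> \<tau> < 1 then \<integral>\<^sup>+X. (if 0 < X \<and> X < T then ennreal X * g (X * \<tau>) X else 0) \<partial>lborel else 0) \<partial>lborel)"
      by (rule polar[OF gm']) (auto simp: g_def)
    also have "\<dots> = (\<integral>\<^sup>+\<tau>. (if 0 < \<tau> \<and> \<tau> < 1 then
      ennreal ((ln 2 + ln (m - \<tau>\<^sup>2 * T\<^sup>2) - ln m - ln (1 - \<tau>\<^sup>2)) / (2 * (m + \<tau>\<^sup>2))) else 0) \<partial>lborel)"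
    proof (intro nn_integral_cong if_cong refl)
      fix \<tau> :: real assume \<tau>: "0 < \<tau> \<and> \<tau> < 1"
      have e: "ennreal X * g (X * \<tau>) X = ennreal (X / ((m - \<tau>\<^sup>2 * X\<^sup>2) * (2 * T\<^sup>2 - (1 + \<tau>\<^sup>2) * X\<^sup>2)))"
        if "0 < X \<and> X < T" for X
      proof -
        have "0 < X * \<tau>" "X * \<tau> < T" using that \<tau> mult_strict_mono[of X T \<tau> 1] by auto
        then show ?thesis unfolding g_def using that h0[of "X * \<tau>" X]
          by (simp add: ennreal_mult[symmetric] h_def power_mult_distrib algebra_simps)
      qed
      have "(\<integral>\<^sup>+X. (if 0 < X \<and> X < T then ennreal X * g (X * \<tau>) X else 0) \<partial>lborel)
        = (\<integral>\<^sup>+X. (if 0 < X \<and> X < T then ennreal (X / ((m - \<tau>\<^sup>2 * X\<^sup>2) * (2 * T\<^sup>2 - (1 + \<tau>\<^sup>2) * X\<^sup>2))) else 0) \<partial>lborel)"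
        by (intro nn_integral_cong if_cong refl e)
      also have "\<dots> = ennreal ((ln 2 + ln (m - \<tau>\<^sup>2 * T\<^sup>2) - ln m - ln (2 - (1 + \<tau>\<^sup>2))) / (2 * ((1 + \<tau>\<^sup>2) * m - 2 * T\<^sup>2 * \<tau>\<^sup>2)))"
        by (rule integral_radial(1)) (use T \<tau> in \<open>auto simp: m_def power_less_one_iff power_le_one add_pos_nonneg\<close>)
      also have "(1 + \<tau>\<^sup>2) * m - 2 * T\<^sup>2 * \<tau>\<^sup>2 = m + \<tau>\<^sup>2" by (simp add: m_def algebra_simps)
      finally show "(\<integral>\<^sup>+X. (if 0 < X \<and> X < T then ennreal X * g (X * \<tau>) X else 0) \<partial>lborel)
        = ennreal ((ln 2 + ln (m - \<tau>\<^sup>2 * T\<^sup>2) - ln m - ln (1 - \<tau>\<^sup>2)) / (2 * (m + \<tau>\<^sup>2)))" by simp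
    qed
    also have "\<dots> = ennreal ((Lob (alp T - arctan T) + Lob (alp T + arctan T) - Lob (2 * alp T)) / 2 / sqrt m)"
      by (rule integral_tau2) (use T m_def in auto)
    finally show ?thesis .
  qed
  note nn = integral_tau1(2)[OF T m_def] integral_tau2(2)[OF T m_def]
  show q0: "0 \<le> qq T" using nn by (simp add: qq_def)
  have "(\<integral>\<^sup>+X. \<integral>\<^sup>+Y. (if 0 < X \<and> X < T \<and> 0 < Y \<and> Y < T then ennreal (ker T X Y) else 0) \<partial>lborel \<partial>lborel)
    = (\<integral>\<^sup>+X. \<integral>\<^sup>+Y. ennreal c * g X Y \<partial>lborel \<partial>lborel)"
    using c h0 by (intro nn_integral_cong) (auto simp: g_def hk ennreal_mult)
  also have "\<dots> = ennreal c * (\<integral>\<^sup>+X. \<integral>\<^sup>+Y. g X Y \<partial>lborel \<partial>lborel)"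
    using gm by (simp add: nn_integral_cmult g_def h_def)
  also have "(\<integral>\<^sup>+X. \<integral>\<^sup>+Y. g X Y \<partial>lborel \<partial>lborel) = ennreal (qq T / sqrt m)"
    unfolding nn_integral_split_diagonal[OF gm] 1 2 using nn m1
    by (subst ennreal_plus[symmetric]) (auto simp: qq_def add_divide_distrib)
  also have "ennreal c * ennreal (qq T / sqrt m) = ennreal (c * (qq T / sqrt m))"
    using c q0 m1 by (intro ennreal_mult[symmetric]) auto
  finally show "(\<integral>\<^sup>+X. \<integral>\<^sup>+Y. (if 0 < X \<and> X < T \<and> 0 < Y \<and> Y < T then ennreal (ker T X Y) else 0) \<partial>lborel \<partial>lborel)
    = ennreal (2 * T / (1 + T\<^sup>2) * (qq T / sqrt (1 + 2 * T\<^sup>2)))"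
    by (simp add: c_def m_def)
qed

text \<open>Keeping both triangles under one integral sign produces the symmetrised kernel
  \<open>ker T X Y + ker T Y X\<close> of \<open>integral_ker_T\<close>.\<close>

lemma nn_integral_fold_diagonal:
  fixes g :: "real \<Rightarrow> real \<Rightarrow> ennreal"
  assumes g: "(\<lambda>(x, y). g x y) \<in> borel_measurable (lborel \<Otimes>\<^sub>M lborel)"
  shows "(\<integral>\<^sup>+x. \<integral>\<^sup>+y. g x y \<partial>lborel \<partial>lborel) =
    (\<integral>\<^sup>+x. \<integral>\<^sup>+y. (if y < x then g x y else 0) + (if y < x then g y x else 0) \<partial>lborel \<partial>lborel)"
proof -
  note [measurable] = g
  have [measurable]: "(\<lambda>y. g x y) \<in> borel_measurable lborel" "(\<lambda>y. g y x) \<in> borel_measurable lborel" for x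
    using measurable_compose[OF measurable_Pair1' g, of x] measurable_compose[OF measurable_Pair2' g, of x] by simp_all
  show ?thesis unfolding nn_integral_split_diagonal[OF g] by (simp add: nn_integral_add)
qed

lemma continuous_on_alp: "continuous_on A alp"
  unfolding alp_def[abs_def] by (intro continuous_intros)

text \<open>The derivative of arctan T is 1 / (1 + T^2) and that of \<open>alp T\<close> is T / ((1
  + T^2) sqrt (1 + 2 T^2)). Hence the integrand is rho times the first minus 2 qq times the second,
  and collecting equal arguments leaves terms Lob(g) g' with g among alp + arctan, alp - arctan, 2
  arctan, alp and 2 alp. Each has the antiderivative -Cl3(g) / 4, up to the inner factor 2.\<close>

lemma integral_rho_minus_qq:
  "((\<lambda>T. rho T / (1 + T\<^sup>2) - 2 * T / (1 + T\<^sup>2) * (qq T / sqrt (1 + 2 * T\<^sup>2))) has_integral 7 * zeta 3 / 96) {0..1}"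
proof -
  define Z where "Z T = ((Cl3 (alp T + arctan T) + Cl3 (alp T - arctan T)) / 2 - Cl3 (2 * arctan T) / 4
    + Cl3 (alp T) - Cl3 (2 * alp T) / 4) / 2" for T
  have d: "(Z has_real_derivative rho T / (1 + T\<^sup>2) - 2 * T / (1 + T\<^sup>2) * (qq T / sqrt (1 + 2 * T\<^sup>2))) (at T)" for T
  proof -
    define m where "m = 1 + 2 * T\<^sup>2"
    have m: "m > 0" unfolding m_def using zero_le_power2[of T] by linarith
    define t' where "t' = inverse (1 + T\<^sup>2)"
    define a' where "a' = T / sqrt m * t'"
    have da: "(alp has_real_derivative a') (at T)"
    proof -
      have 1: "((\<lambda>T. 1 + 2 * T\<^sup>2) has_real_derivative 4 * T) (at T)"
        by (auto intro!: derivative_eq_intros)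
      have "(alp has_real_derivative inverse (1 + (sqrt m)\<^sup>2) * (inverse (sqrt m) / 2 * (4 * T))) (at T)"
      proof -
        have "((\<lambda>T. sqrt (1 + 2 * T\<^sup>2)) has_real_derivative inverse (sqrt m) / 2 * (4 * T)) (at T)"
          unfolding m_def by (rule DERIV_chain2[OF DERIV_real_sqrt 1]) (use m in \<open>simp add: m_def\<close>)
        from DERIV_chain2[OF DERIV_arctan this] show ?thesis
          unfolding alp_def[abs_def] m_def .
      qed
      moreover have "1 + (sqrt m)\<^sup>2 = 2 * (1 + T\<^sup>2)" using m by (simp add: m_def)
      moreover have "inverse (2 * (1 + T\<^sup>2)) * (inverse (sqrt m) / 2 * (4 * T)) = a'"
      proof -
        have "inverse (2 * u) * (inverse v / 2 * (4 * T)) = T / v * inverse u" for u v :: real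
          by (cases "u = 0"; cases "v = 0"; simp add: field_simps)
        then show ?thesis unfolding a'_def t'_def .
      qed
      ultimately show ?thesis by (simp only:)
    qed
    have dt: "(arctan has_real_derivative t') (at T)" unfolding t'_def by (rule DERIV_arctan)
    have "(Z has_real_derivative ((- 4 * Lob (alp T + arctan T) * (a' + t') + - 4 * Lob (alp T - arctan T) * (a' - t')) / 2
       - - 4 * Lob (2 * arctan T) * (2 * t') / 4 + - 4 * Lob (alp T) * a' - - 4 * Lob (2 * alp T) * (2 * a') / 4) / 2) (at T)"
      unfolding Z_def
      by (intro DERIV_cdivide DERIV_add DERIV_diff DERIV_chain2[OF Cl3_has_derivative] da dt DERIV_cmult)
    also have "((- 4 * Lob (alp T + arctan T) * (a' + t') + - 4 * Lob (alp T - arctan T) * (a' - t')) / 2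
       - - 4 * Lob (2 * arctan T) * (2 * t') / 4 + - 4 * Lob (alp T) * a' - - 4 * Lob (2 * alp T) * (2 * a') / 4) / 2
      = rho T * t' - 2 * qq T * a'"
      by (simp add: rho_def qq_def algebra_simps add_divide_distrib diff_divide_distrib)
    also have "\<dots> = rho T / (1 + T\<^sup>2) - 2 * T / (1 + T\<^sup>2) * (qq T / sqrt (1 + 2 * T\<^sup>2))"
      by (simp add: a'_def t'_def m_def divide_inverse algebra_simps)
    finally show ?thesis .
  qed
  have v: "alp 0 = pi / 4" "alp 1 = pi / 3" using arctan_tan[of "pi / 3"] pi_gt_zero by (simp_all add: alp_def arctan_one tan_60)
  have Z: "Z 1 - Z 0 = 7 * zeta 3 / 96"
  proof -
    have e: "pi / 3 + pi / 4 = 7 * pi / 12" "pi / 3 - pi / 4 = pi / 12" "2 * (pi / 4) = pi / 2" "2 * (pi / 3) = 2 * pi / 3"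
      by simp_all
    have c: "Cl3 (7 * pi / 12) + Cl3 (pi / 12) = zeta 3 / 12" using Cl3_values(5) by linarith
    have "Z 1 = (zeta 3 / 12 / 2 - (- 3 / 4 * zeta 3) / 4 + - 4 / 9 * zeta 3 - (- 4 / 9 * zeta 3) / 4) / 2"
      unfolding Z_def v arctan_one e Cl3_values(1-4) c by simp
    moreover have "Z 0 = (- 3 / 32 * zeta 3 - zeta 3 / 4 + - 3 / 32 * zeta 3 - (- 3 / 4 * zeta 3) / 4) / 2"
      unfolding Z_def v arctan_zero_zero by (simp add: Cl3_values Cl3_0)
    ultimately show ?thesis by simp
  qed
  have h: "((\<lambda>T. rho T / (1 + T\<^sup>2) - 2 * T / (1 + T\<^sup>2) * (qq T / sqrt (1 + 2 * T\<^sup>2))) has_integral Z 1 - Z 0) {0..1}"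
    by (rule fundamental_theorem_of_calculus)
      (use d in \<open>auto simp: has_real_derivative_iff_has_vector_derivative intro: has_vector_derivative_at_within\<close>)
  show ?thesis using h unfolding Z .
qed

text \<open>For Y < X, \<open>integral_ker_T\<close> exhibits \<open>lam 1 X Y\<close> as
  \<open>lam X X Y\<close> minus an integral over T. With T taken outermost the region Y < X < T is
  half of the square of \<open>integral_ker_square\<close>, so two integrals in one variable
  remain.\<close>

lemma nn_integral_lam_triangle:
  "(\<integral>\<^sup>+X. \<integral>\<^sup>+Y. (if 0 < Y \<and> Y < X \<and> X < 1 then ennreal (lam 1 X Y) else 0) \<partial>lborel \<partial>lborel) = ennreal (7 * zeta 3 / 96)"
    (is "?A = _")
proof -
  define f1 where "f1 T = rho T / (1 + T\<^sup>2)" for T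
  define f2 where "f2 T = 2 * T / (1 + T\<^sup>2) * (qq T / sqrt (1 + 2 * T\<^sup>2))" for T
  define g where "g X Y T = (if 0 < Y \<and> Y < X \<and> X < T \<and> T < 1 then ennreal (ker T X Y + ker T Y X) else 0)" for X Y T
  have pos: "1 + T\<^sup>2 > 0" "1 + 2 * T\<^sup>2 > 0" for T :: real
    using zero_le_power2[of T] by linarith+
  have c: "continuous_on {0..1} f1" "continuous_on {0..1} f2"
    unfolding f1_def f2_def rho_def qq_def
    by (intro continuous_intros continuous_on_alp ballI; use pos in \<open>metis less_irrefl real_sqrt_gt_zero zero_neq_numeral\<close>)+
  have n: "0 \<le> f1 T" "0 \<le> f2 T" if "0 < T" for T
    using integral_lam_diagonal(2)[OF that] integral_ker_square(2)[OF that] that pos[of T]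
    by (auto simp: f1_def f2_def intro!: divide_nonneg_nonneg mult_nonneg_nonneg)
  have sq: "(\<integral>\<^sup>+X. \<integral>\<^sup>+Y. g X Y T \<partial>lborel \<partial>lborel) = (if 0 < T \<and> T < 1 then ennreal (f2 T) else 0)" for T
  proof (cases "0 < T \<and> T < 1")
    case True
    define k where "k X Y = (if 0 < X \<and> X < T \<and> 0 < Y \<and> Y < T then ennreal (ker T X Y) else 0)" for X Y
    have km: "(\<lambda>(x, y). k x y) \<in> borel_measurable (lborel \<Otimes>\<^sub>M lborel)"
      unfolding k_def ker_def by measurable
    have "ennreal (f2 T) = (\<integral>\<^sup>+X. \<integral>\<^sup>+Y. k X Y \<partial>lborel \<partial>lborel)"
      unfolding k_def f2_def using integral_ker_square(1)[of T] True by simp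
    also have "\<dots> = (\<integral>\<^sup>+X. \<integral>\<^sup>+Y. (if Y < X then k X Y else 0) + (if Y < X then k Y X else 0) \<partial>lborel \<partial>lborel)"
      by (rule nn_integral_fold_diagonal[OF km])
    also have "\<dots> = (\<integral>\<^sup>+X. \<integral>\<^sup>+Y. g X Y T \<partial>lborel \<partial>lborel)"
      using True ker_nonneg[of _ T]
      by (intro nn_integral_cong) (auto simp: k_def g_def ennreal_plus[symmetric] simp del: ennreal_plus)
    finally show ?thesis using True by simp
  next
    case False
    then have "g X Y T = 0" for X Y unfolding g_def by auto
    then show ?thesis using False by auto
  qed
  have "(\<integral>\<^sup>+X. (if 0 < X \<and> X < 1 then ennreal (f1 X) else 0) \<partial>lborel)
    = (\<integral>\<^sup>+X. \<integral>\<^sup>+Y. (if 0 < Y \<and> Y < X \<and> X < 1 then ennreal (lam 1 X Y) else 0) + (\<integral>\<^sup>+T. g X Y T \<partial>lborel) \<partial>lborel \<partial>lborel)"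
  proof (rule nn_integral_cong)
    fix X :: real
    show "(if 0 < X \<and> X < 1 then ennreal (f1 X) else 0)
      = (\<integral>\<^sup>+Y. (if 0 < Y \<and> Y < X \<and> X < 1 then ennreal (lam 1 X Y) else 0) + (\<integral>\<^sup>+T. g X Y T \<partial>lborel) \<partial>lborel)"
    proof (cases "0 < X \<and> X < 1")
      case True
      have "ennreal (f1 X) = (\<integral>\<^sup>+Y. (if 0 < Y \<and> Y < X then ennreal (lam X X Y) else 0) \<partial>lborel)"
        unfolding f1_def using integral_lam_diagonal(1)[of X] True by simp
      also have "\<dots> = (\<integral>\<^sup>+Y. (if 0 < Y \<and> Y < X \<and> X < 1 then ennreal (lam 1 X Y) else 0) + (\<integral>\<^sup>+T. g X Y T \<partial>lborel) \<partial>lborel)"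
      proof (rule nn_integral_cong)
        fix Y :: real
        show "(if 0 < Y \<and> Y < X then ennreal (lam X X Y) else 0)
          = (if 0 < Y \<and> Y < X \<and> X < 1 then ennreal (lam 1 X Y) else 0) + (\<integral>\<^sup>+T. g X Y T \<partial>lborel)"
          using integral_ker_T(1)[of Y X] True by (auto simp: g_def)
      qed
      finally show ?thesis using True by simp
    next
      case False
      then have "(if 0 < Y \<and> Y < X \<and> X < 1 then ennreal (lam 1 X Y) else 0) = 0" "g X Y T = 0" for Y T
        by (auto simp: g_def)
      then show ?thesis using False by (simp only:) simp
    qed
  qed
  also have "\<dots> = ?A + (\<integral>\<^sup>+X. \<integral>\<^sup>+Y. \<integral>\<^sup>+T. g X Y T \<partial>lborel \<partial>lborel \<partial>lborel)"
    unfolding g_def lam_def ker_def by (subst nn_integral_add[symmetric]; (measurable)?) (simp add: nn_integral_add)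
  also have "(\<integral>\<^sup>+X. \<integral>\<^sup>+Y. \<integral>\<^sup>+T. g X Y T \<partial>lborel \<partial>lborel \<partial>lborel) = (\<integral>\<^sup>+X. \<integral>\<^sup>+T. \<integral>\<^sup>+Y. g X Y T \<partial>lborel \<partial>lborel \<partial>lborel)"
    by (rule nn_integral_cong, rule nn_integral_lborel_swap) (unfold g_def ker_def, measurable)
  also have "\<dots> = (\<integral>\<^sup>+T. \<integral>\<^sup>+X. \<integral>\<^sup>+Y. g X Y T \<partial>lborel \<partial>lborel \<partial>lborel)"
    by (rule nn_integral_lborel_swap) (unfold g_def ker_def, measurable)
  finally have "ennreal (integral {0..1} f1) = ?A + ennreal (integral {0..1} f2)"
    unfolding sq using nn_integral_continuous_Ioo(1)[OF c(1)] nn_integral_continuous_Ioo(1)[OF c(2)] n by simp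
  \<comment> \<open>Cancelling is legitimate because both one-variable integrals are finite, being
    integrals of continuous functions.\<close>
  then have "?A = ennreal (integral {0..1} f1) - ennreal (integral {0..1} f2)"
    by simp
  also have "\<dots> = ennreal (integral {0..1} f1 - integral {0..1} f2)"
    using nn_integral_continuous_Ioo(2)[OF c(2)] n by (simp add: ennreal_minus)
  also have "integral {0..1} f1 - integral {0..1} f2 = integral {0..1} (\<lambda>T. f1 T - f2 T)"
    using c by (simp add: integral_diff integrable_continuous_real)
  also have "\<dots> = 7 * zeta 3 / 96"
    using integral_rho_minus_qq unfolding f1_def f2_def by (rule integral_unique)
  finally show ?thesis .
qed

lemma nn_integral_lam:
  "(\<integral>\<^sup>+X. \<integral>\<^sup>+Y. (if 0 < X \<and> X < 1 \<and> 0 < Y \<and> Y < 1 then ennreal (lam 1 X Y) else 0) \<partial>lborel \<partial>lborel) = ennreal (7 * zeta 3 / 48)"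
proof -
  have "(\<integral>\<^sup>+X. \<integral>\<^sup>+Y. (if 0 < X \<and> X < 1 \<and> 0 < Y \<and> Y < 1 then ennreal (lam 1 X Y) else 0) \<partial>lborel \<partial>lborel)
    = 2 * (\<integral>\<^sup>+X. \<integral>\<^sup>+Y. (if Y < X then (if 0 < X \<and> X < 1 \<and> 0 < Y \<and> Y < 1 then ennreal (lam 1 X Y) else 0) else 0) \<partial>lborel \<partial>lborel)"
  proof (rule nn_integral_split_symmetric)
    show "(\<lambda>(X, Y). if 0 < X \<and> X < 1 \<and> 0 < Y \<and> Y < 1 then ennreal (lam 1 X Y) else 0) \<in> borel_measurable (lborel \<Otimes>\<^sub>M lborel)"
      unfolding lam_def by measurable
    show "(if 0 < X \<and> X < 1 \<and> 0 < Y \<and> Y < 1 then ennreal (lam 1 X Y) else 0)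
      = (if 0 < Y \<and> Y < 1 \<and> 0 < X \<and> X < 1 then ennreal (lam 1 Y X) else 0)" for X Y
      by (subst lam_commute) (simp add: conj_ac)
  qed
  also have "(\<integral>\<^sup>+X. \<integral>\<^sup>+Y. (if Y < X then (if 0 < X \<and> X < 1 \<and> 0 < Y \<and> Y < 1 then ennreal (lam 1 X Y) else 0) else 0) \<partial>lborel \<partial>lborel)
    = (\<integral>\<^sup>+X. \<integral>\<^sup>+Y. (if 0 < Y \<and> Y < X \<and> X < 1 then ennreal (lam 1 X Y) else 0) \<partial>lborel \<partial>lborel)"
    by (intro nn_integral_cong) auto
  also have "2 * \<dots> = ennreal (2 * (7 * zeta 3 / 96))"
    unfolding nn_integral_lam_triangle by (subst ennreal_mult') auto
  finally show ?thesis by simp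
qed

text \<open>Here x z is the Jacobian of y = x X, w = z Y, with a = 1 + X^2 and b = 1 + Y^2. The
  condition a + b < 4 keeps the denominator positive up to the corner x = z = 1/2.\<close>

lemma radial_pair_integral:
  fixes a b :: real
  assumes "0 < a" "0 < b" "a + b < 4"
  shows "(\<integral>\<^sup>+x. \<integral>\<^sup>+z. (if 0 < x \<and> x < 1 / 2 \<and> 0 < z \<and> z < 1 / 2 then ennreal (x * z / (1 - a * x\<^sup>2 - b * z\<^sup>2)\<^sup>2) else 0) \<partial>lborel \<partial>lborel)
    = ennreal ((ln (4 - a) + ln (4 - b) - ln 4 - ln (4 - a - b)) / (4 * a * b))"
proof -
  have le: "x\<^sup>2 \<le> 1 / 4" if "0 \<le> x" "x \<le> 1 / 2" for x :: real
    using power_mono[OF that(2,1), of 2] by (simp add: power2_eq_square)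
  have pos: "1 - a * x\<^sup>2 - b * z\<^sup>2 > 0" if "0 \<le> x" "x \<le> 1 / 2" "0 \<le> z" "z \<le> 1 / 2" for x z
  proof -
    have "a * x\<^sup>2 \<le> a * (1 / 4)" "b * z\<^sup>2 \<le> b * (1 / 4)" using le that assms by (auto intro!: mult_left_mono)
    then show ?thesis using assms by linarith
  qed
  have inner: "(\<integral>\<^sup>+z. (if 0 < z \<and> z < 1 / 2 then ennreal (x * z / (1 - a * x\<^sup>2 - b * z\<^sup>2)\<^sup>2) else 0) \<partial>lborel)
    = ennreal (x / (2 * b) / (1 - b / 4 - a * x\<^sup>2) - x / (2 * b) / (1 - a * x\<^sup>2))"
    and inner0: "0 \<le> x / (2 * b) / (1 - b / 4 - a * x\<^sup>2) - x / (2 * b) / (1 - a * x\<^sup>2)"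
    if x: "0 < x" "x < 1 / 2" for x
  proof -
    define F where "F z = x / (2 * b) / (1 - a * x\<^sup>2 - b * z\<^sup>2)" for z
    have c: "continuous_on {0..1 / 2} F"
      unfolding F_def
    proof (intro continuous_intros ballI)
      fix z :: real assume "z \<in> {0..1 / 2}"
      then show "1 - a * x\<^sup>2 - b * z\<^sup>2 \<noteq> 0" using pos[of x z] x by simp
    qed
    have d: "(F has_real_derivative x * z / (1 - a * x\<^sup>2 - b * z\<^sup>2)\<^sup>2) (at z)" if z: "0 < z" "z < 1 / 2" for z
    proof -
      have p: "1 - a * x\<^sup>2 - b * z\<^sup>2 > 0" using pos x z by simp
      have "(F has_real_derivative (0 * (1 - a * x\<^sup>2 - b * z\<^sup>2) - x / (2 * b) * (0 - b * (2 * z))) /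
         ((1 - a * x\<^sup>2 - b * z\<^sup>2) * (1 - a * x\<^sup>2 - b * z\<^sup>2))) (at z)"
        unfolding F_def using p
        by (intro DERIV_divide DERIV_const DERIV_diff) (auto intro!: derivative_eq_intros)
      then show ?thesis using assms by (simp add: power2_eq_square)
    qed
    have n: "0 \<le> x * z / (1 - a * x\<^sup>2 - b * z\<^sup>2)\<^sup>2" if "0 < z" "z < 1 / 2" for z
      using that x by simp
    have e: "F (1 / 2) - F 0 = x / (2 * b) / (1 - b / 4 - a * x\<^sup>2) - x / (2 * b) / (1 - a * x\<^sup>2)"
      by (simp add: F_def power2_eq_square algebra_simps)
    show "(\<integral>\<^sup>+z. (if 0 < z \<and> z < 1 / 2 then ennreal (x * z / (1 - a * x\<^sup>2 - b * z\<^sup>2)\<^sup>2) else 0) \<partial>lborel)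
    = ennreal (x / (2 * b) / (1 - b / 4 - a * x\<^sup>2) - x / (2 * b) / (1 - a * x\<^sup>2))"
      "0 \<le> x / (2 * b) / (1 - b / 4 - a * x\<^sup>2) - x / (2 * b) / (1 - a * x\<^sup>2)"
      using nn_integral_FTC_open[OF _ c d n] unfolding e[symmetric] by simp_all
  qed
  have p2: "1 - b / 4 - a * x\<^sup>2 > 0" "1 - a * x\<^sup>2 > 0" if "0 \<le> x" "x \<le> 1 / 2" for x
    using pos[OF that, of "1 / 2"] pos[OF that, of 0] by (simp_all add: power2_eq_square)
  define F where "F x = (ln (1 - a * x\<^sup>2) - ln (1 - b / 4 - a * x\<^sup>2)) / (4 * a * b)" for x
  have c: "continuous_on {0..1 / 2} F"
    unfolding F_def
  proof (intro continuous_intros ballI)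
    fix x :: real assume "x \<in> {0..1 / 2}"
    then show "1 - a * x\<^sup>2 \<noteq> 0" "1 - b / 4 - a * x\<^sup>2 \<noteq> 0" using p2[of x] by simp_all
  qed (use assms in simp_all)
  have d: "(F has_real_derivative x / (2 * b) / (1 - b / 4 - a * x\<^sup>2) - x / (2 * b) / (1 - a * x\<^sup>2)) (at x)"
    if x: "0 < x" "x < 1 / 2" for x
  proof -
    note p = p2[of x]
    have "(F has_real_derivative (- (2 * a * x) / (1 - a * x\<^sup>2) - - (2 * a * x) / (1 - b / 4 - a * x\<^sup>2)) / (4 * a * b)) (at x)"
      unfolding F_def using p x by (intro DERIV_cdivide DERIV_diff) (auto intro!: derivative_eq_intros)
    also have "(- (2 * a * x) / (1 - a * x\<^sup>2) - - (2 * a * x) / (1 - b / 4 - a * x\<^sup>2)) / (4 * a * b)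
      = x / (2 * b) / (1 - b / 4 - a * x\<^sup>2) - x / (2 * b) / (1 - a * x\<^sup>2)"
    proof -
      have "(- (2 * a * x) / u - - (2 * a * x) / v) / (4 * a * b) = x / (2 * b) / v - x / (2 * b) / u" for u v :: real
      proof -
        have "(- (2 * a * x) / u - - (2 * a * x) / v) / (4 * a * b) = (2 * a) * (x / v - x / u) / ((2 * a) * (2 * b))"
          by (simp add: algebra_simps)
        also have "\<dots> = (x / v - x / u) / (2 * b)"
          using assms by (subst mult_divide_mult_cancel_left) auto
        also have "\<dots> = x / (2 * b) / v - x / (2 * b) / u" by (simp add: diff_divide_distrib mult.commute)
        finally show ?thesis .
      qed
      then show ?thesis .
    qed
    finally show ?thesis .
  qed
  have e: "F (1 / 2) - F 0 = (ln (4 - a) + ln (4 - b) - ln 4 - ln (4 - a - b)) / (4 * a * b)"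
  proof -
    have s: "ln (1 - t / 4) = ln (4 - t) - ln 4" if "t < 4" for t :: real
    proof -
      have "1 - t / 4 = (4 - t) / 4" by simp
      then show ?thesis using that by (simp only: ln_divide_pos diff_gt_0_iff_gt zero_less_numeral)
    qed
    have h: "t * (1 / 2)\<^sup>2 = t / 4" for t :: real by (simp add: power2_eq_square)
    have q1: "1 - a * (1 / 2)\<^sup>2 = 1 - a / 4" unfolding h by simp
    have q2: "1 - b / 4 - a * (1 / 2)\<^sup>2 = 1 - (a + b) / 4" unfolding h by (simp add: add_divide_distrib)
    have q3: "4 - (a + b) = 4 - a - b" by simp
    show ?thesis unfolding F_def q1 q2 using s[of a] s[of b] s[of "a + b"] assms
      by (simp add: q3 diff_divide_distrib[symmetric] add_divide_distrib[symmetric])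
  qed
  have "(\<integral>\<^sup>+x. \<integral>\<^sup>+z. (if 0 < x \<and> x < 1 / 2 \<and> 0 < z \<and> z < 1 / 2 then ennreal (x * z / (1 - a * x\<^sup>2 - b * z\<^sup>2)\<^sup>2) else 0) \<partial>lborel \<partial>lborel)
    = (\<integral>\<^sup>+x. (if 0 < x \<and> x < 1 / 2 then ennreal (x / (2 * b) / (1 - b / 4 - a * x\<^sup>2) - x / (2 * b) / (1 - a * x\<^sup>2)) else 0) \<partial>lborel)"
  proof (rule nn_integral_cong)
    fix x :: real
    show "(\<integral>\<^sup>+z. (if 0 < x \<and> x < 1 / 2 \<and> 0 < z \<and> z < 1 / 2 then ennreal (x * z / (1 - a * x\<^sup>2 - b * z\<^sup>2)\<^sup>2) else 0) \<partial>lborel)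
      = (if 0 < x \<and> x < 1 / 2 then ennreal (x / (2 * b) / (1 - b / 4 - a * x\<^sup>2) - x / (2 * b) / (1 - a * x\<^sup>2)) else 0)"
    proof (cases "0 < x \<and> x < 1 / 2")
      case True
      then show ?thesis using inner[of x] by simp
    next
      case False
      then have "(if 0 < x \<and> x < 1 / 2 \<and> 0 < z \<and> z < 1 / 2 then ennreal (x * z / (1 - a * x\<^sup>2 - b * z\<^sup>2)\<^sup>2) else 0) = 0" for z
        by auto
      then show ?thesis using False by (simp only:) simp
    qed
  qed
  also have "\<dots> = ennreal ((ln (4 - a) + ln (4 - b) - ln 4 - ln (4 - a - b)) / (4 * a * b))"
    using nn_integral_FTC_open(1)[OF _ c d inner0] unfolding e by simp
  finally show ?thesis .
qed

text \<open>Extension by 0 turns the symmetries of the cube into symmetries of an integrand on the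
  whole space. The denominator vanishes at the corner with all coordinates 1/2, which is the ideal
  vertex A_0.\<close>

definition box_density :: "real \<Rightarrow> real \<Rightarrow> real \<Rightarrow> real \<Rightarrow> ennreal" where
  "box_density x y z w = (if 0 < x \<and> x < 1 / 2 \<and> 0 < y \<and> y < 1 / 2 \<and> 0 < z \<and> z < 1 / 2 \<and> 0 < w \<and> w < 1 / 2
     then ennreal (1 / (1 - x\<^sup>2 - y\<^sup>2 - z\<^sup>2 - w\<^sup>2)\<^sup>2) else 0)"

lemma box_density_commute:
  "box_density x y z w = box_density y x z w" "box_density x y z w = box_density x z y w"
  "box_density x y z w = box_density x y w z"
proof -
  have "1 - x\<^sup>2 - y\<^sup>2 - z\<^sup>2 - w\<^sup>2 = 1 - y\<^sup>2 - x\<^sup>2 - z\<^sup>2 - w\<^sup>2" "1 - x\<^sup>2 - y\<^sup>2 - z\<^sup>2 - w\<^sup>2 = 1 - x\<^sup>2 - z\<^sup>2 - y\<^sup>2 - w\<^sup>2"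
    "1 - x\<^sup>2 - y\<^sup>2 - z\<^sup>2 - w\<^sup>2 = 1 - x\<^sup>2 - y\<^sup>2 - w\<^sup>2 - z\<^sup>2" by simp_all
  then show "box_density x y z w = box_density y x z w" "box_density x y z w = box_density x z y w"
    "box_density x y z w = box_density x y w z"
    unfolding box_density_def by (simp_all only: conj_ac)
qed

lemma measurable_box_density [measurable]:
  assumes [measurable]: "f1 \<in> borel_measurable M" "f2 \<in> borel_measurable M" "f3 \<in> borel_measurable M" "f4 \<in> borel_measurable M"
  shows "(\<lambda>u. box_density (f1 u) (f2 u) (f3 u) (f4 u)) \<in> borel_measurable M"
  unfolding box_density_def by measurable

lemma nn_integral_triangle_scale:
  fixes f :: "real \<Rightarrow> real \<Rightarrow> ennreal"
  assumes [measurable]: "(\<lambda>(x, y). f x y) \<in> borel_measurable (borel \<Otimes>\<^sub>M borel)"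
    and f0: "\<And>x y. \<not> (0 < x \<and> x < 1 / 2 \<and> 0 < y) \<Longrightarrow> f x y = 0"
  shows "(\<integral>\<^sup>+x. \<integral>\<^sup>+y. (if y < x then f x y else 0) \<partial>lborel \<partial>lborel)
    = (\<integral>\<^sup>+x. \<integral>\<^sup>+t. (if 0 < x \<and> x < 1 / 2 \<and> 0 < t \<and> t < 1 then ennreal x * f x (x * t) else 0) \<partial>lborel \<partial>lborel)"
proof (rule nn_integral_cong)
  fix x :: real
  have [measurable]: "f x \<in> borel_measurable borel" by measurable
  show "(\<integral>\<^sup>+y. (if y < x then f x y else 0) \<partial>lborel)
    = (\<integral>\<^sup>+t. (if 0 < x \<and> x < 1 / 2 \<and> 0 < t \<and> t < 1 then ennreal x * f x (x * t) else 0) \<partial>lborel)"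
  proof (cases "0 < x \<and> x < 1 / 2")
    case True
    have "(\<integral>\<^sup>+y. (if y < x then f x y else 0) \<partial>lborel) = (\<integral>\<^sup>+y. (if 0 < y \<and> y < x then f x y else 0) \<partial>lborel)"
      using f0 by (intro nn_integral_cong) auto
    also have "\<dots> = (\<integral>\<^sup>+t. (if 0 < t \<and> t < 1 then ennreal x * f x (x * t) else 0) \<partial>lborel)"
      by (rule nn_integral_scale_Ioo) (use True in auto)
    finally show ?thesis using True by simp
  next
    case False
    then have "(if y < x then f x y else 0) = 0"
      "(if 0 < x \<and> x < 1 / 2 \<and> 0 < y \<and> y < 1 then ennreal x * f x (x * y) else 0) = 0" for y
      using f0 by auto
    then show ?thesis by (simp only:)
  qed
qed

text \<open>With y = x X and w = z Y the variables x and z are integrated first; what they leave is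
  a quarter of \<open>lam 1 X Y\<close>.\<close>

lemma nn_integral_two_triangles:
  "(\<integral>\<^sup>+x. \<integral>\<^sup>+y. (if y < x then \<integral>\<^sup>+z. \<integral>\<^sup>+w. (if w < z then box_density x y z w else 0) \<partial>lborel \<partial>lborel else 0) \<partial>lborel \<partial>lborel)
    = ennreal (7 * zeta 3 / 192)"
proof -
  define H where "H x X z Y = (if 0 < X \<and> X < 1 \<and> 0 < Y \<and> Y < 1 \<and> 0 < x \<and> x < 1 / 2 \<and> 0 < z \<and> z < 1 / 2
    then ennreal (x * z / (1 - (1 + X\<^sup>2) * x\<^sup>2 - (1 + Y\<^sup>2) * z\<^sup>2)\<^sup>2) else 0)" for x X z Y
  have Hm [measurable]: "(\<lambda>u. H (f1 u) (f2 u) (f3 u) (f4 u)) \<in> borel_measurable M"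
    if [measurable]: "f1 \<in> borel_measurable M" "f2 \<in> borel_measurable M" "f3 \<in> borel_measurable M" "f4 \<in> borel_measurable M"
    for f1 f2 f3 f4 M
    unfolding H_def by measurable
  have H: "ennreal x * (ennreal z * box_density x (x * X) z (z * Y)) = H x X z Y"
    if "0 < x" "x < 1 / 2" "0 < z" "z < 1 / 2" "0 < X" "X < 1" "0 < Y" "Y < 1" for x X z Y
  proof -
    have lt: "x * X < 1 / 2 * 1" "z * Y < 1 / 2 * 1" using that by (intro mult_strict_mono; simp)+
    have "1 - x\<^sup>2 - (x * X)\<^sup>2 - z\<^sup>2 - (z * Y)\<^sup>2 = 1 - (1 + X\<^sup>2) * x\<^sup>2 - (1 + Y\<^sup>2) * z\<^sup>2"
      by (simp add: power_mult_distrib algebra_simps)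
    note e = this
    have "box_density x (x * X) z (z * Y) = ennreal (1 / (1 - (1 + X\<^sup>2) * x\<^sup>2 - (1 + Y\<^sup>2) * z\<^sup>2)\<^sup>2)"
      using that lt unfolding box_density_def e by simp
    then show ?thesis
      using that unfolding H_def by (simp add: ennreal_mult[symmetric])
  qed
  have H0: "H x X z Y = 0" if "\<not> (0 < X \<and> X < 1 \<and> 0 < Y \<and> Y < 1 \<and> 0 < x \<and> x < 1 / 2 \<and> 0 < z \<and> z < 1 / 2)" for x X z Y
    unfolding H_def using that by auto
  have zw: "(\<integral>\<^sup>+z. \<integral>\<^sup>+w. (if w < z then box_density x y z w else 0) \<partial>lborel \<partial>lborel)
    = (\<integral>\<^sup>+z. \<integral>\<^sup>+Y. (if 0 < z \<and> z < 1 / 2 \<and> 0 < Y \<and> Y < 1 then ennreal z * box_density x y z (z * Y) else 0) \<partial>lborel \<partial>lborel)" for x y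
    by (rule nn_integral_triangle_scale) (measurable, auto simp: box_density_def)
  have "(\<integral>\<^sup>+x. \<integral>\<^sup>+y. (if y < x then \<integral>\<^sup>+z. \<integral>\<^sup>+w. (if w < z then box_density x y z w else 0) \<partial>lborel \<partial>lborel else 0) \<partial>lborel \<partial>lborel)
    = (\<integral>\<^sup>+x. \<integral>\<^sup>+X. (if 0 < x \<and> x < 1 / 2 \<and> 0 < X \<and> X < 1 then ennreal x *
        (\<integral>\<^sup>+z. \<integral>\<^sup>+w. (if w < z then box_density x (x * X) z w else 0) \<partial>lborel \<partial>lborel) else 0) \<partial>lborel \<partial>lborel)"
  proof (rule nn_integral_triangle_scale)
    fix x y :: real assume "\<not> (0 < x \<and> x < 1 / 2 \<and> 0 < y)"
    then have "box_density x y z w = 0" for z w unfolding box_density_def by auto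
    then show "(\<integral>\<^sup>+z. \<integral>\<^sup>+w. (if w < z then box_density x y z w else 0) \<partial>lborel \<partial>lborel) = 0"
      by (simp cong: if_cong)
  qed measurable
  also have "\<dots> = (\<integral>\<^sup>+x. \<integral>\<^sup>+X. \<integral>\<^sup>+z. \<integral>\<^sup>+Y. H x X z Y \<partial>lborel \<partial>lborel \<partial>lborel \<partial>lborel)"
  proof (intro nn_integral_cong)
    fix x X :: real
    show "(if 0 < x \<and> x < 1 / 2 \<and> 0 < X \<and> X < 1 then ennreal x *
        (\<integral>\<^sup>+z. \<integral>\<^sup>+w. (if w < z then box_density x (x * X) z w else 0) \<partial>lborel \<partial>lborel) else 0)
      = (\<integral>\<^sup>+z. \<integral>\<^sup>+Y. H x X z Y \<partial>lborel \<partial>lborel)"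
    proof (cases "0 < x \<and> x < 1 / 2 \<and> 0 < X \<and> X < 1")
      case True
      have "ennreal x * (\<integral>\<^sup>+z. \<integral>\<^sup>+w. (if w < z then box_density x (x * X) z w else 0) \<partial>lborel \<partial>lborel)
        = (\<integral>\<^sup>+z. \<integral>\<^sup>+Y. ennreal x * (if 0 < z \<and> z < 1 / 2 \<and> 0 < Y \<and> Y < 1 then ennreal z * box_density x (x * X) z (z * Y) else 0) \<partial>lborel \<partial>lborel)"
        unfolding zw by (simp add: nn_integral_cmult)
      also have "\<dots> = (\<integral>\<^sup>+z. \<integral>\<^sup>+Y. H x X z Y \<partial>lborel \<partial>lborel)"
      proof (intro nn_integral_cong)
        fix z Y :: real
        show "ennreal x * (if 0 < z \<and> z < 1 / 2 \<and> 0 < Y \<and> Y < 1 then ennreal z * box_density x (x * X) z (z * Y) else 0) = H x X z Y"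
          using True H[of x z X Y] H0[of X Y x z] by auto
      qed
      finally show ?thesis using True by simp
    next
      case False
      then have "H x X z Y = 0" for z Y using H0 by blast
      then show ?thesis using False by auto
    qed
  qed
  also have "\<dots> = (\<integral>\<^sup>+X. \<integral>\<^sup>+x. \<integral>\<^sup>+z. \<integral>\<^sup>+Y. H x X z Y \<partial>lborel \<partial>lborel \<partial>lborel \<partial>lborel)"
    by (rule nn_integral_lborel_swap) measurable
  also have "\<dots> = (\<integral>\<^sup>+X. \<integral>\<^sup>+x. \<integral>\<^sup>+Y. \<integral>\<^sup>+z. H x X z Y \<partial>lborel \<partial>lborel \<partial>lborel \<partial>lborel)"
    by (intro nn_integral_cong nn_integral_lborel_swap) measurable
  also have "\<dots> = (\<integral>\<^sup>+X. \<integral>\<^sup>+Y. \<integral>\<^sup>+x. \<integral>\<^sup>+z. H x X z Y \<partial>lborel \<partial>lborel \<partial>lborel \<partial>lborel)"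
    by (rule nn_integral_cong, rule nn_integral_lborel_swap) measurable
  also have "\<dots> = (\<integral>\<^sup>+X. \<integral>\<^sup>+Y. ennreal (1 / 4) * (if 0 < X \<and> X < 1 \<and> 0 < Y \<and> Y < 1 then ennreal (lam 1 X Y) else 0) \<partial>lborel \<partial>lborel)"
  proof (intro nn_integral_cong)
    fix X Y :: real
    show "(\<integral>\<^sup>+x. \<integral>\<^sup>+z. H x X z Y \<partial>lborel \<partial>lborel) = ennreal (1 / 4) * (if 0 < X \<and> X < 1 \<and> 0 < Y \<and> Y < 1 then ennreal (lam 1 X Y) else 0)"
    proof (cases "0 < X \<and> X < 1 \<and> 0 < Y \<and> Y < 1")
      case True
      define a b where "a = 1 + X\<^sup>2" and "b = 1 + Y\<^sup>2"
      have "X\<^sup>2 < 1" "Y\<^sup>2 < 1" using True by (simp_all add: power_less_one_iff)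
      then have ab: "0 < a" "0 < b" "a + b < 4"
        unfolding a_def b_def using zero_le_power2[of X] zero_le_power2[of Y] by linarith+
      have "(\<integral>\<^sup>+x. \<integral>\<^sup>+z. H x X z Y \<partial>lborel \<partial>lborel)
        = ennreal ((ln (4 - a) + ln (4 - b) - ln 4 - ln (4 - a - b)) / (4 * a * b))"
        unfolding H_def a_def[symmetric] b_def[symmetric] using True radial_pair_integral[OF ab] by simp
      also have "(ln (4 - a) + ln (4 - b) - ln 4 - ln (4 - a - b)) / (4 * a * b) = 1 / 4 * lam 1 X Y"
      proof -
        have "1 + 2 * 1\<^sup>2 - X\<^sup>2 = 4 - a" "1 + 2 * 1\<^sup>2 - Y\<^sup>2 = 4 - b" "2 + 2 * 1\<^sup>2 = (4::real)"
          "2 * 1\<^sup>2 - X\<^sup>2 - Y\<^sup>2 = 4 - a - b" by (simp_all add: a_def b_def)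
        then have "lam 1 X Y = (ln (4 - a) + ln (4 - b) - ln 4 - ln (4 - a - b)) / (a * b)"
          by (simp only: lam_def a_def[symmetric] b_def[symmetric])
        then show ?thesis by simp
      qed
      finally show ?thesis using True by (simp only: ennreal_mult' if_True) simp
    next
      case False
      then have "H x X z Y = 0" for x z using H0 by blast
      then show ?thesis using False by auto
    qed
  qed
  also have "\<dots> = ennreal (1 / 4) * ennreal (7 * zeta 3 / 48)"
    unfolding nn_integral_lam[symmetric] lam_def by (simp add: nn_integral_cmult)
  also have "\<dots> = ennreal (7 * zeta 3 / 192)"
    by (subst ennreal_mult'[symmetric]) auto
  finally show ?thesis .
qed

lemma nn_integral_box:
  "(\<integral>\<^sup>+x. \<integral>\<^sup>+y. \<integral>\<^sup>+z. \<integral>\<^sup>+w. box_density x y z w \<partial>lborel \<partial>lborel \<partial>lborel \<partial>lborel) = ennreal (7 * zeta 3 / 48)"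
proof -
  have "(\<integral>\<^sup>+x. \<integral>\<^sup>+y. \<integral>\<^sup>+z. \<integral>\<^sup>+w. box_density x y z w \<partial>lborel \<partial>lborel \<partial>lborel \<partial>lborel)
    = 2 * (\<integral>\<^sup>+x. \<integral>\<^sup>+y. (if y < x then \<integral>\<^sup>+z. \<integral>\<^sup>+w. box_density x y z w \<partial>lborel \<partial>lborel else 0) \<partial>lborel \<partial>lborel)"
    by (rule nn_integral_split_symmetric) (measurable, simp add: box_density_commute(1))
  also have "(\<integral>\<^sup>+x. \<integral>\<^sup>+y. (if y < x then \<integral>\<^sup>+z. \<integral>\<^sup>+w. box_density x y z w \<partial>lborel \<partial>lborel else 0) \<partial>lborel \<partial>lborel)
    = (\<integral>\<^sup>+x. \<integral>\<^sup>+y. 2 * (if y < x then (\<integral>\<^sup>+z. \<integral>\<^sup>+w. (if w < z then box_density x y z w else 0) \<partial>lborel \<partial>lborel) else 0) \<partial>lborel \<partial>lborel)"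
  proof (intro nn_integral_cong)
    fix x y :: real
    have "(\<integral>\<^sup>+z. \<integral>\<^sup>+w. box_density x y z w \<partial>lborel \<partial>lborel)
      = 2 * (\<integral>\<^sup>+z. \<integral>\<^sup>+w. (if w < z then box_density x y z w else 0) \<partial>lborel \<partial>lborel)"
      by (rule nn_integral_split_symmetric) (measurable, rule box_density_commute(3))
    then show "(if y < x then \<integral>\<^sup>+z. \<integral>\<^sup>+w. box_density x y z w \<partial>lborel \<partial>lborel else 0)
      = 2 * (if y < x then (\<integral>\<^sup>+z. \<integral>\<^sup>+w. (if w < z then box_density x y z w else 0) \<partial>lborel \<partial>lborel) else 0)"
      by simp
  qed
  also have "\<dots> = 2 * ennreal (7 * zeta 3 / 192)"
    unfolding nn_integral_two_triangles[symmetric] by (simp add: nn_integral_cmult)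
  also have "2 * (2 * ennreal (7 * zeta 3 / 192)) = ennreal (2 * (2 * (7 * zeta 3 / 192)))"
    by (simp only: ennreal_mult' zero_le_numeral ennreal_numeral)
  finally show ?thesis by simp
qed

text \<open>Ordering x and y costs a factor 2. For z there remain the case z < y, which is S, and
  the case of y smallest, which by symmetry in x and z is 2 S; hence the whole is 2 (S + 2 S) = 6
  S.\<close>

lemma nn_integral_sorted_box:
  "(\<integral>\<^sup>+x. \<integral>\<^sup>+y. \<integral>\<^sup>+z. \<integral>\<^sup>+w. (if z < y \<and> y < x then box_density x y z w else 0) \<partial>lborel \<partial>lborel \<partial>lborel \<partial>lborel)
    = ennreal (7 * zeta 3 / 288)"
proof -
  define G where "G x y z = (\<integral>\<^sup>+w. box_density x y z w \<partial>lborel)" for x y z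
  have Gm [measurable]: "(\<lambda>u. G (f1 u) (f2 u) (f3 u)) \<in> borel_measurable M"
    if [measurable]: "f1 \<in> borel_measurable M" "f2 \<in> borel_measurable M" "f3 \<in> borel_measurable M"
    for f1 f2 f3 M
    unfolding G_def by measurable
  have Gc: "G x y z = G y x z" "G x y z = G x z y" "G x y z = G z y x" for x y z
  proof -
    have "box_density x y z w = box_density z y x w" for w
      by (metis box_density_commute)
    then show "G x y z = G y x z" "G x y z = G x z y" "G x y z = G z y x"
      unfolding G_def using box_density_commute by (intro nn_integral_cong; simp)+
  qed
  define S where "S = (\<integral>\<^sup>+x. \<integral>\<^sup>+y. \<integral>\<^sup>+z. (if z < y \<and> y < x then G x y z else 0) \<partial>lborel \<partial>lborel \<partial>lborel)"
  have "ennreal (7 * zeta 3 / 48) = (\<integral>\<^sup>+x. \<integral>\<^sup>+y. \<integral>\<^sup>+z. G x y z \<partial>lborel \<partial>lborel \<partial>lborel)"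
    unfolding nn_integral_box[symmetric] G_def ..
  also have "\<dots> = 2 * (\<integral>\<^sup>+x. \<integral>\<^sup>+y. (if y < x then \<integral>\<^sup>+z. G x y z \<partial>lborel else 0) \<partial>lborel \<partial>lborel)"
    by (rule nn_integral_split_symmetric) (measurable, simp add: Gc(1))
  also have "(\<integral>\<^sup>+x. \<integral>\<^sup>+y. (if y < x then \<integral>\<^sup>+z. G x y z \<partial>lborel else 0) \<partial>lborel \<partial>lborel)
    = (\<integral>\<^sup>+x. \<integral>\<^sup>+y. (\<integral>\<^sup>+z. (if z < y \<and> y < x then G x y z else 0) + (if y < z \<and> y < x then G x y z else 0) \<partial>lborel) \<partial>lborel \<partial>lborel)"
  proof (intro nn_integral_cong)
    fix x y :: real
    show "(if y < x then \<integral>\<^sup>+z. G x y z \<partial>lborel else 0)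
      = (\<integral>\<^sup>+z. (if z < y \<and> y < x then G x y z else 0) + (if y < z \<and> y < x then G x y z else 0) \<partial>lborel)"
    proof (cases "y < x")
      case True
      have "(\<integral>\<^sup>+z. G x y z \<partial>lborel)
        = (\<integral>\<^sup>+z. (if z < y \<and> y < x then G x y z else 0) + (if y < z \<and> y < x then G x y z else 0) \<partial>lborel)"
      proof (rule nn_integral_cong_AE)
        show "AE z in lborel. G x y z = (if z < y \<and> y < x then G x y z else 0) + (if y < z \<and> y < x then G x y z else 0)"
          using AE_lborel_singleton[of y] by eventually_elim (use True in auto)
      qed
      then show ?thesis using True by simp
    qed auto
  qed
  also have "\<dots> = S + (\<integral>\<^sup>+x. \<integral>\<^sup>+y. \<integral>\<^sup>+z. (if y < z \<and> y < x then G x y z else 0) \<partial>lborel \<partial>lborel \<partial>lborel)"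
    unfolding S_def by (simp add: nn_integral_add)
  also have "(\<integral>\<^sup>+x. \<integral>\<^sup>+y. \<integral>\<^sup>+z. (if y < z \<and> y < x then G x y z else 0) \<partial>lborel \<partial>lborel \<partial>lborel)
    = (\<integral>\<^sup>+y. \<integral>\<^sup>+x. \<integral>\<^sup>+z. (if y < z \<and> y < x then G x y z else 0) \<partial>lborel \<partial>lborel \<partial>lborel)"
    by (rule nn_integral_lborel_swap) measurable
  also have "\<dots> = (\<integral>\<^sup>+y. 2 * (\<integral>\<^sup>+x. \<integral>\<^sup>+z. (if z < x then (if y < z \<and> y < x then G x y z else 0) else 0) \<partial>lborel \<partial>lborel) \<partial>lborel)"
  proof (intro nn_integral_cong nn_integral_split_symmetric)
    fix x y z :: real
    show "(if y < z \<and> y < x then G x y z else 0) = (if y < x \<and> y < z then G z y x else 0)"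
      using Gc(3)[of x y z] by auto
  qed measurable
  also have "\<dots> = 2 * (\<integral>\<^sup>+y. \<integral>\<^sup>+x. \<integral>\<^sup>+z. (if z < x then (if y < z \<and> y < x then G x y z else 0) else 0) \<partial>lborel \<partial>lborel \<partial>lborel)"
    by (rule nn_integral_cmult) measurable
  also have "(\<integral>\<^sup>+y. \<integral>\<^sup>+x. \<integral>\<^sup>+z. (if z < x then (if y < z \<and> y < x then G x y z else 0) else 0) \<partial>lborel \<partial>lborel \<partial>lborel)
    = (\<integral>\<^sup>+x. \<integral>\<^sup>+y. \<integral>\<^sup>+z. (if z < x then (if y < z \<and> y < x then G x y z else 0) else 0) \<partial>lborel \<partial>lborel \<partial>lborel)"
    by (rule nn_integral_lborel_swap) measurable
  also have "\<dots> = (\<integral>\<^sup>+x. \<integral>\<^sup>+z. \<integral>\<^sup>+y. (if z < x then (if y < z \<and> y < x then G x y z else 0) else 0) \<partial>lborel \<partial>lborel \<partial>lborel)"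
    by (rule nn_integral_cong, rule nn_integral_lborel_swap) measurable
  also have "\<dots> = S"
    unfolding S_def using Gc(2) by (intro nn_integral_cong) auto
  finally have *: "ennreal (7 * zeta 3 / 48) = 2 * (S + 2 * S)" .
  also have "2 * (S + 2 * S) = 6 * S"
    by (simp add: distrib_left mult.assoc[symmetric] distrib_right[symmetric] numeral_plus_numeral flip: mult_2)
  finally have "6 * S = ennreal (6 * (7 * zeta 3 / 288))" by simp
  also have "\<dots> = 6 * ennreal (7 * zeta 3 / 288)" by (subst ennreal_mult') auto
  finally have "S = ennreal (7 * zeta 3 / 288)"
    by (simp add: ennreal_mult_cancel_left)
  moreover have "(\<integral>\<^sup>+x. \<integral>\<^sup>+y. \<integral>\<^sup>+z. \<integral>\<^sup>+w. (if z < y \<and> y < x then box_density x y z w else 0) \<partial>lborel \<partial>lborel \<partial>lborel \<partial>lborel) = S"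
    unfolding S_def G_def by (intro nn_integral_cong) auto
  ultimately show ?thesis by simp
qed

section \<open>Lorentz isometries and hyperbolic volume\<close>

lemma exhaust_5: fixes x :: 5 shows "x = 1 \<or> x = 2 \<or> x = 3 \<or> x = 4 \<or> x = 5"
proof (induct x)
  case (of_int z)
  then have "z = 0 \<or> z = 1 \<or> z = 2 \<or> z = 3 \<or> z = 4" by fastforce
  then show ?case by auto
qed

lemma exhaust_6: fixes x :: 6 shows "x = 1 \<or> x = 2 \<or> x = 3 \<or> x = 4 \<or> x = 5 \<or> x = 6"
proof (induct x)
  case (of_int z)
  then have "z = 0 \<or> z = 1 \<or> z = 2 \<or> z = 3 \<or> z = 4 \<or> z = 5" by fastforce
  then show ?case by auto
qed

lemma UNIV_5: "UNIV = {1, 2, 3, 4, 5 :: 5}" using exhaust_5 by auto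
lemma UNIV_6: "UNIV = {1, 2, 3, 4, 5, 6 :: 6}" using exhaust_6 by auto
lemma forall_5: "(\<forall>i::5. P i) \<longleftrightarrow> P 1 \<and> P 2 \<and> P 3 \<and> P 4 \<and> P 5" by (metis exhaust_5)
lemma forall_6: "(\<forall>i::6. P i) \<longleftrightarrow> P 1 \<and> P 2 \<and> P 3 \<and> P 4 \<and> P 5 \<and> P 6" by (metis exhaust_6)
lemma sum_5: "sum f (UNIV :: 5 set) = f 1 + f 2 + f 3 + f 4 + f 5"
  unfolding UNIV_5 by (simp add: ac_simps)
lemma sum_6: "sum f (UNIV :: 6 set) = f 1 + f 2 + f 3 + f 4 + f 5 + f 6"
  unfolding UNIV_6 by (simp add: ac_simps)

definition vec5 :: "real \<Rightarrow> real \<Rightarrow> real \<Rightarrow> real \<Rightarrow> real \<Rightarrow> real^5" where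
  "vec5 a b c d e = (\<chi> i. if i = 1 then a else if i = 2 then b else if i = 3 then c else if i = 4 then d else e)"

lemma vec5_nth [simp]:
  "vec5 a b c d e $ 1 = a" "vec5 a b c d e $ 2 = b" "vec5 a b c d e $ 3 = c" "vec5 a b c d e $ 4 = d" "vec5 a b c d e $ 5 = e"
  by (simp_all add: vec5_def)

lemma vec5_eq_iff: "(x :: real^5) = y \<longleftrightarrow> x $ 1 = y $ 1 \<and> x $ 2 = y $ 2 \<and> x $ 3 = y $ 3 \<and> x $ 4 = y $ 4 \<and> x $ 5 = y $ 5"
  by (simp add: vec_eq_iff forall_5)

lemma inner_5: "(x :: real^5) \<bullet> y = x $ 1 * y $ 1 + x $ 2 * y $ 2 + x $ 3 * y $ 3 + x $ 4 * y $ 4 + x $ 5 * y $ 5"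
  by (simp add: inner_vec_def sum_5)

text \<open>Identifies the Lebesgue measures of Euclidean spaces of different types, such as tuples
  and vectors. A linear map matching the bases preserves coordinates, hence takes boxes to boxes of
  equal volume.\<close>

lemma distr_lborel_basis_bij:
  fixes J :: "'a::euclidean_space \<Rightarrow> 'b::euclidean_space"
  assumes lin: "linear J" and b: "bij_betw J Basis Basis"
  shows "distr lborel borel J = lborel"
proof (rule lborel_eqI[symmetric])
  have inj: "inj_on J Basis" and im: "J ` Basis = Basis" using b by (auto simp: bij_betw_def)
  have [measurable]: "J \<in> borel_measurable borel"
    using lin by (intro borel_measurable_continuous_onI linear_continuous_on linear_conv_bounded_linear[THEN iffD1])
  have iso: "J x \<bullet> J c = x \<bullet> c" if c: "c \<in> Basis" for x c
  proof -
    have "J x = (\<Sum>d\<in>Basis. (x \<bullet> d) *\<^sub>R J d)"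
      by (subst euclidean_representation[symmetric, of x]) (simp add: linear_sum[OF lin] linear_cmul[OF lin])
    then have "J x \<bullet> J c = (\<Sum>d\<in>Basis. (x \<bullet> d) * (J d \<bullet> J c))"
      by (simp add: inner_sum_left)
    also have "\<dots> = (\<Sum>d\<in>Basis. if d = c then x \<bullet> c else 0)"
    proof (rule sum.cong[OF refl])
      fix d :: 'a assume d: "d \<in> Basis"
      have "J d \<in> Basis" "J c \<in> Basis" using im c d by auto
      then show "(x \<bullet> d) * (J d \<bullet> J c) = (if d = c then x \<bullet> c else 0)"
        using inj c d by (auto simp: inner_Basis inj_on_def)
    qed
    finally show ?thesis using c by simp
  qed
  fix l u :: 'b assume le: "\<And>b. b \<in> Basis \<Longrightarrow> l \<bullet> b \<le> u \<bullet> b"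
  define l' u' where "l' = (\<Sum>c\<in>Basis. (l \<bullet> J c) *\<^sub>R c)" and "u' = (\<Sum>c\<in>Basis. (u \<bullet> J c) *\<^sub>R c)"
  have l': "l' \<bullet> c = l \<bullet> J c" "u' \<bullet> c = u \<bullet> J c" if "c \<in> Basis" for c
    using that by (simp_all add: l'_def u'_def)
  have "J -` box l u = box l' u'"
  proof -
    have "(\<forall>b\<in>J ` Basis. l \<bullet> b < J x \<bullet> b \<and> J x \<bullet> b < u \<bullet> b)
      \<longleftrightarrow> (\<forall>c\<in>Basis. l' \<bullet> c < x \<bullet> c \<and> x \<bullet> c < u' \<bullet> c)" for x
      by (simp add: iso l')
    then show ?thesis unfolding im by (auto simp: box_def)
  qed
  then have "emeasure (distr lborel borel J) (box l u) = emeasure lborel (box l' u')"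
    by (subst emeasure_distr) auto
  also have "\<dots> = (\<Prod>c\<in>Basis. (u' - l') \<bullet> c)"
    by (rule emeasure_lborel_box) (use le im l' in auto)
  also have "(\<Prod>c\<in>Basis. (u' - l') \<bullet> c) = (\<Prod>c\<in>Basis. (u - l) \<bullet> J c)"
    by (intro prod.cong) (auto simp: inner_diff_left l')
  also have "\<dots> = (\<Prod>b\<in>Basis. (u - l) \<bullet> b)"
    using prod.reindex_bij_betw[OF b, of "\<lambda>b. (u - l) \<bullet> b"] .
  finally show "emeasure (distr lborel borel J) (box l u) = (\<Prod>b\<in>Basis. (u - l) \<bullet> b)" .
qed simp

lemma bij_betw_Basis:
  fixes J :: "'a::euclidean_space \<Rightarrow> 'b::euclidean_space"
  assumes "DIM('a) = DIM('b)" "J ` Basis = Basis"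
  shows "bij_betw J Basis Basis"
  unfolding bij_betw_def using assms by (auto intro!: eq_card_imp_inj_on)

lemma Basis_vec5: "(Basis :: (real^5) set) = {axis 1 1, axis 2 1, axis 3 1, axis 4 1, axis 5 1}"
  by (auto simp: Basis_vec_def UNIV_5)

lemma Basis_vec6: "(Basis :: (real^6) set) = {axis 1 1, axis 2 1, axis 3 1, axis 4 1, axis 5 1, axis 6 1}"
  by (auto simp: Basis_vec_def UNIV_6)

text \<open>The fifth coordinate comes first because the slices on which it is constant will be
  rescaled before it is integrated.\<close>

definition T5 :: "real \<times> real \<times> real \<times> real \<times> real \<Rightarrow> real^5" where
  "T5 u = (case u of (e, a, b, c, d) \<Rightarrow> vec5 a b c d e)"

lemma linear_T5: "linear T5"
  by (rule linearI) (auto simp: T5_def vec5_eq_iff split: prod.splits)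

lemma distr_T5: "distr lborel borel T5 = lborel"
proof (rule distr_lborel_basis_bij[OF linear_T5 bij_betw_Basis])
  show "T5 ` Basis = Basis"
    unfolding Basis_vec5 Basis_prod_def
    by (auto simp: T5_def vec5_eq_iff axis_def image_Un image_image zero_prod_def)
qed simp

text \<open>Moves the Lorentzian space to \<open>real^6\<close>, where linear maps have matrices and
  determinants.\<close>

definition J6 :: "real^6 \<Rightarrow> real \<times> (real^5)" where
  "J6 x = (x $ 1, vec5 (x $ 2) (x $ 3) (x $ 4) (x $ 5) (x $ 6))"

lemma linear_J6: "linear J6"
  by (rule linearI) (auto simp: J6_def vec5_eq_iff)

lemma distr_J6: "distr lborel borel J6 = lborel"
proof (rule distr_lborel_basis_bij[OF linear_J6 bij_betw_Basis])
  show "J6 ` Basis = Basis"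
    unfolding Basis_vec6 Basis_prod_def Basis_vec5
    by (auto simp: J6_def vec5_eq_iff axis_def)
qed simp

lemma lborel_distr_det_1:
  fixes f g :: "real^6 \<Rightarrow> real^6"
  assumes lin: "linear f" "linear g" and inv: "\<And>x. f (g x) = x" "\<And>x. g (f x) = x"
    and det: "\<bar>det (matrix g)\<bar> = 1"
  shows "distr lborel borel f = lborel"
proof (rule lborel_eqI[symmetric])
  have [measurable]: "f \<in> borel_measurable borel" "g \<in> borel_measurable borel"
    using lin by (auto intro!: borel_measurable_continuous_onI linear_continuous_on simp: linear_conv_bounded_linear)
  fix l u :: "real^6" assume le: "\<And>b. b \<in> Basis \<Longrightarrow> l \<bullet> b \<le> u \<bullet> b"
  have e: "f -` box l u = g ` box l u" using inv by (auto simp: image_iff) metis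
  have m: "g ` box l u \<in> sets borel"
    unfolding e[symmetric] using measurable_sets[of f borel borel "box l u"] by simp
  have lm: "box l u \<in> lmeasurable" by simp
  have "emeasure (distr lborel borel f) (box l u) = emeasure lebesgue (g ` box l u)"
    using m by (subst emeasure_distr) (auto simp: e)
  also have "\<dots> = ennreal (measure lebesgue (g ` box l u))"
    using measurable_linear_image[OF lin(2) lm] by (intro emeasure_eq_ennreal_measure fmeasurableD2)
  also have "\<dots> = ennreal (measure lebesgue (box l u))"
    using measure_linear_image[OF lin(2) lm] det by simp
  also have "\<dots> = emeasure lebesgue (box l u)"
    using lm by (intro emeasure_eq_ennreal_measure[symmetric] fmeasurableD2)
  also have "\<dots> = emeasure lborel (box l u)" by simp
  also have "\<dots> = (\<Prod>b\<in>Basis. (u - l) \<bullet> b)"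
    by (rule emeasure_lborel_box) (rule le)
  finally show "emeasure (distr lborel borel f) (box l u) = (\<Prod>b\<in>Basis. (u - l) \<bullet> b)" .
qed simp

section \<open>The Lorentzian form and its isometries\<close>

lemma lorentz_add_left: "lorentz (x + y) z = lorentz x z + lorentz y z"
  and lorentz_add_right: "lorentz z (x + y) = lorentz z x + lorentz z y"
  and lorentz_scale_left: "lorentz (c *\<^sub>R x) y = c * lorentz x y"
  and lorentz_scale_right: "lorentz x (c *\<^sub>R y) = c * lorentz x y"
  and lorentz_diff_left: "lorentz (x - y) z = lorentz x z - lorentz y z"
  and lorentz_diff_right: "lorentz z (x - y) = lorentz z x - lorentz z y"
  and lorentz_minus_left: "lorentz (- x) z = - lorentz x z"
  and lorentz_minus_right: "lorentz z (- x) = - lorentz z x"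
  and lorentz_0: "lorentz 0 x = 0" "lorentz x 0 = 0"
  by (simp_all add: lorentz_def algebra_simps inner_add_left inner_add_right inner_diff_left inner_diff_right)

lemma lorentz_commute: "lorentz x y = lorentz y x"
  by (simp add: lorentz_def inner_commute mult.commute)

lemmas lorentz_simps = lorentz_add_left lorentz_add_right lorentz_scale_left lorentz_scale_right
  lorentz_diff_left lorentz_diff_right lorentz_minus_left lorentz_minus_right lorentz_0

lemma lorentz_nondegenerate:
  assumes "\<And>y. lorentz x y = 0"
  shows "x = 0"
proof -
  \<comment> \<open>Pairing with the time-reversed vector gives the Euclidean square norm.\<close>
  have "lorentz x (- fst x, snd x) = 0" by (rule assms)
  then have "(fst x)\<^sup>2 + snd x \<bullet> snd x = 0" by (simp add: lorentz_def power2_eq_square)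
  then have "fst x = 0" "snd x = 0"
    by (smt (verit) inner_ge_zero power2_eq_square inner_eq_zero_iff zero_le_power2 power_eq_0_iff)+
  then show ?thesis by (simp add: prod_eq_iff)
qed

text \<open>Nondegeneracy of the form makes an isometry injective, and finite dimension makes it
  bijective.\<close>

lemma lorentz_isometry_bij:
  fixes L :: "real \<times> (real^'n) \<Rightarrow> real \<times> (real^'n)"
  assumes lin: "linear L" and pres: "\<And>x y. lorentz (L x) (L y) = lorentz x y"
  obtains M where "linear M" "\<And>x. L (M x) = x" "\<And>x. M (L x) = x" "\<And>x y. lorentz (M x) (M y) = lorentz x y"
proof -
  have "inj L"
  proof (rule injI)
    fix x y assume e: "L x = L y"
    have "x - y = 0"
    proof (rule lorentz_nondegenerate)
      fix z
      have "lorentz (x - y) z = lorentz (L (x - y)) (L z)" by (simp add: pres)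
      then show "lorentz (x - y) z = 0" using e by (simp add: linear_diff[OF lin] lorentz_0)
    qed
    then show "x = y" by simp
  qed
  then obtain M where M: "linear M" "\<forall>x. M (L x) = x" "\<forall>x. L (M x) = x"
    using linear_injective_isomorphism[OF lin] by auto
  show thesis
  proof (rule that)
    show "lorentz (M x) (M y) = lorentz x y" for x y
      using pres[of "M x" "M y"] M by simp
  qed (use M in auto)
qed

text \<open>The matrix \<open>A\<close> of a Lorentz isometry satisfies $A^T \eta A = \eta$ for the diagonal Gram matrix
  $\eta$, hence $(\det A)^2 = 1$.\<close>

lemma distr_lorentz_isometry:
  fixes L :: "real \<times> (real^5) \<Rightarrow> real \<times> (real^5)"
  assumes lin: "linear L" and pres: "\<And>x y. lorentz (L x) (L y) = lorentz x y"
  shows "distr lborel borel L = lborel"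
proof -
  obtain M where M: "linear M" "\<And>x. L (M x) = x" "\<And>x. M (L x) = x" "\<And>x y. lorentz (M x) (M y) = lorentz x y"
    using lorentz_isometry_bij[OF lin pres] by metis
  define J' :: "real \<times> (real^5) \<Rightarrow> real^6" where
    "J' y = (\<chi> i. if i = 1 then fst y else if i = 2 then snd y $ 1 else if i = 3 then snd y $ 2
       else if i = 4 then snd y $ 3 else if i = 5 then snd y $ 4 else snd y $ 5)" for y
  have J: "J6 (J' y) = y" "J' (J6 x) = x" for x y
    by (simp_all add: J6_def J'_def prod_eq_iff vec5_eq_iff vec_eq_iff forall_6)
  have lJ: "linear J'" by (rule linearI) (auto simp: J'_def vec_eq_iff)
  define f g where "f x = J' (L (J6 x))" and "g x = J' (M (J6 x))" for x
  have lf: "linear f" "linear g"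
    unfolding f_def[abs_def] g_def[abs_def]
    using linear_compose[OF linear_compose[OF linear_J6 lin] lJ] linear_compose[OF linear_compose[OF linear_J6 M(1)] lJ]
    by (simp_all add: o_def)
  define E :: "real^6^6" where "E = (\<chi> i j. if i = j then (if i = 1 then - 1 else 1) else 0)"
  have lor: "lorentz (J6 x) (J6 y) = x \<bullet> (E *v y)" for x y
    by (simp add: lorentz_def J6_def inner_5 inner_vec_def sum_6 matrix_vector_mult_def E_def)
  have gE: "x \<bullet> ((transpose (matrix g) ** E ** matrix g) *v y) = x \<bullet> (E *v y)" for x y
  proof -
    have mg: "matrix g *v z = g z" for z using lf(2) by (simp add: matrix_works)
    have "x \<bullet> ((transpose (matrix g) ** E ** matrix g) *v y) = (matrix g *v x) \<bullet> (E *v (matrix g *v y))"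
      by (simp only: matrix_vector_mul_assoc[symmetric] dot_lmul_matrix[symmetric, of x "transpose (matrix g)"] vector_transpose_matrix)
    also have "\<dots> = lorentz (J6 (g x)) (J6 (g y))" unfolding mg lor ..
    also have "\<dots> = lorentz (J6 x) (J6 y)" by (simp add: g_def J M(4))
    finally show ?thesis unfolding lor .
  qed
  then have "(transpose (matrix g) ** E ** matrix g) *v y = E *v y" for y
    by (metis vector_eq_rdot inner_commute)
  then have "transpose (matrix g) ** E ** matrix g = E" by (simp add: matrix_eq)
  then have "det (transpose (matrix g) ** E ** matrix g) = det E" by simp
  then have "det (matrix g) * det (matrix g) * det E = det E"
    by (simp add: det_mul det_transpose ac_simps)
  moreover have "det E \<noteq> 0"
  proof -
    have "det E = prod (\<lambda>i. E $ i $ i) UNIV" by (rule det_diagonal) (simp add: E_def)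
    also have "\<dots> \<noteq> 0" by (simp add: E_def)
    finally show ?thesis .
  qed
  ultimately have "det (matrix g) * det (matrix g) = 1" by simp
  then have "\<bar>det (matrix g)\<bar> = 1" by (metis abs_mult_self_eq abs_one mult_cancel_left2 power2_eq_square real_sqrt_abs real_sqrt_one)
  note d = this
  have df: "distr lborel borel f = lborel"
    by (rule lborel_distr_det_1[OF lf _ _ d]) (simp_all add: f_def g_def J M)
  have [measurable]: "f \<in> borel_measurable borel" "L \<in> borel_measurable borel" "J6 \<in> borel_measurable borel"
    using lin lf(1) linear_J6 by (auto intro!: borel_measurable_continuous_onI linear_continuous_on simp: linear_conv_bounded_linear)
  have "distr lborel borel L = distr (distr lborel borel J6) borel L" by (simp add: distr_J6)
  also have "\<dots> = distr lborel borel (L \<circ> J6)" by (rule distr_distr) auto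
  also have "L \<circ> J6 = J6 \<circ> f" by (simp add: fun_eq_iff f_def J)
  also have "distr lborel borel (J6 \<circ> f) = distr (distr lborel borel f) borel J6" by (rule distr_distr[symmetric]) auto
  also have "\<dots> = lborel" by (simp add: df distr_J6)
  finally show ?thesis .
qed

section \<open>Hyperbolic volume in upper half-space coordinates\<close>

definition hyp_density :: "real^5 \<Rightarrow> ennreal" where
  "hyp_density q = (if norm q < 1 then ennreal (1 / (1 - (norm q)\<^sup>2) ^ 3) else 0)"

lemma measurable_hyp_density [measurable]: "hyp_density \<in> borel_measurable borel"
  unfolding hyp_density_def by measurable

lemma emeasure_hyp_measure:
  fixes S :: "(real^5) set"
  assumes [measurable]: "S \<in> sets borel"
  shows "emeasure hyp_measure S = (\<integral>\<^sup>+q. hyp_density q * indicator S q \<partial>lborel)"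
proof -
  have e: "ennreal (if norm p < 1 then (1 - (norm p)\<^sup>2) powr (- (real CARD(5) + 1) / 2) else 0) = hyp_density p" for p :: "real^5"
  proof (cases "norm p < 1")
    case True
    then have "1 - (norm p)\<^sup>2 > 0" by (simp add: power_less_one_iff abs_square_less_1)
    moreover have "- (real CARD(5) + 1) / 2 = - 3" by simp
    ultimately show ?thesis using True
      by (simp add: hyp_density_def powr_minus_divide powr_numeral)
  qed (simp add: hyp_density_def)
  show ?thesis unfolding hyp_measure_def e by (rule emeasure_density) auto
qed

lemma sets_hyp_measure [simp]: "sets (hyp_measure :: (real^'n) measure) = sets borel"
  and space_hyp_measure [simp]: "space (hyp_measure :: (real^'n) measure) = UNIV"
  by (simp_all add: hyp_measure_def)

text \<open>The horizontal upper half-space coordinates when the ideal point (0, 0, 0, 0, -1) is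
  placed at infinity; \<open>hts\<close> is the square of the height.\<close>

definition base :: "real^5 \<Rightarrow> real \<times> real \<times> real \<times> real" where
  "base q = (1 / (1 + q $ 5)) *\<^sub>R (q $ 1, q $ 2, q $ 3, q $ 4)"

definition hts :: "real^5 \<Rightarrow> real" where
  "hts q = (1 - q $ 5) / (1 + q $ 5) - (norm (base q))\<^sup>2"

lemma norm_T5: "(norm (T5 (e, v)))\<^sup>2 = e\<^sup>2 + (norm v)\<^sup>2"
  by (cases v) (simp only: power2_norm_eq_inner, simp add: T5_def inner_5 power2_eq_square)

lemma base_T5: "base (T5 (e, v)) = (1 / (1 + e)) *\<^sub>R v"
  by (cases v) (simp add: base_def T5_def)

lemma T5_5: "T5 (e, v) $ 5 = e"
  by (cases v) (simp add: T5_def)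

lemma nn_integral_lborel_scaleR:
  fixes f :: "'a::euclidean_space \<Rightarrow> ennreal"
  assumes [measurable]: "f \<in> borel_measurable borel" and "0 < c"
  shows "(\<integral>\<^sup>+x. f x \<partial>lborel) = ennreal (c ^ DIM('a)) * (\<integral>\<^sup>+x. f (c *\<^sub>R x) \<partial>lborel)"
proof -
  have "(\<integral>\<^sup>+x. f x \<partial>lborel) = (\<integral>\<^sup>+x. f x \<partial>density (distr lborel borel (\<lambda>x. 0 + c *\<^sub>R x)) (\<lambda>_. \<bar>c\<bar>^DIM('a)))"
    using lborel_affine[of c "0::'a"] assms by simp
  also have "\<dots> = ennreal (c ^ DIM('a)) * (\<integral>\<^sup>+x. f (c *\<^sub>R x) \<partial>lborel)"
    using \<open>0 < c\<close> by (simp add: nn_integral_density nn_integral_distr nn_integral_cmult ennreal_power)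
  finally show ?thesis .
qed

lemma nn_integral_lborel_swap_gen:
  fixes f :: "'a::euclidean_space \<Rightarrow> 'b::euclidean_space \<Rightarrow> ennreal"
  assumes "(\<lambda>(x, y). f x y) \<in> borel_measurable (lborel \<Otimes>\<^sub>M lborel)"
  shows "(\<integral>\<^sup>+x. \<integral>\<^sup>+y. f x y \<partial>lborel \<partial>lborel) = (\<integral>\<^sup>+y. \<integral>\<^sup>+x. f x y \<partial>lborel \<partial>lborel)"
  using lborel_pair.Fubini'[OF assms] by simp

lemma nn_integral_lborel_pair:
  fixes f :: "'a::euclidean_space \<times> 'b::euclidean_space \<Rightarrow> ennreal"
  assumes "f \<in> borel_measurable borel"
  shows "(\<integral>\<^sup>+u. f u \<partial>lborel) = (\<integral>\<^sup>+x. \<integral>\<^sup>+y. f (x, y) \<partial>lborel \<partial>lborel)"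
proof -
  have "f \<in> borel_measurable (lborel \<Otimes>\<^sub>M lborel)" using assms by (simp add: lborel_prod)
  from lborel.nn_integral_fst[OF this] show ?thesis by (simp add: lborel_prod)
qed

lemma measurable_base [measurable]: "base \<in> borel_measurable borel"
  unfolding base_def[abs_def] by measurable

lemma measurable_hts [measurable]: "hts \<in> borel_measurable borel"
  unfolding hts_def[abs_def] by measurable

text \<open>In the upper half-space model the vertical lines over the base carry the density $dt/t^5$;
  here they are parametrised by \<open>e = q $ 5\<close>, with $t^2 =$ \<open>hts q\<close>.\<close>

lemma emeasure_hyp_over_base:
  fixes A :: "(real \<times> real \<times> real \<times> real) set" and f :: "real \<times> real \<times> real \<times> real \<Rightarrow> real"
  assumes A [measurable]: "A \<in> sets borel" and f [measurable]: "f \<in> borel_measurable borel"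
    and pos: "\<And>v. v \<in> A \<Longrightarrow> 0 < f v"
  shows "emeasure hyp_measure {q. norm q < 1 \<and> base q \<in> A \<and> f (base q) \<le> hts q}
    = (\<integral>\<^sup>+v. ennreal (1 / (4 * (f v)\<^sup>2)) * indicator A v \<partial>lborel)"
proof -
  define S where "S = {q. norm q < 1 \<and> base q \<in> A \<and> f (base q) \<le> hts q}"
  have [measurable]: "S \<in> sets borel" unfolding S_def by measurable
  define g where "g e v = (if -1 < e \<and> e < 1 \<and> v \<in> A \<and> f v \<le> (1 - e) / (1 + e) - (norm v)\<^sup>2
    then ennreal (1 / ((1 + e)\<^sup>2 * ((1 - e) / (1 + e) - (norm v)\<^sup>2) ^ 3)) else 0)" for e v
  have gm: "(\<lambda>(e, v). g e v) \<in> borel_measurable (lborel \<Otimes>\<^sub>M lborel)"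
    unfolding g_def by measurable
  have [measurable]: "T5 \<in> borel_measurable borel"
    using linear_T5 by (auto intro!: borel_measurable_continuous_onI linear_continuous_on simp: linear_conv_bounded_linear)
  define h where "h q = hyp_density q * indicator S q" for q
  have [measurable]: "h \<in> borel_measurable borel" unfolding h_def by measurable
  have "emeasure hyp_measure S = (\<integral>\<^sup>+q. h q \<partial>lborel)" by (simp add: emeasure_hyp_measure h_def)
  also have "\<dots> = (\<integral>\<^sup>+u. h (T5 u) \<partial>lborel)"
    by (subst distr_T5[symmetric], subst nn_integral_distr) auto
  also have "\<dots> = (\<integral>\<^sup>+e. \<integral>\<^sup>+v. h (T5 (e, v)) \<partial>lborel \<partial>lborel)"
    by (rule nn_integral_lborel_pair) measurable
  also have "\<dots> = (\<integral>\<^sup>+e. \<integral>\<^sup>+v. g e v \<partial>lborel \<partial>lborel)"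
  proof (rule nn_integral_cong)
    fix e :: real
    show "(\<integral>\<^sup>+v. h (T5 (e, v)) \<partial>lborel) = (\<integral>\<^sup>+v. g e v \<partial>lborel)"
    proof (cases "-1 < e \<and> e < 1")
      case False
      have "h (T5 (e, v)) = 0" for v
      proof -
        have "1 \<le> e\<^sup>2" using False by (metis abs_square_less_1 abs_less_iff linorder_not_le minus_less_iff)
        then have "1 \<le> (norm (T5 (e, v)))\<^sup>2" unfolding norm_T5 using zero_le_power2[of "norm v"] by linarith
        then have "\<not> norm (T5 (e, v)) < 1" by (metis abs_square_less_1 abs_norm_cancel linorder_not_le)
        then show ?thesis by (simp add: h_def hyp_density_def)
      qed
      moreover have "g e v = 0" for v using False by (auto simp: g_def)
      ultimately show ?thesis by simp
    next
      case True
      \<comment> \<open>The slice with fifth coordinate e is scaled by 1 + e, so that the new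
        variable is the base point itself.\<close>
      define c where "c = 1 + e"
      have c: "0 < c" using True by (simp add: c_def)
      have "(\<integral>\<^sup>+v. h (T5 (e, v)) \<partial>lborel) = ennreal (c ^ 4) * (\<integral>\<^sup>+v. h (T5 (e, c *\<^sub>R v)) \<partial>lborel)"
        using nn_integral_lborel_scaleR[of "\<lambda>v. h (T5 (e, v))" c] c by (simp add: eval_nat_numeral)
      also have "\<dots> = (\<integral>\<^sup>+v. ennreal (c ^ 4) * h (T5 (e, c *\<^sub>R v)) \<partial>lborel)"
        by (rule nn_integral_cmult[symmetric]) measurable
      also have "\<dots> = (\<integral>\<^sup>+v. g e v \<partial>lborel)"
      proof (rule nn_integral_cong)
        fix v :: "real \<times> real \<times> real \<times> real"
        have b: "base (T5 (e, c *\<^sub>R v)) = v" using c by (simp add: base_T5 c_def)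
        define k where "k = (1 - e) / (1 + e) - (norm v)\<^sup>2"
        have ht: "hts (T5 (e, c *\<^sub>R v)) = k" by (simp add: hts_def b T5_5 k_def)
        have n: "1 - (norm (T5 (e, c *\<^sub>R v)))\<^sup>2 = c\<^sup>2 * k"
        proof -
          have "c\<^sup>2 * ((1 - e) / c) = c * (1 - e)" using c by (simp add: power2_eq_square)
          also have "\<dots> = 1 - e\<^sup>2" by (simp add: c_def power2_eq_square algebra_simps)
          finally show ?thesis unfolding norm_T5 k_def c_def[symmetric]
            using c by (simp add: power_mult_distrib right_diff_distrib)
        qed
        have nk: "norm (T5 (e, c *\<^sub>R v)) < 1 \<longleftrightarrow> 0 < k"
        proof -
          have "norm (T5 (e, c *\<^sub>R v)) < 1 \<longleftrightarrow> (norm (T5 (e, c *\<^sub>R v)))\<^sup>2 < 1"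
            by (metis abs_square_less_1 abs_norm_cancel)
          also have "\<dots> \<longleftrightarrow> 0 < c\<^sup>2 * k" unfolding n[symmetric] by simp
          also have "\<dots> \<longleftrightarrow> 0 < k" using c by (simp add: zero_less_mult_iff)
          finally show ?thesis .
        qed
        show "ennreal (c ^ 4) * h (T5 (e, c *\<^sub>R v)) = g e v"
        proof (cases "v \<in> A \<and> f v \<le> k")
          case True': True
          then have k: "0 < k" using pos[of v] by linarith
          have "T5 (e, c *\<^sub>R v) \<in> S" using True' k by (simp add: S_def b ht nk)
          then have "ennreal (c ^ 4) * h (T5 (e, c *\<^sub>R v)) = ennreal (c ^ 4 * (1 / (c\<^sup>2 * k) ^ 3))"
            using c k unfolding h_def hyp_density_def n by (simp add: nk ennreal_mult[symmetric])
          also have "c ^ 4 * (1 / (c\<^sup>2 * k) ^ 3) = 1 / (c\<^sup>2 * k ^ 3)"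
            using c k by (simp add: power_mult_distrib divide_simps)
          finally show ?thesis using True True' by (simp add: g_def k_def c_def)
        next
          case False
          then have "T5 (e, c *\<^sub>R v) \<notin> S" by (auto simp: S_def b ht)
          then show ?thesis using False by (auto simp: h_def g_def k_def)
        qed
      qed
      finally show ?thesis .
    qed
  qed
  also have "\<dots> = (\<integral>\<^sup>+v. \<integral>\<^sup>+e. g e v \<partial>lborel \<partial>lborel)"
    by (rule nn_integral_lborel_swap_gen[OF gm])
  also have "\<dots> = (\<integral>\<^sup>+v. ennreal (1 / (4 * (f v)\<^sup>2)) * indicator A v \<partial>lborel)"
  proof (rule nn_integral_cong)
    fix v :: "real \<times> real \<times> real \<times> real"
    show "(\<integral>\<^sup>+e. g e v \<partial>lborel) = ennreal (1 / (4 * (f v)\<^sup>2)) * indicator A v"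
    proof (cases "v \<in> A")
      case False
      then show ?thesis by (simp add: g_def)
    next
      case True
      define r where "r = (norm v)\<^sup>2"
      have r: "0 \<le> r" by (simp add: r_def)
      have fv: "0 < f v" using pos True by simp
      \<comment> \<open>\<open>\<beta>\<close> is the fifth coordinate of the point over v at
        squared height \<open>f v\<close>.\<close>
      define \<beta> where "\<beta> = (1 - (r + f v)) / (1 + (r + f v))"
      have rf: "0 < 1 + (r + f v)" using r fv by simp
      have \<beta>: "-1 < \<beta>" "\<beta> < 1" using rf r fv by (simp_all add: \<beta>_def divide_simps)
      have iff: "f v \<le> (1 - e) / (1 + e) - r \<longleftrightarrow> e \<le> \<beta>" if "-1 < e" for e
      proof -
        have "f v \<le> (1 - e) / (1 + e) - r \<longleftrightarrow> (r + f v) * (1 + e) \<le> 1 - e"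
          using that by (simp add: le_diff_eq pos_le_divide_eq add.commute)
        also have "\<dots> \<longleftrightarrow> e * (1 + (r + f v)) \<le> 1 - (r + f v)" by (simp add: algebra_simps)
        also have "\<dots> \<longleftrightarrow> e \<le> \<beta>" unfolding \<beta>_def using rf by (simp add: pos_le_divide_eq)
        finally show ?thesis .
      qed
      have dpos: "(1 - e) - r * (1 + e) > 0" if "-1 \<le> e" "e \<le> \<beta>" for e
      proof (cases "e = -1")
        case False
        then have e: "-1 < e" using that by simp
        then have "r < (1 - e) / (1 + e)" using iff[OF e] that fv by linarith
        then show ?thesis using e by (simp add: pos_less_divide_eq)
      qed simp
      \<comment> \<open>This is 1 / (4 k^2) for the squared height k at e, written with the inverted
        quotient so that it stays continuous at e = -1, where the height is infinite.\<close>
      define F where "F e = ((1 + e) / ((1 - e) - r * (1 + e)))\<^sup>2 / 4" for e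
      have c: "continuous_on {-1..\<beta>} F"
        unfolding F_def
      proof (intro continuous_intros ballI)
        fix e assume "e \<in> {-1..\<beta>}"
        then show "1 - e - r * (1 + e) \<noteq> 0" using dpos[of e] by simp
      qed simp_all
      have d: "(F has_real_derivative 1 / ((1 + e)\<^sup>2 * ((1 - e) / (1 + e) - r) ^ 3)) (at e)"
        if e: "-1 < e" "e < \<beta>" for e
      proof -
        define D where "D = (1 - e) - r * (1 + e)"
        have D: "D > 0" using dpos[of e] e by (simp add: D_def)
        have e1: "1 + e > 0" using e by simp
        have 1: "((\<lambda>e. (1 + e) / ((1 - e) - r * (1 + e))) has_real_derivative
           ((0 + 1) * D - (1 + e) * ((0 - 1) - r * (0 + 1))) / (D * D)) (at e)"
          unfolding D_def using D[unfolded D_def]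
          by (intro DERIV_divide DERIV_add DERIV_diff DERIV_cmult DERIV_const DERIV_ident) simp
        have "(F has_real_derivative of_nat 2 * (((0 + 1) * D - (1 + e) * ((0 - 1) - r * (0 + 1))) / (D * D) * ((1 + e) / D) ^ (2 - Suc 0)) / 4) (at e)"
          unfolding F_def by (intro DERIV_cdivide) (use DERIV_power[OF 1, of 2] in \<open>simp add: D_def\<close>)
        also have "of_nat 2 * (((0 + 1) * D - (1 + e) * ((0 - 1) - r * (0 + 1))) / (D * D) * ((1 + e) / D) ^ (2 - Suc 0)) / 4
          = (1 + e) / D ^ 3"
        proof -
          have "(0 + 1) * D - (1 + e) * ((0 - 1) - r * (0 + 1)) = 2" by (simp add: D_def algebra_simps)
          then show ?thesis using D by (simp add: power3_eq_cube divide_simps)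
        qed
        also have "\<dots> = 1 / ((1 + e)\<^sup>2 * ((1 - e) / (1 + e) - r) ^ 3)"
        proof -
          have "(1 - e) / (1 + e) - r = D / (1 + e)" using e1 by (simp add: D_def divide_simps)
          then show ?thesis using e1 D by (simp add: power_divide divide_simps) (simp add: eval_nat_numeral)
        qed
        finally show ?thesis .
      qed
      have n: "0 \<le> 1 / ((1 + e)\<^sup>2 * ((1 - e) / (1 + e) - r) ^ 3)" if e: "-1 < e" "e < \<beta>" for e
        using iff[OF e(1)] e fv by simp
      have "(\<integral>\<^sup>+e. g e v \<partial>lborel)
        = (\<integral>\<^sup>+e. (if -1 < e \<and> e < \<beta> then ennreal (1 / ((1 + e)\<^sup>2 * ((1 - e) / (1 + e) - r) ^ 3)) else 0) \<partial>lborel)"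
      proof (rule nn_integral_cong_AE)
        show "AE e in lborel. g e v = (if -1 < e \<and> e < \<beta> then ennreal (1 / ((1 + e)\<^sup>2 * ((1 - e) / (1 + e) - r) ^ 3)) else 0)"
          using AE_lborel_singleton[of \<beta>]
        proof eventually_elim
          case (elim e)
          then show ?case using True iff[of e] \<beta> by (auto simp: g_def r_def[symmetric])
        qed
      qed
      also have "\<dots> = ennreal (F \<beta> - F (-1))"
        by (rule nn_integral_FTC_open(1)[OF _ c d n]) (use \<beta> in auto)
      also have "F \<beta> - F (-1) = 1 / (4 * (f v)\<^sup>2)"
      proof -
        have "1 + \<beta> = 2 / (1 + (r + f v))" "1 - \<beta> = 2 * (r + f v) / (1 + (r + f v))"
          using rf by (simp_all add: \<beta>_def field_simps)
        note e1 = this(1)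
        have e2: "(1 - \<beta>) - r * (1 + \<beta>) = 2 * f v / (1 + (r + f v))"
          unfolding \<open>1 + \<beta> = _\<close> \<open>1 - \<beta> = _\<close> by (simp add: diff_divide_distrib[symmetric] algebra_simps)
        have "(1 + \<beta>) / ((1 - \<beta>) - r * (1 + \<beta>)) = 1 / f v"
        proof -
          have "2 / K / (2 * w / K) = 1 / w" if "0 < K" "0 < w" for K w :: real
            using that by simp
          then show ?thesis unfolding e2 unfolding e1 using rf fv by blast
        qed
        then show ?thesis by (simp add: F_def power_divide)
      qed
      finally show ?thesis using True by simp
    qed
  qed
  finally show ?thesis unfolding S_def .
qed

section \<open>Invariance of the volume under isometries\<close>

lemma lorentz_lift_self: "lorentz (lift q) (lift q) = (norm q)\<^sup>2 - 1"
  by (simp add: lorentz_def lift_def power2_norm_eq_inner)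

lemma fst_lift [simp]: "fst (lift q) = 1" and snd_lift [simp]: "snd (lift q) = q"
  by (simp_all add: lift_def)

lemma lorentz_lift_neg_iff: "lorentz (lift q) (lift q) < 0 \<longleftrightarrow> norm q < 1"
  unfolding lorentz_lift_self by (simp add: abs_square_less_1)

lemma measurable_lift [measurable]: "(lift :: real^'n \<Rightarrow> _) \<in> borel_measurable borel"
proof -
  have "continuous_on UNIV (lift :: real^'n \<Rightarrow> _)" unfolding lift_def[abs_def] by (intro continuous_intros)
  then show ?thesis by (rule borel_measurable_continuous_onI)
qed

lemma measurable_lorentz [measurable]:
  assumes [measurable]: "f \<in> borel_measurable M" "g \<in> borel_measurable M"
  shows "(\<lambda>x. lorentz (f x) (g x :: real \<times> (real^'n))) \<in> borel_measurable M"
proof -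
  have c: "continuous_on UNIV (\<lambda>u :: (real \<times> (real^'n)) \<times> (real \<times> (real^'n)). lorentz (fst u) (snd u))"
    unfolding lorentz_def by (intro continuous_intros)
  have "(\<lambda>x. lorentz (fst (f x, g x)) (snd (f x, g x))) \<in> borel_measurable M"
    by (rule borel_measurable_continuous_on[OF c]) measurable
  then show ?thesis by simp
qed

text \<open>Lebesgue measure of the truncated cone over a set of the model is a constant multiple of its hyperbolic
  volume, and Lorentz isometries preserve Lebesgue measure.\<close>

definition ucone :: "(real \<times> (real^5) \<Rightarrow> bool) \<Rightarrow> (real \<times> (real^5)) set" where
  "ucone C = {x. 0 < fst x \<and> lorentz x x < 0 \<and> - 1 \<le> lorentz x x \<and> C x}"

lemma emeasure_ucone:
  assumes C [measurable]: "Measurable.pred borel C"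
    and hom: "\<And>t x. 0 < t \<Longrightarrow> C (t *\<^sub>R x) \<longleftrightarrow> C x"
  shows "emeasure lborel (ucone C) = ennreal (1 / 6) * emeasure hyp_measure {q. norm q < 1 \<and> C (lift q)}"
proof -
  have fm [measurable]: "fst \<in> borel_measurable (borel :: (real \<times> (real^5)) measure)"
    by (intro borel_measurable_continuous_onI continuous_intros)
  have K [measurable]: "ucone C \<in> sets borel" unfolding ucone_def by measurable
  define g where "g t q = (if 0 < t \<and> norm q < 1 \<and> t\<^sup>2 * (1 - (norm q)\<^sup>2) \<le> 1 \<and> C (lift q) then ennreal (t ^ 5) else 0)" for t q
  have gm: "(\<lambda>(t, q). g t q) \<in> borel_measurable (lborel \<Otimes>\<^sub>M lborel)"
    unfolding g_def by measurable
  have "emeasure lborel (ucone C) = (\<integral>\<^sup>+x. indicator (ucone C) x \<partial>lborel)" by simp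
  also have "\<dots> = (\<integral>\<^sup>+t. \<integral>\<^sup>+v. indicator (ucone C) (t, v) \<partial>lborel \<partial>lborel)"
    by (rule nn_integral_lborel_pair) measurable
  also have "\<dots> = (\<integral>\<^sup>+t. \<integral>\<^sup>+q. g t q \<partial>lborel \<partial>lborel)"
  proof (rule nn_integral_cong)
    fix t :: real
    show "(\<integral>\<^sup>+v. indicator (ucone C) (t, v) \<partial>lborel) = (\<integral>\<^sup>+q. g t q \<partial>lborel)"
    proof (cases "0 < t")
      case False
      then show ?thesis by (simp add: ucone_def g_def)
    next
      case True
      have pm: "(\<lambda>v. indicator (ucone C) (t, v) :: ennreal) \<in> borel_measurable borel"
      proof -
        have "Pair t \<in> borel \<rightarrow>\<^sub>M (borel :: (real \<times> (real^5)) measure)"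
          by (intro borel_measurable_continuous_onI continuous_intros)
        from measurable_compose[OF this borel_measurable_indicator[OF K]] show ?thesis .
      qed
      have "(\<integral>\<^sup>+v. indicator (ucone C) (t, v) \<partial>lborel) = ennreal (t ^ 5) * (\<integral>\<^sup>+q. indicator (ucone C) (t, t *\<^sub>R q) \<partial>lborel)"
        using nn_integral_lborel_scaleR[OF pm True] by simp
      also have "\<dots> = (\<integral>\<^sup>+q. ennreal (t ^ 5) * indicator (ucone C) (t, t *\<^sub>R q) \<partial>lborel)"
      proof (rule nn_integral_cmult[symmetric])
        have "(\<lambda>q. t *\<^sub>R q) \<in> borel \<rightarrow>\<^sub>M (borel :: (real^5) measure)" by measurable
        from measurable_compose[OF this pm]
        show "(\<lambda>q. indicator (ucone C) (t, t *\<^sub>R q) :: ennreal) \<in> borel_measurable lborel" by simp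
      qed
      also have "\<dots> = (\<integral>\<^sup>+q. g t q \<partial>lborel)"
      proof (rule nn_integral_cong)
        fix q :: "real^5"
        have e: "(t, t *\<^sub>R q) = t *\<^sub>R lift q" by (simp add: lift_def)
        have l: "lorentz (t *\<^sub>R lift q) (t *\<^sub>R lift q) = - (t\<^sup>2 * (1 - (norm q)\<^sup>2))"
          by (simp add: lorentz_simps lorentz_lift_self power2_eq_square algebra_simps)
        have "t\<^sup>2 * (1 - (norm q)\<^sup>2) > 0 \<longleftrightarrow> norm q < 1"
          using True by (simp add: zero_less_mult_iff abs_square_less_1)
        then have "t *\<^sub>R lift q \<in> ucone C \<longleftrightarrow> norm q < 1 \<and> t\<^sup>2 * (1 - (norm q)\<^sup>2) \<le> 1 \<and> C (lift q)"
          using True unfolding ucone_def mem_Collect_eq l hom[OF True] by auto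
        then show "ennreal (t ^ 5) * indicator (ucone C) (t, t *\<^sub>R q) = g t q"
          unfolding e g_def using True by (auto simp: indicator_def)
      qed
      finally show ?thesis .
    qed
  qed
  also have "\<dots> = (\<integral>\<^sup>+q. \<integral>\<^sup>+t. g t q \<partial>lborel \<partial>lborel)"
    by (rule nn_integral_lborel_swap_gen[OF gm])
  also have "\<dots> = (\<integral>\<^sup>+q. ennreal (1 / 6) * (hyp_density q * indicator {q. norm q < 1 \<and> C (lift q)} q) \<partial>lborel)"
  proof (rule nn_integral_cong)
    fix q :: "real^5"
    show "(\<integral>\<^sup>+t. g t q \<partial>lborel) = ennreal (1 / 6) * (hyp_density q * indicator {q. norm q < 1 \<and> C (lift q)} q)"
    proof (cases "norm q < 1 \<and> C (lift q)")
      case False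
      then show ?thesis by (auto simp: g_def cong: if_cong)
    next
      case True
      define D where "D = 1 - (norm q)\<^sup>2"
      have D: "0 < D" using True by (simp add: D_def abs_square_less_1)
      define b where "b = 1 / sqrt D"
      have b: "0 < b" "b\<^sup>2 = 1 / D" using D by (simp_all add: b_def power_divide)
      have iff: "t\<^sup>2 * D \<le> 1 \<longleftrightarrow> t \<le> b" if "0 < t" for t
      proof -
        have "t\<^sup>2 * D \<le> 1 \<longleftrightarrow> t\<^sup>2 \<le> b\<^sup>2" using D by (simp add: b pos_le_divide_eq)
        also have "\<dots> \<longleftrightarrow> t \<le> b" using that b by (intro power_mono_iff) auto
        finally show ?thesis .
      qed
      have "(\<integral>\<^sup>+t. g t q \<partial>lborel) = (\<integral>\<^sup>+t. (if 0 < t \<and> t < b then ennreal (t ^ 5) else 0) \<partial>lborel)"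
      proof (rule nn_integral_cong_AE)
        show "AE t in lborel. g t q = (if 0 < t \<and> t < b then ennreal (t ^ 5) else 0)"
          using AE_lborel_singleton[of b]
        proof eventually_elim
          case (elim t)
          then show ?case using True iff[of t] by (auto simp: g_def D_def[symmetric])
        qed
      qed
      \<comment> \<open>The slice at time t has Jacobian t^5; integrating it up to t = (1 -
        |q|^2)^(-1/2) yields (1 - |q|^2)^(-3) / 6, the hyperbolic density with the factor
        1/6.\<close>
      also have "\<dots> = ennreal (b ^ 6 / 6 - 0 ^ 6 / 6)"
        by (rule nn_integral_FTC_open(1)[where F = "\<lambda>t. t ^ 6 / 6"])
          (use b in \<open>auto intro!: continuous_intros derivative_eq_intros\<close>)
      also have "b ^ 6 = 1 / D ^ 3"
      proof -
        have "b ^ 6 = (b\<^sup>2) ^ 3" by (simp flip: power_mult)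
        then show ?thesis by (simp add: b power_divide)
      qed
      finally show ?thesis using True D
        by (simp add: hyp_density_def D_def[symmetric] ennreal_mult[symmetric])
    qed
  qed
  also have "\<dots> = ennreal (1 / 6) * (\<integral>\<^sup>+q. hyp_density q * indicator {q. norm q < 1 \<and> C (lift q)} q \<partial>lborel)"
    by (rule nn_integral_cmult) measurable
  also have "(\<integral>\<^sup>+q. hyp_density q * indicator {q. norm q < 1 \<and> C (lift q)} q \<partial>lborel) = emeasure hyp_measure {q. norm q < 1 \<and> C (lift q)}"
    by (rule emeasure_hyp_measure[symmetric]) measurable
  finally show ?thesis .
qed

definition orthochronous :: "(real \<times> (real^'n) \<Rightarrow> real \<times> (real^'n)) \<Rightarrow> bool" where
  "orthochronous L \<longleftrightarrow> linear L \<and> (\<forall>x y. lorentz (L x) (L y) = lorentz x y) \<and>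
     (\<forall>x. lorentz x x < 0 \<longrightarrow> 0 < fst x \<longrightarrow> 0 < fst (L x))"

lemma lorentz_timelike_neg:
  assumes x: "lorentz x x < 0" "0 < fst x" and y: "lorentz y y \<le> 0" "0 < fst y"
  shows "lorentz x y < 0"
proof -
  have "(norm (snd x))\<^sup>2 < (fst x)\<^sup>2" "(norm (snd y))\<^sup>2 \<le> (fst y)\<^sup>2"
    using x y by (simp_all add: lorentz_def dot_square_norm power2_eq_square)
  then have n: "norm (snd x) < fst x" "norm (snd y) \<le> fst y"
    using x y by (auto intro: power_less_imp_less_base power2_le_imp_le)
  have "snd x \<bullet> snd y \<le> norm (snd x) * norm (snd y)" by (rule norm_cauchy_schwarz)
  also have "\<dots> \<le> norm (snd x) * fst y" using n by (intro mult_left_mono) auto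
  also have "\<dots> < fst x * fst y" using n y by simp
  finally show ?thesis by (simp add: lorentz_def)
qed

lemma orthochronous_future_iff:
  assumes "orthochronous L" "lorentz x x < 0"
  shows "0 < fst (L x) \<longleftrightarrow> 0 < fst x"
proof
  assume *: "0 < fst (L x)"
  show "0 < fst x"
  proof (rule ccontr)
    assume "\<not> 0 < fst x"
    moreover have "fst x \<noteq> 0"
    proof
      assume "fst x = 0"
      then have "lorentz x x = snd x \<bullet> snd x" by (simp add: lorentz_def)
      then show False using assms(2) inner_ge_zero[of "snd x"] by linarith
    qed
    ultimately have "0 < fst (- x)" by simp
    moreover have "lorentz (- x) (- x) < 0" using assms(2) by (simp only: lorentz_simps minus_minus)
    ultimately have "0 < fst (L (- x))" using assms(1) unfolding orthochronous_def by blast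
    moreover have "L (- x) = - L x" using assms(1) by (simp add: orthochronous_def linear_neg)
    ultimately show False using * by simp
  qed
next
  assume "0 < fst x"
  then show "0 < fst (L x)" using assms unfolding orthochronous_def by blast
qed

text \<open>Stated for homogeneous predicates on vectors rather than for subsets of the model, so
  that L acts linearly and no division by the time coordinate occurs.\<close>

lemma emeasure_hyp_orthochronous:
  fixes L :: "real \<times> (real^5) \<Rightarrow> real \<times> (real^5)"
  assumes L: "orthochronous L" and C [measurable]: "Measurable.pred borel C"
    and hom: "\<And>t x. 0 < t \<Longrightarrow> C (t *\<^sub>R x) \<longleftrightarrow> C x"
  shows "emeasure hyp_measure {q. norm q < 1 \<and> C (lift q)} = emeasure hyp_measure {q. norm q < 1 \<and> C (L (lift q))}"
proof -
  have lin: "linear L" and pres: "\<And>x y. lorentz (L x) (L y) = lorentz x y"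
    using L by (auto simp: orthochronous_def)
  have Lm [measurable]: "L \<in> borel_measurable borel"
    using lin by (auto intro!: borel_measurable_continuous_onI linear_continuous_on simp: linear_conv_bounded_linear)
  have fm [measurable]: "fst \<in> borel_measurable (borel :: (real \<times> (real^5)) measure)"
    by (intro borel_measurable_continuous_onI continuous_intros)
  have K [measurable]: "ucone C \<in> sets borel" unfolding ucone_def by measurable
  have "ucone (\<lambda>x. C (L x)) = L -` ucone C"
    unfolding ucone_def using orthochronous_future_iff[OF L] by (auto simp: pres)
  then have "emeasure lborel (ucone (\<lambda>x. C (L x))) = emeasure (distr lborel borel L) (ucone C)"
    by (simp add: emeasure_distr)
  also have "\<dots> = emeasure lborel (ucone C)" by (simp add: distr_lorentz_isometry[OF lin pres])
  finally have "ennreal (1 / 6) * emeasure hyp_measure {q. norm q < 1 \<and> C (L (lift q))}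
    = ennreal (1 / 6) * emeasure hyp_measure {q. norm q < 1 \<and> C (lift q)}"
    using emeasure_ucone[OF C hom] emeasure_ucone[of "\<lambda>x. C (L x)"]
    by (simp add: hom linear_cmul[OF lin])
  then show ?thesis by (simp add: ennreal_mult_cancel_left)
qed

section \<open>Horoballs as null vectors\<close>

lemma timelike_fst_nonzero: "lorentz x x < 0 \<Longrightarrow> fst x \<noteq> 0"
proof
  assume "lorentz x x < 0" "fst x = 0"
  then have "snd x \<bullet> snd x < 0" by (simp add: lorentz_def)
  then show False using inner_ge_zero[of "snd x"] by linarith
qed

lemma lorentz_causal_nonpos:
  assumes x: "lorentz x x \<le> 0" "0 \<le> fst x" and y: "lorentz y y \<le> 0" "0 \<le> fst y"
  shows "lorentz x y \<le> 0"
proof -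
  have "(norm (snd x))\<^sup>2 \<le> (fst x)\<^sup>2" "(norm (snd y))\<^sup>2 \<le> (fst y)\<^sup>2"
    using x y by (simp_all add: lorentz_def dot_square_norm power2_eq_square)
  then have n: "norm (snd x) \<le> fst x" "norm (snd y) \<le> fst y"
    using x y by (auto intro: power2_le_imp_le)
  have "snd x \<bullet> snd y \<le> norm (snd x) * norm (snd y)" by (rule norm_cauchy_schwarz)
  also have "\<dots> \<le> fst x * fst y" using n x by (intro mult_mono) auto
  finally show ?thesis by (simp add: lorentz_def)
qed

lemma timelike_future:
  assumes x: "lorentz x x < 0" and y: "lorentz y y \<le> 0" "0 < fst y" and xy: "lorentz x y < 0"
  shows "0 < fst x"
proof (rule ccontr)
  assume "\<not> 0 < fst x"
  then have "0 < fst (- x)" using timelike_fst_nonzero[OF x] by simp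
  moreover have "lorentz (- x) (- x) < 0" using x by (simp add: lorentz_simps)
  ultimately have "lorentz (- x) y < 0" using y by - (rule lorentz_timelike_neg, auto)
  then show False using xy by (simp add: lorentz_simps)
qed

text \<open>The time direction is read off from the sign of a product. This serves for null vectors,
  of whose images \<open>orthochronous\<close> says nothing directly.\<close>

lemma causal_future:
  assumes x: "lorentz x x < 0" "0 < fst x" and y: "lorentz y y \<le> 0" and xy: "lorentz x y < 0"
  shows "0 < fst y"
proof (rule ccontr)
  assume n: "\<not> 0 < fst y"
  show False
  proof (cases "fst y = 0")
    case True
    then have "snd y \<bullet> snd y \<le> 0" using y by (simp add: lorentz_def)
    then have "snd y = 0" by (metis inner_eq_zero_iff inner_ge_zero order_antisym)
    then show False using xy True by (simp add: lorentz_def)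
  next
    case False
    then have "0 < fst (- y)" using n by simp
    moreover have "lorentz (- y) (- y) \<le> 0" using y by (simp add: lorentz_simps)
    ultimately have "lorentz x (- y) < 0" using x by - (rule lorentz_timelike_neg, auto)
    then show False using xy by (simp add: lorentz_simps)
  qed
qed

lemma lorentz_orthogonal_timelike:
  assumes x: "lorentz x x < 0" and z: "lorentz x z = 0"
  shows "0 \<le> lorentz z z"
proof -
  have a: "snd x \<bullet> snd x < (fst x)\<^sup>2" and e: "fst x * fst z = snd x \<bullet> snd z"
    using x z by (simp_all add: lorentz_def power2_eq_square)
  have f0: "0 < (fst x)\<^sup>2" using timelike_fst_nonzero[OF x] by simp
  have "(fst x)\<^sup>2 * (fst z)\<^sup>2 = (snd x \<bullet> snd z)\<^sup>2" by (simp add: e[symmetric] power_mult_distrib)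
  also have "\<dots> \<le> (snd x \<bullet> snd x) * (snd z \<bullet> snd z)" by (rule Cauchy_Schwarz_ineq)
  also have "\<dots> \<le> (fst x)\<^sup>2 * (snd z \<bullet> snd z)" using a by (intro mult_right_mono) auto
  finally have "(fst z)\<^sup>2 \<le> snd z \<bullet> snd z" using f0 by simp
  then show ?thesis by (simp add: lorentz_def power2_eq_square)
qed

text \<open>The component of y orthogonal to the timelike x has nonnegative square.\<close>

lemma lorentz_reverse_Cauchy_Schwarz:
  assumes x: "lorentz x x < 0"
  shows "lorentz x x * lorentz y y \<le> (lorentz x y)\<^sup>2"
proof -
  define z where "z = y - (lorentz x y / lorentz x x) *\<^sub>R x"
  have "lorentz x z = 0" using x by (simp add: z_def lorentz_simps)
  then have "0 \<le> lorentz z z" by (rule lorentz_orthogonal_timelike[OF x])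
  also have "lorentz z z = lorentz y y - (lorentz x y)\<^sup>2 / lorentz x x"
    using x by (simp add: z_def lorentz_simps lorentz_commute[of y x] power2_eq_square)
  finally show ?thesis using x by (simp add: divide_le_eq_1 neg_divide_le_eq mult.commute)
qed

lemma lift_proj: "fst x \<noteq> 0 \<Longrightarrow> lift (proj x) = (1 / fst x) *\<^sub>R x"
  by (simp add: lift_def proj_def prod_eq_iff)

lemma proj_lift [simp]: "proj (lift q) = q"
  by (simp add: lift_def proj_def)

lemma proj_scale: "c \<noteq> 0 \<Longrightarrow> proj (c *\<^sub>R x) = proj x"
  by (simp add: proj_def)

lemma norm_proj_less_1:
  assumes "lorentz x x < 0" shows "norm (proj x) < 1"
proof -
  have "lorentz (lift (proj x)) (lift (proj x)) = lorentz x x / (fst x)\<^sup>2"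
    using timelike_fst_nonzero[OF assms] by (simp add: lift_proj lorentz_simps power2_eq_square)
  also have "\<dots> < 0" using assms timelike_fst_nonzero[OF assms] by (simp add: divide_neg_pos)
  finally show ?thesis by (simp add: lorentz_lift_neg_iff)
qed

lemma norm_proj_eq_1:
  assumes "lorentz x x = 0" "fst x \<noteq> 0" shows "norm (proj x) = 1"
proof -
  have "lorentz (lift (proj x)) (lift (proj x)) = 0"
    using assms by (simp add: lift_proj lorentz_simps)
  then have "norm (proj x) = 1 \<or> norm (proj x) = - 1" by (simp add: lorentz_lift_self power2_eq_1_iff)
  then show ?thesis using norm_ge_zero[of "proj x"] by linarith
qed

text \<open>For a future null vector \<open>v\<close> this is the horoball $-\langle x,v\rangle\le 1$ of the hyperboloid; a larger
  multiple of \<open>v\<close> gives a smaller horoball.\<close>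

definition HB :: "real \<times> (real^'n) \<Rightarrow> (real^'n) set" where
  "HB v = {q. norm q < 1 \<and> - lorentz (lift q) v \<le> sqrt (- lorentz (lift q) (lift q))}"

lemma horoball_eq_HB:
  fixes c :: "real^'n"
  assumes "0 < s" shows "horoball c s = HB ((1 / s) *\<^sub>R lift c)"
  unfolding horoball_def HB_def
proof (rule Collect_cong, rule conj_cong[OF refl])
  fix q :: "real^'n" assume "norm q < 1"
  then have "0 < sqrt (- lorentz (lift q) (lift q))" using lorentz_lift_neg_iff[of q] by simp
  then show "(- lorentz (lift q) (lift c) / sqrt (- lorentz (lift q) (lift q)) \<le> s) =
    (- lorentz (lift q) ((1 / s) *\<^sub>R lift c) \<le> sqrt (- lorentz (lift q) (lift q)))"
    using assms by (simp add: lorentz_simps divide_simps mult.commute)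
qed

lemma HB_mono:
  assumes "lorentz v v = 0" "0 < fst v" "1 \<le> t"
  shows "HB (t *\<^sub>R v) \<subseteq> HB v"
proof
  fix q assume q: "q \<in> HB (t *\<^sub>R v)"
  then have "lorentz (lift q) v < 0"
    using assms by - (rule lorentz_timelike_neg, auto simp: HB_def lorentz_lift_neg_iff)
  then have "- lorentz (lift q) v \<le> t * - lorentz (lift q) v"
    using assms(3) mult_right_mono[of 1 t "- lorentz (lift q) v"] by simp
  then show "q \<in> HB v" using q by (simp add: HB_def lorentz_simps)
qed

text \<open>The bound 1 on -<v,b> is the tangency of horosphere and hyperplane. For a point x beyond
  the hyperplane, removing the components along b from x and v and applying the reverse
  Cauchy-Schwarz inequality to the rest shows that -<x,v> exceeds what membership in the horoball
  allows.\<close>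

lemma HB_halfspace:
  assumes v: "lorentz v v = 0" "0 < fst v" and b: "lorentz b b = 1" and k: "1 \<le> - lorentz v b"
    and q: "q \<in> HB v"
  shows "lorentz (lift q) b \<le> 0"
proof (rule ccontr)
  define x where "x = lift q"
  define k where "k = - lorentz v b"
  define h where "h = lorentz x b"
  define D where "D = - lorentz x x"
  assume "\<not> lorentz (lift q) b \<le> 0"
  then have h: "h > 0" by (simp add: h_def x_def)
  have D: "D > 0" using q by (simp add: D_def x_def HB_def lorentz_lift_neg_iff)
  have k1: "1 \<le> k" using k by (simp add: k_def)
  have xv: "lorentz x v < 0" using D v by - (rule lorentz_timelike_neg, auto simp: D_def x_def)
  have le: "- lorentz x v \<le> sqrt D" using q by (simp add: HB_def D_def x_def)
  define x' v' where "x' = x - h *\<^sub>R b" and "v' = v + k *\<^sub>R b"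
  have xx: "lorentz x' x' = - (D + h\<^sup>2)"
    by (simp add: x'_def lorentz_simps b D_def h_def lorentz_commute[of b x] power2_eq_square)
  have vv: "lorentz v' v' = - k\<^sup>2"
    by (simp add: v'_def lorentz_simps b v k_def lorentz_commute[of b v] power2_eq_square)
  have x'v': "lorentz x' v' = lorentz x v + h * k"
    by (simp add: x'_def v'_def lorentz_simps b h_def k_def lorentz_commute[of b v])
  have Dh: "0 < D + h\<^sup>2" using D by (simp add: add_pos_nonneg)
  then have "lorentz x' x' * lorentz v' v' \<le> (lorentz x' v')\<^sup>2"
    by (intro lorentz_reverse_Cauchy_Schwarz) (simp add: xx)
  then have "(k * sqrt (D + h\<^sup>2))\<^sup>2 \<le> (lorentz x' v')\<^sup>2"
    unfolding xx vv using Dh by (simp add: power_mult_distrib algebra_simps)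
  then have "k * sqrt (D + h\<^sup>2) \<le> \<bar>lorentz x' v'\<bar>"
    using k1 Dh by (subst (asm) abs_le_square_iff[symmetric]) simp
  moreover have "k * sqrt (D + h\<^sup>2) > h * k"
  proof -
    have "sqrt (D + h\<^sup>2) > sqrt (h\<^sup>2)" using D by (intro real_sqrt_less_mono) simp
    then have "sqrt (D + h\<^sup>2) > h" using h by simp
    then show ?thesis using k1 by (simp add: mult.commute)
  qed
  ultimately have "lorentz x v + h * k \<le> - (k * sqrt (D + h\<^sup>2))"
    unfolding x'v' using xv by (simp add: abs_if split: if_splits)
  moreover have "k * sqrt (D + h\<^sup>2) \<ge> sqrt (D + h\<^sup>2)" using k1 Dh mult_right_mono[of 1 k "sqrt (D + h\<^sup>2)"] by simp
  moreover have "sqrt (D + h\<^sup>2) \<ge> sqrt D" by simp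
  moreover have "h * k > 0" using h k1 by simp
  ultimately show False using le by linarith
qed

text \<open>The witness lies in the plane of v and b: a point of the horosphere on the common
  perpendicular direction, beyond the hyperplane.\<close>

lemma HB_not_halfspace:
  assumes v: "lorentz v v = 0" "0 < fst v" and b: "lorentz b b = 1" and k: "0 < - lorentz v b" "- lorentz v b < 1"
  shows "\<exists>q\<in>HB v. 0 < lorentz (lift q) b"
proof -
  define k where "k = - lorentz v b"
  have k0: "0 < k" "k < 1" using k by (simp_all add: k_def)
  \<comment> \<open>h and g are sinh and cosh of ln (1 / k). Thus h + g = 1 / k, which puts x on the
    horosphere <x,v> = -1, and h > 0 is its product with b.\<close>
  define h where "h = (1 / k - k) / 2"
  define g where "g = (1 / k + k) / 2"
  have "1 / k > 1" using k0 by simp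
  then have h0: "h > 0" using k0 unfolding h_def by (intro divide_pos_pos) linarith+
  have gh: "g\<^sup>2 = 1 + h\<^sup>2" "k * (h + g) = 1"
    using k0 by (simp_all add: g_def h_def power2_eq_square field_simps)
  define v' where "v' = v + k *\<^sub>R b"
  define x where "x = h *\<^sub>R b + (g / k) *\<^sub>R v'"
  have vb: "lorentz v b = - k" "lorentz b v = - k" by (simp_all add: k_def lorentz_commute)
  have "lorentz x x = h\<^sup>2 - g\<^sup>2"
    using k0 by (simp add: x_def v'_def lorentz_simps b v vb power2_eq_square field_simps)
  then have xx: "lorentz x x = - 1" using gh by simp
  have "lorentz x v = - (k * (h + g))"
    using k0 by (simp add: x_def v'_def lorentz_simps b v vb algebra_simps)
  then have xv: "lorentz x v = - 1" using gh by simp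
  have xb: "lorentz x b = h"
    using k0 by (simp add: x_def v'_def lorentz_simps b vb)
  have f: "0 < fst x" using xx xv v by - (rule timelike_future[of x v], auto)
  have l: "lift (proj x) = (1 / fst x) *\<^sub>R x" using f by (intro lift_proj) simp
  have "proj x \<in> HB v"
  proof -
    have "norm (proj x) < 1" using xx by (intro norm_proj_less_1) simp
    moreover have "- lorentz (lift (proj x)) (lift (proj x)) = (1 / fst x)\<^sup>2"
      unfolding l by (simp add: lorentz_simps xx power2_eq_square)
    ultimately show ?thesis using f by (simp add: HB_def real_sqrt_abs) (simp add: l lorentz_simps xv)
  qed
  moreover have "0 < lorentz (lift (proj x)) b"
    unfolding l using f h0 xb by (simp add: lorentz_simps)
  ultimately show ?thesis by blast
qed

text \<open>For null vectors \<open>v\<close>, \<open>w\<close> and a unit timelike \<open>x\<close> one has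
  $\langle x,v\rangle\langle x,w\rangle\ge -\langle v,w\rangle/2$, with equality only for \<open>x\<close> in the span of
  \<open>v\<close> and \<open>w\<close>.\<close>

lemma HB_inter:
  assumes v: "lorentz v v = 0" "0 < fst v" and w: "lorentz w w = 0" "0 < fst w" and vw: "lorentz v w \<le> - 2"
    and q: "q \<in> HB v" "q \<in> HB w"
  shows "q = proj (v + w)"
proof -
  define D where "D = - lorentz (lift q) (lift q)"
  have D: "D > 0" using q by (simp add: D_def HB_def lorentz_lift_neg_iff)
  define x where "x = (1 / sqrt D) *\<^sub>R lift q"
  have xx: "lorentz x x = - 1" using D by (simp add: x_def lorentz_simps D_def[symmetric] flip: real_sqrt_mult)
      (simp add: D_def)
  have f: "0 < fst x" using D by (simp add: x_def)
  define a b where "a = - lorentz x v" and "b = - lorentz x w"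
  have a: "a \<le> 1" "b \<le> 1"
  proof -
    have "- lorentz (lift q) v \<le> sqrt D" "- lorentz (lift q) w \<le> sqrt D" using q by (simp_all add: HB_def D_def)
    then have "- lorentz (lift q) v / sqrt D \<le> 1" "- lorentz (lift q) w / sqrt D \<le> 1" using D by (simp_all only: divide_le_eq_1_pos real_sqrt_gt_zero)
    then show "a \<le> 1" "b \<le> 1" by (simp_all add: a_def b_def x_def lorentz_simps)
  qed
  have ab: "0 < a" "0 < b"
    using lorentz_timelike_neg[of x v] lorentz_timelike_neg[of x w] xx f v w by (auto simp: a_def b_def)
  \<comment> \<open>z is orthogonal to x, so its square 2 <v,w> / (a b) + 4 is nonnegative; with
    <v,w> <= -2 this gives a b >= 1 against a, b <= 1.\<close>
  define z where "z = (1 / a) *\<^sub>R v + (1 / b) *\<^sub>R w - 2 *\<^sub>R x"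
  have "lorentz x z = 0" using ab by (simp add: z_def lorentz_simps xx a_def b_def)
  then have zz0: "0 \<le> lorentz z z" using xx by - (rule lorentz_orthogonal_timelike[of x], auto)
  have zz: "lorentz z z = 2 * lorentz v w / (a * b) + 4"
    using ab by (simp add: z_def lorentz_simps xx v w lorentz_commute[of v x] lorentz_commute[of w x] lorentz_commute[of w v]
        a_def[symmetric] b_def[symmetric] minus_equation_iff[of _ "lorentz _ _"])
      (simp add: a_def b_def field_simps)
  have "a * b \<le> 1 * 1" using a ab by (intro mult_mono) auto
  moreover have "a * b \<ge> 1"
  proof -
    have "- 2 * lorentz v w \<le> 4 * (a * b)" using zz0 ab unfolding zz by (simp add: field_simps)
    then show ?thesis using vw by linarith
  qed
  ultimately have ab1: "a * b = 1" by simp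
  have "a = 1" "b = 1"
    using a ab ab1 by (metis mult.right_neutral mult_left_le mult_less_cancel_left_pos not_le order_antisym mult.commute mult_le_cancel_left1 less_le)+
  then have z: "z = v + w - 2 *\<^sub>R x" by (simp add: z_def)
  have "lorentz z z \<le> 0" unfolding zz ab1 using vw by simp
  then have "lorentz z z = 0" using zz0 by simp
  \<comment> \<open>A vector of square 0 orthogonal to a timelike vector vanishes, by the strict
    inequality |snd x| < fst x.\<close>
  have "z = 0"
  proof -
    have "lorentz x z = 0" by fact
    then have e: "fst x * fst z = snd x \<bullet> snd z" and nz: "(fst z)\<^sup>2 = snd z \<bullet> snd z"
      using \<open>lorentz z z = 0\<close> by (simp_all add: lorentz_def power2_eq_square)
    have "(fst x)\<^sup>2 * (fst z)\<^sup>2 \<le> (snd x \<bullet> snd x) * (fst z)\<^sup>2"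
      using Cauchy_Schwarz_ineq[of "snd x" "snd z"] unfolding nz[symmetric] e[symmetric] by (simp add: power_mult_distrib)
    moreover have "snd x \<bullet> snd x < (fst x)\<^sup>2" using xx by (simp add: lorentz_def power2_eq_square)
    ultimately have "(fst z)\<^sup>2 = 0"
      by (metis linorder_not_le mult_le_cancel_right zero_less_power2 zero_eq_power2)
    then show ?thesis using nz by (simp add: prod_eq_iff)
  qed
  then have "v + w = 2 *\<^sub>R x" using z by simp
  then have "v + w = (2 / sqrt D) *\<^sub>R lift q" by (simp add: x_def)
  then show ?thesis using D by (simp add: proj_scale)
qed

text \<open>The horoballs share at most one point, and a finite open set is empty.\<close>

lemma HB_interior_disjoint:
  fixes v w :: "real \<times> (real^'n)"
  assumes "lorentz v v = 0" "0 < fst v" "lorentz w w = 0" "0 < fst w" "lorentz v w \<le> - 2"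
  shows "interior (HB v) \<inter> interior (HB w) = {}"
proof -
  have "interior (HB v) \<inter> interior (HB w) \<subseteq> {proj (v + w)}"
    using HB_inter[OF assms] interior_subset by blast
  then have "finite (interior (HB v) \<inter> interior (HB w))" by (rule finite_subset) simp
  moreover have "open (interior (HB v) \<inter> interior (HB w))" by (intro open_Int open_interior)
  ultimately show ?thesis using finite_imp_not_open by blast
qed

section \<open>A standard copy of the polytope\<close>

lemma le_6_cases: "i \<le> (6::nat) \<longleftrightarrow> i = 0 \<or> i = 1 \<or> i = 2 \<or> i = 3 \<or> i = 4 \<or> i = 5 \<or> i = 6"
  by presburger

lemma le_5_cases: "i \<le> (5::nat) \<longleftrightarrow> i = 0 \<or> i = 1 \<or> i = 2 \<or> i = 3 \<or> i = 4 \<or> i = 5"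
  by presburger

lemma all_le_6: "(\<forall>i\<le>(6::nat). P i) \<longleftrightarrow> P 0 \<and> P 1 \<and> P 2 \<and> P 3 \<and> P 4 \<and> P 5 \<and> P 6"
  unfolding le_6_cases by blast

lemma all_le_5: "(\<forall>i\<le>(5::nat). P i) \<longleftrightarrow> P 0 \<and> P 1 \<and> P 2 \<and> P 3 \<and> P 4 \<and> P 5"
  unfolding le_5_cases by blast

text \<open>Outward unit normals of a standard copy of the polytope.  In the upper half-space model with
  the null vector \<open>v_inf\<close> at infinity, its base is $0 \le z \le y \le x \le 1/2$,
  $0 \le w \le 1/2$, and \<open>bs 4\<close> is the unit hemisphere centered at the origin.\<close>

definition bs :: "nat \<Rightarrow> real \<times> (real^5)" where
  "bs i = (if i = 0 then (0, vec5 0 0 (- 1) 0 0)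
     else if i = 1 then (0, vec5 0 (- sqrt 2 / 2) (sqrt 2 / 2) 0 0)
     else if i = 2 then (0, vec5 (- sqrt 2 / 2) (sqrt 2 / 2) 0 0 0)
     else if i = 3 then (1 / 2, vec5 1 0 0 0 (- 1 / 2))
     else if i = 4 then (0, vec5 0 0 0 0 1)
     else if i = 5 then (1 / 2, vec5 0 0 0 1 (- 1 / 2))
     else (0, vec5 0 0 0 (- 1) 0))"

text \<open>Null vectors of the vertices A_4 and A_0, scaled so that the product with every standard
  normal not orthogonal to them is -1. By \<open>HB_halfspace\<close> and
  \<open>HB_not_halfspace\<close> their horoballs are then the maximal ones.\<close>

definition v_inf :: "real \<times> (real^5)" where "v_inf = (1, vec5 0 0 0 0 (- 1))"
definition v_cor :: "real \<times> (real^5)" where "v_cor = (2, vec5 1 1 1 1 0)"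

lemma lorentz_bs:
  "lorentz y (bs 0) = - snd y $ 3"
  "lorentz y (bs 1) = sqrt 2 / 2 * (snd y $ 3 - snd y $ 2)"
  "lorentz y (bs (Suc 0)) = sqrt 2 / 2 * (snd y $ 3 - snd y $ 2)"
  "lorentz y (bs 2) = sqrt 2 / 2 * (snd y $ 2 - snd y $ 1)"
  "lorentz y (bs 3) = snd y $ 1 - (fst y + snd y $ 5) / 2"
  "lorentz y (bs 4) = snd y $ 5"
  "lorentz y (bs 5) = snd y $ 4 - (fst y + snd y $ 5) / 2"
  "lorentz y (bs 6) = - snd y $ 4"
  by (simp_all add: lorentz_def bs_def inner_5 field_simps)

lemma lorentz_v_inf: "lorentz y v_inf = - (fst y + snd y $ 5)"
  by (simp add: lorentz_def v_inf_def inner_5)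

lemma lorentz_v_cor: "lorentz y v_cor = - 2 * fst y + snd y $ 1 + snd y $ 2 + snd y $ 3 + snd y $ 4"
  by (simp add: lorentz_def v_cor_def inner_5)

lemma v_inf_null: "lorentz v_inf v_inf = 0" and v_cor_null: "lorentz v_cor v_cor = 0"
  and v_inf_cor: "lorentz v_inf v_cor = - 2"
  by (simp_all add: lorentz_v_inf lorentz_v_cor) (simp_all add: v_inf_def v_cor_def)

lemma lorentz_5: "lorentz (x :: real \<times> (real^5)) y = - fst x * fst y + snd x $ 1 * snd y $ 1 + snd x $ 2 * snd y $ 2 + snd x $ 3 * snd y $ 3
   + snd x $ 4 * snd y $ 4 + snd x $ 5 * snd y $ 5"
  by (simp add: lorentz_def inner_5)

definition frame :: "real \<times> (real^5) \<Rightarrow> real \<times> (real^5) \<Rightarrow> real \<times> (real^5) \<Rightarrow> real \<times> (real^5) \<Rightarrow>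
    real \<times> (real^5) \<Rightarrow> real \<times> (real^5) \<Rightarrow> real \<times> (real^5) \<Rightarrow> real \<times> (real^5)" where
  "frame f0 f1 f2 f3 f4 f5 y = fst y *\<^sub>R f0 + snd y $ 1 *\<^sub>R f1 + snd y $ 2 *\<^sub>R f2 + snd y $ 3 *\<^sub>R f3
     + snd y $ 4 *\<^sub>R f4 + snd y $ 5 *\<^sub>R f5"

lemma orthochronous_frame:
  assumes g: "lorentz f0 f0 = - 1" "lorentz f1 f1 = 1" "lorentz f2 f2 = 1" "lorentz f3 f3 = 1" "lorentz f4 f4 = 1" "lorentz f5 f5 = 1"
    "lorentz f0 f1 = 0" "lorentz f0 f2 = 0" "lorentz f0 f3 = 0" "lorentz f0 f4 = 0" "lorentz f0 f5 = 0"
    "lorentz f1 f2 = 0" "lorentz f1 f3 = 0" "lorentz f1 f4 = 0" "lorentz f1 f5 = 0"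
    "lorentz f2 f3 = 0" "lorentz f2 f4 = 0" "lorentz f2 f5 = 0" "lorentz f3 f4 = 0" "lorentz f3 f5 = 0" "lorentz f4 f5 = 0"
    and f0: "0 < fst f0"
  shows "orthochronous (frame f0 f1 f2 f3 f4 f5)"
proof -
  let ?L = "frame f0 f1 f2 f3 f4 f5"
  have sym: "lorentz f1 f0 = 0" "lorentz f2 f0 = 0" "lorentz f3 f0 = 0" "lorentz f4 f0 = 0" "lorentz f5 f0 = 0"
    "lorentz f2 f1 = 0" "lorentz f3 f1 = 0" "lorentz f4 f1 = 0" "lorentz f5 f1 = 0"
    "lorentz f3 f2 = 0" "lorentz f4 f2 = 0" "lorentz f5 f2 = 0" "lorentz f4 f3 = 0" "lorentz f5 f3 = 0" "lorentz f5 f4 = 0"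
    using g(7-21) by (simp_all only: lorentz_commute)
  have lin: "linear ?L"
    by (rule linearI) (simp_all add: frame_def algebra_simps)
  have pres: "lorentz (?L x) (?L y) = lorentz x y" for x y
    unfolding frame_def lorentz_simps g sym by (simp add: lorentz_5)
  have "0 < fst (?L x)" if x: "lorentz x x < 0" "0 < fst x" for x
  proof -
    have "lorentz (?L x) f0 = - fst x"
      unfolding frame_def lorentz_simps g sym by simp
    then show ?thesis using x pres[of x x] g(1) f0 by - (rule timelike_future[of _ f0], auto)
  qed
  then show ?thesis using lin pres by (simp add: orthochronous_def)
qed

text \<open>An arbitrary realisation seen as an isometric image of the standard one;
  \<open>ex_standard_copy\<close> shows that all arise so. Below, the inverse \<open>M\<close>
  carries conditions on points back to the explicit normals.\<close>

locale standard_copy =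
  fixes b :: "nat \<Rightarrow> real \<times> (real^5)" and L :: "real \<times> (real^5) \<Rightarrow> real \<times> (real^5)"
  assumes L: "orthochronous L" and bL: "\<And>i. i \<le> 6 \<Longrightarrow> b i = L (bs i)"
begin

lemma linL: "linear L" and presL: "lorentz (L x) (L y) = lorentz x y"
  using L unfolding orthochronous_def by blast+

lemma futL: "lorentz x x < 0 \<Longrightarrow> 0 < fst x \<Longrightarrow> 0 < fst (L x)"
  using L unfolding orthochronous_def by blast

definition M where "M = (SOME M. linear M \<and> (\<forall>x. L (M x) = x) \<and> (\<forall>x. M (L x) = x) \<and> (\<forall>x y. lorentz (M x) (M y) = lorentz x y))"

lemma M: "linear M" "L (M x) = x" "M (L x) = x" "lorentz (M x) (M y) = lorentz x y"
proof -
  have "\<exists>M. linear M \<and> (\<forall>x. L (M x) = x) \<and> (\<forall>x. M (L x) = x) \<and> (\<forall>x y. lorentz (M x) (M y) = lorentz x y)"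
    using lorentz_isometry_bij[OF linL presL] by metis
  from someI_ex[OF this, folded M_def]
  show "linear M" "L (M x) = x" "M (L x) = x" "lorentz (M x) (M y) = lorentz x y" by blast+
qed

lemma lorentz_b: "i \<le> 6 \<Longrightarrow> lorentz x (b i) = lorentz (M x) (bs i)"
  using presL[of "M x" "bs i"] by (simp add: bL M)

lemma lorentz_L: "lorentz x (L y) = lorentz (M x) y"
  using presL[of "M x" y] by (simp add: M)

lemma fst_L_null:
  assumes "lorentz v v = 0" "0 < fst v"
  shows "0 < fst (L v)"
proof -
  define e :: "real \<times> (real^5)" where "e = (1, 0)"
  have e: "lorentz e e = - 1" "0 < fst e" by (simp_all add: e_def lorentz_def)
  have "lorentz e v < 0" using e assms by - (rule lorentz_timelike_neg, auto)
  moreover have "0 < fst (L e)" using e by (intro futL) auto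
  ultimately show ?thesis
    using causal_future[of "L e" "L v"] e assms by (simp add: presL)
qed

abbreviation "c4 \<equiv> proj (L v_inf)"
abbreviation "c0 \<equiv> proj (L v_cor)"

lemma L_inf: "lorentz (L v_inf) (L v_inf) = 0" "0 < fst (L v_inf)"
  by (simp add: presL v_inf_null, rule fst_L_null[OF v_inf_null], simp add: v_inf_def)

lemma L_cor: "lorentz (L v_cor) (L v_cor) = 0" "0 < fst (L v_cor)"
  by (simp add: presL v_cor_null, rule fst_L_null[OF v_cor_null], simp add: v_cor_def)

lemma lift_c4: "lift c4 = (1 / fst (L v_inf)) *\<^sub>R L v_inf"
  by (rule lift_proj) (use L_inf in simp)

lemma lift_c0: "lift c0 = (1 / fst (L v_cor)) *\<^sub>R L v_cor"
  by (rule lift_proj) (use L_cor in simp)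

lemma norm_c: "norm c4 = 1" "norm c0 = 1"
  using norm_proj_eq_1[of "L v_inf"] norm_proj_eq_1[of "L v_cor"] L_inf L_cor by auto

lemma c4_neq_c0: "c4 \<noteq> c0"
proof
  assume "c4 = c0"
  then have "(1 / fst (L v_inf)) *\<^sub>R L v_inf = (1 / fst (L v_cor)) *\<^sub>R L v_cor" using lift_c4 lift_c0 by simp
  then have "lorentz ((1 / fst (L v_inf)) *\<^sub>R L v_inf) (L v_cor) = lorentz ((1 / fst (L v_cor)) *\<^sub>R L v_cor) (L v_cor)" by simp
  then show False using L_inf by (simp add: lorentz_simps presL v_inf_cor v_cor_null)
qed

text \<open>Uniqueness is used twice: to evaluate the description defining \<open>vertex\<close>,
  and to see that the point is extreme. The same holds for \<open>c0_unique\<close>.\<close>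

lemma c4_unique:
  assumes "lorentz (lift p) (b 0) = 0" "lorentz (lift p) (b 1) = 0" "lorentz (lift p) (b 2) = 0"
    "lorentz (lift p) (b 3) = 0" "lorentz (lift p) (b 5) = 0"
  shows "p = c4"
proof -
  define y where "y = M (lift p)"
  have "snd y $ 3 = 0" "snd y $ 2 = 0" "snd y $ 1 = 0" "snd y $ 5 = - fst y" "snd y $ 4 = 0"
    using assms by (simp_all add: lorentz_b lorentz_bs y_def)
  then have "y = fst y *\<^sub>R v_inf" by (simp add: v_inf_def prod_eq_iff vec5_eq_iff)
  then have "lift p = fst y *\<^sub>R L v_inf"
    by (metis M(2) linL linear_cmul y_def)
  moreover have "fst y \<noteq> 0"
    using calculation by (auto simp: lift_def prod_eq_iff)
  ultimately show ?thesis by (metis proj_lift proj_scale)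
qed

lemma c0_unique:
  assumes "lorentz (lift p) (b 1) = 0" "lorentz (lift p) (b 2) = 0"
    "lorentz (lift p) (b 3) = 0" "lorentz (lift p) (b 4) = 0" "lorentz (lift p) (b 5) = 0"
  shows "p = c0"
proof -
  define y where "y = M (lift p)"
  have "snd y $ 3 = fst y / 2" "snd y $ 2 = fst y / 2" "snd y $ 1 = fst y / 2" "snd y $ 5 = 0" "snd y $ 4 = fst y / 2"
    using assms by (simp_all add: lorentz_b lorentz_bs y_def)
  then have "y = (fst y / 2) *\<^sub>R v_cor" by (simp add: v_cor_def prod_eq_iff vec5_eq_iff)
  then have "lift p = (fst y / 2) *\<^sub>R L v_cor"
    by (metis M(2) linL linear_cmul y_def)
  moreover have "fst y / 2 \<noteq> 0"
    using calculation by (auto simp: lift_def prod_eq_iff)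
  ultimately show ?thesis by (metis proj_lift proj_scale)
qed

lemma lorentz_c4_b:
  assumes "i \<le> 6"
  shows "lorentz (lift c4) (b i) = (if i = 4 then - 1 / fst (L v_inf) else 0)"
  using assms unfolding le_6_cases lift_c4
  by (elim disjE) (simp_all add: lorentz_simps bL presL lorentz_bs v_inf_def)

lemma lorentz_c0_b:
  assumes "i \<le> 6"
  shows "lorentz (lift c0) (b i) = (if i = 0 \<or> i = 6 then - 1 / fst (L v_cor) else 0)"
  using assms unfolding le_6_cases lift_c0
  by (elim disjE) (simp_all add: lorentz_simps bL presL lorentz_bs v_cor_def)

lemma vertex_4: "vertex b 4 = c4"
  unfolding vertex_def
proof (rule the_equality)
  show "\<forall>j\<le>CARD(5). j \<noteq> 4 \<longrightarrow> lorentz (lift c4) (b j) = 0"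
    by (simp add: all_le_5 lorentz_c4_b)
  fix p assume "\<forall>j\<le>CARD(5). j \<noteq> 4 \<longrightarrow> lorentz (lift p) (b j) = 0"
  then show "p = c4" by (intro c4_unique) (simp_all add: all_le_5)
qed

lemma vertex_0: "vertex b 0 = c0"
  unfolding vertex_def
proof (rule the_equality)
  show "\<forall>j\<le>CARD(5). j \<noteq> 0 \<longrightarrow> lorentz (lift c0) (b j) = 0"
    by (simp add: all_le_5 lorentz_c0_b)
  fix p assume "\<forall>j\<le>CARD(5). j \<noteq> 0 \<longrightarrow> lorentz (lift p) (b j) = 0"
  then show "p = c0" by (intro c0_unique) (simp_all add: all_le_5)
qed

text \<open>A wall function is nonpositive on the polyhedron, so if it vanishes inside a segment it
  vanishes at both ends; both ends then satisfy the equations that determine c.\<close>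

lemma extreme_if_unique:
  assumes c: "\<And>i. i \<le> 6 \<Longrightarrow> lorentz (lift c) (b i) \<le> 0"
    and uniq: "\<And>p. (\<And>i. i \<le> 6 \<Longrightarrow> lorentz (lift c) (b i) = 0 \<Longrightarrow> lorentz (lift p) (b i) = 0) \<Longrightarrow> p = c"
  shows "c extreme_point_of {q. \<forall>i\<le>6. lorentz (lift q) (b i) \<le> 0}"
  unfolding extreme_point_of_def
proof (intro conjI ballI notI)
  fix a a' assume a: "a \<in> {q. \<forall>i\<le>6. lorentz (lift q) (b i) \<le> 0}" "a' \<in> {q. \<forall>i\<le>6. lorentz (lift q) (b i) \<le> 0}"
    and seg: "c \<in> open_segment a a'"
  then obtain u where u: "a \<noteq> a'" "0 < u" "u < 1" "c = (1 - u) *\<^sub>R a + u *\<^sub>R a'"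
    by (auto simp: in_segment)
  have l: "lift c = (1 - u) *\<^sub>R lift a + u *\<^sub>R lift a'"
    using u by (simp add: lift_def algebra_simps)
  have z: "lorentz (lift a) (b i) = 0 \<and> lorentz (lift a') (b i) = 0" if i: "i \<le> 6" "lorentz (lift c) (b i) = 0" for i
  proof -
    have "(1 - u) * lorentz (lift a) (b i) + u * lorentz (lift a') (b i) = 0"
      using i(2) unfolding l by (simp add: lorentz_simps)
    moreover have "(1 - u) * lorentz (lift a) (b i) \<le> 0" "u * lorentz (lift a') (b i) \<le> 0"
      using a i u by (auto simp: mult_le_0_iff)
    ultimately have "(1 - u) * lorentz (lift a) (b i) = 0" "u * lorentz (lift a') (b i) = 0" by linarith+
    then show ?thesis using u by simp
  qed
  have "a = c" by (rule uniq) (use z in blast)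
  moreover have "a' = c" by (rule uniq) (use z in blast)
  ultimately show False using u(1) by simp
qed (use c in auto)

text \<open>With s the product with -\<open>v_inf\<close>, the walls confine each horizontal
  coordinate to [0, s/2], so their squares sum to at most s^2. Nullity makes this sum s^2 - 2 s y_5
  with y_5 <= 0, so all the inequalities are equalities: s = 0 gives A_4, and otherwise y_5 = 0 and
  the coordinates s/2 give A_0.\<close>

lemma ideal_point_cases:
  assumes n: "norm p = 1" and p: "\<And>i. i \<le> 6 \<Longrightarrow> lorentz (lift p) (b i) \<le> 0"
  shows "p = c4 \<or> p = c0"
proof -
  define y where "y = M (lift p)"
  define s where "s = fst y + snd y $ 5"
  have null: "lorentz (lift p) (lift p) = 0" using n by (simp add: lorentz_lift_self)
  then have yy: "lorentz y y = 0" by (simp add: y_def M)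
  have "lorentz (lift p) (L v_inf) \<le> 0" using null L_inf by - (rule lorentz_causal_nonpos, auto)
  then have s0: "0 \<le> s" by (simp add: lorentz_L y_def[symmetric] lorentz_v_inf s_def)
  have i: "0 \<le> snd y $ 3" "snd y $ 3 \<le> snd y $ 2" "snd y $ 2 \<le> snd y $ 1" "snd y $ 1 \<le> s / 2" "snd y $ 5 \<le> 0"
    "snd y $ 4 \<le> s / 2" "0 \<le> snd y $ 4"
  proof -
    have r: "sqrt 2 / 2 * d \<le> 0 \<longleftrightarrow> d \<le> 0" for d :: real by (simp add: mult_le_0_iff)
    have "\<forall>i\<le>6. lorentz y (bs i) \<le> 0" using p by (simp add: lorentz_b y_def)
    then have "- snd y $ 3 \<le> 0 \<and> snd y $ 3 - snd y $ 2 \<le> 0 \<and> snd y $ 2 - snd y $ 1 \<le> 0 \<and> snd y $ 1 - s / 2 \<le> 0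
      \<and> snd y $ 5 \<le> 0 \<and> snd y $ 4 - s / 2 \<le> 0 \<and> - snd y $ 4 \<le> 0"
      unfolding all_le_6 lorentz_bs r s_def .
    then show "0 \<le> snd y $ 3" "snd y $ 3 \<le> snd y $ 2" "snd y $ 2 \<le> snd y $ 1" "snd y $ 1 \<le> s / 2" "snd y $ 5 \<le> 0"
      "snd y $ 4 \<le> s / 2" "0 \<le> snd y $ 4" by linarith+
  qed
  have e: "(snd y $ 1)\<^sup>2 + (snd y $ 2)\<^sup>2 + (snd y $ 3)\<^sup>2 + (snd y $ 4)\<^sup>2 = s\<^sup>2 - 2 * s * snd y $ 5"
    using yy by (simp add: lorentz_5 s_def power2_eq_square algebra_simps)
  have le: "(snd y $ k)\<^sup>2 \<le> (s / 2)\<^sup>2" if "k \<in> {1, 2, 3, 4}" for k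
    using that i by (intro power_mono) auto
  have "s * snd y $ 5 \<le> 0" using s0 i by (simp add: mult_le_0_iff)
  moreover have "(snd y $ 1)\<^sup>2 \<le> s\<^sup>2 / 4" "(snd y $ 2)\<^sup>2 \<le> s\<^sup>2 / 4" "(snd y $ 3)\<^sup>2 \<le> s\<^sup>2 / 4" "(snd y $ 4)\<^sup>2 \<le> s\<^sup>2 / 4"
    using le[of 1] le[of 2] le[of 3] le[of 4] by (simp_all add: power_divide)
  ultimately have eq: "(snd y $ 3)\<^sup>2 = s\<^sup>2 / 4" "(snd y $ 4)\<^sup>2 = s\<^sup>2 / 4" "s * snd y $ 5 = 0"
    using e by linarith+
  have "(snd y $ 3)\<^sup>2 = (s / 2)\<^sup>2" "(snd y $ 4)\<^sup>2 = (s / 2)\<^sup>2" using eq by (simp_all add: power_divide)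
  then have h: "snd y $ 3 = s / 2" "snd y $ 4 = s / 2"
    using i s0 by (simp_all add: power2_eq_iff_nonneg)
  then have h': "snd y $ 2 = s / 2" "snd y $ 1 = s / 2" using i by linarith+
  have b: "lorentz (lift p) (b 0) = - s / 2" "lorentz (lift p) (b 1) = 0" "lorentz (lift p) (b 2) = 0"
    "lorentz (lift p) (b 3) = 0" "lorentz (lift p) (b 4) = snd y $ 5" "lorentz (lift p) (b 5) = 0"
    by (simp_all add: lorentz_b lorentz_bs y_def[symmetric] h h') (simp_all add: s_def)
  show ?thesis
  proof (cases "s = 0")
    case True
    then show ?thesis using b by (intro disjI1 c4_unique) simp_all
  next
    case False
    then show ?thesis using b eq by (intro disjI2 c0_unique) simp_all
  qed
qed

lemma ideal_vertices_eq: "ideal_vertices b = {c0, c4}"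
proof -
  have n6: "CARD(5) + 1 = 6" by simp
  have "c4 extreme_point_of {q. \<forall>i\<le>6. lorentz (lift q) (b i) \<le> 0}"
  proof (rule extreme_if_unique)
    show "lorentz (lift c4) (b i) \<le> 0" if "i \<le> 6" for i
      using that L_inf by (simp add: lorentz_c4_b)
    show "p = c4" if *: "\<And>i. i \<le> 6 \<Longrightarrow> lorentz (lift c4) (b i) = 0 \<Longrightarrow> lorentz (lift p) (b i) = 0" for p
      by (rule c4_unique) (rule *; simp add: lorentz_c4_b)+
  qed
  moreover have "c0 extreme_point_of {q. \<forall>i\<le>6. lorentz (lift q) (b i) \<le> 0}"
  proof (rule extreme_if_unique)
    show "lorentz (lift c0) (b i) \<le> 0" if "i \<le> 6" for i
      using that L_cor by (simp add: lorentz_c0_b)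
    show "p = c0" if *: "\<And>i. i \<le> 6 \<Longrightarrow> lorentz (lift c0) (b i) = 0 \<Longrightarrow> lorentz (lift p) (b i) = 0" for p
      by (rule c0_unique) (rule *; simp add: lorentz_c0_b)+
  qed
  moreover have "p = c4 \<or> p = c0" if "norm p = 1" "p extreme_point_of {q. \<forall>i\<le>6. lorentz (lift q) (b i) \<le> 0}" for p
    using that by (intro ideal_point_cases) (auto simp: extreme_point_of_def)
  ultimately show ?thesis unfolding ideal_vertices_def n6 using norm_c by auto
qed

end

section \<open>Volumes of the polytope and of its horoball sectors\<close>

text \<open>Allows the walls of the polytope to be ignored, so that closed conditions may be
  exchanged for open ones.\<close>

lemma emeasure_hyp_cong_AE:
  fixes S S' :: "(real^5) set"
  assumes S: "S \<in> sets borel" "S' \<in> sets borel"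
    and ae: "AE q in lborel. norm q < 1 \<longrightarrow> (q \<in> S \<longleftrightarrow> q \<in> S')"
  shows "emeasure hyp_measure S = emeasure hyp_measure S'"
  unfolding emeasure_hyp_measure[OF S(1)] emeasure_hyp_measure[OF S(2)]
proof (rule nn_integral_cong_AE)
  show "AE q in lborel. hyp_density q * indicator S q = hyp_density q * indicator S' q"
    using ae by eventually_elim (auto simp: hyp_density_def indicator_def)
qed

lemma AE_lorentz_nonzero:
  fixes u :: "real \<times> (real^5)"
  assumes "snd u \<noteq> 0"
  shows "AE q in lborel. lorentz (lift q) u \<noteq> 0"
proof -
  define N where "N = {q. snd u \<bullet> q = fst u}"
  have "negligible N" unfolding N_def using assms by (intro negligible_hyperplane) auto
  then have n: "N \<in> null_sets lebesgue" by (simp add: negligible_iff_null_sets)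
  have "closed N" unfolding N_def by (intro closed_hyperplane)
  then have b: "N \<in> sets borel" by simp
  have "emeasure lborel N = emeasure lebesgue N" using b by simp
  then have "N \<in> null_sets lborel" using n b by (simp add: null_sets_def)
  then have "AE q in lborel. q \<notin> N" by (rule AE_not_in)
  then show ?thesis
    by eventually_elim (simp add: N_def lorentz_def inner_commute)
qed

lemma norm_less_1_component5:
  fixes q :: "real^5" assumes "norm q < 1" shows "- 1 < q $ 5" "q $ 5 < 1"
  using component_le_norm_cart[of q 5] assms by (auto simp: abs_le_iff)

lemma norm_base: "(norm (base q))\<^sup>2 = ((q $ 1)\<^sup>2 + (q $ 2)\<^sup>2 + (q $ 3)\<^sup>2 + (q $ 4)\<^sup>2) / (1 + q $ 5)\<^sup>2"
proof -
  have "(norm (base q))\<^sup>2 = (1 / (1 + q $ 5))\<^sup>2 * (norm (q $ 1, q $ 2, q $ 3, q $ 4))\<^sup>2"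
    by (simp only: base_def norm_scaleR power_mult_distrib real_norm_def power2_abs)
  also have "(norm (q $ 1, q $ 2, q $ 3, q $ 4))\<^sup>2 = (q $ 1)\<^sup>2 + (q $ 2)\<^sup>2 + (q $ 3)\<^sup>2 + (q $ 4)\<^sup>2"
    by (simp only: power2_norm_eq_inner, simp add: power2_eq_square)
  finally show ?thesis by (simp add: power_divide)
qed

lemma hts_eq:
  assumes "norm q < 1" shows "- lorentz (lift q) (lift q) = (1 + q $ 5)\<^sup>2 * hts q"
proof -
  define s where "s = 1 + q $ 5"
  have s: "0 < s" using norm_less_1_component5[OF assms] by (simp add: s_def)
  have "(norm q)\<^sup>2 = (q $ 1)\<^sup>2 + (q $ 2)\<^sup>2 + (q $ 3)\<^sup>2 + (q $ 4)\<^sup>2 + (q $ 5)\<^sup>2"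
    unfolding power2_norm_eq_inner inner_5 by (simp only: power2_eq_square)
  moreover have "s\<^sup>2 * hts q = s * (1 - q $ 5) - ((q $ 1)\<^sup>2 + (q $ 2)\<^sup>2 + (q $ 3)\<^sup>2 + (q $ 4)\<^sup>2)"
  proof -
    have "s\<^sup>2 * (a / s) = s * a" "s\<^sup>2 * (a / s\<^sup>2) = a" for a
      using s by (simp_all add: power2_eq_square)
    then show ?thesis unfolding hts_def norm_base s_def[symmetric] right_diff_distrib[of "s\<^sup>2"] by simp
  qed
  moreover have "s * (1 - q $ 5) = 1 - (q $ 5)\<^sup>2" by (simp add: s_def power2_eq_square algebra_simps)
  ultimately show ?thesis unfolding lorentz_lift_self s_def[symmetric] by simp
qed

lemma horo_cond:
  assumes q: "norm q < 1" and t: "0 < t"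
  shows "- lorentz (lift q) (t *\<^sub>R v_inf) \<le> sqrt (- lorentz (lift q) (lift q)) \<longleftrightarrow> t\<^sup>2 \<le> hts q"
proof -
  define s where "s = 1 + q $ 5"
  have s: "0 < s" using norm_less_1_component5[OF q] by (simp add: s_def)
  have "- lorentz (lift q) (t *\<^sub>R v_inf) = t * s" by (simp add: lorentz_simps lorentz_v_inf s_def lift_def algebra_simps)
  moreover have "t * s \<le> sqrt (s\<^sup>2 * hts q) \<longleftrightarrow> t\<^sup>2 \<le> hts q"
  proof -
    have "t * s \<le> sqrt (s\<^sup>2 * hts q) \<longleftrightarrow> (t * s)\<^sup>2 \<le> s\<^sup>2 * hts q"
      using s t real_sqrt_le_iff[of "(t * s)\<^sup>2"] by simp
    then show ?thesis using s by (simp add: power_mult_distrib mult.commute)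
  qed
  ultimately show ?thesis by (simp add: hts_eq[OF q] s_def)
qed

section \<open>Cross-sections at the ideal vertices and the volume of the polytope\<close>

definition base_inf :: "(real \<times> real \<times> real \<times> real) set" where
  "base_inf = {(x, y, z, w). 0 < z \<and> z < y \<and> y < x \<and> x < 1 / 2 \<and> 0 < w \<and> w < 1 / 2}"

text \<open>The cross-section at A_0 in the coordinates of \<open>swap_iso\<close>; its five sides
  come from the walls through A_0, which are \<open>bs 1\<close> to \<open>bs 5\<close>.\<close>

definition base_cor :: "(real \<times> real \<times> real \<times> real) set" where
  "base_cor = {(x, y, z, w). z < y \<and> y < x \<and> x < 0 \<and> w < 0 \<and> - 1 < x + y + z + w}"

lemma base_inf_borel [measurable]: "base_inf \<in> sets borel"
proof -
  have "open base_inf" unfolding base_inf_def split_beta'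
    by (intro open_Collect_conj open_Collect_less continuous_intros)
  then show ?thesis by simp
qed

lemma base_cor_borel [measurable]: "base_cor \<in> sets borel"
proof -
  have "open base_cor" unfolding base_cor_def split_beta'
    by (intro open_Collect_conj open_Collect_less continuous_intros)
  then show ?thesis by simp
qed

definition in_F :: "real \<times> (real^5) \<Rightarrow> bool" where
  "in_F y \<longleftrightarrow> (\<forall>i\<le>6. lorentz y (bs i) \<le> 0)"

lemma sqrt2_half_mult_le: "sqrt 2 / 2 * d \<le> 0 \<longleftrightarrow> d \<le> (0::real)"
  by (simp add: mult_le_0_iff)

lemma in_F_iff: "in_F y \<longleftrightarrow> 0 \<le> snd y $ 3 \<and> snd y $ 3 \<le> snd y $ 2 \<and> snd y $ 2 \<le> snd y $ 1 \<and> snd y $ 1 \<le> (fst y + snd y $ 5) / 2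
   \<and> snd y $ 5 \<le> 0 \<and> snd y $ 4 \<le> (fst y + snd y $ 5) / 2 \<and> 0 \<le> snd y $ 4"
  unfolding in_F_def all_le_6 lorentz_bs sqrt2_half_mult_le by auto

lemma snd_bs_nonzero: "i \<le> 6 \<Longrightarrow> snd (bs i) \<noteq> 0"
  unfolding le_6_cases by (elim disjE) (simp_all add: bs_def vec5_eq_iff)

lemma base_mem_base_inf:
  assumes q: "norm q < 1" and nz: "\<And>i. i \<le> 6 \<Longrightarrow> lorentz (lift q) (bs i) \<noteq> 0"
  shows "in_F (lift q) \<longleftrightarrow> base q \<in> base_inf \<and> q $ 5 \<le> 0"
proof -
  define s where "s = 1 + q $ 5"
  have s: "0 < s" using norm_less_1_component5[OF q] by (simp add: s_def)
  have d: "0 < a / s \<longleftrightarrow> 0 < a" "a / s < c / s \<longleftrightarrow> a < c" "a / s < 1 / 2 \<longleftrightarrow> a < s / 2" for a c :: real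
    using s by (simp_all add: divide_simps)
  have "base q \<in> base_inf \<longleftrightarrow> 0 < q $ 3 \<and> q $ 3 < q $ 2 \<and> q $ 2 < q $ 1 \<and> q $ 1 < s / 2 \<and> 0 < q $ 4 \<and> q $ 4 < s / 2"
    unfolding base_inf_def base_def s_def[symmetric] by (simp only: scaleR_Pair real_scaleR_def mem_Collect_eq case_prod_conv d times_divide_eq_left mult_1)
  moreover have "q $ 3 \<noteq> 0" "q $ 3 \<noteq> q $ 2" "q $ 2 \<noteq> q $ 1" "q $ 1 \<noteq> s / 2" "q $ 4 \<noteq> s / 2" "q $ 4 \<noteq> 0"
    using nz[of 0] nz[of 1] nz[of 2] nz[of 3] nz[of 5] nz[of 6] by (simp_all add: lorentz_bs s_def)
  ultimately show ?thesis unfolding in_F_iff by (auto simp: s_def[symmetric])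
qed

lemma AE_bs: "AE q in lborel. \<forall>i\<le>6. lorentz (lift q) (bs i) \<noteq> 0"
  unfolding all_le_6 using snd_bs_nonzero
  by (intro AE_conjI AE_lorentz_nonzero) auto

lemma measurable_in_F [measurable]: "Measurable.pred borel in_F"
  unfolding in_F_def all_le_6 by measurable

lemma nn_integral_real4:
  fixes f :: "real \<times> real \<times> real \<times> real \<Rightarrow> ennreal"
  assumes [measurable]: "f \<in> borel_measurable borel"
  shows "(\<integral>\<^sup>+v. f v \<partial>lborel) = (\<integral>\<^sup>+x. \<integral>\<^sup>+y. \<integral>\<^sup>+z. \<integral>\<^sup>+w. f (x, y, z, w) \<partial>lborel \<partial>lborel \<partial>lborel \<partial>lborel)"
proof -
  have [measurable]: "(\<lambda>u. f (x, u)) \<in> borel_measurable borel" "(\<lambda>u. f (x, y, u)) \<in> borel_measurable borel" for x y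
    by (rule measurable_compose[OF _ assms], intro borel_measurable_continuous_onI continuous_intros)+
  show ?thesis by (simp add: nn_integral_lborel_pair)
qed

lemma emeasure_F:
  "emeasure hyp_measure {q. norm q < 1 \<and> in_F (lift q)} = ennreal (7 * zeta 3 / 1152)"
proof -
  have pos: "0 < 1 - (norm v)\<^sup>2" if v: "v \<in> base_inf" for v
  proof -
    obtain x y z w where e: "v = (x, y, z, w)" by (cases v)
    have "x\<^sup>2 < (1 / 2)\<^sup>2" "y\<^sup>2 < (1 / 2)\<^sup>2" "z\<^sup>2 < (1 / 2)\<^sup>2" "w\<^sup>2 < (1 / 2)\<^sup>2"
      using v unfolding base_inf_def e by (auto intro!: power_strict_mono)
    moreover have "(norm v)\<^sup>2 = x\<^sup>2 + y\<^sup>2 + z\<^sup>2 + w\<^sup>2"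
      unfolding e by (simp only: power2_norm_eq_inner, simp add: power2_eq_square)
    ultimately show ?thesis by (simp add: power2_eq_square)
  qed
  have "emeasure hyp_measure {q. norm q < 1 \<and> in_F (lift q)}
    = emeasure hyp_measure {q. norm q < 1 \<and> base q \<in> base_inf \<and> 1 - (norm (base q))\<^sup>2 \<le> hts q}"
  proof (rule emeasure_hyp_cong_AE)
    show "AE q in lborel. norm q < 1 \<longrightarrow> (q \<in> {q. norm q < 1 \<and> in_F (lift q)})
      = (q \<in> {q. norm q < 1 \<and> base q \<in> base_inf \<and> 1 - (norm (base q))\<^sup>2 \<le> hts q})"
      using AE_bs
    proof eventually_elim
      case (elim q)
      \<comment> \<open>The wall \<open>bs 4\<close> is the unit hemisphere: q_5 <= 0 says that the
        squared height is at least 1 - |v|^2.\<close>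
      have "1 - (norm (base q))\<^sup>2 \<le> hts q \<longleftrightarrow> q $ 5 \<le> 0" if "norm q < 1"
        using norm_less_1_component5[OF that] by (auto simp: hts_def pos_le_divide_eq)
      then show ?case using base_mem_base_inf[of q] elim by auto
    qed
  qed measurable
  also have "\<dots> = (\<integral>\<^sup>+v. ennreal (1 / (4 * (1 - (norm v)\<^sup>2)\<^sup>2)) * indicator base_inf v \<partial>lborel)"
    by (rule emeasure_hyp_over_base) (use pos in auto)
  also have "\<dots> = (\<integral>\<^sup>+x. \<integral>\<^sup>+y. \<integral>\<^sup>+z. \<integral>\<^sup>+w. ennreal (1 / (4 * (1 - (norm (x, y, z, w))\<^sup>2)\<^sup>2)) * indicator base_inf (x, y, z, w) \<partial>lborel \<partial>lborel \<partial>lborel \<partial>lborel)"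
    by (rule nn_integral_real4) measurable
  also have "\<dots> = (\<integral>\<^sup>+x. \<integral>\<^sup>+y. \<integral>\<^sup>+z. \<integral>\<^sup>+w. ennreal (1 / 4) * (if z < y \<and> y < x then box_density x y z w else 0) \<partial>lborel \<partial>lborel \<partial>lborel \<partial>lborel)"
  proof (intro nn_integral_cong)
    fix x y z w :: real
    have "(norm (x, y, z, w))\<^sup>2 = x\<^sup>2 + y\<^sup>2 + z\<^sup>2 + w\<^sup>2"
      by (simp only: power2_norm_eq_inner, simp add: power2_eq_square)
    then have n: "1 - (norm (x, y, z, w))\<^sup>2 = 1 - x\<^sup>2 - y\<^sup>2 - z\<^sup>2 - w\<^sup>2" by simp
    show "ennreal (1 / (4 * (1 - (norm (x, y, z, w))\<^sup>2)\<^sup>2)) * indicator base_inf (x, y, z, w)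
      = ennreal (1 / 4) * (if z < y \<and> y < x then box_density x y z w else 0)"
      unfolding n box_density_def base_inf_def by (auto simp: indicator_def ennreal_mult[symmetric])
  qed
  also have "\<dots> = ennreal (1 / 4) * (\<integral>\<^sup>+x. \<integral>\<^sup>+y. \<integral>\<^sup>+z. \<integral>\<^sup>+w. (if z < y \<and> y < x then box_density x y z w else 0) \<partial>lborel \<partial>lborel \<partial>lborel \<partial>lborel)"
    by (simp add: nn_integral_cmult)
  also have "\<dots> = ennreal (7 * zeta 3 / 1152)"
    unfolding nn_integral_sorted_box by (subst ennreal_mult'[symmetric]) auto
  finally show ?thesis .
qed

text \<open>An interval of length 1/2 times one sixth of a cube of volume 1/8.\<close>

lemma emeasure_base_inf: "emeasure lborel base_inf = ennreal (1 / 96)"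
proof -
  have w: "(\<integral>\<^sup>+(w::real). (if 0 < w \<and> w < 1 / 2 then ennreal 1 else 0) \<partial>lborel) = ennreal (1 / 2)"
    using nn_integral_FTC_open(1)[of 0 "1 / 2" "\<lambda>w. w" "\<lambda>_. 1"] by simp
  have z: "(\<integral>\<^sup>+z. (if 0 < z \<and> z < y then ennreal (1 / 2) else 0) \<partial>lborel) = ennreal (y / 2)" if "0 < y" for y
  proof -
    have "(\<integral>\<^sup>+z. (if 0 < z \<and> z < y then ennreal (1 / 2) else 0) \<partial>lborel) = ennreal (y / 2 - 0 / 2)"
      by (rule nn_integral_FTC_open(1)) (use that in \<open>auto intro!: continuous_intros derivative_eq_intros\<close>)
    then show ?thesis by simp
  qed
  have y: "(\<integral>\<^sup>+y. (if 0 < y \<and> y < x then ennreal (y / 2) else 0) \<partial>lborel) = ennreal (x\<^sup>2 / 4)" if "0 < x" for x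
  proof -
    have "(\<integral>\<^sup>+y. (if 0 < y \<and> y < x then ennreal (y / 2) else 0) \<partial>lborel) = ennreal (x\<^sup>2 / 4 - 0\<^sup>2 / 4)"
      by (rule nn_integral_FTC_open(1)[where F = "\<lambda>y. y\<^sup>2 / 4"]) (use that in \<open>auto intro!: continuous_intros derivative_eq_intros\<close>)
    then show ?thesis by simp
  qed
  have x: "(\<integral>\<^sup>+x. (if 0 < x \<and> x < 1 / 2 then ennreal (x\<^sup>2 / 4) else 0) \<partial>lborel) = ennreal (1 / 96)"
  proof -
    have "(\<integral>\<^sup>+x. (if 0 < x \<and> x < 1 / 2 then ennreal (x\<^sup>2 / 4) else 0) \<partial>lborel) = ennreal ((1 / 2) ^ 3 / 12 - 0 ^ 3 / 12)"
      by (rule nn_integral_FTC_open(1)[where F = "\<lambda>x. x ^ 3 / 12"]) (auto intro!: continuous_intros derivative_eq_intros)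
    then show ?thesis by (simp add: power3_eq_cube)
  qed
  have "emeasure lborel base_inf = (\<integral>\<^sup>+x. \<integral>\<^sup>+y. \<integral>\<^sup>+z. \<integral>\<^sup>+w. indicator base_inf (x, y, z, w) \<partial>lborel \<partial>lborel \<partial>lborel \<partial>lborel)"
    by (subst nn_integral_real4[symmetric]) simp_all
  also have "\<dots> = (\<integral>\<^sup>+(x::real). \<integral>\<^sup>+(y::real). \<integral>\<^sup>+(z::real). (if 0 < z \<and> z < y \<and> y < x \<and> x < 1 / 2 then ennreal (1 / 2) else 0) \<partial>lborel \<partial>lborel \<partial>lborel)"
  proof (intro nn_integral_cong)
    fix x y z :: real
    show "(\<integral>\<^sup>+w. indicator base_inf (x, y, z, w) \<partial>lborel) = (if 0 < z \<and> z < y \<and> y < x \<and> x < 1 / 2 then ennreal (1 / 2) else 0)"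
    proof (cases "0 < z \<and> z < y \<and> y < x \<and> x < 1 / 2")
      case True
      have "(\<integral>\<^sup>+w. indicator base_inf (x, y, z, w) \<partial>lborel) = (\<integral>\<^sup>+(w::real). (if 0 < w \<and> w < 1 / 2 then ennreal 1 else 0) \<partial>lborel)"
        using True by (intro nn_integral_cong) (auto simp: base_inf_def indicator_def)
      then show ?thesis using True unfolding w by simp
    next
      case False
      then have "indicator base_inf (x, y, z, w) = (0 :: ennreal)" for w by (auto simp: base_inf_def)
      then show ?thesis using False by auto
    qed
  qed
  also have "\<dots> = (\<integral>\<^sup>+(x::real). \<integral>\<^sup>+(y::real). (if 0 < y \<and> y < x \<and> x < 1 / 2 then ennreal (y / 2) else 0) \<partial>lborel \<partial>lborel)"
  proof (intro nn_integral_cong)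
    fix x y :: real
    show "(\<integral>\<^sup>+z. (if 0 < z \<and> z < y \<and> y < x \<and> x < 1 / 2 then ennreal (1 / 2) else 0) \<partial>lborel)
      = (if 0 < y \<and> y < x \<and> x < 1 / 2 then ennreal (y / 2) else 0)"
    proof (cases "0 < y \<and> y < x \<and> x < 1 / 2")
      case True
      then show ?thesis using z[of y] by simp
    next
      case False
      then have "(if 0 < z \<and> z < y \<and> y < x \<and> x < 1 / 2 then ennreal (1 / 2) else 0) = 0" for z by auto
      then show ?thesis using False by (simp only:) auto
    qed
  qed
  also have "\<dots> = (\<integral>\<^sup>+x. (if 0 < x \<and> x < 1 / 2 then ennreal (x\<^sup>2 / 4) else 0) \<partial>lborel)"
  proof (intro nn_integral_cong)
    fix x :: real
    show "(\<integral>\<^sup>+y. (if 0 < y \<and> y < x \<and> x < 1 / 2 then ennreal (y / 2) else 0) \<partial>lborel)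
      = (if 0 < x \<and> x < 1 / 2 then ennreal (x\<^sup>2 / 4) else 0)"
    proof (cases "0 < x \<and> x < 1 / 2")
      case True
      then show ?thesis using y[of x] by simp
    next
      case False
      then have "(if 0 < y \<and> y < x \<and> x < 1 / 2 then ennreal (y / 2) else 0) = 0" for y by auto
      then show ?thesis using False by (simp only:) auto
    qed
  qed
  finally show ?thesis unfolding x .
qed

text \<open>The ordering of x, y, z selects one sixth of a corner simplex of volume 1/24.\<close>

lemma emeasure_base_cor: "emeasure lborel base_cor = ennreal (1 / 144)"
proof -
  have w: "(\<integral>\<^sup>+w. (if - c < w \<and> w < 0 then ennreal 1 else 0) \<partial>lborel) = ennreal c" if "0 \<le> c" for c
    using nn_integral_FTC_open(1)[of "- c" 0 "\<lambda>w. w" "\<lambda>_. 1"] that by simp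
  \<comment> \<open>In this and the following integrals the lower limit is the value at which the
    range of the previously integrated variable becomes empty.\<close>
  have z: "(\<integral>\<^sup>+z. (if - 1 - x - y < z \<and> z < y then ennreal (1 + x + y + z) else 0) \<partial>lborel) = ennreal ((1 + x + 2 * y)\<^sup>2 / 2)"
    if "0 \<le> 1 + x + 2 * y" for x y
  proof -
    define F where "F z = (1 + x + y + z)\<^sup>2 / 2" for z
    have "(\<integral>\<^sup>+z. (if - 1 - x - y < z \<and> z < y then ennreal (1 + x + y + z) else 0) \<partial>lborel) = ennreal (F y - F (- 1 - x - y))"
    proof (rule nn_integral_FTC_open(1))
      show "continuous_on {- 1 - x - y..y} F" unfolding F_def by (intro continuous_intros) auto
      show "(F has_real_derivative 1 + x + y + z) (at z)" for z
        unfolding F_def by (auto intro!: derivative_eq_intros)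
    qed (use that in auto)
    then show ?thesis by (simp add: F_def algebra_simps)
  qed
  have y: "(\<integral>\<^sup>+y. (if - (1 + x) / 2 < y \<and> y < x then ennreal ((1 + x + 2 * y)\<^sup>2 / 2) else 0) \<partial>lborel) = ennreal ((1 + 3 * x) ^ 3 / 12)"
    if "0 \<le> 1 + 3 * x" for x
  proof -
    define F where "F y = (1 + x + 2 * y) ^ 3 / 12" for y
    have "(\<integral>\<^sup>+y. (if - (1 + x) / 2 < y \<and> y < x then ennreal ((1 + x + 2 * y)\<^sup>2 / 2) else 0) \<partial>lborel) = ennreal (F x - F (- (1 + x) / 2))"
    proof (rule nn_integral_FTC_open(1))
      show "continuous_on {- (1 + x) / 2..x} F" unfolding F_def by (intro continuous_intros) auto
      show "(F has_real_derivative (1 + x + 2 * y)\<^sup>2 / 2) (at y)" for y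
        unfolding F_def by (auto intro!: derivative_eq_intros)
    qed (use that in auto)
    moreover have "1 + x + 2 * (- (1 + x) / 2) = 0" "1 + x + 2 * x = 1 + 3 * x" by (simp_all add: field_simps)
    then have "F x - F (- (1 + x) / 2) = (1 + 3 * x) ^ 3 / 12" unfolding F_def by (simp only:) simp
    ultimately show ?thesis by (simp only:)
  qed
  have x: "(\<integral>\<^sup>+x. (if - 1 / 3 < x \<and> x < 0 then ennreal ((1 + 3 * x) ^ 3 / 12) else 0) \<partial>lborel) = ennreal (1 / 144)"
  proof -
    define F where "F x = (1 + 3 * x) ^ 4 / 144" for x :: real
    have "(\<integral>\<^sup>+x. (if - 1 / 3 < x \<and> x < 0 then ennreal ((1 + 3 * x) ^ 3 / 12) else 0) \<partial>lborel) = ennreal (F 0 - F (- 1 / 3))"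
    proof (rule nn_integral_FTC_open(1))
      show "continuous_on {- 1 / 3..0} F" unfolding F_def by (intro continuous_intros) auto
      show "(F has_real_derivative (1 + 3 * x) ^ 3 / 12) (at x)" for x
        unfolding F_def by (auto intro!: derivative_eq_intros)
    qed auto
    then show ?thesis by (simp add: F_def)
  qed
  have "emeasure lborel base_cor = (\<integral>\<^sup>+x. \<integral>\<^sup>+y. \<integral>\<^sup>+z. \<integral>\<^sup>+w. indicator base_cor (x, y, z, w) \<partial>lborel \<partial>lborel \<partial>lborel \<partial>lborel)"
    by (subst nn_integral_real4[symmetric]) simp_all
  also have "\<dots> = (\<integral>\<^sup>+(x::real). \<integral>\<^sup>+(y::real). \<integral>\<^sup>+(z::real). (if - 1 - x - y < z \<and> z < y \<and> y < x \<and> x < 0 then ennreal (1 + x + y + z) else 0) \<partial>lborel \<partial>lborel \<partial>lborel)"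
  proof (intro nn_integral_cong)
    fix x y z :: real
    show "(\<integral>\<^sup>+w. indicator base_cor (x, y, z, w) \<partial>lborel) = (if - 1 - x - y < z \<and> z < y \<and> y < x \<and> x < 0 then ennreal (1 + x + y + z) else 0)"
    proof (cases "- 1 - x - y < z \<and> z < y \<and> y < x \<and> x < 0")
      case True
      have "(\<integral>\<^sup>+w. indicator base_cor (x, y, z, w) \<partial>lborel) = (\<integral>\<^sup>+w. (if - (1 + x + y + z) < w \<and> w < 0 then ennreal 1 else 0) \<partial>lborel)"
        using True by (intro nn_integral_cong) (auto simp: base_cor_def indicator_def)
      then show ?thesis using True w[of "1 + x + y + z"] by simp
    next
      case False
      then have "indicator base_cor (x, y, z, w) = (0 :: ennreal)" for w by (auto simp: base_cor_def)
      then show ?thesis using False by auto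
    qed
  qed
  also have "\<dots> = (\<integral>\<^sup>+(x::real). \<integral>\<^sup>+(y::real). (if - (1 + x) / 2 < y \<and> y < x \<and> x < 0 then ennreal ((1 + x + 2 * y)\<^sup>2 / 2) else 0) \<partial>lborel \<partial>lborel)"
  proof (intro nn_integral_cong)
    fix x y :: real
    show "(\<integral>\<^sup>+z. (if - 1 - x - y < z \<and> z < y \<and> y < x \<and> x < 0 then ennreal (1 + x + y + z) else 0) \<partial>lborel)
      = (if - (1 + x) / 2 < y \<and> y < x \<and> x < 0 then ennreal ((1 + x + 2 * y)\<^sup>2 / 2) else 0)"
    proof (cases "- (1 + x) / 2 < y \<and> y < x \<and> x < 0")
      case True
      then show ?thesis using z[of x y] by simp
    next
      case False
      then have "(if - 1 - x - y < z \<and> z < y \<and> y < x \<and> x < 0 then ennreal (1 + x + y + z) else 0) = 0" for z by auto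
      then show ?thesis using False by (simp only:) auto
    qed
  qed
  also have "\<dots> = (\<integral>\<^sup>+x. (if - 1 / 3 < x \<and> x < 0 then ennreal ((1 + 3 * x) ^ 3 / 12) else 0) \<partial>lborel)"
  proof (intro nn_integral_cong)
    fix x :: real
    show "(\<integral>\<^sup>+y. (if - (1 + x) / 2 < y \<and> y < x \<and> x < 0 then ennreal ((1 + x + 2 * y)\<^sup>2 / 2) else 0) \<partial>lborel)
      = (if - 1 / 3 < x \<and> x < 0 then ennreal ((1 + 3 * x) ^ 3 / 12) else 0)"
    proof (cases "- 1 / 3 < x \<and> x < 0")
      case True
      then show ?thesis using y[of x] by simp
    next
      case False
      then have "(if - (1 + x) / 2 < y \<and> y < x \<and> x < 0 then ennreal ((1 + x + 2 * y)\<^sup>2 / 2) else 0) = 0" for y by auto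
      then show ?thesis using False by (simp only:) auto
    qed
  qed
  finally show ?thesis unfolding x .
qed

section \<open>Horoball sectors\<close>

definition horo_in_F :: "real \<Rightarrow> real \<times> (real^5) \<Rightarrow> real \<times> (real^5) \<Rightarrow> bool" where
  "horo_in_F t v y \<longleftrightarrow> in_F y \<and> - lorentz y (t *\<^sub>R v) \<le> sqrt (- lorentz y y)"

lemma measurable_horo_in_F [measurable]: "Measurable.pred borel (horo_in_F t v)"
  unfolding horo_in_F_def by measurable

lemma sqrt_minus_lorentz_scale: "0 < c \<Longrightarrow> sqrt (- lorentz (c *\<^sub>R y) (c *\<^sub>R y)) = c * sqrt (- lorentz y y)"
proof -
  assume c: "0 < c"
  have "- lorentz (c *\<^sub>R y) (c *\<^sub>R y) = c\<^sup>2 * - lorentz y y" by (simp add: lorentz_simps power2_eq_square)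
  then show ?thesis using c by (simp only: real_sqrt_mult real_sqrt_abs abs_of_pos)
qed

lemma in_F_scale: "0 < c \<Longrightarrow> in_F (c *\<^sub>R y) \<longleftrightarrow> in_F y"
  by (simp add: in_F_def lorentz_simps mult_le_0_iff)

lemma horo_in_F_scale: "0 < c \<Longrightarrow> horo_in_F t v (c *\<^sub>R y) \<longleftrightarrow> horo_in_F t v y"
proof -
  assume c: "0 < c"
  have "- lorentz (c *\<^sub>R y) (t *\<^sub>R v) = c * - lorentz y (t *\<^sub>R v)" by (simp add: lorentz_simps)
  then show ?thesis
    unfolding horo_in_F_def in_F_scale[OF c] sqrt_minus_lorentz_scale[OF c] by (simp only: mult_le_cancel_left_pos[OF c])
qed

text \<open>For t >= 1 the horoball lies above the unit hemisphere, so only the vertical walls cut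
  it, and the volume is the base volume divided by 4 t^4.\<close>

lemma emeasure_horo_inf:
  assumes t: "1 \<le> t"
  shows "emeasure hyp_measure {q. norm q < 1 \<and> horo_in_F t v_inf (lift q)} = ennreal (1 / (384 * t ^ 4))"
proof -
  have t1: "1 \<le> t\<^sup>2" using t by simp
  have "emeasure hyp_measure {q. norm q < 1 \<and> horo_in_F t v_inf (lift q)}
    = emeasure hyp_measure {q. norm q < 1 \<and> base q \<in> base_inf \<and> t\<^sup>2 \<le> hts q}"
  proof (rule emeasure_hyp_cong_AE)
    show "AE q in lborel. norm q < 1 \<longrightarrow> (q \<in> {q. norm q < 1 \<and> horo_in_F t v_inf (lift q)})
      = (q \<in> {q. norm q < 1 \<and> base q \<in> base_inf \<and> t\<^sup>2 \<le> hts q})"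
      using AE_bs
    proof eventually_elim
      case (elim q)
      have "q $ 5 \<le> 0" if "norm q < 1" "t\<^sup>2 \<le> hts q"
      proof -
        have "1 \<le> hts q" using that t1 by linarith
        also have "\<dots> \<le> (1 - q $ 5) / (1 + q $ 5)" by (simp add: hts_def)
        finally show ?thesis using norm_less_1_component5[OF that(1)] by (simp add: pos_le_divide_eq)
      qed
      then show ?case using base_mem_base_inf[of q] elim horo_cond[of q t] t by (auto simp: horo_in_F_def)
    qed
  qed measurable
  also have "\<dots> = (\<integral>\<^sup>+v. ennreal (1 / (4 * (t\<^sup>2)\<^sup>2)) * indicator base_inf v \<partial>lborel)"
    by (rule emeasure_hyp_over_base) (use t in auto)
  also have "\<dots> = ennreal (1 / (4 * (t\<^sup>2)\<^sup>2)) * emeasure lborel base_inf"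
    by (simp add: nn_integral_cmult)
  also have "\<dots> = ennreal (1 / (384 * t ^ 4))"
    unfolding emeasure_base_inf using t by (subst ennreal_mult[symmetric]) (auto simp flip: power_mult)
  finally show ?thesis .
qed

text \<open>A Lorentz isometry that moves \<open>v_inf\<close> to \<open>v_cor\<close>; in its coordinates the vertex $A_0$ is at infinity.\<close>

definition swap_iso :: "real \<times> (real^5) \<Rightarrow> real \<times> (real^5)" where
  "swap_iso = frame (3 / 2, vec5 (1 / 2) (1 / 2) (1 / 2) (1 / 2) (- 1 / 2)) (1 / 2, vec5 1 0 0 0 (- 1 / 2))
     (1 / 2, vec5 0 1 0 0 (- 1 / 2)) (1 / 2, vec5 0 0 1 0 (- 1 / 2)) (1 / 2, vec5 0 0 0 1 (- 1 / 2))
     (- 1 / 2, vec5 (- 1 / 2) (- 1 / 2) (- 1 / 2) (- 1 / 2) (- 1 / 2))"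

lemma orthochronous_swap_iso: "orthochronous swap_iso"
  unfolding swap_iso_def by (rule orthochronous_frame) (simp_all add: lorentz_5)

lemma swap_iso_comp:
  "fst (swap_iso y) = 3 / 2 * fst y + (snd y $ 1 + snd y $ 2 + snd y $ 3 + snd y $ 4) / 2 - snd y $ 5 / 2"
  "snd (swap_iso y) $ 1 = fst y / 2 + snd y $ 1 - snd y $ 5 / 2"
  "snd (swap_iso y) $ 2 = fst y / 2 + snd y $ 2 - snd y $ 5 / 2"
  "snd (swap_iso y) $ 3 = fst y / 2 + snd y $ 3 - snd y $ 5 / 2"
  "snd (swap_iso y) $ 4 = fst y / 2 + snd y $ 4 - snd y $ 5 / 2"
  "snd (swap_iso y) $ 5 = - fst y / 2 - (snd y $ 1 + snd y $ 2 + snd y $ 3 + snd y $ 4) / 2 - snd y $ 5 / 2"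
  by (simp_all add: swap_iso_def frame_def field_simps)

lemma swap_iso_v_inf: "swap_iso v_inf = v_cor"
  by (simp add: prod_eq_iff vec5_eq_iff swap_iso_comp) (simp add: v_inf_def v_cor_def)

text \<open>\<open>swap_iso\<close> is the inversion in the unit hemisphere followed by the
  horizontal translation by (1/2, 1/2, 1/2, 1/2). In its coordinates the walls through A_0 are
  vertical, and the first and last inequality are the two walls \<open>bs 0\<close> and
  \<open>bs 6\<close> that miss A_0.\<close>

lemma in_F_swap_iso: "in_F (swap_iso y) \<longleftrightarrow> snd y $ 5 \<le> fst y + 2 * snd y $ 3 \<and> snd y $ 3 \<le> snd y $ 2 \<and> snd y $ 2 \<le> snd y $ 1 \<and> snd y $ 1 \<le> 0
   \<and> 0 \<le> fst y + snd y $ 5 + snd y $ 1 + snd y $ 2 + snd y $ 3 + snd y $ 4 \<and> snd y $ 4 \<le> 0 \<and> snd y $ 5 \<le> fst y + 2 * snd y $ 4"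
  unfolding in_F_iff swap_iso_comp by (auto simp: field_simps)

lemma emeasure_horo_cor:
  assumes t: "1 \<le> t"
  shows "emeasure hyp_measure {q. norm q < 1 \<and> horo_in_F t v_cor (lift q)} = ennreal (1 / (576 * t ^ 4))"
proof -
  have t1: "1 \<le> t\<^sup>2" using t by simp
  have pres: "lorentz (swap_iso x) (swap_iso y) = lorentz x y" for x y
    using orthochronous_swap_iso unfolding orthochronous_def by blast
  have linN: "linear swap_iso" using orthochronous_swap_iso unfolding orthochronous_def by blast
  have [measurable]: "swap_iso \<in> borel_measurable borel"
    using linN by (auto intro!: borel_measurable_continuous_onI linear_continuous_on simp: linear_conv_bounded_linear)
  have "lorentz (swap_iso y) (t *\<^sub>R v_cor) = lorentz y (t *\<^sub>R v_inf)" for y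
    unfolding swap_iso_v_inf[symmetric] by (simp add: lorentz_simps pres)
  then have hN: "horo_in_F t v_cor (swap_iso y) \<longleftrightarrow> in_F (swap_iso y) \<and> - lorentz y (t *\<^sub>R v_inf) \<le> sqrt (- lorentz y y)" for y
    by (simp add: horo_in_F_def pres)
  have nz: "AE (q::real^5) in lborel. q $ 3 \<noteq> q $ 2 \<and> q $ 2 \<noteq> q $ 1 \<and> q $ 1 \<noteq> 0 \<and> q $ 4 \<noteq> 0 \<and> 1 + q $ 5 + q $ 1 + q $ 2 + q $ 3 + q $ 4 \<noteq> 0"
  proof -
    have "AE (q::real^5) in lborel. lorentz (lift q) (0, vec5 0 (- 1) 1 0 0) \<noteq> 0 \<and> lorentz (lift q) (0, vec5 (- 1) 1 0 0 0) \<noteq> 0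
      \<and> lorentz (lift q) (0, vec5 1 0 0 0 0) \<noteq> 0 \<and> lorentz (lift q) (0, vec5 0 0 0 1 0) \<noteq> 0
      \<and> lorentz (lift q) (- 1, vec5 1 1 1 1 1) \<noteq> 0"
      by (intro AE_conjI AE_lorentz_nonzero) (simp_all add: vec5_eq_iff)
    then show ?thesis by eventually_elim (auto simp: lorentz_5)
  qed
  have "emeasure hyp_measure {q. norm q < 1 \<and> horo_in_F t v_cor (lift q)}
    = emeasure hyp_measure {q. norm q < 1 \<and> horo_in_F t v_cor (swap_iso (lift q))}"
    by (rule emeasure_hyp_orthochronous[OF orthochronous_swap_iso]) (measurable, rule horo_in_F_scale)
  also have "\<dots> = emeasure hyp_measure {q. norm q < 1 \<and> base q \<in> base_cor \<and> t\<^sup>2 \<le> hts q}"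
  proof (rule emeasure_hyp_cong_AE)
    show "AE q in lborel. norm q < 1 \<longrightarrow> (q \<in> {q. norm q < 1 \<and> horo_in_F t v_cor (swap_iso (lift q))})
      = (q \<in> {q. norm q < 1 \<and> base q \<in> base_cor \<and> t\<^sup>2 \<le> hts q})"
      using nz
    proof eventually_elim
      case (elim q)
      show ?case
      proof
        assume q: "norm q < 1"
        define s where "s = 1 + q $ 5"
        have s: "0 < s" using norm_less_1_component5[OF q] by (simp add: s_def)
        have d: "a / s < 0 \<longleftrightarrow> a < 0" "a / s < c / s \<longleftrightarrow> a < c" for a c
          using s by (simp_all add: divide_simps)
        have d2: "- 1 < q $ 1 / s + q $ 2 / s + q $ 3 / s + q $ 4 / s \<longleftrightarrow> 0 < s + q $ 1 + q $ 2 + q $ 3 + q $ 4"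
        proof -
          have "q $ 1 / s + q $ 2 / s + q $ 3 / s + q $ 4 / s = (q $ 1 + q $ 2 + q $ 3 + q $ 4) / s" by (simp add: add_divide_distrib)
          then show ?thesis using s by (simp add: pos_less_divide_eq) linarith
        qed
        have A: "base q \<in> base_cor \<longleftrightarrow> q $ 3 < q $ 2 \<and> q $ 2 < q $ 1 \<and> q $ 1 < 0 \<and> q $ 4 < 0 \<and> 0 < s + q $ 1 + q $ 2 + q $ 3 + q $ 4"
          unfolding base_cor_def base_def s_def[symmetric] using d d2 by simp
        \<comment> \<open>A horoball with t >= 1 does not reach the walls \<open>bs 0\<close> and
          \<open>bs 6\<close>; the estimate comes from expanding the square (q_k + s)^2.\<close>
        have far: "q $ 5 \<le> 1 + 2 * q $ k" if h: "t\<^sup>2 \<le> hts q" and k: "k = 3 \<or> k = 4" for k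
        proof -
          have "0 \<le> (q $ k + s)\<^sup>2" by simp
          then have "- 2 * s * q $ k \<le> s\<^sup>2 + (q $ k)\<^sup>2" unfolding power2_sum by (simp add: mult_ac)
          also have "(q $ k)\<^sup>2 \<le> s\<^sup>2 * (norm (base q))\<^sup>2"
            unfolding norm_base s_def[symmetric] using s k by (auto simp: add_nonneg_nonneg)
          also have "s\<^sup>2 + s\<^sup>2 * (norm (base q))\<^sup>2 \<le> s\<^sup>2 * ((1 - q $ 5) / s)"
          proof -
            have "1 + (norm (base q))\<^sup>2 \<le> (1 - q $ 5) / s" using h t1 unfolding hts_def s_def by linarith
            from mult_left_mono[OF this, of "s\<^sup>2"] show ?thesis by (simp add: distrib_left)
          qed
          also have "\<dots> = s * (1 - q $ 5)" using s by (simp add: power2_eq_square)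
          finally have "s * (- 2 * q $ k) \<le> s * (1 - q $ 5)" by (simp add: algebra_simps)
          then have "- 2 * q $ k \<le> 1 - q $ 5" unfolding mult_le_cancel_left_pos[OF s] .
          then show ?thesis by linarith
        qed
        have hc: "- lorentz (lift q) (t *\<^sub>R v_inf) \<le> sqrt (- lorentz (lift q) (lift q)) \<longleftrightarrow> t\<^sup>2 \<le> hts q"
          using horo_cond[OF q, of t] t by simp
        have "in_F (swap_iso (lift q)) \<longleftrightarrow> base q \<in> base_cor" if h: "t\<^sup>2 \<le> hts q"
          unfolding A in_F_swap_iso using elim far[OF h] by (auto simp: s_def)
        then show "(q \<in> {q. norm q < 1 \<and> horo_in_F t v_cor (swap_iso (lift q))})
          = (q \<in> {q. norm q < 1 \<and> base q \<in> base_cor \<and> t\<^sup>2 \<le> hts q})"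
          using q hc by (auto simp: hN)
      qed
    qed
  qed measurable
  also have "\<dots> = (\<integral>\<^sup>+v. ennreal (1 / (4 * (t\<^sup>2)\<^sup>2)) * indicator base_cor v \<partial>lborel)"
    by (rule emeasure_hyp_over_base) (use t in auto)
  also have "\<dots> = ennreal (1 / (4 * (t\<^sup>2)\<^sup>2)) * emeasure lborel base_cor"
    by (simp add: nn_integral_cmult)
  also have "\<dots> = ennreal (1 / (576 * t ^ 4))"
    unfolding emeasure_base_cor using t by (subst ennreal_mult[symmetric]) (auto simp flip: power_mult)
  finally show ?thesis .
qed

section \<open>Orbits of the maximal horoballs\<close>

lemma orthochronousD:
  assumes "orthochronous g"
  shows "linear g" "lorentz (g x) (g y) = lorentz x y" "lorentz x x < 0 \<Longrightarrow> 0 < fst x \<Longrightarrow> 0 < fst (g x)"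
  using assms unfolding orthochronous_def by blast+

lemma orthochronousI:
  assumes "linear g" "\<And>x y. lorentz (g x) (g y) = lorentz x y" "\<And>x. lorentz x x < 0 \<Longrightarrow> 0 < fst x \<Longrightarrow> 0 < fst (g x)"
  shows "orthochronous g"
  using assms unfolding orthochronous_def by blast

lemma orthochronous_reflection:
  fixes e :: "real \<times> (real^'n)"
  assumes e: "lorentz e e = 1"
  shows "orthochronous (reflection e)"
proof -
  have lin: "linear (reflection e)"
    by (rule linearI) (simp_all add: reflection_def lorentz_simps algebra_simps)
  have pres: "lorentz (reflection e x) (reflection e y) = lorentz x y" for x y
    unfolding reflection_def lorentz_simps e by (simp add: lorentz_commute[of e y])
  have fut: "0 < fst (reflection e x)" if x: "lorentz x x < 0" "0 < fst x" for x
  proof -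
    \<comment> \<open>The product of x with its mirror image stays negative, so the reflection keeps
      the time direction.\<close>
    have "lorentz (reflection e x) x = lorentz x x - 2 * (lorentz x e)\<^sup>2"
      unfolding reflection_def lorentz_simps by (simp add: power2_eq_square lorentz_commute[of e x])
    also have "\<dots> < 0" using x(1) zero_le_power2[of "lorentz x e"] by linarith
    finally show ?thesis using x pres[of x x] by - (rule timelike_future[of _ x], auto)
  qed
  show ?thesis unfolding orthochronous_def using lin pres fut by blast
qed

lemma orthochronous_id: "orthochronous id"
  by (rule orthochronousI) (simp_all add: linear_id)

lemma orthochronous_comp: "orthochronous f \<Longrightarrow> orthochronous g \<Longrightarrow> orthochronous (f \<circ> g)"
  by (rule orthochronousI) (simp_all add: linear_compose[unfolded comp_def] orthochronousD comp_def)

lemma orthochronous_null_future: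
  fixes v :: "real \<times> (real^'n)"
  assumes g: "orthochronous g" and v: "lorentz v v = 0" "0 < fst v"
  shows "0 < fst (g v)"
proof -
  note pres = orthochronousD(2)[OF g]
  have e: "lorentz (1, 0) (1, 0 :: real^'n) = - 1" by (simp add: lorentz_def)
  then have "lorentz (1, 0) v < 0" using v by - (rule lorentz_timelike_neg, auto)
  moreover have "0 < fst (g (1, 0))" by (rule orthochronousD(3)[OF g]) (simp_all add: e)
  ultimately show ?thesis using causal_future[of "g (1, 0)" "g v"] v(1) unfolding pres e by simp
qed

text \<open>Replaces orbits of horoballs by orbits of null vectors. It works because the condition
  in \<open>HB\<close> is homogeneous of degree 1 in the point, hence insensitive to the projection
  in \<open>act\<close>.\<close>

lemma act_HB:
  assumes g: "orthochronous g"
  shows "act g ` HB v = HB (g v)"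
proof -
  have lin: "linear g" and pres: "lorentz (g x) (g y) = lorentz x y" for x y
    using g unfolding orthochronous_def by blast+
  have scale: "proj x \<in> HB w \<longleftrightarrow> - lorentz x w \<le> sqrt (- lorentz x x)" if x: "lorentz x x < 0" "0 < fst x" for x w
  proof -
    have "- lorentz (lift (proj x)) w = (1 / fst x) * (- lorentz x w)"
      using x by (simp add: lift_proj lorentz_simps)
    moreover have "- lorentz (lift (proj x)) (lift (proj x)) = (1 / fst x)\<^sup>2 * (- lorentz x x)"
      using x by (simp add: lift_proj lorentz_simps power2_eq_square)
    then have "sqrt (- lorentz (lift (proj x)) (lift (proj x))) = (1 / fst x) * sqrt (- lorentz x x)"
      using x by (simp only: real_sqrt_mult) simp
    ultimately show ?thesis
      using x norm_proj_less_1[of x] unfolding HB_def by (simp only: mem_Collect_eq mult_le_cancel_left_pos zero_less_divide_1_iff simp_thms)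
  qed
  have fut: "0 < fst (g (lift q))" "lorentz (g (lift q)) (g (lift q)) < 0" if "norm q < 1" for q
    using orthochronousD[OF g] that lorentz_lift_neg_iff[of q] by simp_all
  show ?thesis
  proof (intro equalityI subsetI)
    fix p assume "p \<in> act g ` HB v"
    then obtain q where q: "q \<in> HB v" "p = proj (g (lift q))" by (auto simp: act_def)
    then have n: "norm q < 1" by (simp add: HB_def)
    show "p \<in> HB (g v)" using q(1) unfolding q(2) scale[OF fut(2)[OF n] fut(1)[OF n]] by (simp add: pres HB_def)
  next
    fix q assume q: "q \<in> HB (g v)"
    obtain m where m: "linear m" "\<And>x. g (m x) = x" "\<And>x. m (g x) = x" "\<And>x y. lorentz (m x) (m y) = lorentz x y"
      using lorentz_isometry_bij[OF lin pres] by metis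
    have n: "norm q < 1" using q by (simp add: HB_def)
    then have l: "lorentz (lift q) (lift q) < 0" by (simp add: lorentz_lift_neg_iff)
    have mt: "lorentz (m (lift q)) (m (lift q)) < 0" using l by (simp add: m)
    have mf: "0 < fst (m (lift q))" using orthochronous_future_iff[OF g mt] by (simp add: m)
    have "lorentz (m (lift q)) v = lorentz (lift q) (g v)" using m(4)[of "lift q" "g v"] by (simp add: m)
    then have "proj (m (lift q)) \<in> HB v" unfolding scale[OF mt mf] using q by (simp add: m HB_def)
    moreover have "act g (proj (m (lift q))) = q"
      using mf by (simp add: act_def lift_proj linear_cmul[OF lin] m proj_scale)
    ultimately show "q \<in> act g ` HB v" by (metis imageI)
  qed
qed

text \<open>Orthogonality of null vectors is the case of equality in the Cauchy-Schwarz inequality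
  of their spatial parts.\<close>

lemma null_orthogonal_parallel:
  assumes v: "lorentz v v = 0" "0 < fst v" and w: "lorentz w w = 0" "0 < fst w" and vw: "lorentz v w = 0"
  shows "w = (fst w / fst v) *\<^sub>R v"
proof -
  have "(norm (snd v))\<^sup>2 = (fst v)\<^sup>2" "(norm (snd w))\<^sup>2 = (fst w)\<^sup>2"
    using v w by (simp_all add: lorentz_def dot_square_norm power2_eq_square)
  then have n: "norm (snd v) = fst v" "norm (snd w) = fst w" using v w by (simp_all add: power2_eq_iff_nonneg)
  have "snd v \<bullet> snd w = norm (snd v) * norm (snd w)" using vw n by (simp add: lorentz_def)
  then have e: "fst v *\<^sub>R snd w = fst w *\<^sub>R snd v" unfolding norm_cauchy_schwarz_eq unfolding n .
  have "snd w = (1 / fst v) *\<^sub>R fst v *\<^sub>R snd w" using v by simp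
  also have "\<dots> = (fst w / fst v) *\<^sub>R snd v" unfolding e by simp
  finally show ?thesis using v by (simp add: prod_eq_iff)
qed

section \<open>The invariant even lattice\<close>

text \<open>A lattice that is invariant under the reflections in the standard normals, and on which the
  Lorentzian form is even.\<close>

definition Lat :: "real \<times> (real^5) \<Rightarrow> bool" where
  "Lat y \<longleftrightarrow> (\<exists>a a1 a2 a3 a4 a5 :: int. y = (of_int a, vec5 (of_int a1) (of_int a2) (of_int a3) (of_int a4) (of_int a5)) \<and>
     even (a + a5) \<and> even (a1 + a2) \<and> even (a2 + a3) \<and> even (a3 + a4))"

lemma Lat_I:
  assumes "y = (of_int a, vec5 (of_int a1) (of_int a2) (of_int a3) (of_int a4) (of_int a5))"
    "even (a + a5)" "even (a1 + a2)" "even (a2 + a3)" "even (a3 + a4)"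
  shows "Lat y"
  using assms unfolding Lat_def by blast

lemma Lat_v_inf: "Lat v_inf"
  by (rule Lat_I[of _ 1 0 0 0 0 "- 1"]) (simp_all add: v_inf_def)

lemma Lat_v_cor: "Lat v_cor"
  by (rule Lat_I[of _ 2 1 1 1 1 0]) (simp_all add: v_cor_def)

lemma Lat_reflection:
  assumes y: "Lat y" and i: "i \<le> 6"
  shows "Lat (reflection (bs i) y)"
proof -
  obtain a a1 a2 a3 a4 a5 :: int where e: "y = (of_int a, vec5 (of_int a1) (of_int a2) (of_int a3) (of_int a4) (of_int a5))"
    and p: "even (a + a5)" "even (a1 + a2)" "even (a2 + a3)" "even (a3 + a4)"
    using y unfolding Lat_def by blast
  \<comment> \<open>The normals \<open>bs 3\<close> and \<open>bs 5\<close> have entries 1/2; since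
    a + a5 = 2k, their products with y are the integers a1 - k and a4 - k, and doubling in the
    reflection clears the halves.\<close>
  obtain k where k: "a = 2 * k - a5" using p(1) by (metis evenE add_diff_cancel_right')
  have s: "sqrt 2 * (sqrt 2 * u) = 2 * u" for u :: real by (simp flip: mult.assoc)
  show ?thesis
    using i unfolding le_6_cases
  proof (elim disjE)
    assume "i = 0" then show ?thesis using p
      by (intro Lat_I[of _ a a1 a2 "- a3" a4 a5]) (simp_all add: e reflection_def lorentz_5 bs_def prod_eq_iff vec5_eq_iff)
  next
    assume "i = 1" then show ?thesis using p
      by (intro Lat_I[of _ a a1 a3 a2 a4 a5]) (simp_all add: e reflection_def lorentz_5 bs_def prod_eq_iff vec5_eq_iff algebra_simps s)
  next
    assume "i = 2" then show ?thesis using p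
      by (intro Lat_I[of _ a a2 a1 a3 a4 a5]) (simp_all add: e reflection_def lorentz_5 bs_def prod_eq_iff vec5_eq_iff algebra_simps s)
  next
    assume "i = 3" then show ?thesis using p
      by (intro Lat_I[of _ "a + k - a1" "2 * k - a1" a2 a3 a4 "a5 - k + a1"])
        (simp_all add: e k reflection_def lorentz_5 bs_def prod_eq_iff vec5_eq_iff field_simps)
  next
    assume "i = 4" then show ?thesis using p
      by (intro Lat_I[of _ a a1 a2 a3 a4 "- a5"]) (simp_all add: e reflection_def lorentz_5 bs_def prod_eq_iff vec5_eq_iff)
  next
    assume "i = 5" then show ?thesis using p
      by (intro Lat_I[of _ "a + k - a4" a1 a2 a3 "2 * k - a4" "a5 - k + a4"])
        (simp_all add: e k reflection_def lorentz_5 bs_def prod_eq_iff vec5_eq_iff field_simps)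
  next
    assume "i = 6" then show ?thesis using p
      by (intro Lat_I[of _ a a1 a2 a3 "- a4" a5]) (simp_all add: e reflection_def lorentz_5 bs_def prod_eq_iff vec5_eq_iff)
  qed
qed

text \<open>The four middle entries of a lattice vector have one common parity and the outer two
  another, so the products come in an even number of equal parities: four and two.\<close>

lemma Lat_even:
  assumes "Lat x" "Lat y"
  shows "\<exists>k::int. lorentz x y = 2 * of_int k"
proof -
  obtain a a1 a2 a3 a4 a5 :: int where x: "x = (of_int a, vec5 (of_int a1) (of_int a2) (of_int a3) (of_int a4) (of_int a5))"
    and p: "even (a + a5)" "even (a1 + a2)" "even (a2 + a3)" "even (a3 + a4)"
    using assms(1) unfolding Lat_def by blast
  obtain c c1 c2 c3 c4 c5 :: int where y: "y = (of_int c, vec5 (of_int c1) (of_int c2) (of_int c3) (of_int c4) (of_int c5))"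
    and q: "even (c + c5)" "even (c1 + c2)" "even (c2 + c3)" "even (c3 + c4)"
    using assms(2) unfolding Lat_def by blast
  have "even (- a * c + a1 * c1 + a2 * c2 + a3 * c3 + a4 * c4 + a5 * c5)"
    using p q by auto
  then obtain k where "- a * c + a1 * c1 + a2 * c2 + a3 * c3 + a4 * c4 + a5 * c5 = 2 * k" by (rule evenE)
  then have "real_of_int (- a * c + a1 * c1 + a2 * c2 + a3 * c3 + a4 * c4 + a5 * c5) = 2 * real_of_int k" by simp
  then show ?thesis unfolding x y by (intro exI[of _ k]) (simp add: lorentz_5)
qed

lemma lorentz_bs_self: "i \<le> 6 \<Longrightarrow> lorentz (bs i) (bs i) = 1"
  unfolding le_6_cases by (elim disjE) (simp_all add: lorentz_5 bs_def)

context standard_copy begin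

lemma lorentz_b_self: "i \<le> 6 \<Longrightarrow> lorentz (b i) (b i) = 1"
  by (simp add: bL presL lorentz_bs_self)

lemma refl_group_props:
  assumes "g \<in> refl_group b"
  shows "orthochronous g \<and> (\<forall>y. Lat (M y) \<longrightarrow> Lat (M (g y)))"
  using assms
proof induction
  case id
  show ?case using orthochronous_id unfolding id_def by blast
next
  case (step g i)
  then have i: "i \<le> 6" by simp
  have "M (reflection (b i) y) = reflection (bs i) (M y)" for y
    using i by (simp add: reflection_def linear_diff[OF M(1)] linear_cmul[OF M(1)] bL M lorentz_L)
  then show ?case
    using step(3) orthochronous_comp[OF orthochronous_reflection[OF lorentz_b_self[OF i]]] Lat_reflection[OF _ i]
    by (metis comp_apply)
qed

text \<open>Products in the lattice are even, so a partner with product -2 makes v indivisible; this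
  pins the scale of v on its ray. The vectors of A_0 and A_4 are partners of each other.\<close>

definition orbit_vector :: "real \<times> (real^5) \<Rightarrow> bool" where
  "orbit_vector v \<longleftrightarrow> Lat (M v) \<and> lorentz v v = 0 \<and> 0 < fst v \<and> (\<exists>u. Lat (M u) \<and> lorentz v u = - 2)"

lemma orbit_vector_inf: "orbit_vector (L v_inf)" and orbit_vector_cor: "orbit_vector (L v_cor)"
proof -
  have "lorentz (L v_inf) (L v_cor) = - 2" "lorentz (L v_cor) (L v_inf) = - 2"
    using v_inf_cor by (simp_all add: presL lorentz_commute[of v_cor])
  moreover have "Lat (M (L v_inf))" "Lat (M (L v_cor))" by (simp_all add: M Lat_v_inf Lat_v_cor)
  ultimately show "orbit_vector (L v_inf)" "orbit_vector (L v_cor)" unfolding orbit_vector_def using L_inf L_cor by blast+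
qed

lemma orbit_vector_image:
  assumes g: "g \<in> refl_group b" and v: "orbit_vector v"
  shows "orbit_vector (g v)"
proof -
  have o: "orthochronous g" and l: "\<And>y. Lat (M y) \<Longrightarrow> Lat (M (g y))" using refl_group_props[OF g] by blast+
  have pres: "lorentz (g x) (g y) = lorentz x y" for x y using o unfolding orthochronous_def by blast
  obtain u where u: "Lat (M u)" "lorentz v u = - 2" using v unfolding orbit_vector_def by blast
  have "Lat (M (g v))" "lorentz (g v) (g v) = 0" "0 < fst (g v)" "Lat (M (g u))" "lorentz (g v) (g u) = - 2"
    using v u l orthochronous_null_future[OF o, of v] by (simp_all add: pres orbit_vector_def)
  then show ?thesis unfolding orbit_vector_def by blast
qed

text \<open>The product of two such vectors is even and at most 0. If it is negative it is at most
  -2, which separates the horoballs. If it is 0 the vectors are parallel, and the partners force the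
  ratio to be 1.\<close>

lemma orbit_vector_disjoint:
  assumes v: "orbit_vector v" and w: "orbit_vector w" and ne: "HB v \<noteq> HB w"
  shows "interior (HB v) \<inter> interior (HB w) = {}"
proof -
  have v': "lorentz v v = 0" "0 < fst v" "Lat (M v)" and w': "lorentz w w = 0" "0 < fst w" "Lat (M w)"
    using v w by (auto simp: orbit_vector_def)
  obtain k :: int where k: "lorentz v w = 2 * of_int k" using Lat_even[OF v'(3) w'(3)] by (auto simp: M)
  have "lorentz v w \<le> 0" using v' w' by - (rule lorentz_causal_nonpos, auto)
  then have "k \<le> 0" using k by simp
  show ?thesis
  proof (cases "k = 0")
    case True
    define l where "l = fst w / fst v"
    have l0: "0 < l" using v' w' by (simp add: l_def)
    have wl: "w = l *\<^sub>R v" unfolding l_def using v' w' k True by (intro null_orthogonal_parallel) auto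
    obtain u where u: "Lat (M u)" "lorentz v u = - 2" using v by (auto simp: orbit_vector_def)
    obtain u' where u': "Lat (M u')" "lorentz w u' = - 2" using w by (auto simp: orbit_vector_def)
    obtain i :: int where i: "lorentz w u = 2 * of_int i" using Lat_even[OF w'(3) u(1)] by (auto simp: M)
    obtain j :: int where j: "lorentz v u' = 2 * of_int j" using Lat_even[OF v'(3) u'(1)] by (auto simp: M)
    \<comment> \<open>Testing w against the partner of v makes l an integer; testing v against the
      partner of w makes 1 / l one.\<close>
    have li: "l = - of_int i" using i u by (simp add: wl lorentz_simps)
    have lj: "l * of_int j = - 1" using j u' by (simp add: wl lorentz_simps)
    then have "real_of_int (i * j) = 1" using li by simp
    then have "i * j = 1" by linarith
    then have "i = 1 \<or> i = - 1" using zmult_eq_1_iff[of i j] by auto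
    then have "l = 1" using li l0 by auto
    then show ?thesis using wl ne by simp
  next
    case False
    then have "k \<le> - 1" using \<open>k \<le> 0\<close> by simp
    then have "lorentz v w \<le> - 2" using k by simp
    then show ?thesis using v' w' by (intro HB_interior_disjoint) auto
  qed
qed

lemma orbit_disjoint:
  assumes "B \<in> orbit b {HB (L v_cor), HB (L v_inf)}" "B' \<in> orbit b {HB (L v_cor), HB (L v_inf)}" "B \<noteq> B'"
  shows "interior B \<inter> interior B' = {}"
proof -
  have "\<exists>v. orbit_vector v \<and> B = HB v" if B: "B \<in> orbit b {HB (L v_cor), HB (L v_inf)}" for B
  proof -
    obtain g B0 where g: "g \<in> refl_group b" "B = act g ` B0" "B0 \<in> {HB (L v_cor), HB (L v_inf)}"
      using B unfolding orbit_def mem_Collect_eq by (elim exE conjE) (rule that)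
    then obtain v where v: "orbit_vector v" "B0 = HB v" using orbit_vector_inf orbit_vector_cor by blast
    have o: "orthochronous g" using refl_group_props[OF g(1)] by blast
    show ?thesis using g(2) orbit_vector_image[OF g(1) v(1)] unfolding v(2) act_HB[OF o] by blast
  qed
  then show ?thesis using assms orbit_vector_disjoint by metis
qed

end

section \<open>Horoball packings\<close>

lemma emeasure_imp_hvol: "emeasure hyp_measure S = ennreal x \<Longrightarrow> 0 \<le> x \<Longrightarrow> hvol S = x"
  by (simp add: hvol_def measure_def)

lemma measurable_linear:
  fixes m :: "real \<times> (real^5) \<Rightarrow> real \<times> (real^5)"
  assumes "linear m" shows "m \<in> borel_measurable borel"
  using assms by (auto intro!: borel_measurable_continuous_onI linear_continuous_on simp: linear_conv_bounded_linear)

lemma closed_fund_domain: "closed (fund_domain (b :: nat \<Rightarrow> real \<times> (real^'n)))"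
proof -
  have "fund_domain b = {p. norm p \<le> 1} \<inter> (\<Inter>i\<in>{..CARD('n) + 1}. {p. lorentz (lift p) (b i) \<le> 0})"
    by (auto simp: fund_domain_def)
  moreover have "closed {p. lorentz (lift p) (b i) \<le> 0}" for i
    unfolding lorentz_def lift_def by (intro closed_Collect_le continuous_intros)
  moreover have "closed {p :: real^'n. norm p \<le> 1}" by (intro closed_Collect_le continuous_intros)
  ultimately show ?thesis by (simp only:) (intro closed_Int closed_INT ballI, auto)
qed

lemma zeta3_pos: "0 < zeta 3"
proof -
  have "zeta 3 = (\<Sum>k. 1 / real (Suc k) ^ 3)"
    unfolding zeta_def by (simp add: powr_numeral)
  moreover have "summable (\<lambda>k. 1 / real (Suc k) ^ 3)"
    using summable_inverse_Suc_power[of 3] by (simp add: field_simps)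
  ultimately show ?thesis by (simp add: suminf_pos)
qed

lemma divide_ge_1_bounds:
  fixes c u :: real
  assumes "0 < c"
  shows "1 \<le> u \<Longrightarrow> c / u \<le> c" "1 < u \<Longrightarrow> c / u < c"
  using assms by (simp_all add: pos_divide_le_eq pos_divide_less_eq)

context standard_copy begin

lemma orthochronous_M: "orthochronous M"
proof (rule orthochronousI)
  show "0 < fst (M x)" if x: "lorentz x x < 0" "0 < fst x" for x
    using orthochronous_future_iff[OF L, of "M x"] x by (simp add: M)
qed (simp_all add: M)

lemma fund_domain_iff: "norm q < 1 \<Longrightarrow> q \<in> fund_domain b \<longleftrightarrow> in_F (M (lift q))"
  by (simp add: fund_domain_def in_F_def lorentz_b)

lemma hvol_fund_domain: "hvol (fund_domain b) = 7 * zeta 3 / 1152"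
proof (rule emeasure_imp_hvol)
  have [measurable]: "M \<in> borel_measurable borel" by (rule measurable_linear[OF M(1)])
  have "emeasure hyp_measure (fund_domain b) = emeasure hyp_measure {q. norm q < 1 \<and> in_F (M (lift q))}"
  proof (rule emeasure_hyp_cong_AE)
    show "fund_domain b \<in> sets borel" using closed_fund_domain by (rule borel_closed)
    show "AE q in lborel. norm q < 1 \<longrightarrow> (q \<in> fund_domain b) = (q \<in> {q. norm q < 1 \<and> in_F (M (lift q))})"
      by (simp add: fund_domain_iff)
  qed measurable
  also have "\<dots> = emeasure hyp_measure {q. norm q < 1 \<and> in_F (lift q)}"
    by (rule emeasure_hyp_orthochronous[OF orthochronous_M, symmetric]) (measurable, rule in_F_scale)
  finally show "emeasure hyp_measure (fund_domain b) = ennreal (7 * zeta 3 / 1152)"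
    by (simp only: emeasure_F)
qed (use zeta3_pos in simp)

lemma emeasure_HB_fund_domain:
  "emeasure hyp_measure (HB (t *\<^sub>R L v) \<inter> fund_domain b) = emeasure hyp_measure {q. norm q < 1 \<and> horo_in_F t v (lift q)}"
proof -
  have "HB (t *\<^sub>R L v) \<inter> fund_domain b = {q. norm q < 1 \<and> horo_in_F t v (M (lift q))}"
    using fund_domain_iff by (auto simp: HB_def horo_in_F_def lorentz_simps lorentz_L M)
  also have "emeasure hyp_measure \<dots> = emeasure hyp_measure {q. norm q < 1 \<and> horo_in_F t v (lift q)}"
    by (rule emeasure_hyp_orthochronous[OF orthochronous_M, symmetric]) (measurable, rule horo_in_F_scale)
  finally show ?thesis .
qed

lemma hvol_HB_inf: "1 \<le> t \<Longrightarrow> hvol (HB (t *\<^sub>R L v_inf) \<inter> fund_domain b) = 1 / (384 * t ^ 4)"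
  by (rule emeasure_imp_hvol) (simp_all add: emeasure_HB_fund_domain emeasure_horo_inf)

lemma hvol_HB_cor: "1 \<le> t \<Longrightarrow> hvol (HB (t *\<^sub>R L v_cor) \<inter> fund_domain b) = 1 / (576 * t ^ 4)"
  by (rule emeasure_imp_hvol) (simp_all add: emeasure_HB_fund_domain emeasure_horo_cor)

lemma horoball_proj:
  assumes v: "0 < fst v" and s: "0 < s"
  shows "horoball (proj v) s = HB ((1 / (s * fst v)) *\<^sub>R v)"
  using v s by (simp add: horoball_eq_HB lift_proj)

text \<open>In the scale where v has product -1 with each wall missing the vertex, the horoball of
  size s is \<open>HB (t v)\<close> with t = 1 / (s * fst v). All such walls then give the same
  condition t >= 1, sufficient by \<open>HB_halfspace\<close> and necessary, at wall k, by
  \<open>HB_not_halfspace\<close>.\<close>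

lemma admissible_iff:
  assumes v: "lorentz v v = 0" "0 < fst v" and b: "\<And>i. i \<le> 6 \<Longrightarrow> lorentz v (b i) = 0 \<or> lorentz v (b i) = - 1"
    and k: "k \<le> 6" "lorentz v (b k) = - 1"
  shows "admissible_horoball b (proj v) s \<longleftrightarrow> 0 < s \<and> 1 \<le> 1 / (s * fst v)"
proof (cases "0 < s")
  case True
  define t where "t = 1 / (s * fst v)"
  have t: "0 < t" using True v by (simp add: t_def)
  have nz: "lorentz (lift (proj v)) (b i) \<noteq> 0 \<longleftrightarrow> lorentz v (b i) \<noteq> 0" for i
    using v by (simp add: lift_proj lorentz_simps)
  have tv: "lorentz (t *\<^sub>R v) (t *\<^sub>R v) = 0" "0 < fst (t *\<^sub>R v)" using v t by (simp_all add: lorentz_simps)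
  have "(\<forall>i\<le>6. lorentz v (b i) \<noteq> 0 \<longrightarrow> (\<forall>q\<in>HB (t *\<^sub>R v). lorentz (lift q) (b i) \<le> 0)) \<longleftrightarrow> 1 \<le> t"
  proof
    assume *: "\<forall>i\<le>6. lorentz v (b i) \<noteq> 0 \<longrightarrow> (\<forall>q\<in>HB (t *\<^sub>R v). lorentz (lift q) (b i) \<le> 0)"
    show "1 \<le> t"
    proof (rule ccontr)
      assume "\<not> 1 \<le> t"
      then have "\<exists>q\<in>HB (t *\<^sub>R v). 0 < lorentz (lift q) (b k)"
        using k t by (intro HB_not_halfspace[OF tv lorentz_b_self[OF k(1)]]) (simp_all add: lorentz_simps)
      moreover have "lorentz v (b k) \<noteq> 0" using k by simp
      ultimately show False using * k(1) not_less by blast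
    qed
  next
    assume t1: "1 \<le> t"
    show "\<forall>i\<le>6. lorentz v (b i) \<noteq> 0 \<longrightarrow> (\<forall>q\<in>HB (t *\<^sub>R v). lorentz (lift q) (b i) \<le> 0)"
    proof (intro allI impI ballI)
      fix i q assume i: "i \<le> 6" "lorentz v (b i) \<noteq> 0" and q: "q \<in> HB (t *\<^sub>R v)"
      have "lorentz v (b i) = - 1" using b[OF i(1)] i(2) by simp
      then have "1 \<le> - lorentz (t *\<^sub>R v) (b i)" using t1 by (simp add: lorentz_simps)
      then show "lorentz (lift q) (b i) \<le> 0" by (rule HB_halfspace[OF tv lorentz_b_self[OF i(1)] _ q])
    qed
  qed
  then show ?thesis
    unfolding admissible_horoball_def using True v by (simp add: nz horoball_proj t_def)
qed (simp add: admissible_horoball_def)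

lemma maximal_horoball_HB:
  assumes v: "lorentz v v = 0" "0 < fst v" and b: "\<And>i. i \<le> 6 \<Longrightarrow> lorentz v (b i) = 0 \<or> lorentz v (b i) = - 1"
    and k: "k \<le> 6" "lorentz v (b k) = - 1"
  shows "maximal_horoball b (proj v) (HB v)"
  unfolding maximal_horoball_def
proof (intro conjI allI impI exI[of _ "1 / fst v"])
  note adm = admissible_iff[OF v b k]
  show "admissible_horoball b (proj v) (1 / fst v)" using v by (simp add: adm)
  show "HB v = horoball (proj v) (1 / fst v)" using v by (simp add: horoball_proj)
  show "horoball (proj v) s \<subseteq> HB v" if "admissible_horoball b (proj v) s" for s
  proof -
    have s: "0 < s" "1 \<le> 1 / (s * fst v)" using that adm[of s] by blast+
    show ?thesis unfolding horoball_proj[OF v(2) s(1)] by (rule HB_mono[OF v s(2)])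
  qed
qed

lemma lorentz_inf_b: "i \<le> 6 \<Longrightarrow> lorentz (L v_inf) (b i) = (if i = 4 then - 1 else 0)"
  unfolding le_6_cases by (elim disjE) (simp_all add: lorentz_b M lorentz_bs v_inf_def)

lemma lorentz_cor_b: "i \<le> 6 \<Longrightarrow> lorentz (L v_cor) (b i) = (if i = 0 \<or> i = 6 then - 1 else 0)"
  unfolding le_6_cases by (elim disjE) (simp_all add: lorentz_b M lorentz_bs v_cor_def)

lemma admissible_inf: "admissible_horoball b c4 s \<longleftrightarrow> 0 < s \<and> 1 \<le> 1 / (s * fst (L v_inf))"
  by (rule admissible_iff[OF L_inf, of 4]) (simp_all add: lorentz_inf_b)

lemma admissible_cor: "admissible_horoball b c0 s \<longleftrightarrow> 0 < s \<and> 1 \<le> 1 / (s * fst (L v_cor))"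
  by (rule admissible_iff[OF L_cor, of 0]) (simp_all add: lorentz_cor_b)

lemma maximal_inf: "maximal_horoball b c4 (HB (L v_inf))"
  by (rule maximal_horoball_HB[OF L_inf, of 4]) (simp_all add: lorentz_inf_b)

lemma maximal_cor: "maximal_horoball b c0 (HB (L v_cor))"
  by (rule maximal_horoball_HB[OF L_cor, of 0]) (simp_all add: lorentz_cor_b)

text \<open>The density falls as t^(-4), so it is strictly below d unless t = 1, that is unless the
  horoball is \<open>HB v\<close>.\<close>

lemma density_bounds:
  assumes v: "0 < fst v" and adm: "0 < s" "1 \<le> 1 / (s * fst v)"
    and vol: "\<And>t. 1 \<le> t \<Longrightarrow> hvol (HB (t *\<^sub>R v) \<inter> fund_domain b) / hvol (fund_domain b) = d / t ^ 4" and d: "0 < d"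
  shows "horoball_density b (horoball (proj v) s) \<le> d"
    "horoball (proj v) s \<noteq> HB v \<Longrightarrow> horoball_density b (horoball (proj v) s) < d"
    "horoball (proj v) s = HB v \<Longrightarrow> horoball_density b (horoball (proj v) s) = d"
proof -
  define t where "t = 1 / (s * fst v)"
  have t: "1 \<le> t" using adm(2) unfolding t_def .
  have h: "horoball (proj v) s = HB (t *\<^sub>R v)" unfolding t_def by (rule horoball_proj[OF v adm(1)])
  have t4: "1 \<le> t ^ 4" using t by (rule one_le_power)
  show "horoball_density b (horoball (proj v) s) \<le> d"
    unfolding h horoball_density_def vol[OF t] using d t4 by (rule divide_ge_1_bounds)
  show "horoball_density b (horoball (proj v) s) < d" if "horoball (proj v) s \<noteq> HB v"
  proof -
    have "t \<noteq> 1" using that unfolding h by (metis scaleR_one)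
    then have "1 < t ^ 4" using t by (intro one_less_power) auto
    then show ?thesis unfolding h horoball_density_def vol[OF t] using d by - (rule divide_ge_1_bounds)
  qed
  show "horoball_density b (horoball (proj v) s) = d" if "horoball (proj v) s = HB v"
    using vol[of 1] unfolding that horoball_density_def by simp
qed

text \<open>3 is 1152 / 384; in \<open>density_cor\<close> the numerator 2 is 1152 / 576. Their sum
  is the 5 of the optimal density.\<close>

lemma density_inf:
  assumes "admissible_horoball b c4 s"
  shows "horoball_density b (horoball c4 s) \<le> 3 / (7 * zeta 3)"
    "horoball c4 s \<noteq> HB (L v_inf) \<Longrightarrow> horoball_density b (horoball c4 s) < 3 / (7 * zeta 3)"
    "horoball c4 s = HB (L v_inf) \<Longrightarrow> horoball_density b (horoball c4 s) = 3 / (7 * zeta 3)"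
proof -
  have s: "0 < s" "1 \<le> 1 / (s * fst (L v_inf))" using assms unfolding admissible_inf by blast+
  have vol: "hvol (HB (t *\<^sub>R L v_inf) \<inter> fund_domain b) / hvol (fund_domain b) = 3 / (7 * zeta 3) / t ^ 4" if "1 \<le> t" for t
    unfolding hvol_HB_inf[OF that] hvol_fund_domain using zeta3_pos by (simp add: field_simps)
  have d: "0 < 3 / (7 * zeta 3)" using zeta3_pos by simp
  note db = density_bounds[OF L_inf(2) s vol d]
  show "horoball_density b (horoball c4 s) \<le> 3 / (7 * zeta 3)" by (rule db(1))
  show "horoball_density b (horoball c4 s) < 3 / (7 * zeta 3)" if "horoball c4 s \<noteq> HB (L v_inf)" by (rule db(2)[OF _ that])
  show "horoball_density b (horoball c4 s) = 3 / (7 * zeta 3)" if "horoball c4 s = HB (L v_inf)" by (rule db(3)[OF _ that])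
qed

lemma density_cor:
  assumes "admissible_horoball b c0 s"
  shows "horoball_density b (horoball c0 s) \<le> 2 / (7 * zeta 3)"
    "horoball c0 s \<noteq> HB (L v_cor) \<Longrightarrow> horoball_density b (horoball c0 s) < 2 / (7 * zeta 3)"
    "horoball c0 s = HB (L v_cor) \<Longrightarrow> horoball_density b (horoball c0 s) = 2 / (7 * zeta 3)"
proof -
  have s: "0 < s" "1 \<le> 1 / (s * fst (L v_cor))" using assms unfolding admissible_cor by blast+
  have vol: "hvol (HB (t *\<^sub>R L v_cor) \<inter> fund_domain b) / hvol (fund_domain b) = 2 / (7 * zeta 3) / t ^ 4" if "1 \<le> t" for t
    unfolding hvol_HB_cor[OF that] hvol_fund_domain using zeta3_pos by (simp add: field_simps)
  have d: "0 < 2 / (7 * zeta 3)" using zeta3_pos by simp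
  note db = density_bounds[OF L_cor(2) s vol d]
  show "horoball_density b (horoball c0 s) \<le> 2 / (7 * zeta 3)" by (rule db(1))
  show "horoball_density b (horoball c0 s) < 2 / (7 * zeta 3)" if "horoball c0 s \<noteq> HB (L v_cor)" by (rule db(2)[OF _ that])
  show "horoball_density b (horoball c0 s) = 2 / (7 * zeta 3)" if "horoball c0 s = HB (L v_cor)" by (rule db(3)[OF _ that])
qed

lemma optimal_packing:
  "horoball_packing 2 b (orbit b {HB (L v_cor), HB (L v_inf)}) (5 / (7 * zeta 3))"
proof -
  obtain s4 where s4: "admissible_horoball b c4 s4" "HB (L v_inf) = horoball c4 s4"
    using maximal_inf unfolding maximal_horoball_def by blast
  obtain s0 where s0: "admissible_horoball b c0 s0" "HB (L v_cor) = horoball c0 s0"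
    using maximal_cor unfolding maximal_horoball_def by blast
  define s where "s c = (if c = c4 then s4 else s0)" for c
  have s: "s c4 = s4" "s c0 = s0" using c4_neq_c0 by (auto simp: s_def)
  show ?thesis
    unfolding horoball_packing_def
  proof (intro exI[of _ "{c0, c4}"] exI[of _ s] conjI)
    show "\<forall>c\<in>{c0, c4}. admissible_horoball b c (s c)" using s s4 s0 by simp
    show "orbit b {HB (L v_cor), HB (L v_inf)} = orbit b ((\<lambda>c. horoball c (s c)) ` {c0, c4})"
      using s s4 s0 by simp
    show "\<forall>B\<in>orbit b {HB (L v_cor), HB (L v_inf)}. \<forall>B'\<in>orbit b {HB (L v_cor), HB (L v_inf)}.
      B \<noteq> B' \<longrightarrow> interior B \<inter> interior B' = {}" using orbit_disjoint by blast
    show "card ((\<lambda>c. horoball_density b (horoball c (s c))) ` {c0, c4}) \<le> 2"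
      using card_insert_le_m1[of 2 "{horoball_density b (horoball c4 (s c4))}"] by simp
    show "5 / (7 * zeta 3) = (\<Sum>c\<in>{c0, c4}. horoball_density b (horoball c (s c)))"
    proof -
      have notin: "c0 \<notin> {c4}" using c4_neq_c0 by simp
      have "5 / (7 * zeta 3) = 2 / (7 * zeta 3) + 3 / (7 * zeta 3)" by (simp add: add_divide_distrib[symmetric])
      then show ?thesis
        unfolding density_inf(3)[OF s4(1) s4(2)[symmetric], symmetric] density_cor(3)[OF s0(1) s0(2)[symmetric], symmetric]
          sum.insert[OF finite.insertI[OF finite.emptyI] notin] s by (simp only: sum.insert[OF finite.emptyI] sum.empty add_0_right s empty_iff not_False_eq_True)
    qed
  qed (simp_all add: ideal_vertices_eq)
qed

text \<open>If the bodies are not the orbit of the two maximal horoballs, then a vertex carries no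
  horoball or one horoball is smaller than maximal; either loses density.\<close>

lemma packing_bound:
  assumes P: "horoball_packing k b \<P> d"
  shows "d \<le> 5 / (7 * zeta 3) \<and> (\<P> \<noteq> orbit b {HB (L v_cor), HB (L v_inf)} \<longrightarrow> d < 5 / (7 * zeta 3))"
proof -
  obtain V s where V: "V \<noteq> {}" "V \<subseteq> {c0, c4}" and adm: "\<And>c. c \<in> V \<Longrightarrow> admissible_horoball b c (s c)"
    and \<P>: "\<P> = orbit b ((\<lambda>c. horoball c (s c)) ` V)" and d: "d = (\<Sum>c\<in>V. horoball_density b (horoball c (s c)))"
    using P unfolding horoball_packing_def ideal_vertices_eq
    by (elim exE conjE) (rule that, assumption, assumption, erule bspec, assumption+)
  have z: "0 < 2 / (7 * zeta 3)" "0 < 3 / (7 * zeta 3)" using zeta3_pos by simp_all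
  have sum: "5 / (7 * zeta 3) = 2 / (7 * zeta 3) + 3 / (7 * zeta 3)" by (simp add: add_divide_distrib[symmetric])
  consider "V = {c0}" | "V = {c4}" | "V = {c0, c4}" using V by blast
  then show ?thesis
  proof cases
    case 1
    then have "d \<le> 2 / (7 * zeta 3)" using d density_cor(1)[OF adm[of c0]] by simp
    then show ?thesis using z sum by linarith
  next
    case 2
    then have "d \<le> 3 / (7 * zeta 3)" using d density_inf(1)[OF adm[of c4]] by simp
    then show ?thesis using z sum by linarith
  next
    case 3
    then have a: "admissible_horoball b c0 (s c0)" "admissible_horoball b c4 (s c4)" using adm by auto
    have dd: "d = horoball_density b (horoball c0 (s c0)) + horoball_density b (horoball c4 (s c4))"
      using d 3 c4_neq_c0 by simp
    show ?thesis
    proof (cases "horoball c0 (s c0) = HB (L v_cor) \<and> horoball c4 (s c4) = HB (L v_inf)")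
      case True
      then have "\<P> = orbit b {HB (L v_cor), HB (L v_inf)}" using \<P> 3 by simp
      then show ?thesis using dd sum density_cor(1)[OF a(1)] density_inf(1)[OF a(2)] by linarith
    next
      case False
      then show ?thesis using dd sum density_cor(1,2)[OF a(1)] density_inf(1,2)[OF a(2)] by linarith
    qed
  qed
qed

end

section \<open>Ball packings\<close>

text \<open>The unit vector of the hyperboloid with upper half-space coordinates $(x,y,z,w;t)$, multiplied by $t$.\<close>

definition hs :: "real \<Rightarrow> real \<Rightarrow> real \<Rightarrow> real \<Rightarrow> real \<Rightarrow> real \<times> (real^5)" where
  "hs x y z w t = ((1 + x\<^sup>2 + y\<^sup>2 + z\<^sup>2 + w\<^sup>2 + t\<^sup>2) / 2, vec5 x y z w ((1 - x\<^sup>2 - y\<^sup>2 - z\<^sup>2 - w\<^sup>2 - t\<^sup>2) / 2))"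

lemma hs_lorentz:
  "lorentz (hs x y z w t) (hs x' y' z' w' t') = - ((x - x')\<^sup>2 + (y - y')\<^sup>2 + (z - z')\<^sup>2 + (w - w')\<^sup>2 + t\<^sup>2 + t'\<^sup>2) / 2"
  by (simp add: lorentz_5 hs_def power2_eq_square field_simps)

lemma hs_self: "lorentz (hs x y z w t) (hs x y z w t) = - t\<^sup>2"
  by (simp add: hs_lorentz)

lemma fst_hs_pos: "0 < fst (hs x y z w t)"
  by (simp add: hs_def add_pos_nonneg)

text \<open>Every future timelike vector is a positive multiple of some \<open>hs\<close>. The
  factor s is the sum of its first and last coordinate, positive as minus the product with
  \<open>v_inf\<close>, and t is read off from the square of Y.\<close>

lemma timelike_hs:
  assumes Y: "lorentz Y Y < 0" "0 < fst Y"
  obtains x y z w t where "0 < fst Y + snd Y $ 5" "0 < t" "Y = (fst Y + snd Y $ 5) *\<^sub>R hs x y z w t"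
proof -
  define s where "s = fst Y + snd Y $ 5"
  have "lorentz Y v_inf < 0" by (rule lorentz_timelike_neg[OF Y]) (simp_all add: v_inf_null, simp add: v_inf_def)
  then have s: "0 < s" by (simp add: lorentz_v_inf s_def)
  define t where "t = sqrt (- lorentz Y Y) / s"
  have t: "0 < t" using Y s by (simp add: t_def)
  have t2: "s * (s * t\<^sup>2) = - lorentz Y Y" using Y s by (simp add: t_def power_divide power2_eq_square[of s])
  let ?a = "snd Y $ 1 / s" and ?b = "snd Y $ 2 / s" and ?c = "snd Y $ 3 / s" and ?d = "snd Y $ 4 / s"
  define n where "n = ?a\<^sup>2 + ?b\<^sup>2 + ?c\<^sup>2 + ?d\<^sup>2 + t\<^sup>2"
  have "s * (s * n) = (snd Y $ 1)\<^sup>2 + (snd Y $ 2)\<^sup>2 + (snd Y $ 3)\<^sup>2 + (snd Y $ 4)\<^sup>2 + s * (s * t\<^sup>2)"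
    using s unfolding n_def power_divide by (simp add: distrib_left power2_eq_square[of s])
  also have "\<dots> = s * (fst Y - snd Y $ 5)"
    unfolding t2 by (simp add: lorentz_5 s_def power2_eq_square algebra_simps)
  finally have n: "s * n = fst Y - snd Y $ 5" using s by simp
  have "fst Y = s * ((1 + n) / 2)" "snd Y $ 5 = s * ((1 - n) / 2)"
    using n by (simp_all add: distrib_left right_diff_distrib s_def add_divide_distrib diff_divide_distrib)
  moreover have "1 + ?a\<^sup>2 + ?b\<^sup>2 + ?c\<^sup>2 + ?d\<^sup>2 + t\<^sup>2 = 1 + n" "1 - ?a\<^sup>2 - ?b\<^sup>2 - ?c\<^sup>2 - ?d\<^sup>2 - t\<^sup>2 = 1 - n"
    unfolding n_def by simp_all
  ultimately have "Y = s *\<^sub>R hs ?a ?b ?c ?d t"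
    unfolding hs_def using s by (simp add: prod_eq_iff vec5_eq_iff)
  then show thesis using that s t unfolding s_def by blast
qed

lemma lift_hs:
  assumes q: "norm q < 1"
  obtains x y z w t where "0 < 1 + q $ 5" "0 < t" "lift q = (1 + q $ 5) *\<^sub>R hs x y z w t" "base q = (x, y, z, w)" "hts q = t\<^sup>2"
proof -
  have l: "lorentz (lift q) (lift q) < 0" "0 < fst (lift q)" using q by (simp_all add: lorentz_lift_neg_iff)
  obtain x y z w t where h: "0 < 1 + q $ 5" "0 < t" "lift q = (1 + q $ 5) *\<^sub>R hs x y z w t"
    by (rule timelike_hs[OF l, unfolded fst_lift snd_lift])
  have c: "q $ k = (1 + q $ 5) * snd (hs x y z w t) $ k" for k
    using arg_cong[OF h(3), of "\<lambda>v. snd v $ k"] unfolding snd_lift snd_scaleR vector_scaleR_component real_scaleR_def .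
  have b: "base q = (x, y, z, w)" using h(1) c[of 1] c[of 2] c[of 3] c[of 4] unfolding base_def by (simp add: hs_def)
  have "(1 + q $ 5)\<^sup>2 * hts q = (1 + q $ 5)\<^sup>2 * t\<^sup>2"
    unfolding hts_eq[OF q, symmetric] arg_cong2[OF h(3) h(3), of lorentz] by (simp add: lorentz_simps hs_self power2_eq_square)
  then have "hts q = t\<^sup>2" using h(1) by simp
  then show thesis using that h b by blast
qed

text \<open>The condition hyperbolic distance at most r with denominators cleared; it is homogeneous
  in both vectors, so unnormalised representatives may be used.\<close>

definition in_ball :: "real \<Rightarrow> real \<times> (real^'n) \<Rightarrow> real \<times> (real^'n) \<Rightarrow> bool" where
  "in_ball r X y \<longleftrightarrow> - lorentz X y \<le> cosh r * sqrt (lorentz X X * lorentz y y)"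

lemma in_ball_commute: "in_ball r X y \<longleftrightarrow> in_ball r y X"
  unfolding in_ball_def lorentz_commute[of y X] mult.commute[of "lorentz y y"] ..

lemma in_ball_scale:
  assumes c: "0 < c" shows "in_ball r X (c *\<^sub>R y) \<longleftrightarrow> in_ball r X y"
proof -
  have "lorentz X X * lorentz (c *\<^sub>R y) (c *\<^sub>R y) = c\<^sup>2 * (lorentz X X * lorentz y y)"
    by (simp add: lorentz_simps power2_eq_square)
  then have "sqrt (lorentz X X * lorentz (c *\<^sub>R y) (c *\<^sub>R y)) = c * sqrt (lorentz X X * lorentz y y)"
    using c by (simp only: real_sqrt_mult real_sqrt_abs abs_of_pos)
  then have s: "cosh r * sqrt (lorentz X X * lorentz (c *\<^sub>R y) (c *\<^sub>R y)) = c * (cosh r * sqrt (lorentz X X * lorentz y y))"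
    by (simp only: mult.left_commute)
  have m: "- lorentz X (c *\<^sub>R y) = c * - lorentz X y" by (simp add: lorentz_simps)
  show ?thesis unfolding in_ball_def s m by (rule mult_le_cancel_left_pos[OF c])
qed

lemma in_ball_scale_left:
  assumes "0 < c" shows "in_ball r (c *\<^sub>R X) y \<longleftrightarrow> in_ball r X y"
  unfolding in_ball_commute[of r "c *\<^sub>R X" y] in_ball_commute[of r X y] by (rule in_ball_scale[OF assms])

lemma measurable_in_ball: "Measurable.pred borel (in_ball r X)"
proof -
  have "closed {y. in_ball r X y}"
    unfolding in_ball_def lorentz_def by (intro closed_Collect_le continuous_intros)
  then have "{y. in_ball r X y} \<in> sets borel" by (rule borel_closed)
  then show ?thesis by (subst pred_def) (simp only: space_borel mem_Collect_eq UNIV_I simp_thms)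
qed

text \<open>Monotonicity of cosh removes arcosh; the reverse Cauchy-Schwarz inequality guarantees
  that the argument of arcosh is at least 1.\<close>

lemma hball_iff:
  assumes x: "norm x < 1" and r: "0 < r"
  shows "q \<in> hball x r \<longleftrightarrow> norm q < 1 \<and> in_ball r (lift x) (lift q)"
proof (cases "norm q < 1")
  case True
  define a where "a = - lorentz (lift x) (lift q)"
  define d where "d = lorentz (lift x) (lift x) * lorentz (lift q) (lift q)"
  have n: "lorentz (lift x) (lift x) < 0" "lorentz (lift q) (lift q) < 0" using x True by (simp_all add: lorentz_lift_neg_iff)
  then have d: "0 < d" by (simp add: d_def mult_neg_neg)
  have a: "0 < a" unfolding a_def using n lorentz_timelike_neg[of "lift x" "lift q"] by simp
  have "d \<le> a\<^sup>2" using lorentz_reverse_Cauchy_Schwarz[OF n(1), of "lift q"] by (simp add: d_def a_def)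
  then have "sqrt d \<le> a" using a real_le_lsqrt by simp
  then have u: "1 \<le> a / sqrt d" using d by simp
  have "arcosh (a / sqrt d) \<le> r \<longleftrightarrow> cosh (arcosh (a / sqrt d)) \<le> cosh r"
    using u r by (subst cosh_real_nonneg_le_iff) auto
  also have "\<dots> \<longleftrightarrow> a / sqrt d \<le> cosh r" using u by simp
  also have "\<dots> \<longleftrightarrow> a \<le> cosh r * sqrt d" using d by (simp add: pos_divide_le_eq)
  finally show ?thesis using True unfolding hball_def hdist_def in_ball_def a_def d_def by simp
qed (simp add: hball_def)

text \<open>Completing the square in t', with cosh^2 - 1 = sinh^2: the Euclidean center sits at
  height t cosh r and the radius is t sinh r.\<close>

lemma in_ball_hs:
  assumes "0 < t" "0 < t'"
  shows "in_ball r (hs x y z w t) (hs x' y' z' w' t')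
    \<longleftrightarrow> (x - x')\<^sup>2 + (y - y')\<^sup>2 + (z - z')\<^sup>2 + (w - w')\<^sup>2 + (t' - t * cosh r)\<^sup>2 \<le> (t * sinh r)\<^sup>2"
proof -
  have e: "(t * sinh r)\<^sup>2 = t\<^sup>2 * (cosh r)\<^sup>2 - t\<^sup>2" by (simp add: power_mult_distrib sinh_square_eq right_diff_distrib)
  have e': "(t' - t * cosh r)\<^sup>2 = t'\<^sup>2 - 2 * (cosh r * (t * t')) + t\<^sup>2 * (cosh r)\<^sup>2"
    by (simp add: power2_diff power_mult_distrib)
  have "sqrt (- t\<^sup>2 * - t'\<^sup>2) = t * t'" using assms by (simp add: real_sqrt_mult)
  then show ?thesis unfolding in_ball_def hs_self hs_lorentz e e' by (simp only:) argo
qed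

lemma in_F_hs: "in_F (hs x y z w t) \<longleftrightarrow> 0 \<le> z \<and> z \<le> y \<and> y \<le> x \<and> x \<le> 1 / 2 \<and> 1 \<le> x\<^sup>2 + y\<^sup>2 + z\<^sup>2 + w\<^sup>2 + t\<^sup>2 \<and> w \<le> 1 / 2 \<and> 0 \<le> w"
  unfolding in_F_iff hs_def by (auto simp: field_simps)

lemma emeasure_cube:
  fixes a b c d R :: real
  assumes "0 \<le> R"
  shows "emeasure lborel (cbox (a - R, b - R, c - R, d - R) (a + R, b + R, c + R, d + R)) = ennreal ((2 * R) ^ 4)"
proof -
  have "measure lborel (cbox (a - R, b - R, c - R, d - R) (a + R, b + R, c + R, d + R)) = (2 * R) ^ 4"
    unfolding content_Pair using assms by (simp add: power4_eq_xxxx)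
  moreover have "emeasure lborel (cbox (a - R, b - R, c - R, d - R) (a + R, b + R, c + R, d + R)) < \<infinity>"
    by (rule emeasure_lborel_cbox_finite)
  ultimately show ?thesis by (simp add: emeasure_eq_ennreal_measure less_top[symmetric])
qed

text \<open>The last quotient bounds the volume over a cube of side 2R from squared height 3 sqrt 2
  R - 10 R^2 upwards, and 5/1152 = 1/384 + 1/576 is the volume of the two maximal horoball
  sectors.\<close>

lemma inscribed_radius_bound:
  fixes R :: real
  assumes R: "0 < R" "2 * R + 2 * sqrt 2 * R \<le> 1 / 2"
  shows "0 < 3 * sqrt 2 * R - 10 * R\<^sup>2" "(2 * R) ^ 4 / (4 * (3 * sqrt 2 * R - 10 * R\<^sup>2)\<^sup>2) < 5 / 1152"
proof -
  have s: "1414 / 1000 \<le> sqrt 2" by (rule real_le_rsqrt) (simp add: power2_eq_square)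
  have "(2828 / 1000) * R \<le> 2 * sqrt 2 * R" using s R by simp
  then have R1: "R \<le> 1036 / 10000" using R by linarith
  define u where "u = 3 * sqrt 2 - 10 * R"
  \<comment> \<open>R <= 0.1036 gives u >= 3.206, and 2 * 0.1036 < 0.0658 * 3.206; the number 0.0658
    is just below the square root of 5/1152.\<close>
  have u: "2 * R < 658 / 10000 * u" using s R1 by (simp add: u_def)
  then have u0: "0 < u" using R by simp
  have e: "3 * sqrt 2 * R - 10 * R\<^sup>2 = R * u" by (simp add: u_def power2_eq_square algebra_simps)
  show "0 < 3 * sqrt 2 * R - 10 * R\<^sup>2" unfolding e using R u0 by simp
  have "(2 * R)\<^sup>2 < (658 / 10000 * u)\<^sup>2" using u R by (intro power_strict_mono) auto
  also have "\<dots> < 5 / 1152 * u\<^sup>2" using u0 by (simp add: power_mult_distrib power2_eq_square[of "329 / 5000 :: real"] power_divide)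
  finally have "(2 * R)\<^sup>2 / u\<^sup>2 < 5 / 1152" using u0 by (simp add: pos_divide_less_eq)
  moreover have "(2 * R) ^ 4 / (4 * (R * u)\<^sup>2) = (2 * R)\<^sup>2 / u\<^sup>2"
    using R u0 by (simp add: power_mult_distrib field_simps)
  ultimately show "(2 * R) ^ 4 / (4 * (3 * sqrt 2 * R - 10 * R\<^sup>2)\<^sup>2) < 5 / 1152" unfolding e by simp
qed

text \<open>The ball is a Euclidean ball of radius \<open>R = t * sinh r\<close> in the upper half-space.  Its projection touches
  none of the vertical walls, so its coordinates satisfy $x, w \le 1/2$, $y \le 1/2 - \sqrt 2 R$ and
  $z \le 1/2 - 2\sqrt 2 R$, and the ball lies over a cube of side $2R$ at squared height at least
  $1 - x^2 - y^2 - z^2 - w^2 \ge 3\sqrt 2 R - 10 R^2$.\<close>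

lemma emeasure_in_ball:
  fixes X :: "real \<times> (real^5)"
  assumes X: "lorentz X X < 0" "0 < fst X" and r: "0 < r"
    and F: "\<And>y. lorentz y y < 0 \<Longrightarrow> 0 < fst y \<Longrightarrow> in_ball r X y \<Longrightarrow> in_F y"
  shows "emeasure hyp_measure {q. norm q < 1 \<and> in_ball r X (lift q)} < ennreal (5 / 1152)"
proof -
  obtain x y z w t where h: "0 < fst X + snd X $ 5" "0 < t" "X = (fst X + snd X $ 5) *\<^sub>R hs x y z w t"
    by (rule timelike_hs[OF X])
  have ball: "in_ball r X p \<longleftrightarrow> in_ball r (hs x y z w t) p" for p
    using in_ball_scale_left[OF h(1), of r "hs x y z w t" p] h(3) by simp
  define R where "R = t * sinh r"
  define T where "T = t * cosh r"
  have R: "0 < R" using h r by (simp add: R_def)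
  have T: "0 < T" using h by (simp add: T_def)
  \<comment> \<open>At the height of the Euclidean center, every horizontal displacement of length
    at most R stays in the ball, hence in the polytope.\<close>
  have push: "in_F (hs (x + a) (y + b) (z + c) (w + d) T)" if "a\<^sup>2 + b\<^sup>2 + c\<^sup>2 + d\<^sup>2 \<le> R\<^sup>2" for a b c d
  proof (rule F)
    show "lorentz (hs (x + a) (y + b) (z + c) (w + d) T) (hs (x + a) (y + b) (z + c) (w + d) T) < 0" using T by (simp add: hs_self)
    show "0 < fst (hs (x + a) (y + b) (z + c) (w + d) T)" by (rule fst_hs_pos)
    show "in_ball r X (hs (x + a) (y + b) (z + c) (w + d) T)"
      unfolding ball in_ball_hs[OF h(2) T] using that by (simp add: T_def R_def)
  qed
  \<comment> \<open>The displacement by -g and g in two coordinates has length R and is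
    perpendicular to the wall where these coordinates agree.\<close>
  define g where "g = R * sqrt 2 / 2"
  have gg: "g\<^sup>2 + g\<^sup>2 = R\<^sup>2" by (simp add: g_def power2_eq_square)
  have c: "0 \<le> z - R" "x + R \<le> 1 / 2" "w + R \<le> 1 / 2" "0 \<le> w - R" "z + g \<le> y - g" "y + g \<le> x - g"
    using push[of 0 0 "- R" 0] push[of R 0 0 0] push[of 0 0 0 R] push[of 0 0 0 "- R"]
      push[of 0 "- g" g 0] push[of "- g" g 0 0] gg by (simp_all add: in_F_hs)
  have g2: "2 * g = sqrt 2 * R" by (simp add: g_def)
  define k where "k = 3 * sqrt 2 * R - 10 * R\<^sup>2"
  \<comment> \<open>The chain 0, z, y, x, 1/2 has gaps of at least R, 2g, 2g and R, where 2g = sqrt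
    2 R.\<close>
  have "2 * R + 2 * sqrt 2 * R \<le> 1 / 2" using c g2 by simp
  note k = inscribed_radius_bound[OF R this, folded k_def]
  define A where "A = cbox (x - R, y - R, z - R, w - R) (x + R, y + R, z + R, w + R)"
  have "norm q < 1 \<and> base q \<in> A \<and> k \<le> hts q" if q: "norm q < 1" "in_ball r X (lift q)" for q
  proof -
    obtain x' y' z' w' t' where q': "0 < 1 + q $ 5" "0 < t'" "lift q = (1 + q $ 5) *\<^sub>R hs x' y' z' w' t'"
      "base q = (x', y', z', w')" "hts q = t'\<^sup>2" by (rule lift_hs[OF q(1)])
    have "in_F (lift q)" using q F[of "lift q"] by (simp add: lorentz_lift_neg_iff)
    then have "in_F (hs x' y' z' w' t')" unfolding q'(3) in_F_scale[OF q'(1)] .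
    then have i: "0 \<le> z'" "z' \<le> y'" "y' \<le> x'" "x' \<le> 1 / 2" "1 \<le> x'\<^sup>2 + y'\<^sup>2 + z'\<^sup>2 + w'\<^sup>2 + t'\<^sup>2" "w' \<le> 1 / 2" "0 \<le> w'"
      unfolding in_F_hs by blast+
    have "in_ball r (hs x y z w t) (hs x' y' z' w' t')"
      using q(2) unfolding q'(3) in_ball_scale[OF q'(1)] ball .
    then have b: "(x - x')\<^sup>2 + (y - y')\<^sup>2 + (z - z')\<^sup>2 + (w - w')\<^sup>2 + (t' - t * cosh r)\<^sup>2 \<le> R\<^sup>2"
      unfolding in_ball_hs[OF h(2) q'(2)] R_def .
    have sq: "0 \<le> (x - x')\<^sup>2" "0 \<le> (y - y')\<^sup>2" "0 \<le> (z - z')\<^sup>2" "0 \<le> (w - w')\<^sup>2" "0 \<le> (t' - t * cosh r)\<^sup>2" by simp_all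
    have "(x - x')\<^sup>2 \<le> R\<^sup>2" "(y - y')\<^sup>2 \<le> R\<^sup>2" "(z - z')\<^sup>2 \<le> R\<^sup>2" "(w - w')\<^sup>2 \<le> R\<^sup>2" using b sq by linarith+
    then have ab: "\<bar>x - x'\<bar> \<le> R" "\<bar>y - y'\<bar> \<le> R" "\<bar>z - z'\<bar> \<le> R" "\<bar>w - w'\<bar> \<le> R"
      using R by (simp_all add: abs_le_square_iff[symmetric])
    have "y' \<le> 1 / 2 - sqrt 2 * R" "z' \<le> 1 / 2 - 2 * sqrt 2 * R" using ab c g2 by linarith+
    then have "y'\<^sup>2 \<le> (1 / 2 - sqrt 2 * R)\<^sup>2" "z'\<^sup>2 \<le> (1 / 2 - 2 * sqrt 2 * R)\<^sup>2" "x'\<^sup>2 \<le> (1 / 2)\<^sup>2" "w'\<^sup>2 \<le> (1 / 2)\<^sup>2"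
      using i by (intro power_mono; simp)+
    moreover have "(1 / 2 - sqrt 2 * R)\<^sup>2 = 1 / 4 - sqrt 2 * R + 2 * R\<^sup>2" "(1 / 2 - 2 * sqrt 2 * R)\<^sup>2 = 1 / 4 - 2 * sqrt 2 * R + 8 * R\<^sup>2"
      "(1 / 2 :: real)\<^sup>2 = 1 / 4"
      by (simp_all add: power2_diff power_mult_distrib power_divide)
    ultimately have "k \<le> t'\<^sup>2" using i(5) by (simp add: k_def)
    moreover have "base q \<in> A" using ab unfolding A_def q'(4) by (auto simp: cbox_Pair_eq abs_le_iff)
    ultimately show ?thesis using q q'(5) by simp
  qed
  then have "emeasure hyp_measure {q. norm q < 1 \<and> in_ball r X (lift q)} \<le> emeasure hyp_measure {q. norm q < 1 \<and> base q \<in> A \<and> k \<le> hts q}"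
    by (intro emeasure_mono) (auto simp: A_def)
  also have "\<dots> = (\<integral>\<^sup>+v. ennreal (1 / (4 * k\<^sup>2)) * indicator A v \<partial>lborel)"
    by (rule emeasure_hyp_over_base) (use k in \<open>auto simp: A_def\<close>)
  also have "\<dots> = ennreal (1 / (4 * k\<^sup>2)) * emeasure lborel A"
    by (simp add: nn_integral_cmult A_def)
  also have "\<dots> = ennreal ((2 * R) ^ 4 / (4 * k\<^sup>2))"
    unfolding A_def using R by (subst emeasure_cube) (simp_all add: ennreal_mult'[symmetric])
  also have "\<dots> < ennreal (5 / 1152)" using k by (simp add: ennreal_lessI)
  finally show ?thesis .
qed

context standard_copy begin

lemma hvol_hball:
  assumes x: "norm x < 1" and r: "0 < r" and sub: "hball x r \<subseteq> fund_domain b"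
  shows "hvol (hball x r) < 5 / 1152"
proof -
  define X where "X = M (lift x)"
  have X: "lorentz X X < 0" "0 < fst X"
    using x orthochronousD(3)[OF orthochronous_M, of "lift x"] by (simp_all add: X_def M lorentz_lift_neg_iff)
  have inv: "in_ball r (lift x) y \<longleftrightarrow> in_ball r X (M y)" for y
    unfolding in_ball_def X_def by (simp add: M)
  have eq: "hball x r = {q. norm q < 1 \<and> in_ball r X (M (lift q))}"
    using hball_iff[OF x r] inv by auto
  have [measurable]: "M \<in> borel_measurable borel" by (rule measurable_linear[OF M(1)])
  \<comment> \<open>\<open>emeasure_in_ball\<close> speaks of all future timelike vectors; each is
    carried to the realisation by L and rescaled to the lift of a point of the model.\<close>
  have F: "in_F y" if y: "lorentz y y < 0" "0 < fst y" "in_ball r X y" for y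
  proof -
    have Ly: "lorentz (L y) (L y) < 0" "0 < fst (L y)" using y futL by (simp_all add: presL)
    define q where "q = proj (L y)"
    have lq: "lift q = (1 / fst (L y)) *\<^sub>R L y" using Ly by (simp add: q_def lift_proj)
    have Mq: "M (lift q) = (1 / fst (L y)) *\<^sub>R y" unfolding lq by (simp add: linear_cmul[OF M(1)] M)
    have n: "norm q < 1" unfolding q_def by (rule norm_proj_less_1[OF Ly(1)])
    have "q \<in> hball x r" unfolding eq using n y Ly by (simp add: Mq in_ball_scale)
    then have "in_F (M (lift q))" using sub fund_domain_iff[OF n] by blast
    then show ?thesis using Ly by (simp add: Mq in_F_scale)
  qed
  have "emeasure hyp_measure (hball x r) = emeasure hyp_measure {q. norm q < 1 \<and> in_ball r X (lift q)}"
    unfolding eq by (rule emeasure_hyp_orthochronous[OF orthochronous_M, symmetric]) (rule measurable_in_ball, rule in_ball_scale)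
  also have "\<dots> < ennreal (5 / 1152)" by (rule emeasure_in_ball[OF X r F])
  finally have "enn2real (emeasure hyp_measure (hball x r)) < 5 / 1152"
    by (cases "emeasure hyp_measure (hball x r)") (auto simp: ennreal_less_iff)
  then show ?thesis by (simp add: hvol_def measure_def)
qed

lemma ball_packing_bound:
  assumes "congruent_ball_packing b \<P> d"
  shows "d < 5 / (7 * zeta 3)"
proof -
  obtain x r where x: "norm x < 1" "0 < r" "hball x r \<subseteq> fund_domain b" and d: "d = hvol (hball x r) / hvol (fund_domain b)"
    using assms unfolding congruent_ball_packing_def by blast
  have z: "0 < 7 * zeta 3 / 1152" using zeta3_pos by simp
  have "d < (5 / 1152) / (7 * zeta 3 / 1152)"
    unfolding d hvol_fund_domain using hvol_hball[OF x] z by (rule divide_strict_right_mono)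
  then show ?thesis by simp
qed

end

section \<open>The symbol is forced\<close>

text \<open>From cos 3x = -cos 2x at x = pi/5, after cancelling the factor cos x + 1.\<close>

lemma cos_pi_5_eq: "4 * (cos (pi / 5))\<^sup>2 = 2 * cos (pi / 5) + 1"
proof -
  define c where "c = cos (pi / 5)"
  have c: "0 < c" unfolding c_def by (rule cos_gt_zero) simp_all
  have "cos (3 * (pi / 5)) = - cos (pi - 3 * (pi / 5))" by (simp only: cos_pi_minus minus_minus)
  also have "pi - 3 * (pi / 5) = 2 * (pi / 5)" by (simp add: field_simps)
  finally have "4 * c ^ 3 - 3 * c = - (2 * c\<^sup>2 - 1)" unfolding cos_treble_cos cos_double_cos c_def .
  then have "(c + 1) * (4 * c\<^sup>2 - 2 * c - 1) = 0" by (simp add: power2_eq_square power3_eq_cube algebra_simps)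
  then show ?thesis using c unfolding c_def[symmetric] by simp
qed

lemma cos_pi_divide_mono:
  assumes "2 \<le> k" "k \<le> m" shows "cos (pi / real k) \<le> cos (pi / real m)" "0 \<le> cos (pi / real k)"
proof -
  have "pi / real m \<le> pi / real k" using assms by (intro divide_left_mono) auto
  moreover have "pi / real k \<le> pi / 2" using assms by (intro divide_left_mono) auto
  moreover have "pi / 2 \<le> pi" by simp
  ultimately have a: "0 \<le> pi / real m" "pi / real m \<le> pi / real k" "pi / real k \<le> pi" "pi / real k \<le> pi / 2" by (simp, linarith+)
  show "cos (pi / real k) \<le> cos (pi / real m)" using a by (intro cos_monotone_0_pi_le)
  show "0 \<le> cos (pi / real k)" by (intro cos_ge_zero) (use a in linarith)+
qed

text \<open>For m = 5 a lower bound and the exclusion of 2/3 suffice; the latter excludes the value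
  1/3 of 1 - cos^2, which would solve the equation of \<open>chain_434\<close> together with
  3/4.\<close>

lemma cos_pi_divide_cases:
  assumes "3 \<le> m"
  obtains (3) "m = 3" "(cos (pi / real m))\<^sup>2 = 1 / 4" | (4) "m = 4" "(cos (pi / real m))\<^sup>2 = 1 / 2"
    | (5) "9 / 16 < (cos (pi / real m))\<^sup>2" "(cos (pi / real m))\<^sup>2 \<noteq> 2 / 3"
    | (6) "3 / 4 \<le> (cos (pi / real m))\<^sup>2"
proof -
  consider "m = 3" | "m = 4" | "m = 5" | "6 \<le> m" using assms by linarith
  then show thesis
  proof cases
    case 1
    then show thesis using that(1) by (simp add: cos_60 power_divide)
  next
    case 2
    then show thesis using that(2) by (simp add: cos_45 power_divide)
  next
    case 3
    define c where "c = cos (pi / 5)"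
    have c0: "0 < c" unfolding c_def by (rule cos_gt_zero) simp_all
    have e: "4 * c\<^sup>2 = 2 * c + 1" unfolding c_def by (rule cos_pi_5_eq)
    have "3 / 4 < c"
    proof (rule ccontr)
      assume "\<not> 3 / 4 < c"
      then have "c * c \<le> c * (3 / 4)" using c0 by (intro mult_left_mono) auto
      then show False using e c0 \<open>\<not> 3 / 4 < c\<close> unfolding power2_eq_square by linarith
    qed
    then have a: "(3 / 4)\<^sup>2 < c\<^sup>2" by (intro power_strict_mono) auto
    have b: "c\<^sup>2 \<noteq> 2 / 3"
    proof
      assume "c\<^sup>2 = 2 / 3"
      moreover from this have "c = 5 / 6" using e by simp
      ultimately show False by (simp add: power2_eq_square)
    qed
    have "real m = 5" using 3 by simp
    then show thesis using that(3) a b unfolding c_def by (simp add: power_divide)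
  next
    case 4
    have "(cos (pi / real 6))\<^sup>2 \<le> (cos (pi / real m))\<^sup>2"
      using cos_pi_divide_mono[of 6 m] 4 by (intro power_mono) auto
    then show thesis using that(4) by (simp add: cos_30 power_divide)
  qed
qed

text \<open>In s m = sin^2 (pi/m) the equation reads s m1 * s m3 = 1 - s m2. The left side is at
  most 9/16, which forces m2 to be 3 or 4 and the product to be 1/4 or 1/2; among the possible
  factors only 1/2 * 1/2 = 1/4 remains. The group found is that of the cubic honeycomb.\<close>

lemma chain_434:
  assumes m: "3 \<le> m1" "3 \<le> m2" "3 \<le> m3"
    and e: "(1 - (cos (pi / real m1))\<^sup>2) * (1 - (cos (pi / real m3))\<^sup>2) = (cos (pi / real m2))\<^sup>2"
  shows "m1 = 4 \<and> m2 = 3 \<and> m3 = 4"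
proof -
  define s where "s m = 1 - (cos (pi / real m))\<^sup>2" for m
  have s0: "0 \<le> s m" for m unfolding s_def by (simp add: abs_square_le_1)
  have cases: "m = 3 \<and> s m = 3 / 4 \<or> m = 4 \<and> s m = 1 / 2 \<or> s m < 7 / 16 \<and> s m \<noteq> 1 / 3 \<or> s m \<le> 1 / 4" if "3 \<le> m" for m
    by (rule cos_pi_divide_cases[OF that]) (auto simp: s_def)
  have le: "s m \<le> 3 / 4" if "3 \<le> m" for m using cases[OF that] by auto
  have prod: "s m1 * s m3 = 1 - s m2" using e by (simp add: s_def)
  have "s m1 * s m3 \<le> 3 / 4 * (3 / 4)" using le m s0 by (intro mult_mono) auto
  then have m2: "m2 = 3 \<and> s m2 = 3 / 4 \<or> m2 = 4 \<and> s m2 = 1 / 2" using cases[OF m(2)] prod by auto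
  then have q: "1 / 4 \<le> s m1 * s m3" using prod by auto
  consider "m1 = 3" "s m1 = 3 / 4" | "m1 = 4" "s m1 = 1 / 2" | "s m1 < 7 / 16" "s m1 \<noteq> 1 / 3" | "s m1 \<le> 1 / 4"
    using cases[OF m(1)] by blast
  then show ?thesis
  proof cases
    case 1
    have "3 / 4 * s m3 = 1 - s m2" using prod unfolding 1(2) .
    then show ?thesis using m2 cases[OF m(3)] by argo
  next
    case 2
    have "1 / 2 * s m3 = 1 - s m2" using prod unfolding 2(2) .
    then show ?thesis using 2(1) m2 cases[OF m(3)] by argo
  next
    case 3
    have "\<not> s m3 < 7 / 16"
    proof
      assume "s m3 < 7 / 16"
      then have "s m1 * s m3 \<le> 7 / 16 * (7 / 16)" using 3 s0 by (intro mult_mono) auto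
      then show False using q by simp
    qed
    then have "s m3 = 3 / 4 \<or> s m3 = 1 / 2" using cases[OF m(3)] by auto
    then have "s m1 * (3 / 4) = 1 - s m2 \<or> s m1 * (1 / 2) = 1 - s m2" using prod by metis
    then show ?thesis using 3 m2 by argo
  next
    case 4
    then have "s m1 * s m3 \<le> 1 / 4 * (3 / 4)" using le[OF m(3)] s0 by (intro mult_mono) auto
    then show ?thesis using q by simp
  qed
qed

text \<open>For null a the orthogonal complement contains a itself, so the form is only semidefinite
  there.\<close>

lemma causal_orthogonal_nonneg:
  assumes a: "a \<noteq> 0" "lorentz a a \<le> 0" and x: "lorentz a x = 0"
  shows "0 \<le> lorentz x x"
proof (cases "lorentz a a < 0")
  case True
  then show ?thesis using x by (rule lorentz_orthogonal_timelike)
next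
  case False
  then have n: "snd a \<bullet> snd a = (fst a)\<^sup>2" using a by (simp add: lorentz_def power2_eq_square)
  then have f: "fst a \<noteq> 0" using a(1) by (auto simp: prod_eq_iff)
  have "(fst a)\<^sup>2 * (fst x)\<^sup>2 = (snd a \<bullet> snd x)\<^sup>2" using x by (simp add: lorentz_def power_mult_distrib[symmetric])
  also have "\<dots> \<le> (fst a)\<^sup>2 * (snd x \<bullet> snd x)" using Cauchy_Schwarz_ineq[of "snd a" "snd x"] n by simp
  finally show ?thesis using f by (simp add: lorentz_def power2_eq_square[of "fst x"])
qed

lemma range_1_5: "i \<in> {1..5::nat} \<longleftrightarrow> i = 1 \<or> i = 2 \<or> i = 3 \<or> i = 4 \<or> i = 5"
  by auto

section \<open>The Gram matrix of an arbitrary realisation\<close>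

locale orthoscheme5 =
  fixes m1 m2 m3 m4 m5 :: nat and b :: "nat \<Rightarrow> real \<times> (real^5)"
  assumes stp: "simply_truncated_parallel [m1, m2, m3, m4, m5] b"
begin

lemma ge_3: "3 \<le> m1" "3 \<le> m2" "3 \<le> m3" "3 \<le> m4" "3 \<le> m5"
  using stp by (simp_all add: simply_truncated_parallel_def)

lemma unit: "i \<le> 6 \<Longrightarrow> lorentz (b i) (b i) = 1"
  using stp by (simp add: simply_truncated_parallel_def)

lemma far: "j \<le> 6 \<Longrightarrow> i + 2 \<le> j \<Longrightarrow> lorentz (b i) (b j) = 0 \<and> lorentz (b j) (b i) = 0"
  using stp lorentz_commute[of "b j" "b i"] by (simp add: simply_truncated_parallel_def)

lemma near:
  "lorentz (b 0) (b 1) = - cos (pi / m1)" "lorentz (b 1) (b 2) = - cos (pi / m2)"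
  "lorentz (b 2) (b 3) = - cos (pi / m3)" "lorentz (b 3) (b 4) = - cos (pi / m4)"
  "lorentz (b 4) (b 5) = - cos (pi / m5)" "lorentz (b 5) (b 6) = - 1"
proof -
  have *: "\<forall>i\<in>{1..5}. lorentz (b (i - 1)) (b i) = - cos (pi / real ([m1, m2, m3, m4, m5] ! (i - 1)))"
    "lorentz (b 5) (b 6) = - 1"
    using stp by (simp_all add: simply_truncated_parallel_def)
  show "lorentz (b 0) (b 1) = - cos (pi / m1)" "lorentz (b 1) (b 2) = - cos (pi / m2)"
    "lorentz (b 2) (b 3) = - cos (pi / m3)" "lorentz (b 3) (b 4) = - cos (pi / m4)"
    "lorentz (b 4) (b 5) = - cos (pi / m5)" "lorentz (b 5) (b 6) = - 1"
    using bspec[OF *(1), of 1] bspec[OF *(1), of 2] bspec[OF *(1), of 3] bspec[OF *(1), of 4] bspec[OF *(1), of 5] *(2)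
    by simp_all
qed

lemma near':
  "lorentz (b 1) (b 0) = - cos (pi / m1)" "lorentz (b 2) (b 1) = - cos (pi / m2)"
  "lorentz (b 3) (b 2) = - cos (pi / m3)" "lorentz (b 4) (b 3) = - cos (pi / m4)"
  "lorentz (b 5) (b 4) = - cos (pi / m5)" "lorentz (b 6) (b 5) = - 1"
  using near by (simp_all only: lorentz_commute)

lemma gram:
  "lorentz (b 0) (b 0) = 1" "lorentz (b 0) (b 1) = - cos (pi / m1)" "lorentz (b 0) (b 2) = 0" "lorentz (b 0) (b 3) = 0" "lorentz (b 0) (b 4) = 0" "lorentz (b 0) (b 5) = 0" "lorentz (b 0) (b 6) = 0"
  "lorentz (b 1) (b 0) = - cos (pi / m1)" "lorentz (b 1) (b 1) = 1" "lorentz (b 1) (b 2) = - cos (pi / m2)" "lorentz (b 1) (b 3) = 0" "lorentz (b 1) (b 4) = 0" "lorentz (b 1) (b 5) = 0" "lorentz (b 1) (b 6) = 0"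
  "lorentz (b 2) (b 0) = 0" "lorentz (b 2) (b 1) = - cos (pi / m2)" "lorentz (b 2) (b 2) = 1" "lorentz (b 2) (b 3) = - cos (pi / m3)" "lorentz (b 2) (b 4) = 0" "lorentz (b 2) (b 5) = 0" "lorentz (b 2) (b 6) = 0"
  "lorentz (b 3) (b 0) = 0" "lorentz (b 3) (b 1) = 0" "lorentz (b 3) (b 2) = - cos (pi / m3)" "lorentz (b 3) (b 3) = 1" "lorentz (b 3) (b 4) = - cos (pi / m4)" "lorentz (b 3) (b 5) = 0" "lorentz (b 3) (b 6) = 0"
  "lorentz (b 4) (b 0) = 0" "lorentz (b 4) (b 1) = 0" "lorentz (b 4) (b 2) = 0" "lorentz (b 4) (b 3) = - cos (pi / m4)" "lorentz (b 4) (b 4) = 1" "lorentz (b 4) (b 5) = - cos (pi / m5)" "lorentz (b 4) (b 6) = 0"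
  "lorentz (b 5) (b 0) = 0" "lorentz (b 5) (b 1) = 0" "lorentz (b 5) (b 2) = 0" "lorentz (b 5) (b 3) = 0" "lorentz (b 5) (b 4) = - cos (pi / m5)" "lorentz (b 5) (b 5) = 1" "lorentz (b 5) (b 6) = - 1"
  "lorentz (b 6) (b 0) = 0" "lorentz (b 6) (b 1) = 0" "lorentz (b 6) (b 2) = 0" "lorentz (b 6) (b 3) = 0" "lorentz (b 6) (b 4) = 0" "lorentz (b 6) (b 5) = - 1" "lorentz (b 6) (b 6) = 1"
  by (rule unit near near' far[THEN conjunct1] far[THEN conjunct2]; simp)+

lemma apex:
  obtains a where "a \<noteq> 0" "lorentz a a \<le> 0" "\<And>j. 1 \<le> j \<Longrightarrow> j \<le> 5 \<Longrightarrow> lorentz a (b j) = 0"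
proof -
  have "\<forall>i<5. \<exists>a. a \<noteq> 0 \<and> lorentz a a \<le> 0 \<and> (\<forall>j\<le>5. j \<noteq> i \<longrightarrow> lorentz a (b j) = 0)"
    using stp unfolding simply_truncated_parallel_def Let_def by (simp del: split_paired_Ex)
  then have "\<exists>a. a \<noteq> 0 \<and> lorentz a a \<le> 0 \<and> (\<forall>j\<le>5. j \<noteq> 0 \<longrightarrow> lorentz a (b j) = 0)" by (rule allE[of _ 0]) simp
  then obtain a where "a \<noteq> 0" "lorentz a a \<le> 0" and *: "\<forall>j\<le>5. j \<noteq> 0 \<longrightarrow> lorentz a (b j) = 0" by (elim exE conjE)
  moreover have "lorentz a (b j) = 0" if "1 \<le> j" "j \<le> 5" for j using * that by simp
  ultimately show thesis using that by blast
qed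

lemma interior_point:
  obtains p where "norm p < 1" "\<And>i. i \<le> 6 \<Longrightarrow> lorentz (lift p) (b i) < 0"
proof -
  have "\<exists>p. norm p < 1 \<and> (\<forall>i\<le>6. lorentz (lift p) (b i) < 0)"
    using stp unfolding simply_truncated_parallel_def Let_def by simp
  then show thesis using that by blast
qed

text \<open>Seven vectors in a six-dimensional space are dependent.  Since $b^5 + b^6$ is null, the
  coefficient of $b^4$ in a relation vanishes, so the first four vectors have a singular Gram matrix.\<close>

lemma singular_chain: "(1 - (cos (pi / m1))\<^sup>2) * (1 - (cos (pi / m3))\<^sup>2) = (cos (pi / m2))\<^sup>2"
proof -
  define c1 c2 c3 c4 c5 where "c1 = cos (pi / m1)" and "c2 = cos (pi / m2)" and "c3 = cos (pi / m3)" and "c4 = cos (pi / m4)" and "c5 = cos (pi / m5)"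
  have pos: "0 < cos (pi / real m)" if "3 \<le> m" for m
    using cos_pi_divide_mono(1)[of 3 m] that by (simp add: cos_60)
  have c: "0 < c2" "0 < c5" unfolding c2_def c5_def using ge_3 pos by auto
  have nn: "lorentz (b i) (b j) \<le> 0" if ij: "j \<le> 6" "i < j" for i j
  proof (cases "i + 2 \<le> j")
    case True
    then show ?thesis using far[OF ij(1)] by simp
  next
    case False
    then have j: "j = Suc i" "i \<le> 5" using ij by auto
    have p: "0 \<le> cos (pi / real m1)" "0 \<le> cos (pi / real m2)" "0 \<le> cos (pi / real m3)" "0 \<le> cos (pi / real m4)" "0 \<le> cos (pi / real m5)"
      using ge_3 pos by (auto intro: less_imp_le)
    show ?thesis using j(2) near p unfolding j(1) le_5_cases by (auto simp: numeral_eq_Suc)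
  qed
  \<comment> \<open>\<open>dependent\<close> concerns sets, so the seven normals must first be seen
    to be distinct: mutual products are at most 0, squares are 1.\<close>
  have inj: "inj_on b {..6}"
  proof (rule linorder_inj_onI')
    fix i j assume "i \<in> {..6}" "j \<in> {..6}" "i < (j::nat)"
    then show "b i \<noteq> b j" using nn[of j i] unit[of j] by auto
  qed
  have "dependent (b ` {..6})"
    by (rule dependent_biggerset) (simp add: card_image[OF inj])
  then obtain u where u: "\<exists>v\<in>b ` {..6}. u v \<noteq> 0" "(\<Sum>v\<in>b ` {..6}. u v *\<^sub>R v) = 0"
    unfolding dependent_finite[OF finite_imageI[OF finite_atMost]] by blast
  define a where "a i = u (b i)" for i
  have sum: "(\<Sum>i\<le>6. a i *\<^sub>R b i) = 0" using u(2) by (simp add: sum.reindex[OF inj] a_def)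
  then have sum: "a 0 *\<^sub>R b 0 + a 1 *\<^sub>R b 1 + a 2 *\<^sub>R b 2 + a 3 *\<^sub>R b 3 + a 4 *\<^sub>R b 4 + a 5 *\<^sub>R b 5 + a 6 *\<^sub>R b 6 = 0"
    by (simp add: eval_nat_numeral sum.atMost_Suc)
  have nz: "\<not> (a 0 = 0 \<and> a 1 = 0 \<and> a 2 = 0 \<and> a 3 = 0 \<and> a 4 = 0 \<and> a 5 = 0 \<and> a 6 = 0)"
  proof
    assume "a 0 = 0 \<and> a 1 = 0 \<and> a 2 = 0 \<and> a 3 = 0 \<and> a 4 = 0 \<and> a 5 = 0 \<and> a 6 = 0"
    then have "\<forall>i\<le>6. a i = 0" unfolding all_le_6 .
    then show False using u(1) unfolding a_def by auto
  qed
  have row: "a 0 * lorentz (b 0) y + a 1 * lorentz (b 1) y + a 2 * lorentz (b 2) y + a 3 * lorentz (b 3) y + a 4 * lorentz (b 4) y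
    + a 5 * lorentz (b 5) y + a 6 * lorentz (b 6) y = 0" for y
    using arg_cong[OF sum, of "\<lambda>x. lorentz x y"] unfolding lorentz_simps .
  have r: "a 0 = c1 * a 1" "a 1 = c1 * a 0 + c2 * a 2" "a 2 = c2 * a 1 + c3 * a 3" "a 3 = c3 * a 2 + c4 * a 4"
    "a 4 = c4 * a 3 + c5 * a 5" "a 5 = c5 * a 4 + a 6" "a 6 = a 5"
    using row[of "b 0"] row[of "b 1"] row[of "b 2"] row[of "b 3"] row[of "b 4"] row[of "b 5"] row[of "b 6"]
    unfolding gram c1_def[symmetric] c2_def[symmetric] c3_def[symmetric] c4_def[symmetric] c5_def[symmetric]
    by (simp_all add: algebra_simps)
  have a4: "a 4 = 0" using r(6,7) c(2) by simp
  have a3: "a 3 = c3 * a 2" using r(4) a4 by simp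
  have e1: "a 1 * (1 - c1\<^sup>2) = c2 * a 2" using r(1,2) by (simp add: power2_eq_square algebra_simps)
  have e2: "a 2 * (1 - c3\<^sup>2) = c2 * a 1" using r(3) a3 by (simp add: power2_eq_square algebra_simps)
  \<comment> \<open>Otherwise the rows make the remaining coefficients vanish one after
    another.\<close>
  have "a 1 \<noteq> 0"
  proof
    assume a1: "a 1 = 0"
    then have "a 2 = 0" using e1 c by simp
    moreover from this have "a 3 = 0" using a3 by simp
    moreover from this have "a 5 = 0" using r(5) a4 c by simp
    moreover from this have "a 6 = 0" using r(7) by simp
    ultimately show False using nz r(1) a1 a4 by simp
  qed
  moreover have "a 1 * ((1 - c1\<^sup>2) * (1 - c3\<^sup>2)) = a 1 * c2\<^sup>2"
  proof -
    have "a 1 * ((1 - c1\<^sup>2) * (1 - c3\<^sup>2)) = c2 * (a 2 * (1 - c3\<^sup>2))" unfolding mult.assoc[symmetric] e1 ..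
    then show ?thesis unfolding e2 by (simp add: power2_eq_square)
  qed
  ultimately show ?thesis unfolding c1_def[symmetric] c2_def[symmetric] c3_def[symmetric] by simp
qed

lemma symbol_123: "m1 = 4" "m2 = 3" "m3 = 4"
  using chain_434[OF ge_3(1-3) singular_chain] by blast+

lemma coeffs: "cos (pi / m1) = sqrt 2 / 2" "cos (pi / m2) = 1 / 2" "cos (pi / m3) = sqrt 2 / 2"
  unfolding symbol_123 by (simp_all add: cos_45 cos_60)

text \<open>Here and in the next proof \<open>x\<close> minimises the form among the vectors of the span with the last but one
  coefficient fixed.\<close>

lemma symbol_4: "m4 = 3"
proof -
  define c where "c = cos (pi / m4)"
  obtain a where a: "a \<noteq> 0" "lorentz a a \<le> 0" "\<And>j. 1 \<le> j \<Longrightarrow> j \<le> 5 \<Longrightarrow> lorentz a (b j) = 0" by (rule apex) blast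
  have s: "sqrt 2 * (sqrt 2 * x) = 2 * x" for x by (simp flip: mult.assoc)
  define x where "x = (sqrt 2 / 3) *\<^sub>R b 1 + (2 * sqrt 2 / 3) *\<^sub>R b 2 + b 3 + c *\<^sub>R b 4"
  have "0 \<le> lorentz x x"
    by (rule causal_orthogonal_nonneg[OF a(1,2)]) (simp add: x_def lorentz_simps a(3))
  also have "lorentz x x = 1 / 3 - c\<^sup>2"
    unfolding x_def lorentz_simps gram coeffs c_def[symmetric] by (simp add: field_simps power2_eq_square s)
  finally have "c\<^sup>2 \<le> 1 / 3" by simp
  then show ?thesis
    using ge_3(4) unfolding c_def by (elim cos_pi_divide_cases) auto
qed

lemma symbol_5: "m5 = 3"
proof -
  define c where "c = cos (pi / m5)"
  have c4: "cos (pi / m4) = 1 / 2" unfolding symbol_4 by (simp add: cos_60)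
  obtain a where a: "a \<noteq> 0" "lorentz a a \<le> 0" "\<And>j. 1 \<le> j \<Longrightarrow> j \<le> 5 \<Longrightarrow> lorentz a (b j) = 0" by (rule apex) blast
  have s: "sqrt 2 * (sqrt 2 * x) = 2 * x" for x by (simp flip: mult.assoc)
  define x where "x = (sqrt 2 / 2) *\<^sub>R b 1 + sqrt 2 *\<^sub>R b 2 + (3 / 2) *\<^sub>R b 3 + b 4 + c *\<^sub>R b 5"
  have "0 \<le> lorentz x x"
    by (rule causal_orthogonal_nonneg[OF a(1,2)]) (simp add: x_def lorentz_simps a(3))
  also have "lorentz x x = 1 / 4 - c\<^sup>2"
    unfolding x_def lorentz_simps gram coeffs c4 c_def[symmetric] by (simp add: field_simps power2_eq_square s)
  finally have "c\<^sup>2 \<le> 1 / 4" by simp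
  then show ?thesis
    using ge_3(5) unfolding c_def by (elim cos_pi_divide_cases) auto
qed

lemma coeffs': "cos (pi / m4) = 1 / 2" "cos (pi / m5) = 1 / 2"
  unfolding symbol_4 symbol_5 by (simp_all add: cos_60)

lemmas products = gram[unfolded coeffs coeffs']

text \<open>The standard basis is expressed through the standard normals, for instance
  \<open>v_inf\<close> as 2 (bs 5 + bs 6) and the time axis as \<open>v_inf + bs 4\<close>. The same
  formulas in the given normals define a Lorentz frame, and L maps the standard basis to it.\<close>

lemma ex_standard_copy: "\<exists>L. standard_copy b L"
proof -
  define v where "v = 2 *\<^sub>R (b 5 + b 6)"
  define f0 where "f0 = v + b 4"
  define fz where "fz = - b 0"
  define fy where "fy = fz - sqrt 2 *\<^sub>R b 1"
  define fx where "fx = fy - sqrt 2 *\<^sub>R b 2"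
  define fw where "fw = - b 6"
  define L where "L = frame f0 fx fy fz fw (b 4)"
  note defs = v_def f0_def fx_def fy_def fz_def fw_def
  have s: "sqrt 2 * (sqrt 2 * x) = 2 * x" for x by (simp flip: mult.assoc)
  obtain p where p: "norm p < 1" "\<And>i. i \<le> 6 \<Longrightarrow> lorentz (lift p) (b i) < 0" by (rule interior_point) blast
  \<comment> \<open>The interior point decides the time direction: it has negative product with b 5
    and b 6, so their null sum points to the future.\<close>
  have "lorentz (lift p) v < 0" using p(2)[of 5] p(2)[of 6] by (simp add: v_def lorentz_simps)
  moreover have vv: "lorentz v v = 0" unfolding v_def lorentz_simps products by simp
  ultimately have v0: "0 < fst v"
    using p(1) by - (rule causal_future[of "lift p"], simp_all add: lorentz_lift_neg_iff)
  have f00: "lorentz f0 f0 = - 1" unfolding defs lorentz_simps products by simp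
  have f0v: "lorentz f0 v = - 1" unfolding defs lorentz_simps products by simp
  have f0: "0 < fst f0" by (rule timelike_future[of f0 v]) (simp_all add: f00 vv v0 f0v)
  have L: "orthochronous L"
    unfolding L_def
    by (rule orthochronous_frame[OF f00 _ _ _ _ _ _ _ _ _ _ _ _ _ _ _ _ _ _ _ _ f0];
        simp only: defs lorentz_simps products; simp add: algebra_simps s)
  have pres: "lorentz (L x) (L y) = lorentz x y" and lin: "linear L" for x y using orthochronousD[OF L] by blast+
  have Lbs: "L (bs 0) = b 0" "L (bs 1) = b 1" "L (bs 2) = b 2" "L (bs 4) = b 4" "L (bs 5) = b 5" "L (bs 6) = b 6"
    "L (bs 3) = b 5 + b 6 - b 0 - sqrt 2 *\<^sub>R b 1 - sqrt 2 *\<^sub>R b 2"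
    unfolding L_def by (simp_all add: frame_def bs_def defs algebra_simps)
  \<comment> \<open>b 3 does not enter the frame. The other six normals span the space and the Gram
    matrix prescribes the products of b 3 with them, so it must be the image of
    \<open>bs 3\<close>.\<close>
  define d where "d = b 3 - L (bs 3)"
  have db: "lorentz d (b 0) = 0" "lorentz d (b 1) = 0" "lorentz d (b 2) = 0" "lorentz d (b 4) = 0" "lorentz d (b 5) = 0" "lorentz d (b 6) = 0"
    unfolding d_def Lbs lorentz_simps products by (simp_all add: s)
  have "lorentz d y = 0" for y
  proof -
    obtain m where m: "\<And>x. L (m x) = x" using lorentz_isometry_bij[OF lin pres] by metis
    have "lorentz d (L x) = 0" for x
      unfolding L_def frame_def defs lorentz_simps db by simp
    then show ?thesis using m by metis
  qed
  then have "d = 0" by (rule lorentz_nondegenerate)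
  then have L3: "L (bs 3) = b 3" by (simp add: d_def)
  have "standard_copy b L"
  proof
    show "orthochronous L" by (rule L)
    show "b i = L (bs i)" if "i \<le> 6" for i
      using that unfolding le_6_cases by (elim disjE) (simp_all only: Lbs(1-6) L3)
  qed
  then show ?thesis by blast
qed

end

section \<open>Existence of a realisation\<close>

lemma bs_symbol: "simply_truncated_parallel [4, 3, 4, 3, 3] bs"
proof -
  have causal: "\<exists>a. a \<noteq> 0 \<and> lorentz a a \<le> 0 \<and> (\<forall>j\<le>5. j \<noteq> i \<longrightarrow> lorentz a (bs j) = 0)" if "i < 5" for i
  proof -
    have i: "i = 0 \<or> i = 1 \<or> i = 2 \<or> i = 3 \<or> i = 4" using that by auto
    then show ?thesis
    proof (elim disjE)
      assume "i = 0" then show ?thesis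
        by (intro exI[of _ "v_cor"]) (simp add: all_le_5 lorentz_bs v_cor_null, simp add: v_cor_def prod_eq_iff)
    next
      assume "i = 1" then show ?thesis
        \<comment> \<open>This and the next two witnesses are the vertices A_1, A_2, A_3 in the
          chart with first coordinate 1; their spatial squares are 3/4, 1/2 and 1/4.\<close>
        by (intro exI[of _ "(1, vec5 (1/2) (1/2) 0 (1/2) 0)"]) (simp add: all_le_5 lorentz_5 bs_def prod_eq_iff)
    next
      assume "i = 2" then show ?thesis
        by (intro exI[of _ "(1, vec5 (1/2) 0 0 (1/2) 0)"]) (simp add: all_le_5 lorentz_5 bs_def prod_eq_iff)
    next
      assume "i = 3" then show ?thesis
        by (intro exI[of _ "(1, vec5 0 0 0 (1/2) 0)"]) (simp add: all_le_5 lorentz_5 bs_def prod_eq_iff)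
    next
      assume "i = 4" then show ?thesis
        by (intro exI[of _ "v_inf"]) (simp add: all_le_5 lorentz_bs v_inf_null, simp add: v_inf_def prod_eq_iff)
    qed
  qed
  have "norm (vec5 (3/10) (2/10) (1/10) (1/10) (- 1/10)) < 1"
    by (simp add: norm_eq_sqrt_inner inner_5)
  moreover have "\<forall>i\<le>6. lorentz (lift (vec5 (3/10) (2/10) (1/10) (1/10) (- 1/10))) (bs i) < 0"
    unfolding all_le_6 lorentz_bs by (simp add: mult_less_0_iff)
  ultimately have int: "\<exists>p. norm p < 1 \<and> (\<forall>i\<le>6. lorentz (lift p) (bs i) < 0)" by blast
  have far: "lorentz (bs i) (bs j) = 0" if "j \<le> 6" "i + 2 \<le> j" for i j
  proof -
    have "i \<le> 6" using that by simp
    with that show ?thesis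
      unfolding le_6_cases by (elim disjE) (simp_all add: lorentz_bs, simp_all add: bs_def)
  qed
  have near: "lorentz (bs (i - 1)) (bs i) = - cos (pi / real ([4, 3, 4, 3, 3] ! (i - 1)))" if "i \<in> {1..5}" for i
    using that unfolding range_1_5 by (elim disjE) (simp_all add: lorentz_5 bs_def cos_45 cos_60 numeral_nat)
  have "lorentz (bs 5) (bs 6) = - 1" by (simp add: lorentz_5 bs_def)
  then show ?thesis
    unfolding simply_truncated_parallel_def Let_def using causal int far near lorentz_bs_self by simp
qed

lemma simply_truncated_parallel_symbol:
  fixes b :: "nat \<Rightarrow> real \<times> (real^5)"
  assumes "simply_truncated_parallel ms b"
  shows "ms = [4, 3, 4, 3, 3]" "\<exists>L. standard_copy b L"
proof -
  have "length ms = 5" using assms by (simp add: simply_truncated_parallel_def Let_def)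
  then obtain m1 m2 m3 m4 m5 where ms: "ms = [m1, m2, m3, m4, m5]"
    by (auto simp: numeral_eq_Suc length_Suc_conv)
  interpret orthoscheme5 m1 m2 m3 m4 m5 b by standard (use assms ms in simp)
  show "ms = [4, 3, 4, 3, 3]" unfolding ms symbol_123 symbol_4 symbol_5 ..
  show "\<exists>L. standard_copy b L" by (rule ex_standard_copy)
qed

section \<open>Numerical value\<close>

text \<open>The tail lies between two telescoping sums. From above, 1 / (k+1)^3 is at most 1 / (k
  (k+1) (k+2)). From below, 1 / x^3 is at least 4x / (4x^4 + 1), which telescopes by the
  factorisation 4x^4 + 1 = (2x^2 - 2x + 1) (2x^2 + 2x + 1).\<close>

lemma zeta_3_partial_sum_bounds:
  fixes N :: nat
  defines "S \<equiv> \<Sum>k<N. 1 / real (Suc k) ^ 3"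
  assumes N: "0 < N"
  shows "S + 1 / (2 * (real N)\<^sup>2 + 2 * real N + 1) \<le> zeta 3" "zeta 3 \<le> S + 1 / (2 * real N * (real N + 1))"
proof -
  define f where "f k = 1 / real (Suc k) ^ 3" for k
  have z: "zeta 3 = suminf f" unfolding zeta_def f_def by (simp add: powr_numeral)
  have sf: "summable f" using summable_inverse_Suc_power[of 3] unfolding f_def by (simp add: field_simps)
  have tail: "zeta 3 = S + (\<Sum>k. f (k + N))"
    unfolding z S_def using suminf_split_initial_segment[OF sf, of N] by (simp add: f_def)
  have st: "summable (\<lambda>k. f (k + N))" using sf by (simp add: summable_iff_shift)
  have tele: "(\<lambda>k. g (k + N) - g (Suc (k + N))) sums g N" if "g \<longlonglongrightarrow> 0" for g :: "nat \<Rightarrow> real"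
  proof -
    have "(\<lambda>k. g (k + N)) \<longlonglongrightarrow> 0" using that by (rule LIMSEQ_ignore_initial_segment)
    from telescope_sums'[OF this] show ?thesis by simp
  qed
  define h where "h k = 1 / (2 * real k * (real k + 1))" for k
  define l where "l k = 1 / (2 * (real k)\<^sup>2 + 2 * real k + 1)" for k
  have h0: "h \<longlonglongrightarrow> 0" unfolding h_def by real_asymp
  have l0: "l \<longlonglongrightarrow> 0" unfolding l_def by real_asymp
  have up: "f k \<le> h k - h (Suc k)" if "0 < k" for k
  proof -
    define x where "x = real k"
    have x: "0 < x" using that by (simp add: x_def)
    have "h k - h (Suc k) = 1 / (x * (x + 1) * (x + 2))"
      unfolding h_def x_def[symmetric] using x by (simp add: x_def[symmetric] divide_simps) (simp add: algebra_simps)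
    moreover have "x * (x + 1) * (x + 2) \<le> (x + 1) ^ 3" using x by (simp add: power3_eq_cube algebra_simps)
    moreover have "f k = 1 / (x + 1) ^ 3" by (simp add: f_def x_def add.commute)
    ultimately show ?thesis using x by (simp add: frac_le)
  qed
  have lo: "l k - l (Suc k) \<le> f k" for k
  proof -
    define x where "x = real k + 1"
    have x: "1 \<le> x" by (simp add: x_def)
    have e: "real k = x - 1" "real (Suc k) = x" by (simp_all add: x_def)
    have sq: "2 * x\<^sup>2 - 2 * x + 1 = x\<^sup>2 + (x - 1)\<^sup>2" by (simp add: power2_eq_square algebra_simps)
    have p: "0 < 2 * x\<^sup>2 - 2 * x + 1" "0 < 2 * x\<^sup>2 + 2 * x + 1" unfolding sq using x by (simp_all add: add_pos_nonneg)
    have "l k - l (Suc k) = 1 / (2 * x\<^sup>2 - 2 * x + 1) - 1 / (2 * x\<^sup>2 + 2 * x + 1)"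
      unfolding l_def e by (simp add: power2_eq_square algebra_simps)
    also have "\<dots> = 4 * x / (4 * x ^ 4 + 1)"
    proof -
      have "(2 * x\<^sup>2 - 2 * x + 1) * (2 * x\<^sup>2 + 2 * x + 1) = 4 * x ^ 4 + 1"
        by (simp add: power2_eq_square power4_eq_xxxx algebra_simps)
      moreover have "1 / (2 * x\<^sup>2 - 2 * x + 1) - 1 / (2 * x\<^sup>2 + 2 * x + 1) = 4 * x / ((2 * x\<^sup>2 - 2 * x + 1) * (2 * x\<^sup>2 + 2 * x + 1))"
        using p by (simp add: diff_frac_eq)
      ultimately show ?thesis by simp
    qed
    also have "\<dots> \<le> 1 / x ^ 3"
      using x by (simp add: divide_simps power4_eq_xxxx power3_eq_cube add_pos_pos)
    finally show ?thesis unfolding f_def e .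
  qed
  have "(\<Sum>k. f (k + N)) \<le> h N"
    using suminf_le[of "\<lambda>k. f (k + N)", OF _ st sums_summable[OF tele[OF h0]]] up N sums_unique[OF tele[OF h0]] by simp
  then show "zeta 3 \<le> S + 1 / (2 * real N * (real N + 1))" unfolding tail h_def by simp
  have "l N \<le> (\<Sum>k. f (k + N))"
    using suminf_le[of "\<lambda>k. l (k + N) - l (Suc (k + N))", OF _ sums_summable[OF tele[OF l0]] st] lo sums_unique[OF tele[OF l0]] by simp
  then show "S + 1 / (2 * (real N)\<^sup>2 + 2 * real N + 1) \<le> zeta 3" unfolding tail l_def by simp
qed

text \<open>The density is 0.5942195..., less than 10^(-6) below the upper end 0.59422 of the
  permitted interval. The lower bound for zeta(3) therefore has to be accurate to within 10^(-6),
  while the upper bound may be coarse.\<close>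

lemma zeta_3_bounds: "12020563 / 10000000 \<le> zeta 3" "zeta 3 \<le> 120209 / 100000"
  using zeta_3_partial_sum_bounds[of 10] by (simp_all add: eval_nat_numeral lessThan_Suc)

lemma density_approx: "\<bar>5 / (7 * zeta 3) - 0.59421\<bar> \<le> 1 / 10 ^ 5"
proof -
  have "5 / (7 * zeta 3) \<le> 59422 / 100000" "59420 / 100000 \<le> 5 / (7 * zeta 3)"
    using zeta_3_bounds by (simp_all add: divide_le_eq le_divide_eq)
  then have "\<bar>5 / (7 * zeta 3) - 59421 / 100000\<bar> \<le> 1 / 100000" unfolding abs_le_iff by linarith
  then show ?thesis by simp
qed

theorem theorem4p6:
  fixes ms :: "nat list"
  shows "((\<exists>b :: nat \<Rightarrow> real \<times> (real^5). simply_truncated_parallel ms b) \<longleftrightarrow> ms = [4, 3, 4, 3, 3]) \<and>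
    (\<forall>b :: nat \<Rightarrow> real \<times> (real^5). simply_truncated_parallel ms b \<longrightarrow>
       ideal_vertices b = {vertex b 0, vertex b 4} \<and> vertex b 0 \<noteq> vertex b 4 \<and>
       (\<exists>B0 B4. maximal_horoball b (vertex b 0) B0 \<and> maximal_horoball b (vertex b 4) B4 \<and>
          horoball_packing 2 b (orbit b {B0, B4}) (5 / (7 * zeta 3)) \<and>
          (\<forall>\<P> d. congruent_ball_packing b \<P> d \<or> horoball_packing 2 b \<P> d \<longrightarrow>
             d \<le> 5 / (7 * zeta 3) \<and>
             (\<P> \<noteq> orbit b {B0, B4} \<longrightarrow> d < 5 / (7 * zeta 3))))) \<and>
    \<bar>5 / (7 * zeta 3) - 0.59421\<bar> \<le> 1 / 10 ^ 5"
proof (intro conjI allI impI)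
  show "(\<exists>b :: nat \<Rightarrow> real \<times> (real^5). simply_truncated_parallel ms b) \<longleftrightarrow> ms = [4, 3, 4, 3, 3]"
    using simply_truncated_parallel_symbol(1) bs_symbol by blast
  show "\<bar>5 / (7 * zeta 3) - 0.59421\<bar> \<le> 1 / 10 ^ 5" by (rule density_approx)
  fix b :: "nat \<Rightarrow> real \<times> (real^5)" assume stp: "simply_truncated_parallel ms b"
  obtain L where "standard_copy b L" using simply_truncated_parallel_symbol(2)[OF stp] by blast
  then interpret standard_copy b L .
  show "ideal_vertices b = {vertex b 0, vertex b 4}" unfolding vertex_0 vertex_4 by (rule ideal_vertices_eq)
  show "vertex b 0 \<noteq> vertex b 4" unfolding vertex_0 vertex_4 using c4_neq_c0 by simp
  show "\<exists>B0 B4. maximal_horoball b (vertex b 0) B0 \<and> maximal_horoball b (vertex b 4) B4 \<and>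
      horoball_packing 2 b (orbit b {B0, B4}) (5 / (7 * zeta 3)) \<and>
      (\<forall>\<P> d. congruent_ball_packing b \<P> d \<or> horoball_packing 2 b \<P> d \<longrightarrow>
         d \<le> 5 / (7 * zeta 3) \<and> (\<P> \<noteq> orbit b {B0, B4} \<longrightarrow> d < 5 / (7 * zeta 3)))"
  \<comment> \<open>The horoballs are schematic here; the first two claims instantiate them.\<close>
  proof (intro exI conjI allI impI)
    show "maximal_horoball b (vertex b 0) (HB (L v_cor))" unfolding vertex_0 by (rule maximal_cor)
    show "maximal_horoball b (vertex b 4) (HB (L v_inf))" unfolding vertex_4 by (rule maximal_inf)
    show "horoball_packing 2 b (orbit b {HB (L v_cor), HB (L v_inf)}) (5 / (7 * zeta 3))" by (rule optimal_packing)
    fix \<P> d assume P: "congruent_ball_packing b \<P> d \<or> horoball_packing 2 b \<P> d"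
    then show "d \<le> 5 / (7 * zeta 3)" using ball_packing_bound packing_bound less_imp_le by metis
    show "d < 5 / (7 * zeta 3)" if "\<P> \<noteq> orbit b {HB (L v_cor), HB (L v_inf)}"
      using P that ball_packing_bound packing_bound by metis
  qed
qed

end
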